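(* Let $d,k\ge 1$ be integers, $0<\beta<\min(2,k)$, and assume that the functions $\sigma_{ij},b_i:\mathbb{R}^d\to\mathbb{R}$, $1\le i,j\le d$, are globally Lipschitz continuous. Let $u=(u_1,\dots,u_d)$ be the mild solution, with zero initial condition, of the system of stochastic heat equations described in the context. Then for every $T>0$ and every $p\ge 2$ there exists a constant $C_{p,T}>0$ such that for all $s,t\in[0,T]$ with $s\le t$ and all $x,y\in\mathbb{R}^k$, $$\mathrm{E}\left[\|u(t,x)-u(s,y)\|^p\right]\le C_{p,T}\left(|t-s|^{(2-\beta)/2}+\|x-y\|^{2-\beta}\right)^{p/2}.$$
   Context: Setting. $\|\cdot\|$ is the Euclidean norm. The system is $$\frac{\partial}{\partial t}u_i(t,x)=\frac12\Delta_x u_i(t,x)+\sum_{j=1}^d\sigma_{ij}(u(t,x))\dot F^j(t,x)+b_i(u(t,x)),\quad 1\le i\le d,\ t\in[0,T],\ x\in\mathbb{R}^k,$$ with $u(0,x)=0$ for all $x\in\mathbb{R}^k$. Noise. $F=\{F(\phi)=(F^1(\phi),\dots,F^d(\phi)):\phi\in C_c^\infty(\mathbb{R}^{k+1})\}$ is a centered Gaussian family with covariance $$\mathrm{E}[F^i(\phi)F^j(\psi)]=\delta_{ij}\int_{\mathbb{R}_+}dr\int_{\mathbb{R}^k}dy\int_{\mathbb{R}^k}dz\,\phi(r,y)\|y-z\|^{-\beta}\psi(r,z)$$ ($\delta_{ij}$ is the Kronecker symbol). It is extended to a $d$-dimensional worthy martingale measure $M=(M^1,\dots,M^d)$, $M^i=\{M^i_t(A):t\ge0,\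 A\subset\mathbb{R}^k \text{ bounded Borel}\}$. Mild solution. With $S(t,x)=(2\pi t)^{-k/2}\exp(-\|x\|^2/(2t))$, a mild solution is a jointly measurable $\mathbb{R}^d$-valued process $u=\{u(t,x)\}$, adapted to the natural filtration generated by $M$, such that for $i=1,\dots,d$, $$u_i(t,x)=\int_0^t\int_{\mathbb{R}^k}S(t-s,x-y)\sum_{j=1}^d\sigma_{ij}(u(s,y))M^j(ds,dy)+\int_0^tds\int_{\mathbb{R}^k}dy\,S(t-s,x-y)b_i(u(s,y)),$$ where the stochastic integral is in the sense of Walsh. For $0<\beta<\min(2,k)$ and Lipschitz coefficients there is a unique $L^2$-continuous mild solution satisfying $\sup_{(t,x)\in[0,T]\times\mathbb{R}^k}\mathrm{E}[|u_i(t,x)|^p]<\infty$ for all $T>0$, $p\ge1$, $i$; this is the process $u$. *)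

theory Defs
  imports "HOL-Probability.Probability"
begin

section \<open>Test functions\<close>

primrec times_cont_diff :: "nat \<Rightarrow> ('a::real_normed_vector \<Rightarrow> real) \<Rightarrow> bool" where
  "times_cont_diff 0 f \<longleftrightarrow> continuous_on UNIV f"
| "times_cont_diff (Suc n) f \<longleftrightarrow>
     (\<forall>x. f differentiable (at x)) \<and>
     (\<forall>v. times_cont_diff n (\<lambda>x. frechet_derivative f (at x) v))"

definition test_functions :: "('a::real_normed_vector \<Rightarrow> real) set" where
  "test_functions = {\<phi>. (\<forall>n. times_cont_diff n \<phi>) \<and> compact (closure {x. \<phi> x \<noteq> 0})}"


section \<open>The Gaussian noise\<close>

text \<open>The law \<open>N(0, 0)\<close>, i.e. the point mass at zero, counts as Gaussian.\<close>

definition centered_gaussian :: "'w measure \<Rightarrow> ('w \<Rightarrow> real) \<Rightarrow> bool" where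
  "centered_gaussian P X \<longleftrightarrow> X \<in> borel_measurable P \<and>
     ((AE \<omega> in P. X \<omega> = 0) \<or>
      (\<exists>\<tau>>0. distributed P lborel X (\<lambda>x. ennreal (normal_density 0 \<tau> x))))"

definition centered_gaussian_family ::
    "'w measure \<Rightarrow> 'i set \<Rightarrow> ('i \<Rightarrow> 'w \<Rightarrow> real) \<Rightarrow> bool" where
  "centered_gaussian_family P I X \<longleftrightarrow>
     (\<forall>J c. finite J \<and> J \<subseteq> I \<longrightarrow> centered_gaussian P (\<lambda>\<omega>. \<Sum>i\<in>J. c i * X i \<omega>))"

text \<open>Space-time is \<^typ>\<open>real \<times> (real ^ 'k)\<close>. Note that \<open>0 powr a = 0\<close>, so the
  Riesz kernel \<open>norm (y - z) powr -\<beta>\<close> vanishes on the (Lebesgue-null) diagonal.\<close>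

definition noise_covariance ::
    "real \<Rightarrow> (real \<times> (real ^ 'k) \<Rightarrow> real) \<Rightarrow> (real \<times> (real ^ 'k) \<Rightarrow> real) \<Rightarrow> real" where
  "noise_covariance \<beta> \<phi> \<psi> =
     (LINT r:{0..}|lborel. LINT y|lborel. LINT z|lborel.
        \<phi> (r, y) * norm (y - z) powr (-\<beta>) * \<psi> (r, z))"

definition gaussian_noise ::
    "'w measure \<Rightarrow> real \<Rightarrow> ((real \<times> (real ^ 'k) \<Rightarrow> real) \<Rightarrow> 'w \<Rightarrow> real ^ 'd) \<Rightarrow> bool" where
  "gaussian_noise P \<beta> F \<longleftrightarrow>
     centered_gaussian_family P (test_functions \<times> (UNIV :: 'd set)) (\<lambda>(\<phi>, i) \<omega>. F \<phi> \<omega> $ i) \<and>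
     (\<forall>\<phi>\<in>test_functions. \<forall>\<psi>\<in>test_functions. \<forall>i j.
        (\<integral>\<omega>. F \<phi> \<omega> $ i * F \<psi> \<omega> $ j \<partial>P) = (if i = j then noise_covariance \<beta> \<phi> \<psi> else 0))"


section \<open>Worthy martingale measures\<close>

definition bounded_borel_sets :: "'e::euclidean_space set set" where
  "bounded_borel_sets = {A. A \<in> sets borel \<and> bounded A}"

definition martingale :: "'w measure \<Rightarrow> (real \<Rightarrow> 'w measure) \<Rightarrow> (real \<Rightarrow> 'w \<Rightarrow> real) \<Rightarrow> bool" where
  "martingale P \<F> X \<longleftrightarrow>
     (\<forall>t\<ge>0. X t \<in> borel_measurable (\<F> t) \<and> integrable P (X t)) \<and>
     (\<forall>s t. 0 \<le> s \<and> s \<le> t \<longrightarrow> (AE \<omega> in P. real_cond_exp P (\<F> s) (X t) \<omega> = X s \<omega>))"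

text \<open>Walsh's \<open>\<sigma>\<close>-finite martingale measures, the exhausting sequence of the state space being
  that of the closed balls around the origin. Sigma-additivity is in \<open>L\<^sup>2\<close>; finite additivity and
  \<open>M\<^sub>t(\<emptyset>) = 0\<close> are the case in which almost all of the sets are empty.\<close>

definition martingale_measure ::
    "'w measure \<Rightarrow> (real \<Rightarrow> 'w measure) \<Rightarrow> (real \<Rightarrow> 'e::euclidean_space set \<Rightarrow> 'w \<Rightarrow> real) \<Rightarrow> bool" where
  "martingale_measure P \<F> M \<longleftrightarrow>
     filtration (space P) \<F> \<and> (\<forall>t\<ge>0. subalgebra P (\<F> t)) \<and>
     (\<forall>A\<in>bounded_borel_sets. (AE \<omega> in P. M 0 A \<omega> = 0) \<and> martingale P \<F> (\<lambda>t. M t A)) \<and>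
     (\<forall>t\<ge>0. \<forall>n::nat.
        (SUP A\<in>{A \<in> sets borel. A \<subseteq> cball 0 (real n)}. \<integral>\<^sup>+\<omega>. ennreal ((M t A \<omega>)\<^sup>2) \<partial>P) < \<infinity>) \<and>
     (\<forall>t\<ge>0. \<forall>A :: nat \<Rightarrow> 'e set.
        range A \<subseteq> sets borel \<and> disjoint_family A \<and> bounded (\<Union>n. A n) \<longrightarrow>
        (\<lambda>N. \<integral>\<^sup>+\<omega>. ennreal ((M t (\<Union>n. A n) \<omega> - (\<Sum>n<N. M t (A n) \<omega>))\<^sup>2) \<partial>P)
          \<longlonglongrightarrow> 0)"

definition predictable_sigma :: "'w measure \<Rightarrow> (real \<Rightarrow> 'w measure) \<Rightarrow> (real \<times> 'w) measure" where
  "predictable_sigma P \<F> = sigma ({0..} \<times> space P)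
     ({{0} \<times> H |H. H \<in> sets (\<F> 0)} \<union>
      {{s<..t} \<times> H |s t H. 0 \<le> s \<and> s \<le> t \<and> H \<in> sets (\<F> s)})"

text \<open>Walsh's definition of ``worthy with dominating measure \<open>K\<close>''. The random measure \<open>K\<close> lives
  on triples (time, point, point). In the last clause \<open>Q t\<close> is the predictable covariation of
  \<open>M(A)\<close> and \<open>M(B)\<close>; it has finite variation because it is dominated by \<open>K\<close>.\<close>

definition worthy_martingale_measure ::
    "'w measure \<Rightarrow> (real \<Rightarrow> 'w measure) \<Rightarrow> (real \<Rightarrow> 'e::euclidean_space set \<Rightarrow> 'w \<Rightarrow> real) \<Rightarrow>
     ('w \<Rightarrow> (real \<times> 'e \<times> 'e) measure) \<Rightarrow> bool" where
  "worthy_martingale_measure P \<F> M K \<longleftrightarrow>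
     martingale_measure P \<F> M \<and>
     (\<forall>\<omega>\<in>space P. sets (K \<omega>) = sets borel \<and> sigma_finite_measure (K \<omega>) \<and>
        distr (K \<omega>) borel (\<lambda>(s, y, z). (s, z, y)) = K \<omega> \<and>
        (\<forall>f :: real \<times> 'e \<Rightarrow> real. f \<in> borel_measurable borel \<and> bounded (range f) \<and>
           integrable (K \<omega>) (\<lambda>(s, y, z). f (s, y) * f (s, z)) \<longrightarrow>
           0 \<le> (\<integral>(s, y, z). f (s, y) * f (s, z) \<partial>K \<omega>))) \<and>
     (\<forall>\<Lambda>\<in>sets borel. (\<lambda>\<omega>. emeasure (K \<omega>) \<Lambda>) \<in> borel_measurable P) \<and>
     (\<forall>A\<in>sets borel. \<forall>B\<in>sets borel.
        (\<lambda>(t, \<omega>). emeasure (K \<omega>) ({0<..t} \<times> A \<times> B)) \<in> borel_measurable (predictable_sigma P \<F>)) \<and>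
     (\<forall>T\<ge>0. \<forall>n::nat.
        (\<integral>\<^sup>+\<omega>. emeasure (K \<omega>) ({0<..T} \<times> cball 0 (real n) \<times> cball 0 (real n)) \<partial>P) < \<infinity>) \<and>
     (\<forall>A\<in>bounded_borel_sets. \<forall>B\<in>bounded_borel_sets. \<exists>Q :: real \<Rightarrow> 'w \<Rightarrow> real.
        (\<lambda>(t, \<omega>). Q t \<omega>) \<in> borel_measurable (predictable_sigma P \<F>) \<and>
        (\<forall>\<omega>\<in>space P. Q 0 \<omega> = 0) \<and>
        martingale P \<F> (\<lambda>t \<omega>. M t A \<omega> * M t B \<omega> - Q t \<omega>) \<and>
        (AE \<omega> in P. \<forall>s t. 0 \<le> s \<and> s \<le> t \<longrightarrow>
           ennreal \<bar>Q t \<omega> - Q s \<omega>\<bar> \<le> emeasure (K \<omega>) ({s<..t} \<times> A \<times> B)))"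


section \<open>The Walsh integral\<close>

text \<open>A list of quadruples \<open>(X, a, b, A)\<close> represents the simple process
  \<open>\<Sum> X(\<omega>) 1\<^bsub>(a,b]\<^esub>(s) 1\<^bsub>A\<^esub>(y)\<close>.\<close>

type_synonym ('w, 'e) simple_process = "(('w \<Rightarrow> real) \<times> real \<times> real \<times> 'e set) list"

definition simple_process ::
    "(real \<Rightarrow> 'w measure) \<Rightarrow> ('w, 'e::euclidean_space) simple_process \<Rightarrow> bool" where
  "simple_process \<F> g \<longleftrightarrow> (\<forall>(X, a, b, A) \<in> set g.
     0 \<le> a \<and> a \<le> b \<and> X \<in> borel_measurable (\<F> a) \<and>
     (\<exists>c. \<forall>\<omega>\<in>space (\<F> a). \<bar>X \<omega>\<bar> \<le> c) \<and> A \<in> bounded_borel_sets)"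

definition simple_eval :: "('w, 'e) simple_process \<Rightarrow> real \<Rightarrow> 'e \<Rightarrow> 'w \<Rightarrow> real" where
  "simple_eval g s y \<omega> = (\<Sum>(X, a, b, A)\<leftarrow>g. X \<omega> * indicator {a<..b} s * indicator A y)"

definition simple_integral ::
    "(real \<Rightarrow> 'e set \<Rightarrow> 'w \<Rightarrow> real) \<Rightarrow> real \<Rightarrow> ('w, 'e) simple_process \<Rightarrow> 'w \<Rightarrow> real" where
  "simple_integral M t g \<omega> =
     (\<Sum>(X, a, b, A)\<leftarrow>g. X \<omega> * (M (min t b) A \<omega> - M (min t a) A \<omega>))"

definition walsh_norm_sq ::
    "'w measure \<Rightarrow> ('w \<Rightarrow> (real \<times> 'e \<times> 'e) measure) \<Rightarrow> real \<Rightarrow>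
     (real \<Rightarrow> 'e \<Rightarrow> 'w \<Rightarrow> real) \<Rightarrow> ennreal" where
  "walsh_norm_sq P K t f =
     (\<integral>\<^sup>+\<omega>. (\<integral>\<^sup>+(s, y, z). ennreal (indicator {0<..t} s * (\<bar>f s y \<omega>\<bar> * \<bar>f s z \<omega>\<bar>)) \<partial>K \<omega>) \<partial>P)"

text \<open>\<open>Z\<close> is a version of \<open>\<integral>\<^sub>0\<^sup>t \<integral> f(s,y) M(ds,dy)\<close>. The integrands are the jointly measurable
  processes in the closure of the simple processes under Walsh's norm. This comprises all
  predictable processes of finite norm, and also the processes that differ from these by an element
  of norm zero, such as processes having a predictable modification.\<close>

definition has_walsh_integral ::
    "'w measure \<Rightarrow> (real \<Rightarrow> 'w measure) \<Rightarrow> (real \<Rightarrow> 'e::euclidean_space set \<Rightarrow> 'w \<Rightarrow> real) \<Rightarrow>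
     ('w \<Rightarrow> (real \<times> 'e \<times> 'e) measure) \<Rightarrow> real \<Rightarrow> (real \<Rightarrow> 'e \<Rightarrow> 'w \<Rightarrow> real) \<Rightarrow>
     ('w \<Rightarrow> real) \<Rightarrow> bool" where
  "has_walsh_integral P \<F> M K t f Z \<longleftrightarrow>
     (\<lambda>(s, y, \<omega>). f s y \<omega>)
       \<in> borel_measurable (restrict_space borel {0..t} \<Otimes>\<^sub>M (borel \<Otimes>\<^sub>M P)) \<and>
     Z \<in> borel_measurable P \<and>
     (\<exists>g. (\<forall>n::nat. simple_process \<F> (g n)) \<and>
        (\<lambda>n. walsh_norm_sq P K t (\<lambda>s y \<omega>. simple_eval (g n) s y \<omega> - f s y \<omega>)) \<longlonglongrightarrow> 0 \<and>
        (\<lambda>n. \<integral>\<^sup>+\<omega>. ennreal ((simple_integral M t (g n) \<omega> - Z \<omega>)\<^sup>2) \<partial>P) \<longlonglongrightarrow> 0)"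


section \<open>The martingale measure of the noise\<close>

text \<open>The natural filtration is augmented by the null sets, as is usual for stochastic integrals,
  which are only defined almost surely. Every process adapted to the raw natural filtration is
  adapted to this one.\<close>

definition natural_filtration ::
    "'w measure \<Rightarrow> (real \<Rightarrow> 'e::euclidean_space set \<Rightarrow> 'w \<Rightarrow> real ^ 'd) \<Rightarrow> real \<Rightarrow> 'w measure" where
  "natural_filtration P M t = sigma (space P)
     ({M s A -` B \<inter> space P |s A B. 0 \<le> s \<and> s \<le> t \<and> A \<in> bounded_borel_sets \<and> B \<in> sets borel}
      \<union> null_sets P)"

definition noise_dominating_measure ::
    "real \<Rightarrow> (real \<times> (real ^ 'k) \<times> (real ^ 'k)) measure" where
  "noise_dominating_measure \<beta> =
     density lborel (\<lambda>(r, y, z). ennreal (indicator {0..} r * norm (y - z) powr (-\<beta>)))"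

text \<open>\<open>M\<^sub>t(A)\<close> is \<open>F(1\<^bsub>[0,t] \<times> A\<^esub>)\<close>, where \<open>F\<close> is extended by continuity: the covariance form
  measures the distance of test functions to the indicator, and the values converge in \<open>L\<^sup>2\<close>.\<close>

definition noise_martingale_measure ::
    "'w measure \<Rightarrow> real \<Rightarrow> ((real \<times> (real ^ 'k) \<Rightarrow> real) \<Rightarrow> 'w \<Rightarrow> real ^ 'd) \<Rightarrow>
     (real \<Rightarrow> (real ^ 'k) set \<Rightarrow> 'w \<Rightarrow> real ^ 'd) \<Rightarrow> bool" where
  "noise_martingale_measure P \<beta> F M \<longleftrightarrow>
     (\<forall>t\<ge>0. \<forall>A\<in>bounded_borel_sets. \<exists>\<phi>. (\<forall>n::nat. \<phi> n \<in> test_functions) \<and>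
        (\<lambda>n. noise_covariance \<beta> (\<lambda>q. \<phi> n q - indicator ({0..t} \<times> A) q)
                               (\<lambda>q. \<phi> n q - indicator ({0..t} \<times> A) q)) \<longlonglongrightarrow> 0 \<and>
        (\<lambda>n. \<integral>\<^sup>+\<omega>. ennreal ((norm (F (\<phi> n) \<omega> - M t A \<omega>))\<^sup>2) \<partial>P) \<longlonglongrightarrow> 0) \<and>
     (\<forall>i. worthy_martingale_measure P (natural_filtration P M) (\<lambda>t A \<omega>. M t A \<omega> $ i)
            (\<lambda>_. noise_dominating_measure \<beta>))"


section \<open>Mild solutions\<close>

definition heat_kernel :: "real \<Rightarrow> real ^ 'k \<Rightarrow> real" where
  "heat_kernel t x = (2 * pi * t) powr (- real CARD('k) / 2) * exp (- (norm x)\<^sup>2 / (2 * t))"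

definition mild_solution ::
    "'w measure \<Rightarrow> real \<Rightarrow> (real \<Rightarrow> (real ^ 'k) set \<Rightarrow> 'w \<Rightarrow> real ^ 'd) \<Rightarrow>
     ('d \<Rightarrow> 'd \<Rightarrow> real ^ 'd \<Rightarrow> real) \<Rightarrow> ('d \<Rightarrow> real ^ 'd \<Rightarrow> real) \<Rightarrow>
     (real \<Rightarrow> real ^ 'k \<Rightarrow> 'w \<Rightarrow> real ^ 'd) \<Rightarrow> bool" where
  "mild_solution P \<beta> M \<sigma> b u \<longleftrightarrow>
     (\<lambda>(t, x, \<omega>). u t x \<omega>)
       \<in> borel_measurable (restrict_space borel {0..} \<Otimes>\<^sub>M (borel \<Otimes>\<^sub>M P)) \<and>
     (\<forall>t\<ge>0. \<forall>x. u t x \<in> borel_measurable (natural_filtration P M t)) \<and>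
     (\<forall>t\<ge>0. \<forall>x i. \<exists>Z.
        (\<forall>j. has_walsh_integral P (natural_filtration P M) (\<lambda>s A \<omega>. M s A \<omega> $ j)
               (\<lambda>_. noise_dominating_measure \<beta>) t
               (\<lambda>s y \<omega>. heat_kernel (t - s) (x - y) * \<sigma> i j (u s y \<omega>)) (Z j)) \<and>
        (AE \<omega> in P. u t x \<omega> $ i = (\<Sum>j\<in>UNIV. Z j \<omega>) +
           (LINT s:{0..t}|lborel. LINT y|lborel. heat_kernel (t - s) (x - y) * b i (u s y \<omega>))))"

definition L2_continuous ::
    "'w measure \<Rightarrow> (real \<Rightarrow> real ^ 'k \<Rightarrow> 'w \<Rightarrow> real ^ 'd) \<Rightarrow> bool" where
  "L2_continuous P u \<longleftrightarrow> (\<forall>t\<ge>0. \<forall>x.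
     ((\<lambda>(s, y). \<integral>\<^sup>+\<omega>. ennreal ((norm (u s y \<omega> - u t x \<omega>))\<^sup>2) \<partial>P) \<longlongrightarrow> 0)
       (at (t, x) within {0..} \<times> UNIV))"

definition bounded_moments ::
    "'w measure \<Rightarrow> (real \<Rightarrow> real ^ 'k \<Rightarrow> 'w \<Rightarrow> real ^ 'd) \<Rightarrow> bool" where
  "bounded_moments P u \<longleftrightarrow> (\<forall>T>0. \<forall>p\<ge>1. \<forall>i.
     (SUP (t, x)\<in>{0..T} \<times> UNIV. \<integral>\<^sup>+\<omega>. ennreal (\<bar>u t x \<omega> $ i\<bar> powr p) \<partial>P) < \<infinity>)"

end

theory Submission
  imports Defs
begin

text \<open>
  Moments of a Walsh integral \<open>I\<^sub>t = \<integral>\<^sub>0\<^sup>t \<integral> f dM\<close> of even order \<open>p\<close> are estimated without the Burkholder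
  inequality. For simple integrands, Gaussian fourth moments of \<open>M\<close> make the remainder in the Taylor
  expansion along a partition negligible, so \<open>E \<phi>(I\<^sub>t) \<le> \<phi>(0) + (1/2) E \<integral>\<^sub>0\<^sup>t |\<phi>''(I\<^sub>s)| q\<^sub>s ds\<close> with
  \<open>q\<^sub>s = \<integral>\<integral> |f(s,y)| |y - z|\<^sup>-\<^sup>\<beta> |f(s,z)| dy dz\<close>. The choice \<open>\<phi>(x) = (\<nu> sin (x / \<nu>))\<^sup>p\<close> is bounded and satisfies
  \<open>|\<phi>''| \<le> c \<phi>\<^bsup>1 - 2/p\<^esup>\<close> with \<open>c\<close> independent of \<open>\<nu>\<close>; if \<open>|f| \<le> h V\<close> with \<open>h\<close> deterministic and
  \<open>E V\<^sup>p \<le> \<kappa>\<close>, Young's inequality absorbs \<open>\<phi>\<close> and leaves \<open>E |I\<^sub>t|\<^sup>p \<le> C \<kappa> B\<^bsup>p/2\<^esup>\<close>, where \<open>B\<close> is the Riesz energy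
  of \<open>h\<close>. For the increments of the heat kernel at distance \<open>\<tau>\<close> from the final time, the bounds
  \<open>sup |h| \<le> m \<tau>\<^bsup>-k/2\<^esup>\<close> and \<open>\<integral> |h| \<le> m\<close> with \<open>m\<^sup>2 \<le> C min(1, \<theta>/\<tau>)\<close>, where \<open>\<theta>\<close> is \<open>|t - s|\<close> or \<open>|x - y|\<^sup>2\<close>, give
  an energy of order \<open>\<integral> \<tau>\<^bsup>-\<beta>/2\<^esup> min(1, \<theta>/\<tau>) d\<tau>\<close>, that is \<open>\<theta>\<^bsup>(2 - \<beta>)/2\<^esup>\<close>.
\<close>

section \<open>Riesz energies\<close>

text \<open>The martingales here are families of values at fixed times, so every estimate concerns
  expectations over short time intervals. Worthiness bounds covariations only in absolute value;
  this is why the energies carry |f|. Two obstacles shape the moment estimate. The majorant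
  \<open>h V\<close> is known for the integrand but not for the simple processes approximating it,
  and these converge only in Walsh's norm, which is quadratic. So the energy of a simple process is
  split into that of the integrand and that of the error, and the weight |\<phi>''| of the error has
  to be bounded: for fixed \<nu> the error disappears in the limit of the approximation, and only
  afterwards \<nu> tends to infinity. Boundedness of \<phi> also makes the quantity finite that is
  to be absorbed. In the kernel estimate the time and the space increment enter through the same
  function of \<theta>/\<tau>, so one integral over \<tau> serves both, and also the stretch between
  s and t, where only one of the two kernels is alive.\<close>

lemma measurable_in_cball [measurable]:
  "Measurable.pred borel (\<lambda>w::'a::euclidean_space. w \<in> cball c r)"
  unfolding mem_cball by measurable

text \<open>The ball is covered by dyadic shells around \<open>c\<close>. On the shell inside radius
  \<open>R n\<close> the kernel is at most \<open>R (Suc n) powr (-\<beta>)\<close>, the volume is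
  of order \<open>R n ^ k\<close>, and the products form a geometric series of ratio 2^(\<beta>-k),
  which converges because \<beta> < k.\<close>

lemma nn_integral_riesz_ball:
  fixes \<beta> :: real
  assumes "0 < \<beta>" "\<beta> < DIM('a::euclidean_space)"
  shows "\<exists>C>0. \<forall>c::'a. \<forall>\<rho>>0. (\<integral>\<^sup>+w. ennreal (norm (c - w) powr (-\<beta>) * indicator (cball c \<rho>) w) \<partial>lborel)
           \<le> ennreal (C * \<rho> powr (DIM('a) - \<beta>))"
proof -
  define k where "k = DIM('a)"
  define q where "q = 2 powr (\<beta> - real k)"
  have q: "0 < q" "q < 1"
    using assms by (auto simp: q_def k_def powr_less_one)
  define C where "C = unit_ball_vol k * 2 powr \<beta> * (1 / (1 - q))"
  have C: "C > 0" using q by (simp add: C_def)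
  have "(\<integral>\<^sup>+w. ennreal (norm (c - w) powr (-\<beta>) * indicator (cball c \<rho>) w) \<partial>lborel)
           \<le> ennreal (C * \<rho> powr (k - \<beta>))" if \<rho>: "\<rho> > 0" for \<rho> and c :: 'a
  proof -
    define R where "R = (\<lambda>n. \<rho> * 2 powr (- real n))"
    have R: "R n > 0" for n using \<rho> by (simp add: R_def)
    \<comment> \<open>Whole balls stand in for the shells: their volume is explicit, and the overlap
      only changes the constant.\<close>
    define f where "f = (\<lambda>n w. ennreal (R (Suc n) powr (-\<beta>)) * indicator (cball c (R n)) w)"
    have f_meas [measurable]: "f n \<in> borel_measurable borel" for n unfolding f_def by measurable
    have pt: "ennreal (norm (c - w) powr (-\<beta>) * indicator (cball c \<rho>) w) \<le> (\<Sum>n. f n w)" for w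
    proof (cases "w \<in> cball c \<rho> \<and> w \<noteq> c")
      case True
      then have n0: "norm (c - w) > 0" and le: "norm (c - w) \<le> \<rho>" by (auto simp: dist_norm)
      have "\<exists>n. R n < norm (c - w)"
      proof -
        have "((\<lambda>n::nat. \<rho> * 2 powr (- real n)) \<longlongrightarrow> 0) sequentially"
          using \<rho> by real_asymp
        from order_tendstoD(2)[OF this n0] show ?thesis
          unfolding R_def by (auto simp: eventually_sequentially)
      qed
      then obtain n where n: "R n < norm (c - w)" "\<And>m. m < n \<Longrightarrow> \<not> R m < norm (c - w)"
        using exists_least_iff[of "\<lambda>n. R n < norm (c - w)"] by blast
      \<comment> \<open>\<open>R 0\<close> is \<rho> itself, so the first radius below the distance
        has a predecessor, and the ball of that radius still contains \<open>w\<close>.\<close>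
      have "n \<noteq> 0" using n(1) le by (auto simp: R_def intro!: Nat.gr0I)
      then obtain m where m: "n = Suc m" by (cases n) auto
      have "w \<in> cball c (R m)" using n(2)[of m] m by (auto simp: dist_norm)
      moreover have "norm (c - w) powr (-\<beta>) \<le> R (Suc m) powr (-\<beta>)"
        using n(1) m R[of "Suc m"] assms by (intro powr_mono2') auto
      ultimately have "ennreal (norm (c - w) powr (-\<beta>) * indicator (cball c \<rho>) w) \<le> f m w"
        using True by (auto simp: f_def)
      also have "\<dots> \<le> (\<Sum>n. f n w)"
        by (rule sum_le_suminf[where I="{m}", simplified]) auto
      finally show ?thesis .
    qed auto
    have "(\<integral>\<^sup>+w. ennreal (norm (c - w) powr (-\<beta>) * indicator (cball c \<rho>) w) \<partial>lborel)
        \<le> (\<integral>\<^sup>+w. (\<Sum>n. f n w) \<partial>lborel)"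
      by (intro nn_integral_mono pt)
    also have "\<dots> = (\<Sum>n. (\<integral>\<^sup>+w. f n w \<partial>lborel))"
      by (intro nn_integral_suminf) measurable
    also have "\<dots> = (\<Sum>n. ennreal (unit_ball_vol k * 2 powr \<beta> * \<rho> powr (k - \<beta>) * q ^ n))"
    proof (intro suminf_cong)
      fix n
      have "(\<integral>\<^sup>+w. f n w \<partial>lborel) = ennreal (R (Suc n) powr (-\<beta>)) * emeasure lborel (cball c (R n))"
        unfolding f_def by (subst nn_integral_cmult_indicator) auto
      also have "\<dots> = ennreal (R (Suc n) powr (-\<beta>) * (unit_ball_vol k * R n ^ k))"
        using R[of n] by (simp add: emeasure_cball k_def ennreal_mult'[symmetric])
      also have "R (Suc n) powr (-\<beta>) * (unit_ball_vol k * R n ^ k)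
          = unit_ball_vol k * 2 powr \<beta> * \<rho> powr (k - \<beta>) * q ^ n"
      proof -
        have "R (Suc n) powr (-\<beta>) = \<rho> powr (-\<beta>) * (2 powr \<beta> * 2 powr (real n * \<beta>))"
          using \<rho> by (simp add: R_def powr_mult powr_powr flip: powr_add) (simp add: algebra_simps)
        moreover have "R n ^ k = \<rho> powr k * 2 powr (- real n * k)"
          using \<rho> R[of n] by (simp add: powr_realpow[symmetric]) (simp add: R_def powr_mult powr_powr)
        moreover have "q ^ n = 2 powr (real n * \<beta>) * 2 powr (- real n * k)"
          using q by (simp add: powr_realpow[symmetric])
            (simp add: q_def powr_powr algebra_simps flip: powr_add)
        moreover have "\<rho> powr (k - \<beta>) = \<rho> powr k * \<rho> powr (-\<beta>)"
          by (simp flip: powr_add)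
        ultimately show ?thesis by simp
      qed
      finally show "(\<integral>\<^sup>+w. f n w \<partial>lborel) = ennreal (unit_ball_vol k * 2 powr \<beta> * \<rho> powr (k - \<beta>) * q ^ n)" .
    qed
    also have "\<dots> = ennreal (\<Sum>n. unit_ball_vol k * 2 powr \<beta> * \<rho> powr (k - \<beta>) * q ^ n)"
      using q by (intro suminf_ennreal2 summable_mult summable_geometric) auto
    also have "(\<Sum>n. unit_ball_vol k * 2 powr \<beta> * \<rho> powr (k - \<beta>) * q ^ n) = C * \<rho> powr (k - \<beta>)"
      using q by (subst suminf_mult) (auto simp: suminf_geometric C_def intro!: summable_geometric)
    finally show ?thesis .
  qed
  then show ?thesis using C unfolding k_def by blast
qed

text \<open>The inner integral is cut at distance sqrt \<tau>, the scale on which the sup bound and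
  the mass of \<open>a\<close> balance. Near \<open>y\<close> the sup bound meets the integral of
  the kernel over a ball, of order \<tau>^((k-\<beta>)/2); farther away the kernel is at most
  \<tau>^(-\<beta>/2) and the mass takes over. Both give M \<tau>^(-\<beta>/2), and the outer
  integral contributes the second factor M.\<close>

lemma riesz_energy_bound:
  fixes \<beta> :: real
  assumes "0 < \<beta>" "\<beta> < DIM('a::euclidean_space)"
  shows "\<exists>C>0. \<forall>(a::'a \<Rightarrow> real) M \<tau>. a \<in> borel_measurable borel \<and> 0 \<le> M \<and> 0 < \<tau> \<and>
     (\<forall>y. 0 \<le> a y \<and> a y \<le> M * \<tau> powr (- real DIM('a) / 2)) \<and> (\<integral>\<^sup>+y. ennreal (a y) \<partial>lborel) \<le> ennreal M \<longrightarrow>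
     (\<integral>\<^sup>+y. (\<integral>\<^sup>+z. ennreal (a y * norm (y - z) powr (-\<beta>) * a z) \<partial>lborel) \<partial>lborel)
       \<le> ennreal (C * M\<^sup>2 * \<tau> powr (- \<beta> / 2))"
proof -
  obtain C0 where C0: "C0 > 0" "\<And>c::'a. \<And>\<rho>. \<rho> > 0 \<Longrightarrow>
     (\<integral>\<^sup>+w. ennreal (norm (c - w) powr (-\<beta>) * indicator (cball c \<rho>) w) \<partial>lborel)
           \<le> ennreal (C0 * \<rho> powr (DIM('a) - \<beta>))"
    using nn_integral_riesz_ball[OF assms] by blast
  have main: "(\<integral>\<^sup>+y. (\<integral>\<^sup>+z. ennreal (a y * norm (y - z) powr (-\<beta>) * a z) \<partial>lborel) \<partial>lborel)
       \<le> ennreal ((C0 + 1) * M\<^sup>2 * \<tau> powr (- \<beta> / 2))"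
    if [measurable]: "a \<in> borel_measurable borel" and M: "0 \<le> M" and \<tau>: "0 < \<tau>"
    and a: "\<And>y. 0 \<le> a y" "\<And>y. a y \<le> M * \<tau> powr (- real DIM('a) / 2)"
    and I: "(\<integral>\<^sup>+y. ennreal (a y) \<partial>lborel) \<le> ennreal M" for a :: "'a \<Rightarrow> real" and M \<tau>
  proof -
    \<comment> \<open>The summand \<open>C0\<close> comes from the near part, 1 from the far
      part.\<close>
    define K where "K = (C0 + 1) * M * \<tau> powr (- \<beta> / 2)"
    have K: "K \<ge> 0" using C0 M by (simp add: K_def)
    have inner: "(\<integral>\<^sup>+z. ennreal (norm (y - z) powr (-\<beta>) * a z) \<partial>lborel) \<le> ennreal K" for y
    proof -
      have pt: "norm (y - z) powr (-\<beta>) * a z \<le>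
          M * \<tau> powr (- real DIM('a) / 2) * (norm (y - z) powr (-\<beta>) * indicator (cball y (sqrt \<tau>)) z)
          + \<tau> powr (- \<beta> / 2) * a z" (is "?l \<le> ?r1 + ?r2") for z
      proof (cases "z \<in> cball y (sqrt \<tau>)")
        case True
        then have "?l \<le> ?r1" using mult_left_mono[OF a(2)[of z], of "norm (y - z) powr (-\<beta>)"]
          by (simp add: mult_ac)
        moreover have "0 \<le> ?r2" using a by simp
        ultimately show ?thesis by linarith
      next
        case False
        then have n: "sqrt \<tau> < norm (y - z)" by (simp add: dist_norm)
        have "norm (y - z) powr (-\<beta>) \<le> sqrt \<tau> powr (-\<beta>)"
          using n \<tau> assms by (intro powr_mono2') auto
        also have "\<dots> = \<tau> powr (- \<beta> / 2)"
          using \<tau> by (simp add: powr_half_sqrt[symmetric] powr_powr)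
        finally have "?l \<le> ?r2" using a(1)[of z] by (intro mult_right_mono) auto
        moreover have "?r1 \<ge> 0" using M by simp
        ultimately show ?thesis by linarith
      qed
      have "(\<integral>\<^sup>+z. ennreal (norm (y - z) powr (-\<beta>) * a z) \<partial>lborel)
        \<le> (\<integral>\<^sup>+z. ennreal (M * \<tau> powr (- real DIM('a) / 2)) * ennreal (norm (y - z) powr (-\<beta>) * indicator (cball y (sqrt \<tau>)) z)
          + ennreal (\<tau> powr (- \<beta> / 2)) * ennreal (a z) \<partial>lborel)"
        using pt M a by (intro nn_integral_mono) (simp add: ennreal_mult'[symmetric] ennreal_plus[symmetric] del: ennreal_plus)
      also have "\<dots> = ennreal (M * \<tau> powr (- real DIM('a) / 2)) * (\<integral>\<^sup>+z. ennreal (norm (y - z) powr (-\<beta>) * indicator (cball y (sqrt \<tau>)) z) \<partial>lborel)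
          + ennreal (\<tau> powr (- \<beta> / 2)) * (\<integral>\<^sup>+z. ennreal (a z) \<partial>lborel)"
        by (subst nn_integral_add, measurable) (subst nn_integral_cmult, measurable, subst nn_integral_cmult, measurable)
      also have "\<dots> \<le> ennreal (M * \<tau> powr (- real DIM('a) / 2)) * ennreal (C0 * sqrt \<tau> powr (DIM('a) - \<beta>))
          + ennreal (\<tau> powr (- \<beta> / 2)) * ennreal M"
        using \<tau> by (intro add_mono mult_left_mono C0 I) auto
      also have "\<dots> = ennreal (M * \<tau> powr (- real DIM('a) / 2) * (C0 * sqrt \<tau> powr (DIM('a) - \<beta>)) + \<tau> powr (- \<beta> / 2) * M)"
        using M C0 by (simp add: ennreal_mult'[symmetric] ennreal_plus[symmetric] del: ennreal_plus)
      also have "M * \<tau> powr (- real DIM('a) / 2) * (C0 * sqrt \<tau> powr (DIM('a) - \<beta>)) + \<tau> powr (- \<beta> / 2) * M = K"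
      proof -
        have "\<tau> powr (- real DIM('a) / 2) * sqrt \<tau> powr (DIM('a) - \<beta>) = \<tau> powr (- \<beta> / 2)"
          using \<tau> by (simp add: powr_half_sqrt[symmetric] powr_powr flip: powr_add) (simp add: field_simps)
        then show ?thesis by (simp add: K_def algebra_simps)
      qed
      finally show ?thesis .
    qed
    have "(\<integral>\<^sup>+y. (\<integral>\<^sup>+z. ennreal (a y * norm (y - z) powr (-\<beta>) * a z) \<partial>lborel) \<partial>lborel)
      = (\<integral>\<^sup>+y. ennreal (a y) * (\<integral>\<^sup>+z. ennreal (norm (y - z) powr (-\<beta>) * a z) \<partial>lborel) \<partial>lborel)"
      using a by (simp add: nn_integral_cmult[symmetric] ennreal_mult'[symmetric] mult_ac)
    also have "\<dots> \<le> (\<integral>\<^sup>+y. ennreal (a y) * ennreal K \<partial>lborel)"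
      by (intro nn_integral_mono mult_left_mono inner) auto
    also have "\<dots> = (\<integral>\<^sup>+y. ennreal (a y) \<partial>lborel) * ennreal K"
      by (simp add: nn_integral_multc)
    also have "\<dots> \<le> ennreal M * ennreal K" by (intro mult_right_mono I) auto
    also have "\<dots> = ennreal ((C0 + 1) * M\<^sup>2 * \<tau> powr (- \<beta> / 2))"
      using M K by (simp add: ennreal_mult'[symmetric] K_def power2_eq_square mult_ac)
    finally show ?thesis .
  qed
  show ?thesis
    by (rule exI[of _ "C0 + 1"]) (use C0 main in auto)
qed

section \<open>The heat kernel\<close>

lemma heat_kernel_nonneg: "0 \<le> heat_kernel t x"
  by (simp add: heat_kernel_def)

lemma borel_measurable_heat_kernel [measurable]:
  assumes [measurable]: "f \<in> borel_measurable M" "g \<in> borel_measurable M"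
  shows "(\<lambda>w. heat_kernel (f w) (g w :: real ^ 'k)) \<in> borel_measurable M"
  unfolding heat_kernel_def by measurable

lemma heat_kernel_zero [simp]: "heat_kernel 0 x = 0"
  by (simp add: heat_kernel_def)

text \<open>The prefactor decreases in time, and dropping 2 pi only increases it.\<close>

lemma heat_kernel_le:
  assumes "0 < \<tau>" "\<tau> \<le> t"
  shows "heat_kernel t (x :: real ^ 'k) \<le> \<tau> powr (- real CARD('k) / 2)"
proof -
  have "1 * t \<le> (2 * pi) * t" using assms pi_ge_two by (intro mult_right_mono) linarith+
  then have "\<tau> \<le> 2 * pi * t" using assms by linarith
  then have "(2 * pi * t) powr (- real CARD('k) / 2) \<le> \<tau> powr (- real CARD('k) / 2)"
    using assms by (intro powr_mono2') auto
  moreover have "exp (- (norm x)\<^sup>2 / (2 * t)) \<le> 1" using assms by simp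
  ultimately show ?thesis
    unfolding heat_kernel_def
    using mult_mono[of "(2 * pi * t) powr (- real CARD('k) / 2)" "\<tau> powr (- real CARD('k) / 2)"
        "exp (- (norm x)\<^sup>2 / (2 * t))" 1] by simp
qed

text \<open>In coordinates the kernel is the product of one-dimensional normal densities of variance
  t centred at the coordinates of x, so the claim reduces to their total mass.\<close>

lemma nn_integral_heat_kernel:
  assumes "0 < t"
  shows "(\<integral>\<^sup>+y. ennreal (heat_kernel t (x - y :: real ^ 'k)) \<partial>lborel) = 1"
proof -
  have one: "(\<integral>\<^sup>+z. ennreal (normal_density \<mu> (sqrt t) z) \<partial>lborel) = 1" for \<mu>
    using assms by (subst nn_integral_eq_integral) auto
  have eq: "ennreal (heat_kernel t (x - y)) = (\<Prod>b\<in>Basis. ennreal (normal_density (x \<bullet> b) (sqrt t) (y \<bullet> b)))" for y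
  proof -
    have "(\<Prod>b\<in>(Basis :: (real ^ 'k) set). normal_density (x \<bullet> b) (sqrt t) (y \<bullet> b))
        = (1 / sqrt (2 * pi * t)) ^ CARD('k) * exp (\<Sum>b\<in>(Basis :: (real ^ 'k) set). - (y \<bullet> b - x \<bullet> b)\<^sup>2 / (2 * t))"
      using assms by (simp add: normal_density_def prod_dividef power_divide exp_sum)
    also have "(1 / sqrt (2 * pi * t)) ^ CARD('k) = (2 * pi * t) powr (- real CARD('k) / 2)"
    proof -
      have "1 / sqrt (2 * pi * t) = (2 * pi * t) powr (- 1 / 2)"
        using assms by (simp add: powr_minus_divide powr_half_sqrt)
      moreover have "\<dots> ^ CARD('k) = (2 * pi * t) powr (- 1 / 2 * real CARD('k))"
        using assms by (subst powr_realpow[symmetric]) (auto simp: powr_powr)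
      ultimately show ?thesis by simp
    qed
    also have "(\<Sum>b\<in>(Basis :: (real ^ 'k) set). - (y \<bullet> b - x \<bullet> b)\<^sup>2 / (2 * t)) = - (norm (x - y))\<^sup>2 / (2 * t)"
    proof -
      have "(norm (x - y))\<^sup>2 = (\<Sum>b\<in>Basis. ((x - y) \<bullet> b)\<^sup>2)"
        unfolding power2_norm_eq_inner by (subst euclidean_inner) (simp add: power2_eq_square)
      also have "\<dots> = (\<Sum>b\<in>Basis. (y \<bullet> b - x \<bullet> b)\<^sup>2)"
        by (simp add: inner_diff_left power2_commute)
      finally show ?thesis by (simp only: sum_divide_distrib[symmetric] sum_negf)
    qed
    finally have "heat_kernel t (x - y) = (\<Prod>b\<in>(Basis :: (real ^ 'k) set). normal_density (x \<bullet> b) (sqrt t) (y \<bullet> b))"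
      unfolding heat_kernel_def by (rule sym)
    then show ?thesis by (simp add: prod_ennreal)
  qed
  have "(\<integral>\<^sup>+y. ennreal (heat_kernel t (x - y)) \<partial>lborel)
      = (\<Prod>b\<in>(Basis :: (real ^ 'k) set). (\<integral>\<^sup>+z. ennreal (normal_density (x \<bullet> b) (sqrt t) z) \<partial>lborel))"
    unfolding eq by (rule nn_integral_lborel_prod) auto
  then show ?thesis by (simp add: one)
qed

section \<open>Gaussian bounds for increments of the heat kernel in space and time\<close>

lemma exp_square_diff_le:
  fixes a b :: real
  assumes "0 \<le> a" "0 \<le> b"
  shows "\<bar>exp (- a\<^sup>2) - exp (- b\<^sup>2)\<bar> \<le> 2 * \<bar>a - b\<bar> * (exp (- a\<^sup>2 / 2) + exp (- b\<^sup>2 / 2))"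
  using assms
proof (induction a b rule: linorder_wlog)
  case (le a b)
  show ?case
  proof (cases "a = b")
    case False
    with le have "a < b" by simp
    have "\<exists>z>a. z < b \<and> exp (- b\<^sup>2) - exp (- a\<^sup>2) = (b - a) * (- 2 * z * exp (- z\<^sup>2))"
      using \<open>a < b\<close> by (intro MVT2) (auto intro!: derivative_eq_intros)
    then obtain z where z: "a < z" "z < b" "exp (- b\<^sup>2) - exp (- a\<^sup>2) = (b - a) * (- 2 * z * exp (- z\<^sup>2))"
      by blast
    \<comment> \<open>The factor z is paid for with half of the exponent; monotonicity then moves
      what is left from the unknown point z to the endpoint a.\<close>
    have "z \<le> 1 + z\<^sup>2 / 2" using sum_power2_ge_zero[of "z - 1" 0] by (simp add: power2_eq_square algebra_simps)
    also have "\<dots> \<le> exp (z\<^sup>2 / 2)" by (rule exp_ge_add_one_self)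
    finally have "z * exp (- z\<^sup>2) \<le> exp (z\<^sup>2 / 2) * exp (- z\<^sup>2)" by simp
    also have "\<dots> = exp (- z\<^sup>2 / 2)" by (simp flip: exp_add)
    also have "\<dots> \<le> exp (- a\<^sup>2 / 2)" using z le by (simp add: power_mono)
    finally have *: "z * exp (- z\<^sup>2) \<le> exp (- a\<^sup>2 / 2) + exp (- b\<^sup>2 / 2)"
      by (smt (verit) exp_gt_zero)
    have "\<bar>exp (- a\<^sup>2) - exp (- b\<^sup>2)\<bar> = \<bar>exp (- b\<^sup>2) - exp (- a\<^sup>2)\<bar>" by simp
    also have "\<dots> = 2 * (b - a) * (z * exp (- z\<^sup>2))"
      unfolding z(3) using z le by (simp add: abs_mult)
    also have "\<dots> \<le> 2 * (b - a) * (exp (- a\<^sup>2 / 2) + exp (- b\<^sup>2 / 2))"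
      using * z by (intro mult_left_mono) auto
    finally show ?thesis using z by simp
  qed simp
next
  case (sym a b)
  then show ?case by (simp add: abs_minus_commute add.commute)
qed

text \<open>The bounds below give up part of the exponent while the prefactor stays that of time t.
  This reads the result as a heat kernel at a later time, at the price of c^(k/2).\<close>

lemma heat_kernel_scale:
  assumes "0 < t" "0 < c"
  shows "(2 * pi * t) powr (- real CARD('k) / 2) * exp (- (norm x)\<^sup>2 / (2 * (c * t)))
    = c powr (real CARD('k) / 2) * heat_kernel (c * t) (x :: real ^ 'k)"
proof -
  have "(2 * pi * (c * t)) powr (- real CARD('k) / 2) = c powr (- real CARD('k) / 2) * (2 * pi * t) powr (- real CARD('k) / 2)"
    using assms by (simp flip: powr_mult add: mult_ac)
  moreover have "c powr (real CARD('k) / 2) * c powr (- real CARD('k) / 2) = 1"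
    using assms by (simp flip: powr_add)
  ultimately show ?thesis
    unfolding heat_kernel_def by (metis (no_types, lifting) mult.assoc mult_1)
qed

text \<open>The kernel depends on the norm alone, so after rescaling by sqrt (2 \<tau>) this is a
  one-dimensional estimate for exp (-a^2). Half of the exponent is given up, which doubles the time.
  The alternative 1 in the minimum is the triangle inequality.\<close>

lemma heat_kernel_space_diff_le:
  assumes \<tau>: "0 < \<tau>"
  shows "\<bar>heat_kernel \<tau> a - heat_kernel \<tau> (b :: real ^ 'k)\<bar> \<le>
    2 * 2 powr (real CARD('k) / 2) * min 1 (norm (a - b) / sqrt \<tau>) * (heat_kernel (2 * \<tau>) a + heat_kernel (2 * \<tau>) b)"
proof -
  define P where "P = (2 * pi * \<tau>) powr (- real CARD('k) / 2)"
  define D where "D = 2 powr (real CARD('k) / 2)"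
  have D: "D > 0" by (simp add: D_def)
  have P: "P \<ge> 0" by (simp add: P_def)
  define A where "A = (\<lambda>v::real^'k. norm v / sqrt (2 * \<tau>))"
  have A: "A v \<ge> 0" "(A v)\<^sup>2 = (norm v)\<^sup>2 / (2 * \<tau>)" for v
    using \<tau> by (auto simp: A_def power_divide)
  have S: "heat_kernel \<tau> v = P * exp (- (A v)\<^sup>2)" for v
    by (simp add: heat_kernel_def P_def A)
  have S2: "P * exp (- (A v)\<^sup>2 / 2) = D * heat_kernel (2 * \<tau>) v" for v
    using heat_kernel_scale[OF \<tau>, of 2 v] by (simp add: P_def A D_def)
  have "\<bar>heat_kernel \<tau> a - heat_kernel \<tau> b\<bar> = P * \<bar>exp (- (A a)\<^sup>2) - exp (- (A b)\<^sup>2)\<bar>"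
    unfolding S using P by (simp add: abs_mult flip: right_diff_distrib)
  also have "\<dots> \<le> P * (2 * \<bar>A a - A b\<bar> * (exp (- (A a)\<^sup>2 / 2) + exp (- (A b)\<^sup>2 / 2)))"
    by (intro mult_left_mono exp_square_diff_le A P)
  also have "\<dots> = 2 * \<bar>A a - A b\<bar> * (P * exp (- (A a)\<^sup>2 / 2) + P * exp (- (A b)\<^sup>2 / 2))"
    by (simp add: algebra_simps)
  also have "\<dots> = 2 * D * \<bar>A a - A b\<bar> * (heat_kernel (2 * \<tau>) a + heat_kernel (2 * \<tau>) b)"
    unfolding S2 by (simp add: algebra_simps)
  also have "\<dots> \<le> 2 * D * (norm (a - b) / sqrt \<tau>) * (heat_kernel (2 * \<tau>) a + heat_kernel (2 * \<tau>) b)"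
  proof (intro mult_right_mono mult_left_mono)
    have "\<bar>A a - A b\<bar> = \<bar>norm a - norm b\<bar> / sqrt (2 * \<tau>)"
      using \<tau> by (simp add: A_def abs_divide flip: diff_divide_distrib)
    also have "\<dots> \<le> norm (a - b) / sqrt \<tau>"
      using \<tau> by (intro frac_le norm_triangle_ineq3) auto
    finally show "\<bar>A a - A b\<bar> \<le> norm (a - b) / sqrt \<tau>" .
  qed (auto simp: heat_kernel_nonneg D_def)
  finally have 1: "\<bar>heat_kernel \<tau> a - heat_kernel \<tau> b\<bar> \<le> 2 * D * (norm (a - b) / sqrt \<tau>) * (heat_kernel (2 * \<tau>) a + heat_kernel (2 * \<tau>) b)" .
  have le: "heat_kernel \<tau> v \<le> D * heat_kernel (2 * \<tau>) v" for v :: "real ^ 'k"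
  proof -
    have "P * exp (- (A v)\<^sup>2) \<le> P * exp (- (A v)\<^sup>2 / 2)"
      using P by (intro mult_left_mono) auto
    then show ?thesis by (simp only: S S2)
  qed
  have "\<bar>heat_kernel \<tau> a - heat_kernel \<tau> b\<bar> \<le> heat_kernel \<tau> a + heat_kernel \<tau> b"
    using heat_kernel_nonneg[of \<tau> a] heat_kernel_nonneg[of \<tau> b] by linarith
  also have "\<dots> \<le> D * (heat_kernel (2 * \<tau>) a + heat_kernel (2 * \<tau>) b)"
    using le[of a] le[of b] by (simp add: algebra_simps)
  also have "\<dots> \<le> 2 * D * 1 * (heat_kernel (2 * \<tau>) a + heat_kernel (2 * \<tau>) b)"
    using D heat_kernel_nonneg[of "2 * \<tau>" a] heat_kernel_nonneg[of "2 * \<tau>" b] by (intro mult_right_mono) auto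
  finally show ?thesis using 1 unfolding D_def min_def by (simp split: if_splits)
qed

text \<open>The mean value theorem in time. The derivative multiplies the kernel by (-k/2 + B)/t
  with B = |a|^2/(2t), and half of the exponent absorbs B. Since \<delta> is at most \<tau>, the
  intermediate time lies below 2 \<tau>; together with the halved exponent this costs a factor four
  in time.\<close>

lemma heat_kernel_time_diff_le:
  assumes \<tau>: "0 < \<tau>" and \<delta>: "0 \<le> \<delta>" "\<delta> \<le> \<tau>"
  shows "\<bar>heat_kernel (\<tau> + \<delta>) a - heat_kernel \<tau> (a :: real ^ 'k)\<bar> \<le>
    (real CARD('k) / 2 + 2) * 4 powr (real CARD('k) / 2) * (\<delta> / \<tau>) * heat_kernel (4 * \<tau>) a"
proof (cases "\<delta> = 0")
  case False
  define k where "k = real CARD('k)"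
  define A where "A = (norm a)\<^sup>2"
  have k: "k \<ge> 0" by (simp add: k_def)
  have A: "A \<ge> 0" by (simp add: A_def)
  have S: "heat_kernel t a = (2 * pi * t) powr (- k / 2) * exp (- A / (2 * t))" for t
    by (simp add: heat_kernel_def k_def A_def)
  \<comment> \<open>The time derivative of the kernel, with the kernel itself factored out.\<close>
  define S' where "S' = (\<lambda>t. (2 * pi * t) powr (- k / 2) * exp (- A / (2 * t)) * ((- k / 2 + A / (2 * t)) / t))"
  have "((\<lambda>t. heat_kernel t a) has_real_derivative S' t) (at t)" if "t > 0" for t
  proof -
    have "((\<lambda>t. (2 * pi * t) powr (- k / 2) * exp (- A / (2 * t))) has_real_derivative
       (- k / 2) * (2 * pi * t) powr (- k / 2 - 1) * (2 * pi) * exp (- A / (2 * t)) +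
       (2 * pi * t) powr (- k / 2) * (exp (- A / (2 * t)) * (A / (2 * t\<^sup>2)))) (at t)"
      using that by (auto intro!: derivative_eq_intros simp: power2_eq_square field_simps)
    moreover have "(2 * pi * t) powr (- k / 2 - 1) = (2 * pi * t) powr (- k / 2) / (2 * pi * t)"
      using that by (simp add: powr_diff)
    ultimately show ?thesis unfolding S S'_def using that
      by (elim DERIV_cong) (simp add: field_simps power2_eq_square)
  qed
  then have "\<exists>z>\<tau>. z < \<tau> + \<delta> \<and> heat_kernel (\<tau> + \<delta>) a - heat_kernel \<tau> a = (\<tau> + \<delta> - \<tau>) * S' z"
    using \<tau> \<delta> False by (intro MVT2) auto
  then obtain z where z: "\<tau> < z" "z < \<tau> + \<delta>" "heat_kernel (\<tau> + \<delta>) a - heat_kernel \<tau> a = \<delta> * S' z"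
    by auto
  have z2: "z < 2 * \<tau>" using z \<delta> by simp
  define B where "B = A / (2 * z)"
  have B: "B \<ge> 0" using A z \<tau> by (simp add: B_def)
  have "\<bar>S' z\<bar> = (2 * pi * z) powr (- k / 2) * (exp (- B) * \<bar>- k / 2 + B\<bar>) / z"
    using z \<tau> by (simp add: S'_def B_def abs_mult abs_divide)
  also have "\<dots> \<le> (2 * pi * \<tau>) powr (- k / 2) * ((k / 2 + 2) * exp (- A / (2 * (4 * \<tau>)))) / \<tau>"
  proof (rule frac_le)
    show "(2 * pi * z) powr (- k / 2) * (exp (- B) * \<bar>- k / 2 + B\<bar>)
        \<le> (2 * pi * \<tau>) powr (- k / 2) * ((k / 2 + 2) * exp (- A / (2 * (4 * \<tau>))))"
    proof (rule mult_mono)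
      show "(2 * pi * z) powr (- k / 2) \<le> (2 * pi * \<tau>) powr (- k / 2)"
        using z \<tau> k by (intro powr_mono2') auto
      \<comment> \<open>B is traded for half of the exponent through 1 + B/2 <= exp (B/2).\<close>
      have "B \<le> 2 * exp (B / 2)" using exp_ge_add_one_self[of "B/2"] by linarith
      then have "exp (- B) * B \<le> exp (- B) * (2 * exp (B / 2))" by (intro mult_left_mono) auto
      also have "\<dots> = 2 * exp (- B / 2)" by (simp flip: exp_add)
      finally have 1: "exp (- B) * B \<le> 2 * exp (- B / 2)" .
      have 2: "exp (- B) \<le> exp (- B / 2)" using B by simp
      have "exp (- B) * \<bar>- k / 2 + B\<bar> \<le> exp (- B) * (k / 2 + B)"
        using k B by (intro mult_left_mono) auto
      also have "\<dots> \<le> (k / 2 + 2) * exp (- B / 2)"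
        using 1 mult_left_mono[OF 2, of "k / 2"] k by (simp add: algebra_simps)
      also have "\<dots> \<le> (k / 2 + 2) * exp (- A / (2 * (4 * \<tau>)))"
      proof (intro mult_left_mono)
        have "A / (8 * \<tau>) \<le> A / (4 * z)" using A z z2 \<tau> by (intro divide_left_mono) auto
        then show "exp (- B / 2) \<le> exp (- A / (2 * (4 * \<tau>)))" by (simp add: B_def)
      qed (use k in auto)
      finally show "exp (- B) * \<bar>- k / 2 + B\<bar> \<le> (k / 2 + 2) * exp (- A / (2 * (4 * \<tau>)))" .
    qed auto
  qed (use z \<tau> k in auto)
  also have "\<dots> = (k / 2 + 2) * (4 powr (k / 2) * heat_kernel (4 * \<tau>) a) / \<tau>"
    using heat_kernel_scale[OF \<tau>, of 4 a] by (simp add: k_def A_def)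
  finally have "\<delta> * \<bar>S' z\<bar> \<le> \<delta> * ((k / 2 + 2) * (4 powr (k / 2) * heat_kernel (4 * \<tau>) a) / \<tau>)"
    using \<delta> by (intro mult_left_mono) auto
  then show ?thesis using z \<delta> by (simp add: abs_mult k_def mult_ac)
qed simp

text \<open>The two quantities that control the Riesz energy of a function on the scale \<open>\<tau>\<close>.\<close>

definition heat_bounded :: "real \<Rightarrow> real \<Rightarrow> (real ^ 'k \<Rightarrow> real) \<Rightarrow> bool" where
  "heat_bounded \<tau> m a \<longleftrightarrow> (\<forall>y. \<bar>a y\<bar> \<le> m * \<tau> powr (- real CARD('k) / 2)) \<and>
     (\<integral>\<^sup>+y. ennreal \<bar>a y\<bar> \<partial>lborel) \<le> ennreal m"

text \<open>The increment bounds compare with a sum of two heat kernels, each of which has both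
  quantities under control.\<close>

lemma heat_bounded_add:
  fixes a1 a2 :: "real ^ 'k \<Rightarrow> real"
  assumes [measurable]: "a1 \<in> borel_measurable borel" "a2 \<in> borel_measurable borel"
  assumes 1: "heat_bounded \<tau> m1 a1" and 2: "heat_bounded \<tau> m2 a2"
    and le: "\<And>y. \<bar>a y\<bar> \<le> c * (\<bar>a1 y\<bar> + \<bar>a2 y\<bar>)" and c: "0 \<le> c" "0 \<le> m1" "0 \<le> m2"
  shows "heat_bounded \<tau> (c * (m1 + m2)) a"
  unfolding heat_bounded_def
proof (intro conjI allI)
  fix y
  have "\<bar>a y\<bar> \<le> c * (\<bar>a1 y\<bar> + \<bar>a2 y\<bar>)" by (rule le)
  also have "\<dots> \<le> c * (m1 * \<tau> powr (- real CARD('k) / 2) + m2 * \<tau> powr (- real CARD('k) / 2))"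
    using 1 2 c by (intro mult_left_mono add_mono) (auto simp: heat_bounded_def)
  finally show "\<bar>a y\<bar> \<le> c * (m1 + m2) * \<tau> powr (- real CARD('k) / 2)"
    by (simp add: algebra_simps)
next
  have "(\<integral>\<^sup>+y. ennreal \<bar>a y\<bar> \<partial>lborel) \<le> (\<integral>\<^sup>+y. ennreal c * (ennreal \<bar>a1 y\<bar> + ennreal \<bar>a2 y\<bar>) \<partial>lborel)"
    using le c by (intro nn_integral_mono) (simp add: ennreal_mult'[symmetric] ennreal_plus[symmetric] del: ennreal_plus)
  also have "\<dots> = ennreal c * ((\<integral>\<^sup>+y. ennreal \<bar>a1 y\<bar> \<partial>lborel) + (\<integral>\<^sup>+y. ennreal \<bar>a2 y\<bar> \<partial>lborel))"
    by (subst nn_integral_cmult, measurable) (subst nn_integral_add, auto)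
  also have "\<dots> \<le> ennreal c * (ennreal m1 + ennreal m2)"
    using 1 2 by (intro mult_left_mono add_mono) (auto simp: heat_bounded_def)
  also have "\<dots> = ennreal (c * (m1 + m2))"
    using c by (simp add: ennreal_mult'[symmetric] ennreal_plus[symmetric] del: ennreal_plus)
  finally show "(\<integral>\<^sup>+y. ennreal \<bar>a y\<bar> \<partial>lborel) \<le> ennreal (c * (m1 + m2))" .
qed

lemma heat_bounded_heat_kernel:
  assumes "0 < \<tau>" "\<tau> \<le> t"
  shows "heat_bounded \<tau> 1 (\<lambda>y :: real ^ 'k. heat_kernel t (x - y))"
  using assms heat_kernel_le[OF assms] nn_integral_heat_kernel[of t x]
  by (auto simp: heat_bounded_def heat_kernel_nonneg)

lemma heat_bounded_space_diff:
  assumes "0 < \<tau>"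
  shows "heat_bounded \<tau> (4 * 2 powr (real CARD('k) / 2) * min 1 (norm (x - x') / sqrt \<tau>))
    (\<lambda>y :: real ^ 'k. heat_kernel \<tau> (x - y) - heat_kernel \<tau> (x' - y))"
proof -
  define c where "c = 2 * 2 powr (real CARD('k) / 2) * min 1 (norm (x - x') / sqrt \<tau>)"
  have "heat_bounded \<tau> (c * (1 + 1)) (\<lambda>y :: real ^ 'k. heat_kernel \<tau> (x - y) - heat_kernel \<tau> (x' - y))"
  proof (rule heat_bounded_add)
    show "heat_bounded \<tau> 1 (\<lambda>y. heat_kernel (2 * \<tau>) (x - y))" "heat_bounded \<tau> 1 (\<lambda>y. heat_kernel (2 * \<tau>) (x' - y))"
      using assms by (auto intro!: heat_bounded_heat_kernel)
    fix y
    show "\<bar>heat_kernel \<tau> (x - y) - heat_kernel \<tau> (x' - y)\<bar> \<le> c *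
        (\<bar>heat_kernel (2 * \<tau>) (x - y)\<bar> + \<bar>heat_kernel (2 * \<tau>) (x' - y)\<bar>)"
      using heat_kernel_space_diff_le[OF assms, of "x - y" "x' - y"] by (simp add: heat_kernel_nonneg c_def)
  qed (use assms in \<open>auto simp: c_def\<close>)
  then show ?thesis by (simp add: c_def mult_ac)
qed

lemma heat_bounded_time_diff:
  assumes "0 < \<tau>" "0 \<le> \<delta>"
  shows "heat_bounded \<tau> (2 * ((real CARD('k) / 2 + 2) * 4 powr (real CARD('k) / 2)) * min 1 (\<delta> / \<tau>))
    (\<lambda>y :: real ^ 'k. heat_kernel (\<tau> + \<delta>) (x - y) - heat_kernel \<tau> (x - y))"
proof -
  define c where "c = (real CARD('k) / 2 + 2) * 4 powr (real CARD('k) / 2) * min 1 (\<delta> / \<tau>)"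
  \<comment> \<open>At least 1, so that the constant also covers the range \<delta> > \<tau>, where
    the triangle inequality is used.\<close>
  have C: "1 \<le> (real CARD('k) / 2 + 2) * 4 powr (real CARD('k) / 2)"
    using mult_mono[of 1 "real CARD('k) / 2 + 2" 1 "4 powr (real CARD('k) / 2)"] by (simp add: ge_one_powr_ge_zero)
  have c: "0 \<le> c" using assms by (simp add: c_def)
  \<comment> \<open>One bound for both ranges: the first comparison kernel sits at 4 \<tau> when
    \<delta> is at most \<tau>, as the derivative estimate wants, and at \<tau> otherwise.\<close>
  have "\<bar>heat_kernel (\<tau> + \<delta>) (x - y) - heat_kernel \<tau> (x - y)\<bar>
     \<le> c * (\<bar>heat_kernel (if \<delta> \<le> \<tau> then 4 * \<tau> else \<tau>) (x - y)\<bar> + \<bar>heat_kernel (\<tau> + \<delta>) (x - y)\<bar>)" for y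
  proof (cases "\<delta> \<le> \<tau>")
    case True
    then have "c = (real CARD('k) / 2 + 2) * 4 powr (real CARD('k) / 2) * (\<delta> / \<tau>)"
      using assms by (simp add: c_def min_def divide_simps)
    then have "\<bar>heat_kernel (\<tau> + \<delta>) (x - y) - heat_kernel \<tau> (x - y)\<bar> \<le> c * heat_kernel (4 * \<tau>) (x - y)"
      using heat_kernel_time_diff_le[OF assms(1,2) True, of "x - y"] by simp
    also have "\<dots> \<le> c * (heat_kernel (4 * \<tau>) (x - y) + heat_kernel (\<tau> + \<delta>) (x - y))"
      using c by (intro mult_left_mono) (auto simp: heat_kernel_nonneg)
    finally show ?thesis using True by (simp add: heat_kernel_nonneg)
  next
    case False
    then have "1 \<le> c" using C assms by (simp add: c_def min_def divide_simps)
    have "\<bar>heat_kernel (\<tau> + \<delta>) (x - y) - heat_kernel \<tau> (x - y)\<bar> \<le> 1 * (heat_kernel \<tau> (x - y) + heat_kernel (\<tau> + \<delta>) (x - y))"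
      using heat_kernel_nonneg[of \<tau> "x - y"] heat_kernel_nonneg[of "\<tau> + \<delta>" "x - y"]
      unfolding mult_1 abs_le_iff by linarith
    also have "\<dots> \<le> c * (heat_kernel \<tau> (x - y) + heat_kernel (\<tau> + \<delta>) (x - y))"
      using \<open>1 \<le> c\<close> by (intro mult_right_mono) (auto simp: heat_kernel_nonneg)
    finally show ?thesis using False by (simp add: heat_kernel_nonneg)
  qed
  then have "heat_bounded \<tau> (c * (1 + 1)) (\<lambda>y :: real ^ 'k. heat_kernel (\<tau> + \<delta>) (x - y) - heat_kernel \<tau> (x - y))"
    using assms c by (intro heat_bounded_add[OF _ _ heat_bounded_heat_kernel[of \<tau> "if \<delta> \<le> \<tau> then 4 * \<tau> else \<tau>" x] heat_bounded_heat_kernel[of \<tau> "\<tau> + \<delta>" x]])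
      auto
  then show ?thesis by (simp add: c_def mult_ac)
qed

section \<open>Increments of the heat kernel\<close>

lemma has_integral_indicator_times:
  fixes f :: "real \<Rightarrow> real"
  assumes "(f has_integral I) S"
  shows "((\<lambda>x. indicator S x * f x) has_integral I) UNIV"
proof -
  have "(\<lambda>x. indicator S x * f x) = (\<lambda>x. if x \<in> S then f x else 0)"
    by (auto simp: fun_eq_iff indicator_def)
  then show ?thesis using assms by (simp add: has_integral_restrict_UNIV)
qed

text \<open>Cut at \<tau> = \<theta>. Below, \<tau>^(-\<beta>/2) is integrable because \<beta> < 2;
  above, \<theta> \<tau>^(-\<beta>/2-1) is integrable because \<beta> > 0. Both parts scale like
  \<theta>^(1-\<beta>/2), and \<open>C\<close> is the sum of their constants.\<close>

lemma nn_integral_powr_min: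
  assumes \<beta>: "0 < \<beta>" "\<beta> < 2"
  shows "\<exists>C>0. \<forall>\<theta>\<ge>0. (\<integral>\<^sup>+\<tau>. ennreal (indicator {0<..} \<tau> * (\<tau> powr (-\<beta> / 2) * min 1 (\<theta> / \<tau>))) \<partial>lborel)
     \<le> ennreal (C * \<theta> powr ((2 - \<beta>) / 2))"
proof -
  define C where "C = 1 / (1 - \<beta> / 2) + 2 / \<beta>"
  have C: "C > 0" using \<beta> by (simp add: C_def add_pos_pos)
  have "(\<integral>\<^sup>+\<tau>. ennreal (indicator {0<..} \<tau> * (\<tau> powr (-\<beta> / 2) * min 1 (\<theta> / \<tau>))) \<partial>lborel)
     \<le> ennreal (C * \<theta> powr ((2 - \<beta>) / 2))" if \<theta>: "\<theta> > 0" for \<theta>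
  proof -
    define f where "f = (\<lambda>\<tau>::real. indicator {0..\<theta>} \<tau> * \<tau> powr (-\<beta> / 2))"
    define g where "g = (\<lambda>\<tau>::real. indicator {\<theta>..} \<tau> * \<tau> powr (-\<beta> / 2 - 1))"
    have [measurable]: "f \<in> borel_measurable borel" "g \<in> borel_measurable borel"
      unfolding f_def g_def by measurable
    have "(f has_integral (\<theta> powr (-\<beta> / 2 + 1) / (-\<beta> / 2 + 1))) UNIV"
      using has_integral_powr_from_0[of "-\<beta>/2" \<theta>] \<beta> \<theta> unfolding f_def
      by (intro has_integral_indicator_times) simp
    then have f: "(\<integral>\<^sup>+\<tau>. ennreal (f \<tau>) \<partial>lborel) = ennreal (\<theta> powr (-\<beta> / 2 + 1) / (-\<beta> / 2 + 1))"
      by (intro nn_integral_has_integral_lborel) (auto simp: f_def)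
    have "(g has_integral (- (\<theta> powr (-\<beta> / 2 - 1 + 1)) / (-\<beta> / 2 - 1 + 1))) UNIV"
      using has_integral_powr_to_inf[of "-\<beta>/2 - 1" \<theta>] \<beta> \<theta> unfolding g_def
      by (intro has_integral_indicator_times) simp
    then have g: "(\<integral>\<^sup>+\<tau>. ennreal (g \<tau>) \<partial>lborel) = ennreal (- (\<theta> powr (-\<beta> / 2 - 1 + 1)) / (-\<beta> / 2 - 1 + 1))"
      by (intro nn_integral_has_integral_lborel) (auto simp: g_def)
    have "(\<integral>\<^sup>+\<tau>. ennreal (indicator {0<..} \<tau> * (\<tau> powr (-\<beta> / 2) * min 1 (\<theta> / \<tau>))) \<partial>lborel)
      \<le> (\<integral>\<^sup>+\<tau>. ennreal (f \<tau>) + ennreal \<theta> * ennreal (g \<tau>) \<partial>lborel)"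
    proof (intro nn_integral_mono)
      fix \<tau> :: real
      have "indicator {0<..} \<tau> * (\<tau> powr (-\<beta> / 2) * min 1 (\<theta> / \<tau>)) \<le> f \<tau> + \<theta> * g \<tau>"
      proof (cases "0 < \<tau>")
        case True
        show ?thesis
        proof (cases "\<tau> \<le> \<theta>")
          case True
          have "\<tau> powr (-\<beta> / 2) * min 1 (\<theta> / \<tau>) \<le> \<tau> powr (-\<beta> / 2) * 1"
            by (intro mult_left_mono) auto
          moreover have "0 \<le> \<theta> * g \<tau>" using \<theta> by (simp add: g_def)
          ultimately show ?thesis using True \<open>0 < \<tau>\<close> by (simp add: f_def)
        next
          case False
          have "\<tau> powr (-\<beta> / 2) * min 1 (\<theta> / \<tau>) \<le> \<tau> powr (-\<beta> / 2) * (\<theta> / \<tau>)"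
            by (intro mult_left_mono) auto
          also have "\<dots> = \<theta> * g \<tau>"
            using False True by (simp add: g_def powr_diff)
          finally show ?thesis using False True by (simp add: f_def)
        qed
      qed (use \<theta> in \<open>auto simp: f_def g_def\<close>)
      then show "ennreal (indicator {0<..} \<tau> * (\<tau> powr (-\<beta> / 2) * min 1 (\<theta> / \<tau>))) \<le> ennreal (f \<tau>) + ennreal \<theta> * ennreal (g \<tau>)"
        using \<theta> by (simp add: ennreal_mult'[symmetric] ennreal_plus[symmetric] f_def g_def del: ennreal_plus)
    qed
    also have "\<dots> = (\<integral>\<^sup>+\<tau>. ennreal (f \<tau>) \<partial>lborel) + ennreal \<theta> * (\<integral>\<^sup>+\<tau>. ennreal (g \<tau>) \<partial>lborel)"
      by (subst nn_integral_add, measurable) (subst nn_integral_cmult, auto)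
    also have "\<dots> = ennreal (\<theta> powr (-\<beta> / 2 + 1) / (-\<beta> / 2 + 1) + \<theta> * (\<theta> powr (-\<beta> / 2) / (\<beta> / 2)))"
      unfolding f g using \<beta> \<theta>
      by (simp add: ennreal_mult'[symmetric] ennreal_plus[symmetric] del: ennreal_plus)
    also have "\<theta> powr (-\<beta> / 2 + 1) / (-\<beta> / 2 + 1) + \<theta> * (\<theta> powr (-\<beta> / 2) / (\<beta> / 2)) = C * \<theta> powr ((2 - \<beta>) / 2)"
    proof -
      have "\<theta> powr ((2 - \<beta>) / 2) = \<theta> * \<theta> powr (-\<beta> / 2)"
        using \<theta> powr_add[of \<theta> 1 "-\<beta>/2"] by (simp add: diff_divide_distrib)
      moreover have "\<theta> powr (-\<beta> / 2 + 1) = \<theta> * \<theta> powr (-\<beta> / 2)"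
        using \<theta> powr_add[of \<theta> 1 "-\<beta>/2"] by (simp add: add.commute)
      ultimately show ?thesis by (simp add: C_def algebra_simps)
    qed
    finally show ?thesis .
  qed
  moreover have "(\<integral>\<^sup>+\<tau>. ennreal (indicator {0<..} \<tau> * (\<tau> powr (-\<beta> / 2) * min 1 (0 / \<tau>))) \<partial>lborel)
     \<le> ennreal (C * 0 powr ((2 - \<beta>) / 2))" by simp
  ultimately show ?thesis using C by (metis less_eq_real_def)
qed

text \<open>The drift involves the mass of the increment rather than its energy, hence the square
  root. As sqrt (min 1 v) <= v^\<alpha> for 0 < \<alpha> < 1/2, the exponent is chosen such that
  \<theta>^\<alpha> is the root of the rate of the energy; \<tau>^(-\<alpha>) is integrable on
  bounded intervals, and so \<open>C\<close> depends on \<open>T\<close>.\<close>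

lemma nn_integral_sqrt_min:
  assumes \<beta>: "0 < \<beta>" "\<beta> < 2" and T: "0 < T"
  shows "\<exists>C>0. \<forall>\<theta>\<ge>0. (\<integral>\<^sup>+\<tau>. ennreal (indicator {0<..T} \<tau> * sqrt (min 1 (\<theta> / \<tau>))) \<partial>lborel)
     \<le> ennreal (C * sqrt (\<theta> powr ((2 - \<beta>) / 2)))"
proof -
  define \<alpha> where "\<alpha> = (2 - \<beta>) / 4"
  have \<alpha>: "0 < \<alpha>" "\<alpha> < 1/2" using \<beta> by (auto simp: \<alpha>_def)
  define C where "C = T powr (- \<alpha> + 1) / (- \<alpha> + 1)"
  have C: "C > 0" using \<alpha> T by (simp add: C_def)
  have "(\<integral>\<^sup>+\<tau>. ennreal (indicator {0<..T} \<tau> * sqrt (min 1 (\<theta> / \<tau>))) \<partial>lborel)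
     \<le> ennreal (C * sqrt (\<theta> powr ((2 - \<beta>) / 2)))" if \<theta>: "\<theta> \<ge> 0" for \<theta>
  proof -
    define f where "f = (\<lambda>\<tau>::real. indicator {0..T} \<tau> * \<tau> powr (-\<alpha>))"
    have [measurable]: "f \<in> borel_measurable borel" unfolding f_def by measurable
    have "(f has_integral C) UNIV"
      using has_integral_powr_from_0[of "-\<alpha>" T] \<alpha> T unfolding f_def C_def
      by (intro has_integral_indicator_times) simp
    then have f: "(\<integral>\<^sup>+\<tau>. ennreal (f \<tau>) \<partial>lborel) = ennreal C"
      by (intro nn_integral_has_integral_lborel) (auto simp: f_def)
    have "(\<integral>\<^sup>+\<tau>. ennreal (indicator {0<..T} \<tau> * sqrt (min 1 (\<theta> / \<tau>))) \<partial>lborel)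
      \<le> (\<integral>\<^sup>+\<tau>. ennreal (\<theta> powr \<alpha>) * ennreal (f \<tau>) \<partial>lborel)"
    proof (intro nn_integral_mono)
      fix \<tau> :: real
      have "indicator {0<..T} \<tau> * sqrt (min 1 (\<theta> / \<tau>)) \<le> \<theta> powr \<alpha> * f \<tau>"
      proof (cases "0 < \<tau> \<and> \<tau> \<le> T")
        case True
        have "sqrt (min 1 (\<theta> / \<tau>)) \<le> (\<theta> / \<tau>) powr \<alpha>"
        proof (cases "\<theta> / \<tau> \<le> 1")
          case False
          then have "1 powr \<alpha> \<le> (\<theta> / \<tau>) powr \<alpha>" using \<alpha> by (intro powr_mono2) auto
          then show ?thesis using False by simp
        next
          case le: True
          show ?thesis
          proof (cases "\<theta> = 0")
            case False
            then have "(\<theta> / \<tau>) powr (1/2) \<le> (\<theta> / \<tau>) powr \<alpha>"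
              using le True \<theta> \<alpha> by (intro powr_mono') auto
            then show ?thesis using le True \<theta> by (simp add: powr_half_sqrt min_def)
          qed simp
        qed
        also have "\<dots> = \<theta> powr \<alpha> * \<tau> powr (-\<alpha>)"
          using True \<theta> by (simp add: powr_divide powr_minus_divide)
        finally show ?thesis using True by (simp add: f_def)
      qed (auto simp: f_def)
      then show "ennreal (indicator {0<..T} \<tau> * sqrt (min 1 (\<theta> / \<tau>))) \<le> ennreal (\<theta> powr \<alpha>) * ennreal (f \<tau>)"
        by (simp add: ennreal_mult'[symmetric] f_def)
    qed
    also have "\<dots> = ennreal (\<theta> powr \<alpha> * C)"
      using C by (subst nn_integral_cmult) (auto simp: f ennreal_mult')
    also have "\<theta> powr \<alpha> = sqrt (\<theta> powr ((2 - \<beta>) / 2))"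
      using \<theta> by (simp add: powr_half_sqrt[symmetric] powr_powr \<alpha>_def)
    finally show ?thesis by (simp add: mult.commute)
  qed
  then show ?thesis using C by blast
qed

section \<open>Energy and mass of the increments of the kernel\<close>

lemma nn_integral_reflect:
  fixes f :: "real \<Rightarrow> ennreal"
  assumes [measurable]: "f \<in> borel_measurable borel"
  shows "(\<integral>\<^sup>+r. f (s - r) \<partial>lborel) = (\<integral>\<^sup>+r. f r \<partial>lborel)"
  using nn_integral_real_affine[of f "-1" s] by simp

text \<open>Extension by zero past the final time turns the difference of two kernels with different
  final times into a single integrand.\<close>

definition mild_kernel :: "real \<Rightarrow> real ^ 'k \<Rightarrow> real \<Rightarrow> real ^ 'k \<Rightarrow> real" where
  "mild_kernel t x r y = indicator {..t} r * heat_kernel (t - r) (x - y)"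

lemma borel_measurable_mild_kernel [measurable]:
  assumes [measurable]: "f \<in> borel_measurable M" "g \<in> borel_measurable M"
  shows "(\<lambda>w. mild_kernel t x (f w) (g w :: real ^ 'k)) \<in> borel_measurable M"
  unfolding mild_kernel_def by measurable

text \<open>The increment passes through the kernel with final time s at x: a time increment at
  fixed x, then a space increment at fixed s. The roots put both on one footing: |x - x'|/sqrt
  \<tau> is the root of \<theta>/\<tau> with \<theta> = |x - x'|^2, and the time increment, bounded
  by a multiple of min 1 (\<theta>/\<tau>), is weakened to the root of this minimum.\<close>

lemma heat_bounded_kernel_increment:
  "\<exists>C>0. \<forall>s t (x :: real ^ 'k) x' r. s \<le> t \<and> r < s \<longrightarrow>
     heat_bounded (s - r) (C * (sqrt (min 1 ((t - s) / (s - r))) + sqrt (min 1 ((norm (x - x'))\<^sup>2 / (s - r)))))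
        (\<lambda>y. mild_kernel t x r y - mild_kernel s x' r y)"
proof -
  define C1 where "C1 = 2 * ((real CARD('k) / 2 + 2) * 4 powr (real CARD('k) / 2))"
  define C2 where "C2 = 4 * 2 powr (real CARD('k) / 2)"
  define C where "C = C1 + C2"
  have C: "C1 > 0" "C2 > 0" "C > 0" by (auto simp: C1_def C2_def C_def add_pos_pos)
  have "heat_bounded (s - r) (C * (sqrt (min 1 ((t - s) / (s - r))) + sqrt (min 1 ((norm (x - x'))\<^sup>2 / (s - r)))))
        (\<lambda>y :: real ^ 'k. mild_kernel t x r y - mild_kernel s x' r y)"
    if "s \<le> t" "r < s" for s t r and x x' :: "real ^ 'k"
  proof -
    define m1 where "m1 = C1 * min 1 ((t - s) / (s - r))"
    define m2 where "m2 = C2 * min 1 (norm (x - x') / sqrt (s - r))"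
    have m: "m1 \<ge> 0" "m2 \<ge> 0" using C that by (auto simp: m1_def m2_def)
    have b: "heat_bounded (s - r) (1 * (m1 + m2)) (\<lambda>y :: real ^ 'k. mild_kernel t x r y - mild_kernel s x' r y)"
    proof (rule heat_bounded_add)
      show "heat_bounded (s - r) m1 (\<lambda>y. heat_kernel ((s - r) + (t - s)) (x - y) - heat_kernel (s - r) (x - y))"
        unfolding m1_def C1_def using that by (intro heat_bounded_time_diff) auto
      show "heat_bounded (s - r) m2 (\<lambda>y. heat_kernel (s - r) (x - y) - heat_kernel (s - r) (x' - y))"
        unfolding m2_def C2_def using that by (intro heat_bounded_space_diff) auto
    qed (use m that in \<open>auto simp: mild_kernel_def\<close>)
    have le_sqrt: "v \<le> sqrt v" if "0 \<le> v" "v \<le> 1" for v :: real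
      using that by (intro real_le_rsqrt) (simp add: power2_eq_square mult_left_le)
    have 1: "m1 \<le> C * sqrt (min 1 ((t - s) / (s - r)))"
      unfolding m1_def using C that by (intro mult_mono le_sqrt) (auto simp: C_def)
    have "min 1 (norm (x - x') / sqrt (s - r)) = sqrt (min 1 ((norm (x - x'))\<^sup>2 / (s - r)))"
      using that by (simp add: min_def real_sqrt_divide)
        (metis divide_le_eq_1_pos le_divide_eq_1_pos real_sqrt_abs2 real_sqrt_le_iff abs_norm_cancel power2_eq_square diff_gt_0_iff_gt real_sqrt_gt_0_iff)
    then have 2: "m2 \<le> C * sqrt (min 1 ((norm (x - x'))\<^sup>2 / (s - r)))"
      unfolding m2_def using C that by (intro mult_mono) (auto simp: C_def)
    from 1 2 have le: "m1 + m2 \<le> C * (sqrt (min 1 ((t - s) / (s - r))) + sqrt (min 1 ((norm (x - x'))\<^sup>2 / (s - r))))"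
      by (simp add: algebra_simps)
    show ?thesis
      using b mult_right_mono[OF le, of "(s - r) powr - (real CARD('k) / 2)"] ennreal_leI[OF le]
      unfolding heat_bounded_def by (fastforce intro: order_trans)
  qed
  with C show ?thesis by blast
qed

lemma nn_integral_noise_dominating_measure:
  fixes f :: "real \<times> (real ^ 'k) \<times> (real ^ 'k) \<Rightarrow> ennreal"
  assumes [measurable]: "f \<in> borel_measurable borel"
  shows "(\<integral>\<^sup>+w. f w \<partial>noise_dominating_measure \<beta>) =
    (\<integral>\<^sup>+r. (\<integral>\<^sup>+y. (\<integral>\<^sup>+z. ennreal (indicator {0..} r * norm (y - z) powr (-\<beta>)) * f (r, y, z) \<partial>lborel) \<partial>lborel) \<partial>lborel)"
proof -
  have [measurable]: "f \<in> borel_measurable (borel \<Otimes>\<^sub>M (borel \<Otimes>\<^sub>M borel))"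
    unfolding borel_prod by measurable
  have "(\<lambda>(r, y, z). ennreal (indicator {0..} r * norm (y - z) powr (-\<beta>)) :: ennreal)
      \<in> borel_measurable (borel :: (real \<times> (real ^ 'k) \<times> (real ^ 'k)) measure)"
    unfolding borel_prod[symmetric] by measurable
  then have g: "(\<lambda>(r, y, z). ennreal (indicator {0..} r * norm (y - z) powr (-\<beta>)) :: ennreal)
      \<in> borel_measurable (lborel :: (real \<times> (real ^ 'k) \<times> (real ^ 'k)) measure)"
    by (simp only: measurable_lborel1 measurable_lborel2)
  have f: "f \<in> borel_measurable lborel" by simp
  have "(\<integral>\<^sup>+w. f w \<partial>noise_dominating_measure \<beta>)
     = (\<integral>\<^sup>+w. (case w of (r, y, z) \<Rightarrow> ennreal (indicator {0..} r * norm (y - z) powr (-\<beta>))) * f w \<partial>lborel)"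
    unfolding noise_dominating_measure_def by (rule nn_integral_density[OF g f])
  also have "\<dots> = (\<integral>\<^sup>+r. (\<integral>\<^sup>+q. ennreal (indicator {0..} r * norm (fst q - snd q) powr (-\<beta>)) * f (r, q) \<partial>lborel) \<partial>lborel)"
  proof -
    define F where "F = (\<lambda>w. (case w of (r, y, z) \<Rightarrow> ennreal (indicator {0..} r * norm (y - z) powr (-\<beta>))) * f w)"
    have "F \<in> borel_measurable (lborel \<Otimes>\<^sub>M lborel)"
      unfolding lborel_prod F_def by (rule borel_measurable_times_ennreal[OF g f])
    from lborel.nn_integral_fst[OF this, symmetric] show ?thesis
      unfolding lborel_prod F_def by (simp add: split_beta')
  qed
  also have "\<dots> = (\<integral>\<^sup>+r. (\<integral>\<^sup>+y. (\<integral>\<^sup>+z. ennreal (indicator {0..} r * norm (y - z) powr (-\<beta>)) * f (r, y, z) \<partial>lborel) \<partial>lborel) \<partial>lborel)"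
  proof (rule nn_integral_cong)
    fix r :: real
    define F where "F = (\<lambda>q. ennreal (indicator {0..} r * norm (fst q - snd q) powr (-\<beta>)) * f (r, q))"
    have "F \<in> borel_measurable (lborel \<Otimes>\<^sub>M lborel)"
      unfolding F_def by measurable
    from lborel.nn_integral_fst[OF this, symmetric]
    show "(\<integral>\<^sup>+q. ennreal (indicator {0..} r * norm (fst q - snd q) powr (-\<beta>)) * f (r, q) \<partial>lborel)
       = (\<integral>\<^sup>+y. (\<integral>\<^sup>+z. ennreal (indicator {0..} r * norm (y - z) powr (-\<beta>)) * f (r, y, z) \<partial>lborel) \<partial>lborel)"
      unfolding lborel_prod F_def by simp
  qed
  finally show ?thesis .
qed

lemma heat_bounded_energy:
  assumes "0 < \<beta>" "\<beta> < real CARD('k)"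
  shows "\<exists>C>0. \<forall>(a :: real ^ 'k \<Rightarrow> real) m \<tau>. a \<in> borel_measurable borel \<and> 0 \<le> m \<and> 0 < \<tau> \<and> heat_bounded \<tau> m a \<longrightarrow>
     (\<integral>\<^sup>+y. (\<integral>\<^sup>+z. ennreal (norm (y - z) powr (-\<beta>)) * ennreal (\<bar>a y\<bar> * \<bar>a z\<bar>) \<partial>lborel) \<partial>lborel)
       \<le> ennreal (C * m\<^sup>2 * \<tau> powr (- \<beta> / 2))"
proof -
  have "\<beta> < DIM(real ^ 'k)" using assms by simp
  from riesz_energy_bound[OF assms(1) this] obtain C where C: "C > 0"
    and bound: "\<forall>(a::real ^ 'k \<Rightarrow> real) M \<tau>. a \<in> borel_measurable borel \<and> 0 \<le> M \<and> 0 < \<tau> \<and>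
     (\<forall>y. 0 \<le> a y \<and> a y \<le> M * \<tau> powr (- real DIM(real ^ 'k) / 2)) \<and> (\<integral>\<^sup>+y. ennreal (a y) \<partial>lborel) \<le> ennreal M \<longrightarrow>
     (\<integral>\<^sup>+y. (\<integral>\<^sup>+z. ennreal (a y * norm (y - z) powr (-\<beta>) * a z) \<partial>lborel) \<partial>lborel)
       \<le> ennreal (C * M\<^sup>2 * \<tau> powr (- \<beta> / 2))" by blast
  show ?thesis
  proof (intro exI[of _ C] conjI C allI impI)
    fix a :: "real ^ 'k \<Rightarrow> real" and m \<tau>
    assume a: "a \<in> borel_measurable borel \<and> 0 \<le> m \<and> 0 < \<tau> \<and> heat_bounded \<tau> m a"
    have "(\<integral>\<^sup>+y. (\<integral>\<^sup>+z. ennreal (\<bar>a y\<bar> * norm (y - z) powr (-\<beta>) * \<bar>a z\<bar>) \<partial>lborel) \<partial>lborel)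
       \<le> ennreal (C * m\<^sup>2 * \<tau> powr (- \<beta> / 2))"
      using a by (intro bound[rule_format]) (auto simp: heat_bounded_def)
    then show "(\<integral>\<^sup>+y. (\<integral>\<^sup>+z. ennreal (norm (y - z) powr (-\<beta>)) * ennreal (\<bar>a y\<bar> * \<bar>a z\<bar>) \<partial>lborel) \<partial>lborel)
       \<le> ennreal (C * m\<^sup>2 * \<tau> powr (- \<beta> / 2))"
      by (simp add: ennreal_mult'[symmetric] mult_ac)
  qed
qed

text \<open>Before time s the increment is controlled on the scale \<tau> = s - r; between s and t
  only the kernel with final time t is left, on the scale \<tau> = t - r. After reflection the
  integrals over r are those of \<open>f\<close> and \<open>g\<close>.\<close>

lemma kernel_increment_bounds:
  assumes \<beta>: "0 < \<beta>" "\<beta> < 2" "\<beta> < real CARD('k)" and T: "0 < T"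
  shows "\<exists>C>0. \<forall>s t (x :: real ^ 'k) x'. 0 \<le> s \<and> s \<le> t \<and> t \<le> T \<longrightarrow>
     (\<integral>\<^sup>+(r, y, z). ennreal (indicator {0<..t} r * (\<bar>mild_kernel t x r y - mild_kernel s x' r y\<bar> * \<bar>mild_kernel t x r z - mild_kernel s x' r z\<bar>)) \<partial>noise_dominating_measure \<beta>)
       \<le> ennreal (C * (\<bar>t - s\<bar> powr ((2 - \<beta>) / 2) + norm (x - x') powr (2 - \<beta>))) \<and>
     (\<integral>\<^sup>+r. (\<integral>\<^sup>+y. ennreal (indicator {0<..t} r * \<bar>mild_kernel t x r y - mild_kernel s x' r y\<bar>) \<partial>lborel) \<partial>lborel)
       \<le> ennreal (C * sqrt (\<bar>t - s\<bar> powr ((2 - \<beta>) / 2) + norm (x - x') powr (2 - \<beta>)))"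
proof -
  obtain C1 where C1: "C1 > 0" and hb: "\<And>s t x x' r. s \<le> t \<Longrightarrow> r < s \<Longrightarrow>
     heat_bounded (s - r) (C1 * (sqrt (min 1 ((t - s) / (s - r))) + sqrt (min 1 ((norm (x - x'))\<^sup>2 / (s - r)))))
        (\<lambda>y :: real ^ 'k. mild_kernel t x r y - mild_kernel s x' r y)"
    using heat_bounded_kernel_increment[where 'k='k] by blast
  obtain C2 where C2: "C2 > 0" and en: "\<And>(a :: real ^ 'k \<Rightarrow> real) m \<tau>. a \<in> borel_measurable borel \<Longrightarrow> 0 \<le> m \<Longrightarrow> 0 < \<tau> \<Longrightarrow> heat_bounded \<tau> m a \<Longrightarrow>
     (\<integral>\<^sup>+y. (\<integral>\<^sup>+z. ennreal (norm (y - z) powr (-\<beta>)) * ennreal (\<bar>a y\<bar> * \<bar>a z\<bar>) \<partial>lborel) \<partial>lborel)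
       \<le> ennreal (C2 * m\<^sup>2 * \<tau> powr (- \<beta> / 2))"
    using heat_bounded_energy[OF \<beta>(1,3)] by blast
  define f where "f = (\<lambda>\<theta> \<tau>::real. ennreal (indicator {0<..} \<tau> * (\<tau> powr (-\<beta> / 2) * min 1 (\<theta> / \<tau>))))"
  define g where "g = (\<lambda>\<theta> \<tau>::real. ennreal (indicator {0<..T} \<tau> * sqrt (min 1 (\<theta> / \<tau>))))"
  have fg [measurable]: "f \<theta> \<in> borel_measurable borel" "g \<theta> \<in> borel_measurable borel" for \<theta>
    unfolding f_def g_def by measurable
  obtain C3 where C3: "C3 > 0" and fint: "\<And>\<theta>. \<theta> \<ge> 0 \<Longrightarrow> (\<integral>\<^sup>+\<tau>. f \<theta> \<tau> \<partial>lborel) \<le> ennreal (C3 * \<theta> powr ((2 - \<beta>) / 2))"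
    using nn_integral_powr_min[OF \<beta>(1,2)] unfolding f_def by blast
  obtain C4 where C4: "C4 > 0" and gint: "\<And>\<theta>. \<theta> \<ge> 0 \<Longrightarrow> (\<integral>\<^sup>+\<tau>. g \<theta> \<tau> \<partial>lborel) \<le> ennreal (C4 * sqrt (\<theta> powr ((2 - \<beta>) / 2)))"
    using nn_integral_sqrt_min[OF \<beta>(1,2) T] unfolding g_def by blast
  \<comment> \<open>The first summand belongs to the times before s, its 2 to the square of a sum of
    two roots; the second belongs to the times between s and t.\<close>
  define Ca where "Ca = (2 * C1\<^sup>2 * C2 + C2) * C3"
  define Cb where "Cb = (2 * C1 + 1) * C4"
  define C where "C = Ca + Cb"
  have C: "Ca > 0" "Cb > 0" using C1 C2 C3 C4 by (auto simp: Ca_def Cb_def add_pos_pos)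
  show ?thesis
  proof (intro exI[of _ C] conjI allI impI)
    show "C > 0" using C by (simp add: C_def)
    fix s t and x x' :: "real ^ 'k"
    assume "0 \<le> s \<and> s \<le> t \<and> t \<le> T"
    then have st: "0 \<le> s" "s \<le> t" "t \<le> T" by auto
    define l where "l = (\<lambda>r y. mild_kernel t x r y - mild_kernel s x' r y)"
    have [measurable]: "(\<lambda>w. l (h1 w) (h2 w)) \<in> borel_measurable N"
      if [measurable]: "h1 \<in> borel_measurable N" "h2 \<in> borel_measurable N" for h1 h2 and N :: "'z measure"
      unfolding l_def by measurable
    define \<delta> where "\<delta> = t - s"
    \<comment> \<open>In parabolic scaling the squared distance plays the role of a time.\<close>
    define h where "h = (norm (x - x'))\<^sup>2"
    have \<delta>: "\<delta> \<ge> 0" and h: "h \<ge> 0" using st by (auto simp: \<delta>_def h_def)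
    have hp: "h powr ((2 - \<beta>) / 2) = norm (x - x') powr (2 - \<beta>)"
      unfolding h_def by (cases "norm (x - x') = 0") (simp_all add: powr_powr diff_divide_distrib flip: powr_numeral)
    define \<Theta> where "\<Theta> = \<bar>t - s\<bar> powr ((2 - \<beta>) / 2) + norm (x - x') powr (2 - \<beta>)"
    have \<Theta>: "\<Theta> = \<delta> powr ((2 - \<beta>) / 2) + h powr ((2 - \<beta>) / 2)"
      using \<delta> by (simp add: \<Theta>_def hp \<delta>_def)
    have \<Theta>0: "\<Theta> \<ge> 0" by (simp add: \<Theta>)
    define E where "E = (\<lambda>r. \<integral>\<^sup>+y. (\<integral>\<^sup>+z. ennreal (norm (y - z) powr (-\<beta>)) * ennreal (\<bar>l r y\<bar> * \<bar>l r z\<bar>) \<partial>lborel) \<partial>lborel)"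
    define D where "D = (\<lambda>r. \<integral>\<^sup>+y. ennreal \<bar>l r y\<bar> \<partial>lborel)"
    define m where "m = (\<lambda>r. C1 * (sqrt (min 1 (\<delta> / (s - r))) + sqrt (min 1 (h / (s - r)))))"
    have hb1: "heat_bounded (s - r) (m r) (l r)" if "r < s" for r
      using hb[OF st(2) that, of x x'] by (simp add: m_def l_def \<delta>_def h_def)
    have hb2: "heat_bounded (t - r) 1 (l r)" if "s < r" "r < t" for r
      using heat_bounded_heat_kernel[of "t - r" "t - r" x] that unfolding l_def
      by (simp add: mild_kernel_def)
    have m0: "m r \<ge> 0" if "r < s" for r using C1 \<delta> h that by (simp add: m_def)
    have pt: "indicator {0<..t} r * E r \<le> ennreal (2 * C1\<^sup>2 * C2) * (f \<delta> (s - r) + f h (s - r)) + ennreal C2 * f \<delta> (t - r)"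
          "indicator {0<..t} r * D r \<le> ennreal C1 * (g \<delta> (s - r) + g h (s - r)) + g \<delta> (t - r)"
        if rst: "r \<noteq> s" "r \<noteq> t" for r
    proof -
      consider "r \<le> 0 \<or> t < r" | "0 < r" "r < s" | "0 < r" "s < r" "r < t" using rst by linarith
      then have "indicator {0<..t} r * E r \<le> ennreal (2 * C1\<^sup>2 * C2) * (f \<delta> (s - r) + f h (s - r)) + ennreal C2 * f \<delta> (t - r)
        \<and> indicator {0<..t} r * D r \<le> ennreal C1 * (g \<delta> (s - r) + g h (s - r)) + g \<delta> (t - r)"
      proof cases
        case 1
        then show ?thesis by auto
      next
        case 2
        define p where "p = min 1 (\<delta> / (s - r))"
        define q where "q = min 1 (h / (s - r))"
        have pq: "p \<ge> 0" "q \<ge> 0" using \<delta> h 2 by (auto simp: p_def q_def)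
        have mr: "m r = C1 * (sqrt p + sqrt q)" by (simp add: m_def p_def q_def)
        have "(sqrt p + sqrt q)\<^sup>2 \<le> 2 * (p + q)"
          using pq sum_squares_bound[of "sqrt p" "sqrt q"] by (simp add: power2_sum)
        then have m2: "(m r)\<^sup>2 \<le> 2 * C1\<^sup>2 * (p + q)"
          unfolding mr power_mult_distrib using mult_left_mono[of "(sqrt p + sqrt q)\<^sup>2" "2 * (p + q)" "C1\<^sup>2"] by (simp add: algebra_simps)
        have "E r \<le> ennreal (C2 * (m r)\<^sup>2 * (s - r) powr (-\<beta> / 2))"
          unfolding E_def using 2 m0 hb1 by (intro en) auto
        also have "\<dots> \<le> ennreal (C2 * (2 * C1\<^sup>2 * (p + q)) * (s - r) powr (-\<beta> / 2))"
          using C2 m2 by (intro ennreal_leI mult_right_mono mult_left_mono) auto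
        also have "\<dots> = ennreal (2 * C1\<^sup>2 * C2) * (f \<delta> (s - r) + f h (s - r))"
          using C2 pq 2 unfolding f_def p_def[symmetric] q_def[symmetric]
          by (simp add: ennreal_mult'[symmetric] ennreal_plus[symmetric] algebra_simps del: ennreal_plus)
        finally have e: "E r \<le> ennreal (2 * C1\<^sup>2 * C2) * (f \<delta> (s - r) + f h (s - r))" .
        have "D r \<le> ennreal (m r)" using hb1[OF 2(2)] by (simp add: heat_bounded_def D_def)
        also have "\<dots> = ennreal C1 * (g \<delta> (s - r) + g h (s - r))"
          using C1 pq 2 st unfolding g_def p_def[symmetric] q_def[symmetric] mr
          by (simp add: ennreal_mult'[symmetric] ennreal_plus[symmetric] algebra_simps del: ennreal_plus)
        finally have "D r \<le> ennreal C1 * (g \<delta> (s - r) + g h (s - r))" .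
        with e 2 st show ?thesis by (auto intro: add_increasing2)
      next
        case 3
        \<comment> \<open>Here t - r < \<delta>, so the minimum equals 1 and the plain bound for a
          single kernel takes the form that has been integrated already.\<close>
        have p: "min 1 (\<delta> / (t - r)) = 1" using 3 by (simp add: \<delta>_def min_def)
        have "E r \<le> ennreal (C2 * 1\<^sup>2 * (t - r) powr (-\<beta> / 2))"
          unfolding E_def using 3 hb2[of r] by (intro en) auto
        also have "\<dots> = ennreal C2 * f \<delta> (t - r)"
          unfolding f_def p using C2 3 by (simp add: ennreal_mult'[symmetric])
        finally have e: "E r \<le> ennreal C2 * f \<delta> (t - r)" .
        have "D r \<le> ennreal 1" using hb2[of r] 3 by (simp add: heat_bounded_def D_def)
        also have "\<dots> = g \<delta> (t - r)" unfolding g_def p using 3 st by simp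
        finally have "D r \<le> g \<delta> (t - r)" .
        with e 3 st show ?thesis by (auto intro: add_increasing)
      qed
      then show "indicator {0<..t} r * E r \<le> ennreal (2 * C1\<^sup>2 * C2) * (f \<delta> (s - r) + f h (s - r)) + ennreal C2 * f \<delta> (t - r)"
          "indicator {0<..t} r * D r \<le> ennreal C1 * (g \<delta> (s - r) + g h (s - r)) + g \<delta> (t - r)" by blast+
    qed
    \<comment> \<open>At these two times the scale \<tau> degenerates to zero; they form a null
      set.\<close>
    have ae: "AE r in lborel. r \<noteq> s \<and> r \<noteq> t" by (intro AE_conjI AE_lborel_singleton)
    have "(\<integral>\<^sup>+(r, y, z). ennreal (indicator {0<..t} r * (\<bar>l r y\<bar> * \<bar>l r z\<bar>)) \<partial>noise_dominating_measure \<beta>)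
      = (\<integral>\<^sup>+r. (\<integral>\<^sup>+y. (\<integral>\<^sup>+z. ennreal (indicator {0..} r * norm (y - z) powr (-\<beta>)) * ennreal (indicator {0<..t} r * (\<bar>l r y\<bar> * \<bar>l r z\<bar>)) \<partial>lborel) \<partial>lborel) \<partial>lborel)"
      by (subst nn_integral_noise_dominating_measure) (auto simp: borel_prod[symmetric])
    also have "\<dots> = (\<integral>\<^sup>+r. indicator {0<..t} r * E r \<partial>lborel)"
      unfolding E_def by (intro nn_integral_cong) (auto simp: indicator_def)
    also have "\<dots> \<le> (\<integral>\<^sup>+r. ennreal (2 * C1\<^sup>2 * C2) * (f \<delta> (s - r) + f h (s - r)) + ennreal C2 * f \<delta> (t - r) \<partial>lborel)"
      by (rule nn_integral_mono_AE, use ae in eventually_elim) (rule pt; simp)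
    also have "\<dots> = ennreal (2 * C1\<^sup>2 * C2) * ((\<integral>\<^sup>+r. f \<delta> r \<partial>lborel) + (\<integral>\<^sup>+r. f h r \<partial>lborel)) + ennreal C2 * (\<integral>\<^sup>+r. f \<delta> r \<partial>lborel)"
      by (subst nn_integral_add, measurable, subst nn_integral_cmult, measurable, subst nn_integral_cmult, measurable,
          subst nn_integral_add, measurable) (simp add: nn_integral_reflect)
    also have "\<dots> \<le> ennreal (2 * C1\<^sup>2 * C2) * (ennreal (C3 * \<delta> powr ((2 - \<beta>) / 2)) + ennreal (C3 * h powr ((2 - \<beta>) / 2))) + ennreal C2 * ennreal (C3 * \<delta> powr ((2 - \<beta>) / 2))"
      using \<delta> h by (intro add_mono mult_left_mono fint) auto
    also have "\<dots> = ennreal (2 * C1\<^sup>2 * C2 * (C3 * \<delta> powr ((2 - \<beta>) / 2) + C3 * h powr ((2 - \<beta>) / 2)) + C2 * (C3 * \<delta> powr ((2 - \<beta>) / 2)))"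
      using C2 C3 by (simp add: ennreal_mult'[symmetric] ennreal_plus[symmetric] del: ennreal_plus)
    also have "\<dots> \<le> ennreal (C * \<Theta>)"
    proof (intro ennreal_leI)
      have "2 * C1\<^sup>2 * C2 * (C3 * \<delta> powr ((2 - \<beta>) / 2) + C3 * h powr ((2 - \<beta>) / 2)) + C2 * (C3 * \<delta> powr ((2 - \<beta>) / 2))
         \<le> 2 * C1\<^sup>2 * C2 * (C3 * \<delta> powr ((2 - \<beta>) / 2) + C3 * h powr ((2 - \<beta>) / 2)) + C2 * (C3 * \<Theta>)"
        using C2 C3 by (intro add_left_mono mult_left_mono) (auto simp: \<Theta>)
      also have "\<dots> = Ca * \<Theta>" by (simp add: Ca_def \<Theta> algebra_simps)
      also have "\<dots> \<le> C * \<Theta>" using \<Theta>0 C by (intro mult_right_mono) (auto simp: C_def)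
      finally show "2 * C1\<^sup>2 * C2 * (C3 * \<delta> powr ((2 - \<beta>) / 2) + C3 * h powr ((2 - \<beta>) / 2)) + C2 * (C3 * \<delta> powr ((2 - \<beta>) / 2)) \<le> C * \<Theta>" .
    qed
    finally show "(\<integral>\<^sup>+(r, y, z). ennreal (indicator {0<..t} r * (\<bar>mild_kernel t x r y - mild_kernel s x' r y\<bar> * \<bar>mild_kernel t x r z - mild_kernel s x' r z\<bar>)) \<partial>noise_dominating_measure \<beta>)
       \<le> ennreal (C * (\<bar>t - s\<bar> powr ((2 - \<beta>) / 2) + norm (x - x') powr (2 - \<beta>)))"
      unfolding l_def \<Theta>_def .
    have "(\<integral>\<^sup>+r. (\<integral>\<^sup>+y. ennreal (indicator {0<..t} r * \<bar>l r y\<bar>) \<partial>lborel) \<partial>lborel) = (\<integral>\<^sup>+r. indicator {0<..t} r * D r \<partial>lborel)"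
      unfolding D_def by (intro nn_integral_cong) (auto simp: indicator_def)
    also have "\<dots> \<le> (\<integral>\<^sup>+r. ennreal C1 * (g \<delta> (s - r) + g h (s - r)) + g \<delta> (t - r) \<partial>lborel)"
      by (rule nn_integral_mono_AE, use ae in eventually_elim) (rule pt; simp)
    also have "\<dots> = ennreal C1 * ((\<integral>\<^sup>+r. g \<delta> r \<partial>lborel) + (\<integral>\<^sup>+r. g h r \<partial>lborel)) + (\<integral>\<^sup>+r. g \<delta> r \<partial>lborel)"
      by (subst nn_integral_add, measurable, subst nn_integral_cmult, measurable,
          subst nn_integral_add, measurable) (simp add: nn_integral_reflect)
    also have "\<dots> \<le> ennreal C1 * (ennreal (C4 * sqrt (\<delta> powr ((2 - \<beta>) / 2))) + ennreal (C4 * sqrt (h powr ((2 - \<beta>) / 2)))) + ennreal (C4 * sqrt (\<delta> powr ((2 - \<beta>) / 2)))"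
      using \<delta> h by (intro add_mono mult_left_mono gint) auto
    also have "\<dots> \<le> ennreal C1 * (ennreal (C4 * sqrt \<Theta>) + ennreal (C4 * sqrt \<Theta>)) + ennreal (C4 * sqrt \<Theta>)"
      using C4 by (intro add_mono mult_left_mono ennreal_leI) (auto simp: \<Theta>)
    also have "\<dots> = ennreal (Cb * sqrt \<Theta>)"
      using C1 C4 \<Theta>0 by (simp add: ennreal_mult'[symmetric] ennreal_plus[symmetric] Cb_def algebra_simps del: ennreal_plus)
    also have "\<dots> \<le> ennreal (C * sqrt \<Theta>)"
      using \<Theta>0 C by (intro ennreal_leI mult_right_mono) (auto simp: C_def)
    finally show "(\<integral>\<^sup>+r. (\<integral>\<^sup>+y. ennreal (indicator {0<..t} r * \<bar>mild_kernel t x r y - mild_kernel s x' r y\<bar>) \<partial>lborel) \<partial>lborel)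
       \<le> ennreal (C * sqrt (\<bar>t - s\<bar> powr ((2 - \<beta>) / 2) + norm (x - x') powr (2 - \<beta>)))"
      unfolding l_def \<Theta>_def .
  qed
qed

section \<open>Worthy martingale measures\<close>

text \<open>It suffices to look at the rectangles that generate the predictable sigma-algebra: the
  section of a rectangle at time t is empty or its second side.\<close>

lemma measurable_predictable_section:
  assumes "\<And>s. 0 \<le> s \<Longrightarrow> subalgebra P (\<F> s)" and "0 \<le> t"
    and Q: "(\<lambda>(t, \<omega>). Q t \<omega>) \<in> borel_measurable (predictable_sigma P \<F>)"
  shows "Q t \<in> borel_measurable P"
proof -
  have sp: "\<And>s. 0 \<le> s \<Longrightarrow> space (\<F> s) = space P" "\<And>s. 0 \<le> s \<Longrightarrow> sets (\<F> s) \<subseteq> sets P"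
    using assms(1) by (auto simp: subalgebra_def)
  have "(\<lambda>\<omega>. (t, \<omega>)) \<in> measurable P (predictable_sigma P \<F>)"
    unfolding predictable_sigma_def
  proof (rule measurable_measure_of)
    have HP: "H \<subseteq> space P" if "H \<in> sets (\<F> s)" "0 \<le> s" for H s
      using sets.sets_into_space[OF that(1)] sp(1)[OF that(2)] by simp
    have key: "(\<lambda>\<omega>. (t, \<omega>)) -` (I \<times> H) \<inter> space P \<in> sets P" if "H \<in> sets (\<F> s)" "0 \<le> s" for I H s
    proof -
      have "(\<lambda>\<omega>. (t, \<omega>)) -` (I \<times> H) \<inter> space P = (if t \<in> I then H \<inter> space P else {})" by auto
      then show ?thesis using that sp(2)[OF that(2)] by auto
    qed
    show "(\<lambda>\<omega>. (t, \<omega>)) \<in> space P \<rightarrow> {0..} \<times> space P" using assms by auto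
    show "{{0} \<times> H |H. H \<in> sets (\<F> 0)} \<union> {{s<..t} \<times> H |s t H. 0 \<le> s \<and> s \<le> t \<and> H \<in> sets (\<F> s)} \<subseteq> Pow ({0..} \<times> space P)"
      by (auto dest: HP[THEN subsetD, rotated 2])
    fix y assume "y \<in> {{0} \<times> H |H. H \<in> sets (\<F> 0)} \<union> {{s<..t} \<times> H |s t H. 0 \<le> s \<and> s \<le> t \<and> H \<in> sets (\<F> s)}"
    then show "(\<lambda>\<omega>. (t, \<omega>)) -` y \<inter> space P \<in> sets P"
      by (elim UnE CollectE exE conjE) (simp only:, rule key, assumption, simp)+
  qed
  from measurable_compose[OF this Q] show ?thesis by simp
qed

text \<open>The martingale property tested against a factor known at time r; all cross terms of
  increments are evaluated in this form.\<close>

lemma (in prob_space) martingale_integral_eq: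
  assumes N: "martingale M \<F> N" and sub: "subalgebra M (\<F> r)" and r: "0 \<le> r" "r \<le> r'"
    and X: "X \<in> borel_measurable (\<F> r)" and int: "integrable M (\<lambda>\<omega>. X \<omega> * N r' \<omega>)"
  shows "integrable M (\<lambda>\<omega>. X \<omega> * N r \<omega>)" "(\<integral>\<omega>. X \<omega> * N r' \<omega> \<partial>M) = (\<integral>\<omega>. X \<omega> * N r \<omega> \<partial>M)"
proof -
  interpret finite_measure_subalgebra M "\<F> r" by unfold_locales (rule sub)
  have X': "X \<in> borel_measurable M" using X sub by (rule measurable_from_subalg[rotated])
  have m: "N r' \<in> borel_measurable M" "N r \<in> borel_measurable M"
    using N r by (auto simp: martingale_def intro: borel_measurable_integrable)
  have ae: "AE \<omega> in M. real_cond_exp M (\<F> r) (N r') \<omega> = N r \<omega>"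
    using N r by (auto simp: martingale_def)
  note * = real_cond_exp_intg[OF int X m(1)]
  have ae2: "AE \<omega> in M. X \<omega> * real_cond_exp M (\<F> r) (N r') \<omega> = X \<omega> * N r \<omega>" using ae by auto
  have "integrable M (\<lambda>\<omega>. X \<omega> * real_cond_exp M (\<F> r) (N r') \<omega>) \<longleftrightarrow> integrable M (\<lambda>\<omega>. X \<omega> * N r \<omega>)"
    using X' m ae2 by (intro integrable_cong_AE) auto
  with *(1) show "integrable M (\<lambda>\<omega>. X \<omega> * N r \<omega>)" by blast
  have "(\<integral>\<omega>. X \<omega> * real_cond_exp M (\<F> r) (N r') \<omega> \<partial>M) = (\<integral>\<omega>. X \<omega> * N r \<omega> \<partial>M)"
    using X' m ae2 by (intro integral_cong_AE) auto
  with *(2) show "(\<integral>\<omega>. X \<omega> * N r' \<omega> \<partial>M) = (\<integral>\<omega>. X \<omega> * N r \<omega> \<partial>M)" by simp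
qed

text \<open>The dominating measure is deterministic, as it is for the noise. This lets
  \<open>K\<close> be exchanged with the expectation and reduces moments to energies of
  deterministic functions.\<close>

locale worthy_measure = prob_space P for P :: "'w measure" +
  fixes \<F> :: "real \<Rightarrow> 'w measure" and M :: "real \<Rightarrow> 'e::euclidean_space set \<Rightarrow> 'w \<Rightarrow> real"
    and K :: "(real \<times> 'e \<times> 'e) measure"
  assumes worthy: "worthy_martingale_measure P \<F> M (\<lambda>_. K)"
begin

lemma mart_measure: "martingale_measure P \<F> M"
  using worthy by (simp add: worthy_martingale_measure_def)

lemma filt: "filtration (space P) \<F>"
  using mart_measure by (simp add: martingale_measure_def)

lemma subalg: "0 \<le> t \<Longrightarrow> subalgebra P (\<F> t)"
  using mart_measure by (simp add: martingale_measure_def)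

lemma mart: "A \<in> bounded_borel_sets \<Longrightarrow> martingale P \<F> (\<lambda>t. M t A)"
  using mart_measure by (simp add: martingale_measure_def)

lemma M_adapted: "A \<in> bounded_borel_sets \<Longrightarrow> 0 \<le> t \<Longrightarrow> M t A \<in> borel_measurable (\<F> t)"
  using mart by (simp add: martingale_def)

lemma M_integrable: "A \<in> bounded_borel_sets \<Longrightarrow> 0 \<le> t \<Longrightarrow> integrable P (M t A)"
  using mart by (simp add: martingale_def)

lemma M_measurable [measurable]: "A \<in> bounded_borel_sets \<Longrightarrow> 0 \<le> t \<Longrightarrow> M t A \<in> borel_measurable P"
  by (rule borel_measurable_integrable[OF M_integrable])

lemma measurable_mono: "X \<in> borel_measurable (\<F> r) \<Longrightarrow> r \<le> r' \<Longrightarrow> X \<in> borel_measurable (\<F> r')"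
  by (rule measurable_from_subalg[where F = "\<F> r"])
    (use filt in \<open>simp_all add: filtration_def subalgebra_def\<close>)

lemma measurable_P: "X \<in> borel_measurable (\<F> r) \<Longrightarrow> 0 \<le> r \<Longrightarrow> X \<in> borel_measurable P"
  by (rule measurable_from_subalg[OF subalg])

lemma space_F: "0 \<le> r \<Longrightarrow> space (\<F> r) = space P"
  using subalg by (simp add: subalgebra_def)

lemma K_facts:
  "sets K = sets borel" "sigma_finite_measure K"
  "\<And>f :: real \<times> 'e \<Rightarrow> real. f \<in> borel_measurable borel \<Longrightarrow> bounded (range f) \<Longrightarrow>
     integrable K (\<lambda>(s, y, z). f (s, y) * f (s, z)) \<Longrightarrow> 0 \<le> (\<integral>(s, y, z). f (s, y) * f (s, z) \<partial>K)"
proof -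
  \<comment> \<open>The conditions on \<open>K\<close> are stated for every outcome; as
    \<open>K\<close> does not depend on it, any outcome yields them.\<close>
  obtain \<omega> where \<omega>: "\<omega> \<in> space P" using not_empty by blast
  note w = bspec[OF worthy[unfolded worthy_martingale_measure_def, THEN conjunct2, THEN conjunct1] \<omega>]
  show "sets K = sets borel" "sigma_finite_measure K" by (fact w[THEN conjunct1] w[THEN conjunct2, THEN conjunct1])+
  fix f :: "real \<times> 'e \<Rightarrow> real"
  assume "f \<in> borel_measurable borel" "bounded (range f)" "integrable K (\<lambda>(s, y, z). f (s, y) * f (s, z))"
  then show "0 \<le> (\<integral>(s, y, z). f (s, y) * f (s, z) \<partial>K)"
    using w[THEN conjunct2, THEN conjunct2, THEN conjunct2, rule_format, of f] by blast
qed

lemmas sets_K [measurable_cong] = K_facts(1)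

lemma K_finite:
  assumes "A \<in> bounded_borel_sets" "B \<in> bounded_borel_sets" "0 \<le> r"
  shows "emeasure K ({r<..r'} \<times> A \<times> B) < \<infinity>"
proof (cases "r \<le> r'")
  case True
  have "bounded (A \<union> B)" using assms by (auto simp: bounded_borel_sets_def)
  then obtain c where c: "\<forall>x\<in>A \<union> B. norm x \<le> c" unfolding bounded_iff by blast
  define n where "n = nat \<lceil>c\<rceil>"
  have "c \<le> real n" unfolding n_def by (rule real_nat_ceiling_ge)
  then have "norm x \<le> real n" if "x \<in> A \<union> B" for x
    using c that by (blast intro: order_trans)
  then have n: "A \<union> B \<subseteq> cball 0 (real n)" by auto
  have "emeasure K ({r<..r'} \<times> A \<times> B) \<le> emeasure K ({0<..r'} \<times> cball 0 (real n) \<times> cball 0 (real n))"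
  proof (rule emeasure_mono)
    show "{r<..r'} \<times> A \<times> B \<subseteq> {0<..r'} \<times> cball 0 (real n) \<times> cball 0 (real n)"
      using n assms(3) by (intro Sigma_mono) auto
    show "{0<..r'} \<times> cball 0 (real n) \<times> cball 0 (real n) \<in> sets K"
      unfolding sets_K by (intro borel_Times) auto
  qed
  \<comment> \<open>Walsh's finiteness condition concerns an expectation, here that of a
    constant.\<close>
  also have "\<dots> = (\<integral>\<^sup>+\<omega>. emeasure K ({0<..r'} \<times> cball 0 (real n) \<times> cball 0 (real n)) \<partial>P)"
    by (simp add: emeasure_space_1)
  also have "\<dots> < \<infinity>"
    using worthy[unfolded worthy_martingale_measure_def, THEN conjunct2, THEN conjunct2, THEN conjunct2, THEN conjunct2, THEN conjunct1] True assms
    by auto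
  finally show ?thesis .
qed simp

text \<open>Integrability of \<open>Q t\<close> comes from \<open>Q 0 = 0\<close> and the domination
  of the increment by the mass of a bounded box, which is finite.\<close>

lemma covariation:
  assumes "A \<in> bounded_borel_sets" "B \<in> bounded_borel_sets"
  obtains Q where "\<And>t. 0 \<le> t \<Longrightarrow> Q t \<in> borel_measurable P" "\<And>t. 0 \<le> t \<Longrightarrow> integrable P (Q t)"
    "martingale P \<F> (\<lambda>t \<omega>. M t A \<omega> * M t B \<omega> - Q t \<omega>)"
    "\<And>r r'. 0 \<le> r \<Longrightarrow> r \<le> r' \<Longrightarrow> (AE \<omega> in P. \<bar>Q r' \<omega> - Q r \<omega>\<bar> \<le> measure K ({r<..r'} \<times> A \<times> B))"
proof -
  obtain Q where Q: "(\<lambda>(t, \<omega>). Q t \<omega>) \<in> borel_measurable (predictable_sigma P \<F>)"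
      "\<forall>\<omega>\<in>space P. Q 0 \<omega> = 0"
      "martingale P \<F> (\<lambda>t \<omega>. M t A \<omega> * M t B \<omega> - Q t \<omega>)"
      "AE \<omega> in P. \<forall>s t. 0 \<le> s \<and> s \<le> t \<longrightarrow> ennreal \<bar>Q t \<omega> - Q s \<omega>\<bar> \<le> emeasure K ({s<..t} \<times> A \<times> B)"
    using worthy assms unfolding worthy_martingale_measure_def by blast
  have m: "Q t \<in> borel_measurable P" if "0 \<le> t" for t
    using that Q(1) subalg by (intro measurable_predictable_section[of P \<F>]) auto
  have ae: "AE \<omega> in P. \<bar>Q r' \<omega> - Q r \<omega>\<bar> \<le> measure K ({r<..r'} \<times> A \<times> B)" if "0 \<le> r" "r \<le> r'" for r r'
    using Q(4)
  proof eventually_elim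
    case (elim \<omega>)
    then have "ennreal \<bar>Q r' \<omega> - Q r \<omega>\<bar> \<le> emeasure K ({r<..r'} \<times> A \<times> B)" using that by blast
    also have "\<dots> = ennreal (measure K ({r<..r'} \<times> A \<times> B))"
      using K_finite[OF assms that(1), of r'] by (intro emeasure_eq_ennreal_measure) auto
    finally show ?case by simp
  qed
  have int: "integrable P (Q t)" if "0 \<le> t" for t
  proof (rule integrableI_bounded[OF m[OF that]])
    have "AE \<omega> in P. ennreal (norm (Q t \<omega>)) \<le> ennreal (measure K ({0<..t} \<times> A \<times> B))"
      using ae[OF order_refl that] AE_space
    proof eventually_elim
      case (elim \<omega>)
      then show ?case using Q(2) by (intro ennreal_leI) auto
    qed
    then have "(\<integral>\<^sup>+\<omega>. ennreal (norm (Q t \<omega>)) \<partial>P) \<le> (\<integral>\<^sup>+\<omega>. ennreal (measure K ({0<..t} \<times> A \<times> B)) \<partial>P)"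
      by (rule nn_integral_mono_AE)
    also have "\<dots> < \<infinity>" by (simp add: emeasure_space_1)
    finally show "(\<integral>\<^sup>+\<omega>. ennreal (norm (Q t \<omega>)) \<partial>P) < \<infinity>" .
  qed
  show ?thesis by (rule that[OF m int Q(3) ae])
qed

lemma M_mult_integrable:
  assumes "A \<in> bounded_borel_sets" "B \<in> bounded_borel_sets" "0 \<le> t"
  shows "integrable P (\<lambda>\<omega>. M t A \<omega> * M t B \<omega>)"
proof -
  obtain Q where "\<And>t. 0 \<le> t \<Longrightarrow> integrable P (Q t)"
    "martingale P \<F> (\<lambda>t \<omega>. M t A \<omega> * M t B \<omega> - Q t \<omega>)"
    by (rule covariation[OF assms(1,2)], rule that)
  then have "integrable P (\<lambda>\<omega>. (M t A \<omega> * M t B \<omega> - Q t \<omega>) + Q t \<omega>)"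
    using assms(3) by (intro Bochner_Integration.integrable_add) (auto simp: martingale_def)
  then show ?thesis by simp
qed

lemma M_mult_integrable':
  assumes "A \<in> bounded_borel_sets" "B \<in> bounded_borel_sets" "0 \<le> r" "0 \<le> r'"
  shows "integrable P (\<lambda>\<omega>. M r A \<omega> * M r' B \<omega>)"
proof (rule Bochner_Integration.integrable_bound)
  show "integrable P (\<lambda>\<omega>. M r A \<omega> * M r A \<omega> + M r' B \<omega> * M r' B \<omega>)"
    using assms by (intro Bochner_Integration.integrable_add M_mult_integrable)
  show "(\<lambda>\<omega>. M r A \<omega> * M r' B \<omega>) \<in> borel_measurable P" using assms by measurable
  have "\<bar>a * b\<bar> \<le> \<bar>a * a + b * b\<bar>" for a b :: real
  proof -
    have "2 * \<bar>a * b\<bar> \<le> a * a + b * b"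
      using sum_squares_bound[of "\<bar>a\<bar>" "\<bar>b\<bar>"] by (simp add: abs_mult power2_eq_square)
    then show ?thesis by linarith
  qed
  then show "AE \<omega> in P. norm (M r A \<omega> * M r' B \<omega>) \<le> norm (M r A \<omega> * M r A \<omega> + M r' B \<omega> * M r' B \<omega>)"
    by simp
qed

lemma bounded_mult_integrable:
  fixes X Y :: "'w \<Rightarrow> real"
  assumes "X \<in> borel_measurable P" "\<And>\<omega>. \<omega> \<in> space P \<Longrightarrow> \<bar>X \<omega>\<bar> \<le> c" "integrable P Y"
  shows "integrable P (\<lambda>\<omega>. X \<omega> * Y \<omega>)"
proof (rule Bochner_Integration.integrable_bound[of P "\<lambda>\<omega>. c * Y \<omega>"])
  show "AE \<omega> in P. norm (X \<omega> * Y \<omega>) \<le> norm (c * Y \<omega>)"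
  proof (rule AE_I2)
    fix \<omega> assume "\<omega> \<in> space P"
    from assms(2)[OF this] show "norm (X \<omega> * Y \<omega>) \<le> norm (c * Y \<omega>)"
      by (auto simp: abs_mult intro!: mult_right_mono)
  qed
qed (use assms in auto)

section \<open>First and second moments of increments, weighted with the past\<close>

lemma increment_orthogonal:
  assumes A: "A \<in> bounded_borel_sets" and r: "0 \<le> r" "r \<le> r'"
    and X: "X \<in> borel_measurable (\<F> r)" "\<And>\<omega>. \<omega> \<in> space P \<Longrightarrow> \<bar>X \<omega>\<bar> \<le> c"
  shows "integrable P (\<lambda>\<omega>. X \<omega> * (M r' A \<omega> - M r A \<omega>))" "(\<integral>\<omega>. X \<omega> * (M r' A \<omega> - M r A \<omega>) \<partial>P) = 0"
proof -
  have i: "integrable P (\<lambda>\<omega>. X \<omega> * M r' A \<omega>)" "integrable P (\<lambda>\<omega>. X \<omega> * M r A \<omega>)"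
    using A r X measurable_P[OF X(1) r(1)] by (auto intro!: bounded_mult_integrable M_integrable)
  then show "integrable P (\<lambda>\<omega>. X \<omega> * (M r' A \<omega> - M r A \<omega>))"
    unfolding right_diff_distrib by (rule Bochner_Integration.integrable_diff)
  show "(\<integral>\<omega>. X \<omega> * (M r' A \<omega> - M r A \<omega>) \<partial>P) = 0"
    unfolding right_diff_distrib
    using i martingale_integral_eq(2)[OF mart[OF A] subalg r X(1) i(1)] r by simp
qed

text \<open>By the martingale property, the mixed products of values at the times r and r' may be
  replaced by products at time r. What remains is the expectation of \<open>X\<close> times the
  increment of M(A) M(B), hence of \<open>X\<close> times the increment of Q, which \<open>K\<close>
  dominates.\<close>

lemma increment_covariation:
  assumes A: "A \<in> bounded_borel_sets" and B: "B \<in> bounded_borel_sets" and r: "0 \<le> r" "r \<le> r'"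
    and X: "X \<in> borel_measurable (\<F> r)" "\<And>\<omega>. \<omega> \<in> space P \<Longrightarrow> \<bar>X \<omega>\<bar> \<le> c"
  shows "integrable P (\<lambda>\<omega>. X \<omega> * ((M r' A \<omega> - M r A \<omega>) * (M r' B \<omega> - M r B \<omega>)))"
    "(\<integral>\<omega>. X \<omega> * ((M r' A \<omega> - M r A \<omega>) * (M r' B \<omega> - M r B \<omega>)) \<partial>P)
      \<le> (\<integral>\<omega>. \<bar>X \<omega>\<bar> \<partial>P) * measure K ({r<..r'} \<times> A \<times> B)"
proof -
  have r': "0 \<le> r'" using r by simp
  have Xm: "X \<in> borel_measurable P" using measurable_P[OF X(1) r(1)] .
  obtain Q where Q: "\<And>t. 0 \<le> t \<Longrightarrow> Q t \<in> borel_measurable P" "\<And>t. 0 \<le> t \<Longrightarrow> integrable P (Q t)"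
    "martingale P \<F> (\<lambda>t \<omega>. M t A \<omega> * M t B \<omega> - Q t \<omega>)"
    "\<And>r r'. 0 \<le> r \<Longrightarrow> r \<le> r' \<Longrightarrow> (AE \<omega> in P. \<bar>Q r' \<omega> - Q r \<omega>\<bar> \<le> measure K ({r<..r'} \<times> A \<times> B))"
    by (rule covariation[OF A B], rule that)
  note bi = bounded_mult_integrable[OF Xm X(2)]
  have i: "integrable P (\<lambda>\<omega>. X \<omega> * (M s A \<omega> * M s' B \<omega>))" if "s \<in> {r, r'}" "s' \<in> {r, r'}" for s s'
    using that r r' A B by (intro bi M_mult_integrable') auto
  have i': "integrable P (\<lambda>\<omega>. X \<omega> * (M s B \<omega> * M s' A \<omega>))" if "s \<in> {r, r'}" "s' \<in> {r, r'}" for s s'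
    using that r r' A B by (intro bi M_mult_integrable') auto
  have eq: "X \<omega> * ((M r' A \<omega> - M r A \<omega>) * (M r' B \<omega> - M r B \<omega>)) =
     X \<omega> * (M r' A \<omega> * M r' B \<omega>) - X \<omega> * (M r A \<omega> * M r' B \<omega>) - X \<omega> * (M r B \<omega> * M r' A \<omega>) + X \<omega> * (M r A \<omega> * M r B \<omega>)" for \<omega>
    by (simp add: algebra_simps)
  show int: "integrable P (\<lambda>\<omega>. X \<omega> * ((M r' A \<omega> - M r A \<omega>) * (M r' B \<omega> - M r B \<omega>)))"
    unfolding eq by (intro Bochner_Integration.integrable_add Bochner_Integration.integrable_diff i i') auto
  \<comment> \<open>\<open>X\<close> times the value of M(A) at time r is known at time r, so the
    martingale property of M(B) applies with this unbounded factor, given the integrability of the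
    product.\<close>
  have c1: "(\<integral>\<omega>. X \<omega> * (M r A \<omega> * M r' B \<omega>) \<partial>P) = (\<integral>\<omega>. X \<omega> * (M r A \<omega> * M r B \<omega>) \<partial>P)"
    using martingale_integral_eq(2)[OF mart[OF B] subalg[OF r(1)] r, of "\<lambda>\<omega>. X \<omega> * M r A \<omega>"] i[of r r'] X(1) M_adapted[OF A r(1)]
    by (simp add: mult.assoc)
  have c2: "(\<integral>\<omega>. X \<omega> * (M r B \<omega> * M r' A \<omega>) \<partial>P) = (\<integral>\<omega>. X \<omega> * (M r A \<omega> * M r B \<omega>) \<partial>P)"
    using martingale_integral_eq(2)[OF mart[OF A] subalg[OF r(1)] r, of "\<lambda>\<omega>. X \<omega> * M r B \<omega>"] i'[of r r'] X(1) M_adapted[OF B r(1)]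
    by (simp add: mult.assoc mult.commute[of "M r B _"])
  have iQ: "integrable P (\<lambda>\<omega>. X \<omega> * Q r \<omega>)" "integrable P (\<lambda>\<omega>. X \<omega> * Q r' \<omega>)"
    using Q(2) r r' by (auto intro!: bi)
  have iN: "integrable P (\<lambda>\<omega>. X \<omega> * (M r' A \<omega> * M r' B \<omega> - Q r' \<omega>))"
    unfolding right_diff_distrib by (intro Bochner_Integration.integrable_diff i iQ) auto
  have c3: "(\<integral>\<omega>. X \<omega> * (M r' A \<omega> * M r' B \<omega>) \<partial>P) - (\<integral>\<omega>. X \<omega> * Q r' \<omega> \<partial>P)
     = (\<integral>\<omega>. X \<omega> * (M r A \<omega> * M r B \<omega>) \<partial>P) - (\<integral>\<omega>. X \<omega> * Q r \<omega> \<partial>P)"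
    using martingale_integral_eq(2)[OF Q(3) subalg[OF r(1)] r X(1) iN] i iQ
    by (simp add: right_diff_distrib)
  have "(\<integral>\<omega>. X \<omega> * ((M r' A \<omega> - M r A \<omega>) * (M r' B \<omega> - M r B \<omega>)) \<partial>P)
     = (\<integral>\<omega>. X \<omega> * (M r' A \<omega> * M r' B \<omega>) \<partial>P) - (\<integral>\<omega>. X \<omega> * (M r A \<omega> * M r B \<omega>) \<partial>P)"
    unfolding eq using i i' c1 c2 by simp
  also have "\<dots> = (\<integral>\<omega>. X \<omega> * Q r' \<omega> \<partial>P) - (\<integral>\<omega>. X \<omega> * Q r \<omega> \<partial>P)"
    using c3 by linarith
  also have "\<dots> = (\<integral>\<omega>. X \<omega> * (Q r' \<omega> - Q r \<omega>) \<partial>P)"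
    using iQ by (simp add: right_diff_distrib)
  also have "\<dots> \<le> (\<integral>\<omega>. \<bar>X \<omega>\<bar> * measure K ({r<..r'} \<times> A \<times> B) \<partial>P)"
  proof (rule integral_mono_AE)
    show "integrable P (\<lambda>\<omega>. X \<omega> * (Q r' \<omega> - Q r \<omega>))"
      unfolding right_diff_distrib by (intro Bochner_Integration.integrable_diff iQ)
    show "integrable P (\<lambda>\<omega>. \<bar>X \<omega>\<bar> * measure K ({r<..r'} \<times> A \<times> B))"
      using bi[of "\<lambda>_. 1"] by (intro integrable_mult_left integrable_abs) simp
    show "AE \<omega> in P. X \<omega> * (Q r' \<omega> - Q r \<omega>) \<le> \<bar>X \<omega>\<bar> * measure K ({r<..r'} \<times> A \<times> B)"
      using Q(4)[OF r]
    proof eventually_elim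
      case (elim \<omega>)
      have "X \<omega> * (Q r' \<omega> - Q r \<omega>) \<le> \<bar>X \<omega>\<bar> * \<bar>Q r' \<omega> - Q r \<omega>\<bar>"
        by (metis abs_ge_self abs_mult)
      also have "\<dots> \<le> \<bar>X \<omega>\<bar> * measure K ({r<..r'} \<times> A \<times> B)" using elim by (intro mult_left_mono) auto
      finally show ?case .
    qed
  qed
  finally show "(\<integral>\<omega>. X \<omega> * ((M r' A \<omega> - M r A \<omega>) * (M r' B \<omega> - M r B \<omega>)) \<partial>P)
      \<le> (\<integral>\<omega>. \<bar>X \<omega>\<bar> \<partial>P) * measure K ({r<..r'} \<times> A \<times> B)" by simp
qed

section \<open>Finite additivity, from sigma-additivity in mean square\<close>

lemma M_empty:
  assumes "0 \<le> t"
  shows "AE \<omega> in P. M t {} \<omega> = 0"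
proof -
  have e: "{} \<in> bounded_borel_sets" by (simp add: bounded_borel_sets_def)
  note [measurable] = M_measurable[OF e assms]
  define c where "c = (\<integral>\<^sup>+\<omega>. ennreal ((M t {} \<omega>)\<^sup>2) \<partial>P)"
  have "(\<lambda>N. \<integral>\<^sup>+\<omega>. ennreal ((M t (\<Union>n::nat. {}) \<omega> - (\<Sum>n<N. M t {} \<omega>))\<^sup>2) \<partial>P) \<longlonglongrightarrow> 0"
    using mart_measure assms unfolding martingale_measure_def
    by (auto dest!: spec[of _ t] spec[of _ "\<lambda>_::nat. {}"] simp: disjoint_family_on_def)
  moreover have "c \<le> (\<integral>\<^sup>+\<omega>. ennreal ((M t (\<Union>n::nat. {}) \<omega> - (\<Sum>n<N. M t {} \<omega>))\<^sup>2) \<partial>P)" if "N \<ge> 2" for N :: nat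
    unfolding c_def
  proof (intro nn_integral_mono ennreal_leI)
    fix \<omega>
    \<comment> \<open>For a sequence of empty sets the defect after N terms is 1 - N times the value
      at the empty set; its second moment can tend to zero only if that value vanishes almost
      surely.\<close>
    have "(M t {} \<omega> - (\<Sum>n<N. M t {} \<omega>))\<^sup>2 = (real N - 1)\<^sup>2 * (M t {} \<omega>)\<^sup>2"
      by (simp add: power2_eq_square algebra_simps)
    moreover have "1 \<le> (real N - 1)\<^sup>2" using that by (intro one_le_power) auto
    ultimately show "(M t {} \<omega>)\<^sup>2 \<le> (M t (\<Union>n::nat. {}) \<omega> - (\<Sum>n<N. M t {} \<omega>))\<^sup>2"
      by (simp add: mult_le_cancel_right1)
  qed
  ultimately have "c \<le> 0"
    by (intro tendsto_lowerbound[of _ 0 sequentially]) (auto simp: eventually_sequentially)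
  then have "AE \<omega> in P. ennreal ((M t {} \<omega>)\<^sup>2) = 0"
    unfolding c_def by (subst (asm) nn_integral_0_iff_AE[symmetric] | simp add: nn_integral_0_iff_AE)+
  then show ?thesis by auto
qed

text \<open>For the sequence A, B, {}, {}, ... the defect is almost surely constant from the second
  partial sum on, so its norm equals its limit, which is zero.\<close>

lemma M_disjoint_Un:
  assumes "A \<in> bounded_borel_sets" "B \<in> bounded_borel_sets" "A \<inter> B = {}" "0 \<le> t"
  shows "AE \<omega> in P. M t (A \<union> B) \<omega> = M t A \<omega> + M t B \<omega>"
proof -
  define S where "S = (\<lambda>n::nat. if n = 0 then A else if n = 1 then B else {})"
  have U: "(\<Union>n. S n) = A \<union> B"
    by (auto simp: S_def split: if_splits intro!: exI[of _ 0] exI[of _ 1])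
  have AB: "A \<union> B \<in> bounded_borel_sets" using assms by (auto simp: bounded_borel_sets_def)
  have e: "{} \<in> bounded_borel_sets" by (simp add: bounded_borel_sets_def)
  note [measurable] = M_measurable[OF assms(1,4)] M_measurable[OF assms(2,4)] M_measurable[OF AB assms(4)] M_measurable[OF e assms(4)]
  have d: "range S \<subseteq> sets borel \<and> disjoint_family S \<and> bounded (\<Union>n. S n)"
    unfolding U using AB assms by (auto simp: S_def bounded_borel_sets_def disjoint_family_on_def)
  then have lim: "(\<lambda>N. \<integral>\<^sup>+\<omega>. ennreal ((M t (\<Union>n. S n) \<omega> - (\<Sum>n<N. M t (S n) \<omega>))\<^sup>2) \<partial>P) \<longlonglongrightarrow> 0"
    using mart_measure assms(4) unfolding martingale_measure_def by blast
  define c where "c = (\<integral>\<^sup>+\<omega>. ennreal ((M t (A \<union> B) \<omega> - (M t A \<omega> + M t B \<omega>))\<^sup>2) \<partial>P)"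
  have "(\<integral>\<^sup>+\<omega>. ennreal ((M t (\<Union>n. S n) \<omega> - (\<Sum>n<N. M t (S n) \<omega>))\<^sup>2) \<partial>P) = c" if "N \<ge> 2" for N
    unfolding c_def U
  proof (rule nn_integral_cong_AE)
    show "AE \<omega> in P. ennreal ((M t (A \<union> B) \<omega> - (\<Sum>n<N. M t (S n) \<omega>))\<^sup>2) = ennreal ((M t (A \<union> B) \<omega> - (M t A \<omega> + M t B \<omega>))\<^sup>2)"
      using M_empty[OF assms(4)]
    proof eventually_elim
      case (elim \<omega>)
      have "(\<Sum>n<N. M t (S n) \<omega>) = (\<Sum>n\<in>{0,1}. M t (S n) \<omega>)"
        using that elim by (intro sum.mono_neutral_right) (auto simp: S_def)
      also have "\<dots> = M t A \<omega> + M t B \<omega>" by (simp add: S_def)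
      finally show ?case by simp
    qed
  qed
  then have "eventually (\<lambda>N. (\<integral>\<^sup>+\<omega>. ennreal ((M t (\<Union>n. S n) \<omega> - (\<Sum>n<N. M t (S n) \<omega>))\<^sup>2) \<partial>P) = c) sequentially"
    unfolding eventually_sequentially by blast
  then have "((\<lambda>_. c) \<longlongrightarrow> 0) sequentially" by (rule Lim_transform_eventually[OF lim])
  then have "c = 0" by (simp add: LIMSEQ_const_iff)
  then have "AE \<omega> in P. ennreal ((M t (A \<union> B) \<omega> - (M t A \<omega> + M t B \<omega>))\<^sup>2) = 0"
    unfolding c_def by (subst (asm) nn_integral_0_iff_AE) auto
  then show ?thesis by auto
qed

lemma M_disjoint_UN:
  assumes "finite I" "\<And>i. i \<in> I \<Longrightarrow> B i \<in> bounded_borel_sets" "disjoint_family_on B I" "0 \<le> t"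
  shows "(\<Union>i\<in>I. B i) \<in> bounded_borel_sets \<and> (AE \<omega> in P. M t (\<Union>i\<in>I. B i) \<omega> = (\<Sum>i\<in>I. M t (B i) \<omega>))"
  using assms(1-3)
proof (induction I)
  case empty
  then show ?case using M_empty[OF assms(4)] by (simp add: bounded_borel_sets_def)
next
  case (insert i I)
  have IH: "(\<Union>i\<in>I. B i) \<in> bounded_borel_sets" "AE \<omega> in P. M t (\<Union>i\<in>I. B i) \<omega> = (\<Sum>i\<in>I. M t (B i) \<omega>)"
    using insert by (auto simp: disjoint_family_on_def)
  have d: "B i \<inter> (\<Union>i\<in>I. B i) = {}" using insert(2,5) by (auto simp: disjoint_family_on_def)
  have "AE \<omega> in P. M t (B i \<union> (\<Union>i\<in>I. B i)) \<omega> = M t (B i) \<omega> + M t (\<Union>i\<in>I. B i) \<omega>"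
    using insert IH d assms(4) by (intro M_disjoint_Un) auto
  moreover have "B i \<union> (\<Union>i\<in>I. B i) \<in> bounded_borel_sets"
    using IH insert(4)[of i] by (auto simp: bounded_borel_sets_def)
  ultimately show ?case using IH(2) insert(1,2) by auto
qed

lemma increment_square:
  assumes "A \<in> bounded_borel_sets" "0 \<le> r" "r \<le> r'"
  shows "(\<integral>\<^sup>+\<omega>. ennreal ((M r' A \<omega> - M r A \<omega>)\<^sup>2) \<partial>P) \<le> emeasure K ({r<..r'} \<times> A \<times> A)"
proof -
  have c: "integrable P (\<lambda>\<omega>. 1 * ((M r' A \<omega> - M r A \<omega>) * (M r' A \<omega> - M r A \<omega>)))"
    "(\<integral>\<omega>. 1 * ((M r' A \<omega> - M r A \<omega>) * (M r' A \<omega> - M r A \<omega>)) \<partial>P) \<le> (\<integral>\<omega>. \<bar>1\<bar> \<partial>P) * measure K ({r<..r'} \<times> A \<times> A)"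
    using increment_covariation[OF assms(1,1,2,3), of "\<lambda>_. 1" 1] by auto
  have "(\<integral>\<^sup>+\<omega>. ennreal ((M r' A \<omega> - M r A \<omega>)\<^sup>2) \<partial>P) = ennreal (\<integral>\<omega>. (M r' A \<omega> - M r A \<omega>)\<^sup>2 \<partial>P)"
    using c(1) by (intro nn_integral_eq_integral) (auto simp: power2_eq_square)
  also have "\<dots> \<le> ennreal (measure K ({r<..r'} \<times> A \<times> A))"
    using c(2) by (intro ennreal_leI) (simp add: power2_eq_square prob_space)
  also have "\<dots> = emeasure K ({r<..r'} \<times> A \<times> A)"
    using K_finite[OF assms(1,1,2), of r'] by (intro emeasure_eq_ennreal_measure[symmetric]) auto
  finally show ?thesis .
qed

end

text \<open>By \<open>K_linear\<close>, second moments of increments are of order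
  \<open>r' - r\<close>. With fourth moments of order \<open>(r' - r)\<^sup>2\<close>, third
  absolute moments are of lower order than \<open>r' - r\<close>, which is what a Taylor expansion
  along a partition requires.\<close>

locale fourth_moment_martingale_measure = worthy_measure P \<F> M K
  for P :: "'w measure" and \<F> :: "real \<Rightarrow> 'w measure"
    and M :: "real \<Rightarrow> 'e::euclidean_space set \<Rightarrow> 'w \<Rightarrow> real" and K :: "(real \<times> 'e \<times> 'e) measure" +
  assumes fourth_moment: "A \<in> bounded_borel_sets \<Longrightarrow>
      \<exists>C\<ge>0. \<forall>r r'. 0 \<le> r \<and> r \<le> r' \<longrightarrow> (\<integral>\<^sup>+\<omega>. ennreal ((M r' A \<omega> - M r A \<omega>) ^ 4) \<partial>P) \<le> ennreal (C * (r' - r)\<^sup>2)"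
    and K_linear: "A \<in> bounded_borel_sets \<Longrightarrow>
      \<exists>C\<ge>0. \<forall>r r'. 0 \<le> r \<and> r \<le> r' \<longrightarrow> emeasure K ({r<..r'} \<times> A \<times> A) \<le> ennreal (C * (r' - r))"

section \<open>Walsh's norm\<close>

lemma nn_integral_limit_le:
  fixes u :: "nat \<Rightarrow> 'a \<Rightarrow> ennreal"
  assumes [measurable]: "\<And>n. u n \<in> borel_measurable N"
    and lim: "AE x in N. (\<lambda>n. u n x) \<longlonglongrightarrow> v x"
    and le: "\<And>n. (\<integral>\<^sup>+x. u n x \<partial>N) \<le> c n" and c: "c \<longlonglongrightarrow> C"
  shows "(\<integral>\<^sup>+x. v x \<partial>N) \<le> C"
proof -
  have "(\<integral>\<^sup>+x. v x \<partial>N) \<le> (\<integral>\<^sup>+x. liminf (\<lambda>n. u n x) \<partial>N)"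
    by (rule nn_integral_mono_AE, use lim in eventually_elim) (simp add: lim_imp_Liminf)
  also have "\<dots> \<le> liminf (\<lambda>n. \<integral>\<^sup>+x. u n x \<partial>N)" by (rule nn_integral_liminf) measurable
  also have "\<dots> \<le> liminf c" by (intro Liminf_mono always_eventually allI le)
  also have "\<dots> = C" using c by (simp add: lim_imp_Liminf)
  finally show ?thesis .
qed

text \<open>The sum is at most the number of terms times the largest term, whose power is one of the
  summands on the right.\<close>

lemma abs_sum_power_le:
  fixes a :: "'i \<Rightarrow> real"
  assumes "finite I" "0 < p"
  shows "\<bar>\<Sum>i\<in>I. a i\<bar> ^ p \<le> real (card I) ^ p * (\<Sum>i\<in>I. \<bar>a i\<bar> ^ p)"
proof (cases "I = {}")
  case False
  define m where "m = Max ((\<lambda>i. \<bar>a i\<bar>) ` I)"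
  have "m \<in> (\<lambda>i. \<bar>a i\<bar>) ` I" unfolding m_def using assms False by (intro Max_in) auto
  then obtain j where j: "j \<in> I" "m = \<bar>a j\<bar>" by auto
  have "\<bar>\<Sum>i\<in>I. a i\<bar> \<le> (\<Sum>i\<in>I. \<bar>a i\<bar>)" by (rule sum_abs)
  also have "\<dots> \<le> real (card I) * m"
    by (rule sum_bounded_above) (use assms in \<open>auto simp: m_def\<close>)
  finally have "\<bar>\<Sum>i\<in>I. a i\<bar> ^ p \<le> (real (card I) * m) ^ p" by (intro power_mono) auto
  also have "\<dots> = real (card I) ^ p * \<bar>a j\<bar> ^ p" by (simp add: power_mult_distrib j)
  also have "\<dots> \<le> real (card I) ^ p * (\<Sum>i\<in>I. \<bar>a i\<bar> ^ p)"
    using assms j by (intro mult_left_mono member_le_sum) auto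
  finally show ?thesis .
qed (use assms in \<open>simp add: zero_power\<close>)

text \<open>The inner integral of \<open>walsh_norm_sq\<close> for one outcome, over a window of
  time; the windows will be the intervals of a partition.\<close>

definition cross_energy ::
    "(real \<times> 'e \<times> 'e) measure \<Rightarrow> real \<Rightarrow> real \<Rightarrow> (real \<Rightarrow> 'e \<Rightarrow> real) \<Rightarrow> ennreal" where
  "cross_energy K r r' f = (\<integral>\<^sup>+(s, y, z). ennreal (indicator {r<..r'} s * (\<bar>f s y\<bar> * \<bar>f s z\<bar>)) \<partial>K)"

context fourth_moment_martingale_measure
begin

lemma bounded_product_integrable:
  fixes F G :: "real \<times> 'e \<Rightarrow> real"
  assumes [measurable]: "F \<in> borel_measurable borel" "G \<in> borel_measurable borel"
    and "\<And>w. \<bar>F w\<bar> \<le> c" "\<And>w. \<bar>G w\<bar> \<le> c" "0 \<le> c" "0 \<le> r"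
    and 0: "\<And>s y. \<not> (r < s \<and> s \<le> r' \<and> norm y \<le> R) \<Longrightarrow> F (s, y) = 0"
      "\<And>s y. \<not> (r < s \<and> s \<le> r' \<and> norm y \<le> R) \<Longrightarrow> G (s, y) = 0"
  shows "integrable K (\<lambda>(s, y, z). F (s, y) * G (s, z))"
proof (rule Bochner_Integration.integrable_bound)
  let ?S = "{r<..r'} \<times> cball (0::'e) R \<times> cball 0 R"
  have S: "?S \<in> sets K" unfolding sets_K by (intro borel_Times) auto
  have "cball (0::'e) R \<in> bounded_borel_sets" by (simp add: bounded_borel_sets_def)
  then have "emeasure K ?S < \<infinity>" using assms by (intro K_finite)
  then show "integrable K (\<lambda>w. c * c * indicator ?S w)"
    using S by (intro integrable_mult_right integrable_real_indicator) auto
  show "(\<lambda>(s, y, z). F (s, y) * G (s, z)) \<in> borel_measurable K"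
    unfolding measurable_cong_sets[OF sets_K refl] borel_prod[symmetric] by measurable
  show "AE w in K. norm (case w of (s, y, z) \<Rightarrow> F (s, y) * G (s, z)) \<le> norm (c * c * indicator ?S w)"
  proof (rule AE_I2)
    fix w :: "real \<times> 'e \<times> 'e"
    obtain s y z where w: "w = (s, y, z)" by (cases w)
    show "norm (case w of (s, y, z) \<Rightarrow> F (s, y) * G (s, z)) \<le> norm (c * c * indicator ?S w)"
    proof (cases "(s, y, z) \<in> ?S")
      case True
      have "\<bar>F (s, y)\<bar> * \<bar>G (s, z)\<bar> \<le> c * c" using assms by (intro mult_mono) auto
      then show ?thesis using True \<open>0 \<le> c\<close> by (simp add: abs_mult w)
    next
      case False
      then have "F (s, y) = 0 \<or> G (s, z) = 0" using 0 by (auto simp: dist_norm)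
      then show ?thesis by (auto simp: w)
    qed
  qed
qed

text \<open>By positive definiteness the parallelogram identity \<open>(f + g)(f + g)' + (f - g)(f - g)' = 2 f f' + 2 g g'\<close>
  becomes an inequality for the energies; truncation removes the integrability conditions.\<close>

lemma cross_energy_add_le:
  assumes [measurable]: "(\<lambda>(s, y). f s y) \<in> borel_measurable borel" "(\<lambda>(s, y). g s y) \<in> borel_measurable borel"
    and r: "0 \<le> r"
    and le: "\<And>s y. r < s \<Longrightarrow> s \<le> r' \<Longrightarrow> \<bar>h s y\<bar> \<le> \<bar>f s y\<bar> + \<bar>g s y\<bar>"
  shows "cross_energy K r r' h \<le> 2 * cross_energy K r r' f + 2 * cross_energy K r r' g"
proof -
  \<comment> \<open>Positive definiteness of \<open>K\<close> is available for bounded functions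
    with integrable product. Truncation in height and in space provides both, and the absolute value
    keeps everything nonnegative.\<close>
  define tr where "tr = (\<lambda>(f :: real \<Rightarrow> 'e \<Rightarrow> real) (n::nat) (s, y). if r < s \<and> s \<le> r' \<and> norm y \<le> real n then min \<bar>f s y\<bar> (real n) else 0)"
  have tr_meas [measurable]: "tr f n \<in> borel_measurable borel" if "(\<lambda>(s, y). f s y) \<in> borel_measurable borel" for f n
  proof -
    have "(\<lambda>w. f (fst w) (snd w)) \<in> borel_measurable (borel \<Otimes>\<^sub>M borel)"
      using that by (simp add: borel_prod split_beta')
    then show ?thesis unfolding tr_def borel_prod[symmetric] split_beta' by measurable
  qed
  have tr_bd: "\<bar>tr f n w\<bar> \<le> real n" "tr f n w \<ge> 0" for f n w by (auto simp: tr_def split: prod.split)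
  have tr_le: "tr f n (s, y) \<le> indicator {r<..r'} s * \<bar>f s y\<bar>" for f n s y by (auto simp: tr_def)
  have tr_0: "tr f n (s, y) = 0" if "\<not> (r < s \<and> s \<le> r' \<and> norm y \<le> real n)" for f n s y using that by (auto simp: tr_def)
  have en_le: "(\<integral>\<^sup>+(s, y, z). ennreal (tr f n (s, y) * tr f n (s, z)) \<partial>K) \<le> cross_energy K r r' f" for f n
    unfolding cross_energy_def
  proof (rule nn_integral_mono)
    fix w :: "real \<times> 'e \<times> 'e"
    obtain s y z where w: "w = (s, y, z)" by (cases w)
    have "tr f n (s, y) * tr f n (s, z) \<le> (indicator {r<..r'} s * \<bar>f s y\<bar>) * (indicator {r<..r'} s * \<bar>f s z\<bar>)"
      using tr_bd by (intro mult_mono tr_le) auto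
    also have "\<dots> = indicator {r<..r'} s * (\<bar>f s y\<bar> * \<bar>f s z\<bar>)" by (simp add: indicator_def)
    finally show "(case w of (s, y, z) \<Rightarrow> ennreal (tr f n (s, y) * tr f n (s, z)))
        \<le> (case w of (s, y, z) \<Rightarrow> ennreal (indicator {r<..r'} s * (\<bar>f s y\<bar> * \<bar>f s z\<bar>)))"
      unfolding w by (simp add: ennreal_leI)
  qed
  have main: "(\<integral>\<^sup>+(s, y, z). ennreal ((tr f n (s, y) + tr g n (s, y)) * (tr f n (s, z) + tr g n (s, z))) \<partial>K)
     \<le> 2 * cross_energy K r r' f + 2 * cross_energy K r r' g" for n
  proof -
    define F G where "F = tr f n" "G = tr g n"
    have [measurable]: "F \<in> borel_measurable borel" "G \<in> borel_measurable borel" unfolding F_G_def by measurable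
    have nn: "F w \<ge> 0" "G w \<ge> 0" for w unfolding F_G_def by (rule tr_bd)+
    have bd: "\<bar>F w\<bar> \<le> real n" "\<bar>G w\<bar> \<le> real n" for w unfolding F_G_def by (rule tr_bd)+
    have bd2: "\<bar>F w - G w\<bar> \<le> 2 * real n" "\<bar>F w + G w\<bar> \<le> 2 * real n" for w
      using bd[of w] by linarith+
    have z: "F (s, y) = 0" "G (s, y) = 0" if "\<not> (r < s \<and> s \<le> r' \<and> norm y \<le> real n)" for s y
      using that unfolding F_G_def by (auto intro: tr_0)
    have iF: "integrable K (\<lambda>(s, y, z). F (s, y) * F (s, z))"
      by (rule bounded_product_integrable[where R = "real n" and r' = r', OF _ _ bd(1) bd(1) _ r]) (use z in auto)
    have iG: "integrable K (\<lambda>(s, y, z). G (s, y) * G (s, z))"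
      by (rule bounded_product_integrable[where R = "real n" and r' = r', OF _ _ bd(2) bd(2) _ r]) (use z in auto)
    have iD: "integrable K (\<lambda>(s, y, z). (F (s, y) - G (s, y)) * (F (s, z) - G (s, z)))"
      by (rule bounded_product_integrable[where F = "\<lambda>w. F w - G w" and G = "\<lambda>w. F w - G w" and c = "2 * real n" and R = "real n" and r' = r', OF _ _ bd2(1) bd2(1) _ r])
        (use z in auto)
    have iS: "integrable K (\<lambda>(s, y, z). (F (s, y) + G (s, y)) * (F (s, z) + G (s, z)))"
      by (rule bounded_product_integrable[where F = "\<lambda>w. F w + G w" and G = "\<lambda>w. F w + G w" and c = "2 * real n" and R = "real n" and r' = r', OF _ _ bd2(2) bd2(2) _ r])
        (use z in auto)
    \<comment> \<open>Positive definiteness enters here: the term of the parallelogram identity that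
      is dropped is nonnegative.\<close>
    have D0: "0 \<le> (\<integral>(s, y, z). (F (s, y) - G (s, y)) * (F (s, z) - G (s, z)) \<partial>K)"
    proof (rule K_facts(3)[where f = "\<lambda>w. F w - G w"])
      show "bounded (range (\<lambda>w. F w - G w))"
        unfolding bounded_iff using bd2(1) by (intro exI[of _ "2 * real n"]) auto
    qed (use iD in auto)
    have "(\<integral>(s, y, z). (F (s, y) + G (s, y)) * (F (s, z) + G (s, z)) \<partial>K)
       = (\<integral>w. 2 * (case w of (s, y, z) \<Rightarrow> F (s, y) * F (s, z)) + 2 * (case w of (s, y, z) \<Rightarrow> G (s, y) * G (s, z))
             - (case w of (s, y, z) \<Rightarrow> (F (s, y) - G (s, y)) * (F (s, z) - G (s, z))) \<partial>K)"
      by (intro Bochner_Integration.integral_cong) (auto simp: algebra_simps)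
    also have "\<dots> = 2 * (\<integral>(s, y, z). F (s, y) * F (s, z) \<partial>K) + 2 * (\<integral>(s, y, z). G (s, y) * G (s, z) \<partial>K)
       - (\<integral>(s, y, z). (F (s, y) - G (s, y)) * (F (s, z) - G (s, z)) \<partial>K)"
      using iF iG iD by simp
    finally have ineq: "(\<integral>(s, y, z). (F (s, y) + G (s, y)) * (F (s, z) + G (s, z)) \<partial>K)
       \<le> 2 * (\<integral>(s, y, z). F (s, y) * F (s, z) \<partial>K) + 2 * (\<integral>(s, y, z). G (s, y) * G (s, z) \<partial>K)"
      using D0 by linarith
    have conv: "(\<integral>\<^sup>+(s, y, z). ennreal (H (s, y) * H (s, z)) \<partial>K) = ennreal (\<integral>(s, y, z). H (s, y) * H (s, z) \<partial>K)"
      if "integrable K (\<lambda>(s, y, z). H (s, y) * H (s, z))" "\<And>w. H w \<ge> 0" for H :: "real \<times> 'e \<Rightarrow> real"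
      using nn_integral_eq_integral[OF that(1)] that(2) by (simp add: split_beta')
    have pos: "0 \<le> (\<integral>(s, y, z). H (s, y) * H (s, z) \<partial>K)" if "\<And>w. H w \<ge> 0" for H :: "real \<times> 'e \<Rightarrow> real"
      using that by (intro integral_nonneg_AE) auto
    have "(\<integral>\<^sup>+(s, y, z). ennreal ((F (s, y) + G (s, y)) * (F (s, z) + G (s, z))) \<partial>K)
        = ennreal (\<integral>(s, y, z). (F (s, y) + G (s, y)) * (F (s, z) + G (s, z)) \<partial>K)"
      using conv[of "\<lambda>w. F w + G w"] iS nn by simp
    also have "\<dots> \<le> ennreal (2 * (\<integral>(s, y, z). F (s, y) * F (s, z) \<partial>K) + 2 * (\<integral>(s, y, z). G (s, y) * G (s, z) \<partial>K))"
      using ineq by (rule ennreal_leI)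
    also have "\<dots> = 2 * (\<integral>\<^sup>+(s, y, z). ennreal (F (s, y) * F (s, z)) \<partial>K) + 2 * (\<integral>\<^sup>+(s, y, z). ennreal (G (s, y) * G (s, z)) \<partial>K)"
      unfolding conv[of F, OF iF nn(1)] conv[of G, OF iG nn(2)] using pos[of F, OF nn(1)] pos[of G, OF nn(2)]
      by (simp add: ennreal_mult')
    also have "\<dots> \<le> 2 * cross_energy K r r' f + 2 * cross_energy K r r' g"
      unfolding F_G_def by (intro add_mono mult_left_mono en_le) auto
    finally show ?thesis unfolding F_G_def .
  qed
  have "(\<integral>\<^sup>+(s, y, z). ennreal (indicator {r<..r'} s * ((\<bar>f s y\<bar> + \<bar>g s y\<bar>) * (\<bar>f s z\<bar> + \<bar>g s z\<bar>))) \<partial>K)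
     \<le> 2 * cross_energy K r r' f + 2 * cross_energy K r r' g"
  proof (rule nn_integral_limit_le[OF _ _ main tendsto_const])
    fix n
    have [measurable]: "tr f n \<in> borel_measurable (borel \<Otimes>\<^sub>M borel)" "tr g n \<in> borel_measurable (borel \<Otimes>\<^sub>M borel)"
      unfolding borel_prod by measurable
    show "(\<lambda>(s, y, z). ennreal ((tr f n (s, y) + tr g n (s, y)) * (tr f n (s, z) + tr g n (s, z)))) \<in> borel_measurable K"
      unfolding measurable_cong_sets[OF sets_K refl] borel_prod[symmetric] by measurable
  next
    \<comment> \<open>At each point the truncations are eventually equal to the full function, so
      Fatou's lemma removes them.\<close>
    have tr_lim: "\<forall>\<^sub>F n in sequentially. tr f n (s, y) = indicator {r<..r'} s * \<bar>f s y\<bar>" for f s y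
      unfolding eventually_sequentially
    proof (intro exI allI impI)
      fix n assume "nat \<lceil>max (norm y) \<bar>f s y\<bar>\<rceil> \<le> n"
      then have "max (norm y) \<bar>f s y\<bar> \<le> real n" by linarith
      then show "tr f n (s, y) = indicator {r<..r'} s * \<bar>f s y\<bar>" by (auto simp: tr_def)
    qed
    show "AE x in K. (\<lambda>n. case x of (s, y, z) \<Rightarrow> ennreal ((tr f n (s, y) + tr g n (s, y)) * (tr f n (s, z) + tr g n (s, z))))
       \<longlonglongrightarrow> (case x of (s, y, z) \<Rightarrow> ennreal (indicator {r<..r'} s * ((\<bar>f s y\<bar> + \<bar>g s y\<bar>) * (\<bar>f s z\<bar> + \<bar>g s z\<bar>))))"
    proof (rule AE_I2)
      fix w :: "real \<times> 'e \<times> 'e"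
      obtain s y z where w: "w = (s, y, z)" by (cases w)
      have "\<forall>\<^sub>F n in sequentially. ennreal ((tr f n (s, y) + tr g n (s, y)) * (tr f n (s, z) + tr g n (s, z)))
        = ennreal (indicator {r<..r'} s * ((\<bar>f s y\<bar> + \<bar>g s y\<bar>) * (\<bar>f s z\<bar> + \<bar>g s z\<bar>)))"
        using tr_lim[of f s y] tr_lim[of f s z] tr_lim[of g s y] tr_lim[of g s z]
        by eventually_elim (simp add: indicator_def)
      then show "(\<lambda>n. case w of (s, y, z) \<Rightarrow> ennreal ((tr f n (s, y) + tr g n (s, y)) * (tr f n (s, z) + tr g n (s, z))))
       \<longlonglongrightarrow> (case w of (s, y, z) \<Rightarrow> ennreal (indicator {r<..r'} s * ((\<bar>f s y\<bar> + \<bar>g s y\<bar>) * (\<bar>f s z\<bar> + \<bar>g s z\<bar>))))"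
        unfolding w by (simp add: tendsto_eventually)
    qed
  qed
  moreover have "cross_energy K r r' h \<le> (\<integral>\<^sup>+(s, y, z). ennreal (indicator {r<..r'} s * ((\<bar>f s y\<bar> + \<bar>g s y\<bar>) * (\<bar>f s z\<bar> + \<bar>g s z\<bar>))) \<partial>K)"
    unfolding cross_energy_def
  proof (rule nn_integral_mono)
    fix w :: "real \<times> 'e \<times> 'e"
    obtain s y z where w: "w = (s, y, z)" by (cases w)
    show "(case w of (s, y, z) \<Rightarrow> ennreal (indicator {r<..r'} s * (\<bar>h s y\<bar> * \<bar>h s z\<bar>)))
        \<le> (case w of (s, y, z) \<Rightarrow> ennreal (indicator {r<..r'} s * ((\<bar>f s y\<bar> + \<bar>g s y\<bar>) * (\<bar>f s z\<bar> + \<bar>g s z\<bar>))))"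
      unfolding w using le[of s y] le[of s z] by (cases "s \<in> {r<..r'}") (auto intro!: ennreal_leI mult_mono)
  qed
  ultimately show ?thesis by (rule order_trans[rotated])
qed


section \<open>Increments of simple integrals over one short interval\<close>

lemma increment_sum_moments:
  fixes n :: nat
  assumes A: "\<And>i. i < n \<Longrightarrow> A i \<in> bounded_borel_sets" and c: "0 \<le> c"
  shows "\<exists>C\<ge>0. \<forall>r r' X. 0 \<le> r \<and> r \<le> r' \<and> (\<forall>i<n. \<forall>\<omega>\<in>space P. \<bar>X i \<omega>\<bar> \<le> c) \<longrightarrow>
     (\<integral>\<^sup>+\<omega>. ennreal ((\<Sum>i<n. X i \<omega> * (M r' (A i) \<omega> - M r (A i) \<omega>))\<^sup>2) \<partial>P) \<le> ennreal (C * (r' - r)) \<and>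
     (\<integral>\<^sup>+\<omega>. ennreal ((\<Sum>i<n. X i \<omega> * (M r' (A i) \<omega> - M r (A i) \<omega>)) ^ 4) \<partial>P) \<le> ennreal (C * (r' - r)\<^sup>2)"
proof -
  have "\<forall>i. \<exists>C\<ge>0. i < n \<longrightarrow> (\<forall>r r'. 0 \<le> r \<and> r \<le> r' \<longrightarrow> (\<integral>\<^sup>+\<omega>. ennreal ((M r' (A i) \<omega> - M r (A i) \<omega>) ^ 4) \<partial>P) \<le> ennreal (C * (r' - r)\<^sup>2))"
    using fourth_moment[OF A] by blast
  then obtain C4 where C4: "\<And>i. C4 i \<ge> 0" "\<And>i r r'. i < n \<Longrightarrow> 0 \<le> r \<Longrightarrow> r \<le> r' \<Longrightarrow>
     (\<integral>\<^sup>+\<omega>. ennreal ((M r' (A i) \<omega> - M r (A i) \<omega>) ^ 4) \<partial>P) \<le> ennreal (C4 i * (r' - r)\<^sup>2)"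
    by metis
  have "\<forall>i. \<exists>C\<ge>0. i < n \<longrightarrow> (\<forall>r r'. 0 \<le> r \<and> r \<le> r' \<longrightarrow> emeasure K ({r<..r'} \<times> A i \<times> A i) \<le> ennreal (C * (r' - r)))"
    using K_linear[OF A] by blast
  then obtain C2 where C2: "\<And>i. C2 i \<ge> 0" "\<And>i r r'. i < n \<Longrightarrow> 0 \<le> r \<Longrightarrow> r \<le> r' \<Longrightarrow> emeasure K ({r<..r'} \<times> A i \<times> A i) \<le> ennreal (C2 i * (r' - r))"
    by metis
  have gen: "(\<integral>\<^sup>+\<omega>. ennreal ((\<Sum>i<n. X i \<omega> * (M r' (A i) \<omega> - M r (A i) \<omega>)) ^ p) \<partial>P)
      \<le> ennreal (real n ^ p * c ^ p * (\<Sum>i<n. D i) * \<rho>)"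
    if p: "even p" "0 < p" and D: "\<And>i. 0 \<le> D i" "\<And>i. i < n \<Longrightarrow> (\<integral>\<^sup>+\<omega>. ennreal ((M r' (A i) \<omega> - M r (A i) \<omega>) ^ p) \<partial>P) \<le> ennreal (D i * \<rho>)"
      and \<rho>: "0 \<le> \<rho>" and r: "0 \<le> r" "r \<le> r'" and X: "\<And>i \<omega>. i < n \<Longrightarrow> \<omega> \<in> space P \<Longrightarrow> \<bar>X i \<omega>\<bar> \<le> c" for p D \<rho> r r' X
  proof -
    have r': "0 \<le> r'" using r by simp
    have "(\<integral>\<^sup>+\<omega>. ennreal ((\<Sum>i<n. X i \<omega> * (M r' (A i) \<omega> - M r (A i) \<omega>)) ^ p) \<partial>P)
       \<le> (\<integral>\<^sup>+\<omega>. ennreal (real n ^ p * c ^ p) * (\<Sum>i<n. ennreal ((M r' (A i) \<omega> - M r (A i) \<omega>) ^ p)) \<partial>P)"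
    proof (rule nn_integral_mono)
      fix \<omega> assume \<omega>: "\<omega> \<in> space P"
      let ?a = "\<lambda>i. X i \<omega> * (M r' (A i) \<omega> - M r (A i) \<omega>)"
      have "(\<Sum>i<n. ?a i) ^ p = \<bar>\<Sum>i<n. ?a i\<bar> ^ p" using p by (simp add: power_even_abs)
      also have "\<dots> \<le> real n ^ p * (\<Sum>i<n. \<bar>?a i\<bar> ^ p)" using abs_sum_power_le[of "{..<n}" p ?a] p by simp
      also have "\<dots> \<le> real n ^ p * (\<Sum>i<n. c ^ p * (M r' (A i) \<omega> - M r (A i) \<omega>) ^ p)"
      proof (intro mult_left_mono sum_mono)
        fix i assume "i \<in> {..<n}"
        then have "\<bar>X i \<omega>\<bar> ^ p \<le> c ^ p" using X \<omega> by (intro power_mono) auto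
        then have "\<bar>X i \<omega>\<bar> ^ p * \<bar>M r' (A i) \<omega> - M r (A i) \<omega>\<bar> ^ p \<le> c ^ p * \<bar>M r' (A i) \<omega> - M r (A i) \<omega>\<bar> ^ p"
          by (intro mult_right_mono) auto
        then show "\<bar>?a i\<bar> ^ p \<le> c ^ p * (M r' (A i) \<omega> - M r (A i) \<omega>) ^ p"
          using p by (simp add: abs_mult power_mult_distrib power_even_abs)
      qed auto
      also have "\<dots> = real n ^ p * c ^ p * (\<Sum>i<n. (M r' (A i) \<omega> - M r (A i) \<omega>) ^ p)"
        by (simp add: sum_distrib_left mult.assoc)
      finally show "ennreal ((\<Sum>i<n. ?a i) ^ p) \<le> ennreal (real n ^ p * c ^ p) * (\<Sum>i<n. ennreal ((M r' (A i) \<omega> - M r (A i) \<omega>) ^ p))"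
        using p c by (subst sum_ennreal) (auto simp: ennreal_mult'[symmetric] intro!: ennreal_leI zero_le_even_power)
    qed
    also have "\<dots> = ennreal (real n ^ p * c ^ p) * (\<Sum>i<n. \<integral>\<^sup>+\<omega>. ennreal ((M r' (A i) \<omega> - M r (A i) \<omega>) ^ p) \<partial>P)"
    proof -
      have m: "(\<lambda>\<omega>. ennreal ((M r' (A i) \<omega> - M r (A i) \<omega>) ^ p)) \<in> borel_measurable P" if "i < n" for i
        using M_measurable[OF A[OF that] r'] M_measurable[OF A[OF that] r(1)] by measurable
      show ?thesis
        by (subst nn_integral_cmult, intro borel_measurable_sum m, simp, subst nn_integral_sum) (auto intro: m)
    qed
    also have "\<dots> \<le> ennreal (real n ^ p * c ^ p) * (\<Sum>i<n. ennreal (D i * \<rho>))"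
      by (intro mult_left_mono sum_mono D) auto
    also have "\<dots> = ennreal (real n ^ p * c ^ p * (\<Sum>i<n. D i) * \<rho>)"
      using D \<rho> c by (subst sum_ennreal) (auto simp: ennreal_mult'[symmetric] sum_distrib_right mult.assoc)
    finally show ?thesis .
  qed
  \<comment> \<open>The constants depend on the sets and on the bound \<open>c\<close>, but on
    neither the interval nor the coefficients: along a partition the coefficients change from one
    interval to the next.\<close>
  define Ca where "Ca = real n ^ 2 * c ^ 2 * (\<Sum>i<n. C2 i)"
  define Cb where "Cb = real n ^ 4 * c ^ 4 * (\<Sum>i<n. C4 i)"
  have Cab: "0 \<le> Ca" "0 \<le> Cb" using c C2(1) C4(1) by (auto simp: Ca_def Cb_def intro!: mult_nonneg_nonneg sum_nonneg)
  show ?thesis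
  proof (intro exI[of _ "Ca + Cb"] conjI allI impI)
    fix r r' :: real and X :: "nat \<Rightarrow> 'w \<Rightarrow> real"
    assume "0 \<le> r \<and> r \<le> r' \<and> (\<forall>i<n. \<forall>\<omega>\<in>space P. \<bar>X i \<omega>\<bar> \<le> c)"
    then have r: "0 \<le> r" "r \<le> r'" and X: "\<And>i \<omega>. i < n \<Longrightarrow> \<omega> \<in> space P \<Longrightarrow> \<bar>X i \<omega>\<bar> \<le> c" by auto
    have "(\<integral>\<^sup>+\<omega>. ennreal ((\<Sum>i<n. X i \<omega> * (M r' (A i) \<omega> - M r (A i) \<omega>))\<^sup>2) \<partial>P) \<le> ennreal (Ca * (r' - r))"
      unfolding Ca_def
      by (rule gen) (use r X C2 in \<open>auto intro: order_trans[OF increment_square[OF A]]\<close>)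
    also have "\<dots> \<le> ennreal ((Ca + Cb) * (r' - r))" using Cab r by (intro ennreal_leI mult_right_mono) auto
    finally show "(\<integral>\<^sup>+\<omega>. ennreal ((\<Sum>i<n. X i \<omega> * (M r' (A i) \<omega> - M r (A i) \<omega>))\<^sup>2) \<partial>P) \<le> ennreal ((Ca + Cb) * (r' - r))" .
    have "(\<integral>\<^sup>+\<omega>. ennreal ((\<Sum>i<n. X i \<omega> * (M r' (A i) \<omega> - M r (A i) \<omega>)) ^ 4) \<partial>P) \<le> ennreal (Cb * (r' - r)\<^sup>2)"
      unfolding Cb_def by (rule gen) (use r X C4 in auto)
    also have "\<dots> \<le> ennreal ((Ca + Cb) * (r' - r)\<^sup>2)" using Cab r by (intro ennreal_leI mult_right_mono) auto
    finally show "(\<integral>\<^sup>+\<omega>. ennreal ((\<Sum>i<n. X i \<omega> * (M r' (A i) \<omega> - M r (A i) \<omega>)) ^ 4) \<partial>P) \<le> ennreal ((Ca + Cb) * (r' - r)\<^sup>2)" .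
  qed (use Cab in auto)
qed

text \<open>For disjoint sets the absolute value of the step function is the step function of the
  absolute values. The covariation bound leads to the double sum of |Y i| |Y j| times the mass of a
  box, which is then exactly the cross energy.\<close>

lemma quadratic_variation_disjoint:
  assumes fin: "finite I" and B: "\<And>i. i \<in> I \<Longrightarrow> B i \<in> bounded_borel_sets" and disj: "disjoint_family_on B I"
    and r: "0 \<le> r" "r \<le> r'"
    and Y: "\<And>i. i \<in> I \<Longrightarrow> Y i \<in> borel_measurable (\<F> r)" "\<And>i \<omega>. i \<in> I \<Longrightarrow> \<omega> \<in> space P \<Longrightarrow> \<bar>Y i \<omega>\<bar> \<le> c"
    and V: "V \<in> borel_measurable (\<F> r)" "\<And>\<omega>. \<omega> \<in> space P \<Longrightarrow> \<bar>V \<omega>\<bar> \<le> b"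
  shows "ennreal (\<integral>\<omega>. V \<omega> * (\<Sum>i\<in>I. Y i \<omega> * (M r' (B i) \<omega> - M r (B i) \<omega>))\<^sup>2 \<partial>P)
    \<le> (\<integral>\<^sup>+\<omega>. ennreal \<bar>V \<omega>\<bar> * cross_energy K r r' (\<lambda>s y. \<Sum>i\<in>I. Y i \<omega> * indicator (B i) y) \<partial>P)"
proof -
  define D where "D = (\<lambda>i \<omega>. M r' (B i) \<omega> - M r (B i) \<omega>)"
  define \<kappa> where "\<kappa> = (\<lambda>i j. measure K ({r<..r'} \<times> B i \<times> B j))"
  define Z where "Z = (\<lambda>i j \<omega>. V \<omega> * Y i \<omega> * Y j \<omega>)"
  have Zm: "Z i j \<in> borel_measurable (\<F> r)" if "i \<in> I" "j \<in> I" for i j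
    unfolding Z_def using Y(1) that V(1) by (intro borel_measurable_times) auto
  have Zb: "\<bar>Z i j \<omega>\<bar> \<le> b * c * c" if "i \<in> I" "j \<in> I" "\<omega> \<in> space P" for i j \<omega>
    unfolding Z_def abs_mult using that Y(2)[of i \<omega>] Y(2)[of j \<omega>] V(2)[of \<omega>]
    by (intro mult_mono) auto
  have Zi: "integrable P (\<lambda>\<omega>. \<bar>Z i j \<omega>\<bar> * \<kappa> i j)" if "i \<in> I" "j \<in> I" for i j
    using Zb[OF that] measurable_P[OF Zm[OF that] r(1)]
    by (intro integrable_mult_left integrable_abs integrable_const_bound[where B = "b * c * c"]) auto
  have cov: "integrable P (\<lambda>\<omega>. Z i j \<omega> * (D i \<omega> * D j \<omega>))"
      "(\<integral>\<omega>. Z i j \<omega> * (D i \<omega> * D j \<omega>) \<partial>P) \<le> (\<integral>\<omega>. \<bar>Z i j \<omega>\<bar> \<partial>P) * \<kappa> i j" if "i \<in> I" "j \<in> I" for i j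
    unfolding D_def \<kappa>_def using increment_covariation[OF B[OF that(1)] B[OF that(2)] r Zm[OF that] Zb[OF that]] by auto
  have eq: "V \<omega> * (\<Sum>i\<in>I. Y i \<omega> * D i \<omega>)\<^sup>2 = (\<Sum>i\<in>I. \<Sum>j\<in>I. Z i j \<omega> * (D i \<omega> * D j \<omega>))" for \<omega>
    by (simp add: power2_eq_square sum_product sum_distrib_left Z_def mult_ac)
  have "(\<integral>\<omega>. V \<omega> * (\<Sum>i\<in>I. Y i \<omega> * D i \<omega>)\<^sup>2 \<partial>P) = (\<Sum>i\<in>I. \<Sum>j\<in>I. \<integral>\<omega>. Z i j \<omega> * (D i \<omega> * D j \<omega>) \<partial>P)"
    unfolding eq using cov(1) by (simp add: Bochner_Integration.integral_sum Bochner_Integration.integrable_sum)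
  also have "\<dots> \<le> (\<Sum>i\<in>I. \<Sum>j\<in>I. (\<integral>\<omega>. \<bar>Z i j \<omega>\<bar> \<partial>P) * \<kappa> i j)"
    by (intro sum_mono cov(2))
  also have "\<dots> = (\<integral>\<omega>. (\<Sum>i\<in>I. \<Sum>j\<in>I. \<bar>Z i j \<omega>\<bar> * \<kappa> i j) \<partial>P)"
    using Zi by (simp add: Bochner_Integration.integral_sum Bochner_Integration.integrable_sum)
  finally have "ennreal (\<integral>\<omega>. V \<omega> * (\<Sum>i\<in>I. Y i \<omega> * D i \<omega>)\<^sup>2 \<partial>P) \<le> ennreal (\<integral>\<omega>. (\<Sum>i\<in>I. \<Sum>j\<in>I. \<bar>Z i j \<omega>\<bar> * \<kappa> i j) \<partial>P)"
    by (rule ennreal_leI)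
  also have "\<dots> = (\<integral>\<^sup>+\<omega>. ennreal (\<Sum>i\<in>I. \<Sum>j\<in>I. \<bar>Z i j \<omega>\<bar> * \<kappa> i j) \<partial>P)"
    using Zi by (intro nn_integral_eq_integral[symmetric] Bochner_Integration.integrable_sum AE_I2 sum_nonneg) (auto simp: \<kappa>_def)
  also have "\<dots> \<le> (\<integral>\<^sup>+\<omega>. ennreal \<bar>V \<omega>\<bar> * cross_energy K r r' (\<lambda>s y. \<Sum>i\<in>I. Y i \<omega> * indicator (B i) y) \<partial>P)"
  proof (rule nn_integral_mono)
    fix \<omega>
    let ?G = "\<lambda>y. \<Sum>i\<in>I. Y i \<omega> * indicator (B i) y"
    have absG: "\<bar>?G y\<bar> = (\<Sum>i\<in>I. \<bar>Y i \<omega>\<bar> * indicator (B i) y)" for y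
    proof (cases "\<exists>i\<in>I. y \<in> B i")
      case True
      then obtain i where i: "i \<in> I" "y \<in> B i" by blast
      have "y \<notin> B j" if "j \<in> I - {i}" for j using i that disj by (auto simp: disjoint_family_on_def)
      then have "(\<Sum>j\<in>I. H j * indicator (B j) y) = H i" for H :: "_ \<Rightarrow> real"
        using i fin by (subst sum.remove[of I i]) (auto intro!: sum.neutral)
      then show ?thesis by simp
    next
      case False
      then have "(\<Sum>j\<in>I. H j * indicator (B j) y) = 0" for H :: "_ \<Rightarrow> real"
        by (intro sum.neutral) auto
      then show ?thesis by simp
    qed
    have "cross_energy K r r' (\<lambda>s. ?G) = (\<integral>\<^sup>+w. (\<Sum>i\<in>I. \<Sum>j\<in>I. ennreal (\<bar>Y i \<omega>\<bar> * \<bar>Y j \<omega>\<bar>) * indicator ({r<..r'} \<times> B i \<times> B j) w) \<partial>K)"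
      unfolding cross_energy_def
    proof (rule nn_integral_cong)
      fix w :: "real \<times> 'e \<times> 'e"
      obtain s y z where w: "w = (s, y, z)" by (cases w)
      have "indicator {r<..r'} s * (\<bar>?G y\<bar> * \<bar>?G z\<bar>) = (\<Sum>i\<in>I. \<Sum>j\<in>I. (\<bar>Y i \<omega>\<bar> * \<bar>Y j \<omega>\<bar>) * indicator ({r<..r'} \<times> B i \<times> B j) w)"
        unfolding absG w unfolding sum_product unfolding sum_distrib_left
        by (intro sum.cong refl) (simp add: indicator_times)
      then have "ennreal (indicator {r<..r'} s * (\<bar>?G y\<bar> * \<bar>?G z\<bar>))
         = (\<Sum>i\<in>I. \<Sum>j\<in>I. ennreal ((\<bar>Y i \<omega>\<bar> * \<bar>Y j \<omega>\<bar>) * indicator ({r<..r'} \<times> B i \<times> B j) w))"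
        by (simp only: sum_ennreal sum_nonneg mult_nonneg_nonneg abs_ge_zero indicator_pos_le)
      also have "\<dots> = (\<Sum>i\<in>I. \<Sum>j\<in>I. ennreal (\<bar>Y i \<omega>\<bar> * \<bar>Y j \<omega>\<bar>) * indicator ({r<..r'} \<times> B i \<times> B j) w)"
        by (intro sum.cong refl) (simp add: ennreal_mult' ennreal_indicator)
      finally show "(case w of (s, y, z) \<Rightarrow> ennreal (indicator {r<..r'} s * (\<bar>?G y\<bar> * \<bar>?G z\<bar>)))
         = (\<Sum>i\<in>I. \<Sum>j\<in>I. ennreal (\<bar>Y i \<omega>\<bar> * \<bar>Y j \<omega>\<bar>) * indicator ({r<..r'} \<times> B i \<times> B j) w)"
        by (simp only: w prod.case)
    qed
    also have "\<dots> = (\<Sum>i\<in>I. \<Sum>j\<in>I. ennreal (\<bar>Y i \<omega>\<bar> * \<bar>Y j \<omega>\<bar>) * emeasure K ({r<..r'} \<times> B i \<times> B j))"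
    proof -
      have [measurable]: "{r<..r'} \<times> B i \<times> B j \<in> sets K" if "i \<in> I" "j \<in> I" for i j
        unfolding sets_K using B that by (intro borel_Times) (auto simp: bounded_borel_sets_def)
      show ?thesis by (simp add: nn_integral_sum nn_integral_cmult)
    qed
    also have "\<dots> = (\<Sum>i\<in>I. \<Sum>j\<in>I. ennreal (\<bar>Y i \<omega>\<bar> * \<bar>Y j \<omega>\<bar>) * ennreal (\<kappa> i j))"
    proof -
      have "emeasure K ({r<..r'} \<times> B i \<times> B j) = ennreal (\<kappa> i j)" if "i \<in> I" "j \<in> I" for i j
        unfolding \<kappa>_def using K_finite[OF B[OF that(1)] B[OF that(2)] r(1), of r']
        by (intro emeasure_eq_ennreal_measure) auto
      then show ?thesis by simp
    qed
    finally have ce: "cross_energy K r r' (\<lambda>s. ?G) = ennreal (\<Sum>i\<in>I. \<Sum>j\<in>I. \<bar>Y i \<omega>\<bar> * \<bar>Y j \<omega>\<bar> * \<kappa> i j)"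
      by (simp add: sum_ennreal[symmetric] sum_nonneg ennreal_mult' \<kappa>_def)
    have "(\<Sum>i\<in>I. \<Sum>j\<in>I. \<bar>Z i j \<omega>\<bar> * \<kappa> i j) = \<bar>V \<omega>\<bar> * (\<Sum>i\<in>I. \<Sum>j\<in>I. \<bar>Y i \<omega>\<bar> * \<bar>Y j \<omega>\<bar> * \<kappa> i j)"
      by (simp add: Z_def abs_mult sum_distrib_left mult_ac)
    then show "ennreal (\<Sum>i\<in>I. \<Sum>j\<in>I. \<bar>Z i j \<omega>\<bar> * \<kappa> i j) \<le> ennreal \<bar>V \<omega>\<bar> * cross_energy K r r' (\<lambda>s. ?G)"
      unfolding ce by (simp add: ennreal_mult')
  qed
  finally show ?thesis by (simp add: D_def)
qed

text \<open>The sets of a simple process may overlap, whereas Walsh's norm involves the absolute value of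
  the whole process; hence the sets are first split into the atoms they generate.\<close>

lemma quadratic_variation_le:
  fixes n :: nat
  assumes A: "\<And>i. i < n \<Longrightarrow> A i \<in> bounded_borel_sets"
    and r: "0 \<le> r" "r \<le> r'"
    and X: "\<And>i. i < n \<Longrightarrow> X i \<in> borel_measurable (\<F> r)" "\<And>i \<omega>. i < n \<Longrightarrow> \<omega> \<in> space P \<Longrightarrow> \<bar>X i \<omega>\<bar> \<le> c"
    and V: "V \<in> borel_measurable (\<F> r)" "\<And>\<omega>. \<omega> \<in> space P \<Longrightarrow> \<bar>V \<omega>\<bar> \<le> b"
  shows "ennreal (\<integral>\<omega>. V \<omega> * (\<Sum>i<n. X i \<omega> * (M r' (A i) \<omega> - M r (A i) \<omega>))\<^sup>2 \<partial>P)
    \<le> (\<integral>\<^sup>+\<omega>. ennreal \<bar>V \<omega>\<bar> * cross_energy K r r' (\<lambda>s y. \<Sum>i<n. X i \<omega> * indicator (A i) y) \<partial>P)"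
proof -
  \<comment> \<open>An atom is labelled by the set of those indices i for which \<open>A i\<close>
    contains it. The empty label is left out: its atom is the complement of the union of the
    \<open>A i\<close>, which is unbounded.\<close>
  define I where "I = Pow {..<n} - {{}}"
  define B where "B = (\<lambda>S. {y. \<forall>i<n. y \<in> A i \<longleftrightarrow> i \<in> S})"
  \<comment> \<open>On an atom the simple function takes the sum of the coefficients of the sets
    containing that atom.\<close>
  define Y where "Y = (\<lambda>S \<omega>. \<Sum>i\<in>S. X i \<omega>)"
  have r': "0 \<le> r'" using r by simp
  have I: "finite I" "\<And>S. S \<in> I \<Longrightarrow> finite S" "\<And>S. S \<in> I \<Longrightarrow> S \<subseteq> {..<n}" "\<And>S. S \<in> I \<Longrightarrow> S \<noteq> {}"
    by (auto simp: I_def intro: finite_subset)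
  have B: "B S \<in> bounded_borel_sets" if "S \<in> I" for S
  proof -
    have "S \<subseteq> {..<n}" "S \<noteq> {}" using I(3,4)[OF that] by auto
    then obtain i where "i \<in> S" "i < n" by fastforce
    have Am: "A i \<in> sets borel" if "i < n" for i using A that by (auto simp: bounded_borel_sets_def)
    have "(\<Inter>i\<in>{..<n}. if i \<in> S then A i else - A i) \<in> sets borel"
      by (rule sets.finite_INT) (use \<open>i < n\<close> in \<open>auto intro!: Am borel_comp\<close>)
    moreover have "B S = (\<Inter>i\<in>{..<n}. if i \<in> S then A i else - A i)" by (auto simp: B_def split: if_splits)
    moreover have "B S \<subseteq> A i" using \<open>i \<in> S\<close> \<open>i < n\<close> by (auto simp: B_def)
    then have "bounded (B S)" using A[OF \<open>i < n\<close>] by (auto simp: bounded_borel_sets_def intro: bounded_subset)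
    ultimately show ?thesis by (simp add: bounded_borel_sets_def)
  qed
  have disj: "disjoint_family_on B J" if "J \<subseteq> I" for J
    unfolding disjoint_family_on_def
  proof (intro ballI impI)
    fix S S' assume "S \<in> J" "S' \<in> J" "S \<noteq> S'"
    then have "S \<subseteq> {..<n}" "S' \<subseteq> {..<n}" using that I(3) by auto
    then show "B S \<inter> B S' = {}" using \<open>S \<noteq> S'\<close> by (auto simp: B_def)
  qed
  have A_eq: "A i = (\<Union>S\<in>{S \<in> I. i \<in> S}. B S)" if "i < n" for i
  proof (intro equalityI subsetI)
    fix y assume y: "y \<in> A i"
    define S where "S = {j. j < n \<and> y \<in> A j}"
    have "S \<in> I" "i \<in> S" "y \<in> B S" using y that by (auto simp: S_def I_def B_def)
    then show "y \<in> (\<Union>S\<in>{S \<in> I. i \<in> S}. B S)" by blast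
  qed (use that in \<open>auto simp: B_def\<close>)
  have Y: "Y S \<in> borel_measurable (\<F> r)" if "S \<in> I" for S
    unfolding Y_def using I(3)[OF that] X(1) by (intro borel_measurable_sum) auto
  have Yb: "\<bar>Y S \<omega>\<bar> \<le> real n * \<bar>c\<bar>" if "S \<in> I" "\<omega> \<in> space P" for S \<omega>
  proof -
    have "\<bar>Y S \<omega>\<bar> \<le> (\<Sum>i\<in>S. \<bar>X i \<omega>\<bar>)" unfolding Y_def by (rule sum_abs)
    also have "\<dots> \<le> (\<Sum>i<n. \<bar>X i \<omega>\<bar>)" using I(3)[OF that(1)] by (intro sum_mono2) auto
    also have "\<dots> \<le> (\<Sum>i<n. \<bar>c\<bar>)" using X(2) that(2) by (intro sum_mono) (force intro: order_trans[OF _ abs_ge_self])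
    finally show ?thesis by simp
  qed
  \<comment> \<open>One interchange of sums for general \<open>H\<close>, used for the indicators
    and for the increments of M.\<close>
  have swap: "(\<Sum>i<n. X i \<omega> * (\<Sum>S | S \<in> I \<and> i \<in> S. H S)) = (\<Sum>S\<in>I. Y S \<omega> * H S)" for H :: "nat set \<Rightarrow> real" and \<omega>
  proof -
    have "(\<Sum>i<n. X i \<omega> * (\<Sum>S | S \<in> I \<and> i \<in> S. H S)) = (\<Sum>i<n. \<Sum>S\<in>I. if i \<in> S then X i \<omega> * H S else 0)"
      using I(1) by (simp add: sum_distrib_left sum.inter_filter[symmetric])
    also have "\<dots> = (\<Sum>S\<in>I. \<Sum>i<n. if i \<in> S then X i \<omega> * H S else 0)" by (rule sum.swap)
    also have "\<dots> = (\<Sum>S\<in>I. Y S \<omega> * H S)"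
    proof (intro sum.cong refl)
      fix S assume "S \<in> I"
      then have "{i \<in> {..<n}. i \<in> S} = S" using I(3) by auto
      then show "(\<Sum>i<n. if i \<in> S then X i \<omega> * H S else 0) = Y S \<omega> * H S"
        by (simp add: Y_def sum_distrib_right sum.inter_filter[symmetric])
    qed
    finally show ?thesis .
  qed
  have ind: "(\<Sum>i<n. X i \<omega> * indicator (A i) y) = (\<Sum>S\<in>I. Y S \<omega> * indicator (B S) y)" for \<omega> y
  proof -
    have "indicator (A i) y = (\<Sum>S | S \<in> I \<and> i \<in> S. indicator (B S) y :: real)" if "i < n" for i
      unfolding A_eq[OF that] using I(1) disj[of "{S \<in> I. i \<in> S}"]
      by (subst indicator_UN_disjoint) auto
    then show ?thesis by (simp add: swap)
  qed
  \<comment> \<open>Additivity of M holds almost surely for each of finitely many sets, hence for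
    all of them at once.\<close>
  have ae: "AE \<omega> in P. \<forall>i\<in>{..<n}. M t (A i) \<omega> = (\<Sum>S | S \<in> I \<and> i \<in> S. M t (B S) \<omega>)" if "0 \<le> t" for t
  proof (intro AE_finite_allI)
    fix i assume "i \<in> {..<n}"
    then have i: "i < n" by simp
    show "AE \<omega> in P. M t (A i) \<omega> = (\<Sum>S | S \<in> I \<and> i \<in> S. M t (B S) \<omega>)"
      unfolding A_eq[OF i]
      by (rule M_disjoint_UN[THEN conjunct2]) (use I(1) B disj that in auto)
  qed auto
  have "AE \<omega> in P. (\<Sum>i<n. X i \<omega> * (M r' (A i) \<omega> - M r (A i) \<omega>)) = (\<Sum>S\<in>I. Y S \<omega> * (M r' (B S) \<omega> - M r (B S) \<omega>))"
    using ae[OF r(1)] ae[OF r']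
  proof eventually_elim
    case (elim \<omega>)
    then have "(\<Sum>i<n. X i \<omega> * (M r' (A i) \<omega> - M r (A i) \<omega>)) = (\<Sum>i<n. X i \<omega> * (\<Sum>S | S \<in> I \<and> i \<in> S. M r' (B S) \<omega> - M r (B S) \<omega>))"
      by (intro sum.cong refl) (simp add: sum_subtractf)
    then show ?case by (simp only: swap)
  qed
  then have "(\<integral>\<omega>. V \<omega> * (\<Sum>i<n. X i \<omega> * (M r' (A i) \<omega> - M r (A i) \<omega>))\<^sup>2 \<partial>P)
      = (\<integral>\<omega>. V \<omega> * (\<Sum>S\<in>I. Y S \<omega> * (M r' (B S) \<omega> - M r (B S) \<omega>))\<^sup>2 \<partial>P)"
    using A B r r' measurable_P[OF X(1) r(1)] measurable_P[OF Y r(1)] measurable_P[OF V(1) r(1)]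
    by (intro integral_cong_AE borel_measurable_times borel_measurable_power borel_measurable_sum borel_measurable_diff M_measurable) auto
  then show ?thesis
    unfolding ind using quadratic_variation_disjoint[OF I(1) B disj[OF order_refl] r Y Yb V] by simp
qed


text \<open>Taylor's formula at \<open>U\<close> with the increment \<Delta> over (r, r']. The
  first-order term has mean zero, because \<open>\<phi>' (U \<omega>) * X i \<omega>\<close> is
  known at time r; the second-order term is bounded through the quadratic variation, and the
  remainder by second and fourth moments of \<Delta>.\<close>

lemma one_step:
  fixes n :: nat
  assumes A: "\<And>i. i < n \<Longrightarrow> A i \<in> bounded_borel_sets"
    and r: "0 \<le> r" "r \<le> r'"
    and X: "\<And>i. i < n \<Longrightarrow> X i \<in> borel_measurable (\<F> r)" "\<And>i \<omega>. i < n \<Longrightarrow> \<omega> \<in> space P \<Longrightarrow> \<bar>X i \<omega>\<bar> \<le> c"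
    and U: "U \<in> borel_measurable (\<F> r)"
    and \<phi> [measurable]: "\<phi> \<in> borel_measurable borel" "\<phi>' \<in> borel_measurable borel" "\<psi> \<in> borel_measurable borel"
    and bd: "\<And>x. 0 \<le> \<phi> x" "\<And>x. \<phi> x \<le> b" "\<And>x. \<bar>\<phi>' x\<bar> \<le> b" "\<And>x. \<bar>\<psi> x\<bar> \<le> b"
    and taylor: "\<And>x h. \<phi> (x + h) \<le> \<phi> x + \<phi>' x * h + \<psi> x * h\<^sup>2 + L * \<bar>h\<bar> ^ 3" and L: "0 \<le> L"
    and \<eta>: "0 < \<eta>" and e: "0 \<le> e2" "0 \<le> e4"
    and E2: "(\<integral>\<^sup>+\<omega>. ennreal ((\<Sum>i<n. X i \<omega> * (M r' (A i) \<omega> - M r (A i) \<omega>))\<^sup>2) \<partial>P) \<le> ennreal e2"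
    and E4: "(\<integral>\<^sup>+\<omega>. ennreal ((\<Sum>i<n. X i \<omega> * (M r' (A i) \<omega> - M r (A i) \<omega>)) ^ 4) \<partial>P) \<le> ennreal e4"
  shows "(\<integral>\<^sup>+\<omega>. ennreal (\<phi> (U \<omega> + (\<Sum>i<n. X i \<omega> * (M r' (A i) \<omega> - M r (A i) \<omega>)))) \<partial>P)
    \<le> (\<integral>\<^sup>+\<omega>. ennreal (\<phi> (U \<omega>)) \<partial>P)
      + (\<integral>\<^sup>+\<omega>. ennreal \<bar>\<psi> (U \<omega>)\<bar> * cross_energy K r r' (\<lambda>s y. \<Sum>i<n. X i \<omega> * indicator (A i) y) \<partial>P)
      + ennreal (L * (\<eta> * e2 + e4 / \<eta>))"
proof -
  define \<Delta> where "\<Delta> = (\<lambda>\<omega>. \<Sum>i<n. X i \<omega> * (M r' (A i) \<omega> - M r (A i) \<omega>))"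
  have r': "0 \<le> r'" using r by simp
  have [measurable]: "U \<in> borel_measurable P" using measurable_P[OF U r(1)] .
  have [measurable]: "\<Delta> \<in> borel_measurable P"
    unfolding \<Delta>_def using A measurable_P[OF X(1) r(1)] r r'
    by (intro borel_measurable_sum borel_measurable_times borel_measurable_diff M_measurable) auto
  have E2': "(\<integral>\<^sup>+\<omega>. ennreal ((\<Delta> \<omega>)\<^sup>2) \<partial>P) \<le> ennreal e2" and E4': "(\<integral>\<^sup>+\<omega>. ennreal ((\<Delta> \<omega>) ^ 4) \<partial>P) \<le> ennreal e4"
    using E2 E4 by (simp_all only: \<Delta>_def)
  have I2: "integrable P (\<lambda>\<omega>. (\<Delta> \<omega>)\<^sup>2)"
  proof (rule integrableI_nonneg)
    show "(\<integral>\<^sup>+\<omega>. ennreal ((\<Delta> \<omega>)\<^sup>2) \<partial>P) < \<infinity>" using E2' by (rule le_less_trans) simp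
  qed auto
  have I4: "integrable P (\<lambda>\<omega>. (\<Delta> \<omega>) ^ 4)"
  proof (rule integrableI_nonneg)
    show "(\<integral>\<^sup>+\<omega>. ennreal ((\<Delta> \<omega>) ^ 4) \<partial>P) < \<infinity>" using E4' by (rule le_less_trans) simp
  qed (auto intro!: AE_I2 zero_le_even_power)
  have i2: "(\<integral>\<omega>. (\<Delta> \<omega>)\<^sup>2 \<partial>P) \<le> e2"
    using E2' e by (subst (asm) nn_integral_eq_integral[OF I2]) auto
  have i4: "(\<integral>\<omega>. (\<Delta> \<omega>) ^ 4 \<partial>P) \<le> e4"
    using E4' e by (subst (asm) nn_integral_eq_integral[OF I4]) (auto intro!: AE_I2 zero_le_even_power)
  have bi: "integrable P (\<lambda>\<omega>. f (U \<omega>))" if [measurable]: "f \<in> borel_measurable borel" and "\<And>x. \<bar>f x\<bar> \<le> b" for f :: "real \<Rightarrow> real"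
    using that(2) by (intro integrable_const_bound[where B = b]) auto
  have \<phi>b: "\<bar>\<phi> x\<bar> \<le> b" for x using bd by auto
  have o: "integrable P (\<lambda>\<omega>. (\<phi>' (U \<omega>) * X i \<omega>) * (M r' (A i) \<omega> - M r (A i) \<omega>))"
      "(\<integral>\<omega>. (\<phi>' (U \<omega>) * X i \<omega>) * (M r' (A i) \<omega> - M r (A i) \<omega>) \<partial>P) = 0" if "i < n" for i
  proof -
    have m: "(\<lambda>\<omega>. \<phi>' (U \<omega>) * X i \<omega>) \<in> borel_measurable (\<F> r)"
      using X(1)[OF that] U by measurable
    have "\<bar>\<phi>' (U \<omega>) * X i \<omega>\<bar> \<le> b * c" if "\<omega> \<in> space P" for \<omega>
      unfolding abs_mult using bd(3)[of "U \<omega>"] X(2)[OF \<open>i < n\<close> that] by (intro mult_mono) auto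
    from increment_orthogonal[OF A[OF that] r m this]
    show "integrable P (\<lambda>\<omega>. (\<phi>' (U \<omega>) * X i \<omega>) * (M r' (A i) \<omega> - M r (A i) \<omega>))"
      "(\<integral>\<omega>. (\<phi>' (U \<omega>) * X i \<omega>) * (M r' (A i) \<omega> - M r (A i) \<omega>) \<partial>P) = 0" by auto
  qed
  have eq1: "\<phi>' (U \<omega>) * \<Delta> \<omega> = (\<Sum>i<n. (\<phi>' (U \<omega>) * X i \<omega>) * (M r' (A i) \<omega> - M r (A i) \<omega>))" for \<omega>
    by (simp add: \<Delta>_def sum_distrib_left mult.assoc)
  have I1: "integrable P (\<lambda>\<omega>. \<phi>' (U \<omega>) * \<Delta> \<omega>)" unfolding eq1 using o(1) by (intro Bochner_Integration.integrable_sum) auto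
  have i1: "(\<integral>\<omega>. \<phi>' (U \<omega>) * \<Delta> \<omega> \<partial>P) = 0" unfolding eq1 using o by (subst Bochner_Integration.integral_sum) auto
  have Ip: "integrable P (\<lambda>\<omega>. \<psi> (U \<omega>) * (\<Delta> \<omega>)\<^sup>2)"
    using I2 bd(4) by (intro bounded_mult_integrable[where c = b]) auto
  have Ie: "integrable P (\<lambda>\<omega>. L * (\<eta> * (\<Delta> \<omega>)\<^sup>2 + (\<Delta> \<omega>) ^ 4 / \<eta>))" using I2 I4 by simp
  \<comment> \<open>The cube lies between square and fourth power. Later \<eta> is the root of the
    mesh, and both terms become small against the length of the interval.\<close>
  have cube: "\<bar>h\<bar> ^ 3 \<le> \<eta> * h\<^sup>2 + h ^ 4 / \<eta>" for h :: real
  proof -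
    have "2 * (\<eta> * \<bar>h\<bar> ^ 3) \<le> \<bar>h\<bar>\<^sup>2 * (\<eta>\<^sup>2 + \<bar>h\<bar>\<^sup>2)"
      using mult_left_mono[OF sum_squares_bound[of \<eta> "\<bar>h\<bar>"], of "\<bar>h\<bar>\<^sup>2"]
      by (simp add: power2_eq_square power3_eq_cube mult_ac)
    moreover have "0 \<le> \<bar>h\<bar>\<^sup>2 * (\<eta>\<^sup>2 + \<bar>h\<bar>\<^sup>2)" by simp
    ultimately have "\<eta> * \<bar>h\<bar> ^ 3 \<le> \<bar>h\<bar>\<^sup>2 * (\<eta>\<^sup>2 + \<bar>h\<bar>\<^sup>2)" by linarith
    also have "\<dots> = \<eta> * (\<eta> * h\<^sup>2 + h ^ 4 / \<eta>)"
      using \<eta> by (simp add: field_simps power2_eq_square power4_eq_xxxx)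
    finally show ?thesis using \<eta> by simp
  qed
  have "(\<integral>\<omega>. \<phi> (U \<omega> + \<Delta> \<omega>) \<partial>P) \<le> (\<integral>\<omega>. \<phi> (U \<omega>) + \<phi>' (U \<omega>) * \<Delta> \<omega> + \<psi> (U \<omega>) * (\<Delta> \<omega>)\<^sup>2 + L * (\<eta> * (\<Delta> \<omega>)\<^sup>2 + (\<Delta> \<omega>) ^ 4 / \<eta>) \<partial>P)"
  proof (rule integral_mono)
    show "integrable P (\<lambda>\<omega>. \<phi> (U \<omega> + \<Delta> \<omega>))"
      using \<phi>b by (intro integrable_const_bound[where B = b]) auto
    show "integrable P (\<lambda>\<omega>. \<phi> (U \<omega>) + \<phi>' (U \<omega>) * \<Delta> \<omega> + \<psi> (U \<omega>) * (\<Delta> \<omega>)\<^sup>2 + L * (\<eta> * (\<Delta> \<omega>)\<^sup>2 + (\<Delta> \<omega>) ^ 4 / \<eta>))"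
      by (intro Bochner_Integration.integrable_add bi \<phi> \<phi>b I1 Ip Ie)
    fix \<omega>
    show "\<phi> (U \<omega> + \<Delta> \<omega>) \<le> \<phi> (U \<omega>) + \<phi>' (U \<omega>) * \<Delta> \<omega> + \<psi> (U \<omega>) * (\<Delta> \<omega>)\<^sup>2 + L * (\<eta> * (\<Delta> \<omega>)\<^sup>2 + (\<Delta> \<omega>) ^ 4 / \<eta>)"
      using taylor[of "U \<omega>" "\<Delta> \<omega>"] mult_left_mono[OF cube[of "\<Delta> \<omega>"] L] by linarith
  qed
  also have "\<dots> = (\<integral>\<omega>. \<phi> (U \<omega>) \<partial>P) + (\<integral>\<omega>. \<psi> (U \<omega>) * (\<Delta> \<omega>)\<^sup>2 \<partial>P) + L * (\<eta> * (\<integral>\<omega>. (\<Delta> \<omega>)\<^sup>2 \<partial>P) + (\<integral>\<omega>. (\<Delta> \<omega>) ^ 4 \<partial>P) / \<eta>)"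
    using bi[OF \<phi>(1) \<phi>b] I1 Ip Ie I2 I4 i1 by simp
  \<comment> \<open>\<psi> has no fixed sign, while the quadratic variation is estimated in
    \<open>ennreal\<close>, where negative numbers become 0; the maximum makes the two readings
    agree.\<close>
  also have "\<dots> \<le> (\<integral>\<omega>. \<phi> (U \<omega>) \<partial>P) + max 0 (\<integral>\<omega>. \<psi> (U \<omega>) * (\<Delta> \<omega>)\<^sup>2 \<partial>P) + L * (\<eta> * e2 + e4 / \<eta>)"
    using i2 i4 L \<eta> by (intro add_mono mult_left_mono divide_right_mono) auto
  finally have *: "(\<integral>\<omega>. \<phi> (U \<omega> + \<Delta> \<omega>) \<partial>P) \<le> (\<integral>\<omega>. \<phi> (U \<omega>) \<partial>P) + max 0 (\<integral>\<omega>. \<psi> (U \<omega>) * (\<Delta> \<omega>)\<^sup>2 \<partial>P) + L * (\<eta> * e2 + e4 / \<eta>)" .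
  have "(\<integral>\<^sup>+\<omega>. ennreal (\<phi> (U \<omega> + \<Delta> \<omega>)) \<partial>P) = ennreal (\<integral>\<omega>. \<phi> (U \<omega> + \<Delta> \<omega>) \<partial>P)"
    using \<phi>b bd(1) by (intro nn_integral_eq_integral integrable_const_bound[where B = b]) auto
  also have "\<dots> \<le> ennreal ((\<integral>\<omega>. \<phi> (U \<omega>) \<partial>P) + max 0 (\<integral>\<omega>. \<psi> (U \<omega>) * (\<Delta> \<omega>)\<^sup>2 \<partial>P) + L * (\<eta> * e2 + e4 / \<eta>))"
    using * by (rule ennreal_leI)
  also have "\<dots> = ennreal (\<integral>\<omega>. \<phi> (U \<omega>) \<partial>P) + ennreal (\<integral>\<omega>. \<psi> (U \<omega>) * (\<Delta> \<omega>)\<^sup>2 \<partial>P) + ennreal (L * (\<eta> * e2 + e4 / \<eta>))"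
    using bd(1) L \<eta> e by (subst ennreal_plus ennreal_plus | simp)+
  also have "ennreal (\<integral>\<omega>. \<phi> (U \<omega>) \<partial>P) = (\<integral>\<^sup>+\<omega>. ennreal (\<phi> (U \<omega>)) \<partial>P)"
    using bi[OF \<phi>(1) \<phi>b] bd(1) by (intro nn_integral_eq_integral[symmetric]) auto
  also have "ennreal (\<integral>\<omega>. \<psi> (U \<omega>) * (\<Delta> \<omega>)\<^sup>2 \<partial>P)
     \<le> (\<integral>\<^sup>+\<omega>. ennreal \<bar>\<psi> (U \<omega>)\<bar> * cross_energy K r r' (\<lambda>s y. \<Sum>i<n. X i \<omega> * indicator (A i) y) \<partial>P)"
  proof -
    have "(\<lambda>\<omega>. \<psi> (U \<omega>)) \<in> borel_measurable (\<F> r)" using U by measurable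
    from quadratic_variation_le[OF A r X this bd(4)] show ?thesis unfolding \<Delta>_def .
  qed
  finally show ?thesis unfolding \<Delta>_def by (simp add: add_mono)
qed

end

section \<open>From short intervals to arbitrary ones\<close>

lemma partition_induction:
  fixes G :: "real \<Rightarrow> ennreal" and \<Psi> :: "real \<Rightarrow> real \<Rightarrow> ennreal"
  assumes S: "finite S"
    and step: "\<And>r r'. 0 \<le> r \<Longrightarrow> r < r' \<Longrightarrow> r' \<le> t \<Longrightarrow> {r<..<r'} \<inter> S = {} \<Longrightarrow> G r' \<le> G r + \<Psi> r r'"
    and add: "\<And>r q r'. 0 \<le> r \<Longrightarrow> r \<le> q \<Longrightarrow> q \<le> r' \<Longrightarrow> r' \<le> t \<Longrightarrow> \<Psi> r q + \<Psi> q r' \<le> \<Psi> r r'"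
    and r: "0 \<le> r" "r \<le> r'" "r' \<le> t"
  shows "G r' \<le> G r + \<Psi> r r'"
  using r
\<comment> \<open>Induction on the number of points of \<open>S\<close> inside the interval: any
  such point splits it into two intervals with fewer points, and superadditivity of \<Psi> joins the
  two bounds.\<close>
proof (induction "card ({r<..<r'} \<inter> S)" arbitrary: r r' rule: less_induct)
  case less
  show ?case
  proof (cases "r = r'")
    case False
    then have rr: "r < r'" using less.prems by simp
    show ?thesis
    proof (cases "{r<..<r'} \<inter> S = {}")
      case True
      then show ?thesis using step less.prems rr by blast
    next
      case False
      then obtain q where q: "r < q" "q < r'" "q \<in> S" by auto
      have "card ({r<..<q} \<inter> S) < card ({r<..<r'} \<inter> S)" "card ({q<..<r'} \<inter> S) < card ({r<..<r'} \<inter> S)"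
        using q S by (auto intro!: psubset_card_mono)
      then have "G q \<le> G r + \<Psi> r q" "G r' \<le> G q + \<Psi> q r'"
        using less.hyps[of r q] less.hyps[of q r'] less.prems q by auto
      then have "G r' \<le> G r + \<Psi> r q + \<Psi> q r'" by (meson add_right_mono order_trans)
      also have "\<dots> \<le> G r + \<Psi> r r'"
        using add[of r q r'] less.prems q by (simp add: add.assoc add_left_mono)
      finally show ?thesis .
    qed
  qed auto
qed

lemma mesh_point:
  fixes d :: real
  assumes "0 < d" "0 \<le> r" "d < r' - r" "r' \<le> t"
  shows "{r<..<r'} \<inter> (\<lambda>i. real i * d) ` {..nat \<lceil>t / d\<rceil>} \<noteq> {}"
proof -
  \<comment> \<open>The first multiple of \<open>d\<close> beyond \<open>r\<close>. It exceeds
    \<open>r\<close> by at most \<open>d\<close>, which is less than the length of the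
    interval.\<close>
  define i where "i = nat \<lfloor>r / d\<rfloor> + 1"
  have i: "real i = of_int \<lfloor>r / d\<rfloor> + 1" using assms by (simp add: i_def)
  have "r / d < real i" "real i \<le> r / d + 1" unfolding i by linarith+
  then have 1: "r < real i * d" "real i * d \<le> r + d" using assms by (simp_all add: field_simps)
  then have 2: "real i * d < r'" using assms by linarith
  then have "real i \<le> t / d" using assms by (simp add: field_simps)
  then have "i \<le> nat \<lceil>t / d\<rceil>" by linarith
  then show ?thesis using 1 2 by auto
qed

lemma measurable_curried2:
  assumes "(\<lambda>(s, y). f s y) \<in> borel_measurable (borel :: ('a::second_countable_topology \<times> 'b::second_countable_topology) measure)"
    and [measurable]: "p \<in> borel_measurable N" "q \<in> borel_measurable N"
  shows "(\<lambda>w. f (p w) (q w)) \<in> borel_measurable N"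
proof -
  have "(\<lambda>(s, y). f s y) \<in> borel_measurable (borel \<Otimes>\<^sub>M borel)"
    using assms(1) by (simp only: borel_prod)
  from measurable_compose[OF _ this, of "\<lambda>w. (p w, q w)" N] show ?thesis by simp
qed

lemma measurable_curried3:
  assumes "(\<lambda>(s, y, \<omega>). f s y \<omega>) \<in> borel_measurable (M1 \<Otimes>\<^sub>M (M2 \<Otimes>\<^sub>M M3))"
    and [measurable]: "p \<in> measurable N M1" "q \<in> measurable N M2" "o' \<in> measurable N M3"
  shows "(\<lambda>w. f (p w) (q w) (o' w)) \<in> borel_measurable N"
  using measurable_compose[OF _ assms(1), of "\<lambda>w. (p w, q w, o' w)" N] by simp

section \<open>Moments of Walsh integrals\<close>

lemma cross_energy_split:
  assumes K: "sets K = sets (borel :: (real \<times> 'e::euclidean_space \<times> 'e) measure)"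
    and [measurable]: "(\<lambda>(s, y). f s y) \<in> borel_measurable (borel :: (real \<times> 'e) measure)"
    and r: "r \<le> q" "q \<le> r'"
  shows "cross_energy K r q f + cross_energy K q r' f = cross_energy K r r' f"
proof -
  note m = measurable_curried2[OF assms(2)]
  have [measurable]: "(\<lambda>(s, y, z). ennreal (indicator {a<..b} s * (\<bar>f s y\<bar> * \<bar>f s z\<bar>))) \<in> borel_measurable K" for a b
    unfolding measurable_cong_sets[OF K refl] borel_prod[symmetric] split_beta'
    by (intro measurable_compose[OF _ measurable_ennreal] borel_measurable_times borel_measurable_abs m) measurable
  show ?thesis
    unfolding cross_energy_def
  proof (subst nn_integral_add[symmetric])
    show "(\<integral>\<^sup>+w. (case w of (s, y, z) \<Rightarrow> ennreal (indicator {r<..q} s * (\<bar>f s y\<bar> * \<bar>f s z\<bar>)))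
        + (case w of (s, y, z) \<Rightarrow> ennreal (indicator {q<..r'} s * (\<bar>f s y\<bar> * \<bar>f s z\<bar>))) \<partial>K)
      = (\<integral>\<^sup>+(s, y, z). ennreal (indicator {r<..r'} s * (\<bar>f s y\<bar> * \<bar>f s z\<bar>)) \<partial>K)"
      using r by (intro nn_integral_cong) (auto simp: indicator_def)
  qed measurable
qed

lemma cross_energy_mono:
  assumes "0 \<le> r" "r' \<le> t"
  shows "cross_energy K r r' f \<le> cross_energy K 0 t f"
  unfolding cross_energy_def using assms
  by (intro nn_integral_mono) (auto simp: indicator_def intro!: ennreal_leI split: prod.splits)

lemma simple_integral_nth:
  "simple_integral M t g \<omega> = (\<Sum>i<length g. case g ! i of (X, a, b, A) \<Rightarrow> X \<omega> * (M (min t b) A \<omega> - M (min t a) A \<omega>))"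
  unfolding simple_integral_def by (simp add: sum_list_sum_nth atLeast0LessThan)

lemma simple_eval_nth:
  "simple_eval g s y \<omega> = (\<Sum>i<length g. case g ! i of (X, a, b, A) \<Rightarrow> X \<omega> * indicator {a<..b} s * indicator A y)"
  unfolding simple_eval_def by (simp add: sum_list_sum_nth atLeast0LessThan)

context fourth_moment_martingale_measure
begin

lemma simple_process_nth:
  assumes "simple_process \<F> g"
  obtains X a b A c where
    "\<And>i. i < length g \<Longrightarrow> g ! i = (X i, a i, b i, A i)"
    "\<And>i. i < length g \<Longrightarrow> 0 \<le> a i" "\<And>i. i < length g \<Longrightarrow> a i \<le> b i"
    "\<And>i. i < length g \<Longrightarrow> X i \<in> borel_measurable (\<F> (a i))"
    "\<And>i. i < length g \<Longrightarrow> A i \<in> bounded_borel_sets"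
    "\<And>i \<omega>. i < length g \<Longrightarrow> \<omega> \<in> space P \<Longrightarrow> \<bar>X i \<omega>\<bar> \<le> c" "0 \<le> c"
proof -
  define X where "X = (\<lambda>i. fst (g ! i))"
  define a where "a = (\<lambda>i. fst (snd (g ! i)))"
  define b where "b = (\<lambda>i. fst (snd (snd (g ! i))))"
  define A where "A = (\<lambda>i. snd (snd (snd (g ! i))))"
  have g: "g ! i = (X i, a i, b i, A i)" for i by (simp add: X_def a_def b_def A_def)
  have sp: "0 \<le> a i \<and> a i \<le> b i \<and> X i \<in> borel_measurable (\<F> (a i)) \<and>
     (\<exists>c. \<forall>\<omega>\<in>space (\<F> (a i)). \<bar>X i \<omega>\<bar> \<le> c) \<and> A i \<in> bounded_borel_sets" if "i < length g" for i
  proof -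
    have "(X i, a i, b i, A i) \<in> set g" using nth_mem[OF that] by (simp add: g)
    then show ?thesis using assms unfolding simple_process_def by fastforce
  qed
  have "\<forall>i. \<exists>c. i < length g \<longrightarrow> (\<forall>\<omega>\<in>space P. \<bar>X i \<omega>\<bar> \<le> c)"
    using sp space_F by metis
  then obtain c where c: "\<And>i \<omega>. i < length g \<Longrightarrow> \<omega> \<in> space P \<Longrightarrow> \<bar>X i \<omega>\<bar> \<le> c i" by metis
  have "\<bar>X i \<omega>\<bar> \<le> (\<Sum>i<length g. \<bar>c i\<bar>)" if "i < length g" "\<omega> \<in> space P" for i \<omega>
  proof -
    have "\<bar>X i \<omega>\<bar> \<le> \<bar>c i\<bar>" using c[OF that] by linarith
    also have "\<dots> \<le> (\<Sum>i<length g. \<bar>c i\<bar>)" using that by (intro member_le_sum) auto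
    finally show ?thesis .
  qed
  then show ?thesis
    by (intro that[of X a b A "\<Sum>i<length g. \<bar>c i\<bar>"]) (use g sp in \<open>auto intro: sum_nonneg\<close>)
qed

lemma cross_energy_measurable:
  assumes "(\<lambda>(s, y, \<omega>). f s y \<omega>) \<in> borel_measurable (borel \<Otimes>\<^sub>M (borel \<Otimes>\<^sub>M P))"
  shows "(\<lambda>\<omega>. cross_energy K r r' (\<lambda>s y. f s y \<omega>)) \<in> borel_measurable P"
proof -
  note m = measurable_curried3[OF assms]
  interpret K: sigma_finite_measure K by (rule K_facts(2))
  have "(\<lambda>(\<omega>, s, y, z). ennreal (indicator {r<..r'} s * (\<bar>f s y \<omega>\<bar> * \<bar>f s z \<omega>\<bar>))) \<in> borel_measurable (P \<Otimes>\<^sub>M K)"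
    unfolding measurable_cong_sets[OF sets_pair_measure_cong[OF refl sets_K] refl] borel_prod[symmetric] split_beta'
    by (intro measurable_compose[OF _ measurable_ennreal] borel_measurable_times borel_measurable_abs m) measurable
  then show ?thesis
    unfolding cross_energy_def by (intro K.borel_measurable_nn_integral) (simp add: split_beta')
qed

lemma section_measurable:
  fixes f :: "real \<Rightarrow> 'e \<Rightarrow> 'w \<Rightarrow> real"
  assumes "(\<lambda>(s, y, \<omega>). f s y \<omega>) \<in> borel_measurable (borel \<Otimes>\<^sub>M (borel \<Otimes>\<^sub>M P))" and "\<omega> \<in> space P"
  shows "(\<lambda>(s, y). f s y \<omega>) \<in> borel_measurable borel"
proof -
  have "(\<lambda>w. (fst w, snd w, \<omega>)) \<in> measurable (borel \<Otimes>\<^sub>M borel) (borel \<Otimes>\<^sub>M (borel \<Otimes>\<^sub>M P))"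
    using assms(2) by measurable
  from measurable_compose[OF this assms(1)] show ?thesis
    unfolding borel_prod[symmetric] split_beta' by simp
qed

text \<open>Fubini and the pointwise inequality \<open>|\<psi>| a c \<le> \<delta> \<phi> + D (a\<^sup>q + c\<^sup>q)\<close> replace Hoelder's inequality
  for the three factors \<open>\<psi>(U)\<close>, \<open>f(s,y)\<close> and \<open>f(s,z)\<close>.\<close>

lemma weighted_energy_le:
  fixes \<phi> \<psi> :: "real \<Rightarrow> real"
  assumes f: "(\<lambda>(s, y, \<omega>). f s y \<omega>) \<in> borel_measurable (borel \<Otimes>\<^sub>M (borel \<Otimes>\<^sub>M P))"
    and V: "(\<lambda>(s, y, \<omega>). V s y \<omega>) \<in> borel_measurable (borel \<Otimes>\<^sub>M (borel \<Otimes>\<^sub>M P))"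
    and h: "(\<lambda>(s, y). h s y) \<in> borel_measurable borel"
    and [measurable]: "U \<in> borel_measurable P" "\<phi> \<in> borel_measurable borel" "\<psi> \<in> borel_measurable borel"
    and fhV: "\<And>s y \<omega>. r < s \<Longrightarrow> s \<le> r' \<Longrightarrow> \<omega> \<in> space P \<Longrightarrow> \<bar>f s y \<omega>\<bar> \<le> h s y * V s y \<omega>"
    and nn: "\<And>s y. 0 \<le> h s y" "\<And>s y \<omega>. 0 \<le> V s y \<omega>" "\<And>x. 0 \<le> \<phi> x" "0 \<le> \<delta>" "0 \<le> D" "0 \<le> \<kappa>"
    and young: "\<And>x a c. 0 \<le> a \<Longrightarrow> 0 \<le> c \<Longrightarrow> \<bar>\<psi> x\<bar> * (a * c) \<le> \<delta> * \<phi> x + D * (a ^ q + c ^ q)"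
    and V\<kappa>: "\<And>s y. r < s \<Longrightarrow> s \<le> r' \<Longrightarrow> (\<integral>\<^sup>+\<omega>. ennreal (V s y \<omega> ^ q) \<partial>P) \<le> ennreal \<kappa>"
    and a: "(\<integral>\<^sup>+\<omega>. ennreal (\<phi> (U \<omega>)) \<partial>P) \<le> a"
  shows "(\<integral>\<^sup>+\<omega>. ennreal \<bar>\<psi> (U \<omega>)\<bar> * cross_energy K r r' (\<lambda>s y. f s y \<omega>) \<partial>P)
    \<le> (ennreal \<delta> * a + ennreal (2 * D * \<kappa>)) * cross_energy K r r' h"
proof -
  interpret K: sigma_finite_measure K by (rule K_facts(2))
  interpret PK: pair_sigma_finite P K ..
  note [measurable] = measurable_curried3[OF f] measurable_curried3[OF V] measurable_curried2[OF h]
  define F where "F = (\<lambda>\<omega> (s, y, z). ennreal \<bar>\<psi> (U \<omega>)\<bar> * ennreal (indicator {r<..r'} s * (\<bar>f s y \<omega>\<bar> * \<bar>f s z \<omega>\<bar>)))"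
  have F: "case_prod F \<in> borel_measurable (P \<Otimes>\<^sub>M K)"
    unfolding F_def measurable_cong_sets[OF sets_pair_measure_cong[OF refl sets_K] refl] borel_prod[symmetric] split_beta'
    by measurable
  have G: "(\<lambda>(s, y, z). ennreal (indicator {r<..r'} s * (\<bar>h s y\<bar> * \<bar>h s z\<bar>))) \<in> borel_measurable K"
    unfolding measurable_cong_sets[OF sets_K refl] borel_prod[symmetric] split_beta' by measurable
  have Fw: "(\<lambda>w. ennreal (indicator {r<..r'} (fst w) * (\<bar>f (fst w) (fst (snd w)) \<omega>\<bar> * \<bar>f (fst w) (snd (snd w)) \<omega>\<bar>))) \<in> borel_measurable K"
    if "\<omega> \<in> space P" for \<omega>
    unfolding measurable_cong_sets[OF sets_K refl] borel_prod[symmetric] using that by measurable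
  have "(\<integral>\<^sup>+\<omega>. ennreal \<bar>\<psi> (U \<omega>)\<bar> * cross_energy K r r' (\<lambda>s y. f s y \<omega>) \<partial>P) = (\<integral>\<^sup>+\<omega>. (\<integral>\<^sup>+w. F \<omega> w \<partial>K) \<partial>P)"
    unfolding cross_energy_def F_def split_beta' by (intro nn_integral_cong nn_integral_cmult[symmetric] Fw)
  \<comment> \<open>With the expectation innermost, the moment bound for \<open>V\<close> can be
    applied at each of the points (s, y) and (s, z) separately.\<close>
  also have "\<dots> = (\<integral>\<^sup>+w. (\<integral>\<^sup>+\<omega>. F \<omega> w \<partial>P) \<partial>K)"
    by (rule PK.Fubini'[OF F, symmetric])
  also have "\<dots> \<le> (\<integral>\<^sup>+w. (ennreal \<delta> * a + ennreal (2 * D * \<kappa>)) * (case w of (s, y, z) \<Rightarrow> ennreal (indicator {r<..r'} s * (\<bar>h s y\<bar> * \<bar>h s z\<bar>))) \<partial>K)"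
  proof (rule nn_integral_mono)
    fix w :: "real \<times> 'e \<times> 'e"
    obtain s y z where w: "w = (s, y, z)" by (cases w)
    show "(\<integral>\<^sup>+\<omega>. F \<omega> w \<partial>P) \<le> (ennreal \<delta> * a + ennreal (2 * D * \<kappa>)) * (case w of (s, y, z) \<Rightarrow> ennreal (indicator {r<..r'} s * (\<bar>h s y\<bar> * \<bar>h s z\<bar>)))"
    proof (cases "r < s \<and> s \<le> r'")
      case True
      have "(\<integral>\<^sup>+\<omega>. F \<omega> w \<partial>P) \<le> (\<integral>\<^sup>+\<omega>. ennreal (h s y * h s z) * (ennreal \<delta> * ennreal (\<phi> (U \<omega>)) + ennreal D * (ennreal (V s y \<omega> ^ q) + ennreal (V s z \<omega> ^ q))) \<partial>P)"
      proof (rule nn_integral_mono)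
        fix \<omega> assume \<omega>: "\<omega> \<in> space P"
        have "\<bar>\<psi> (U \<omega>)\<bar> * (\<bar>f s y \<omega>\<bar> * \<bar>f s z \<omega>\<bar>) \<le> \<bar>\<psi> (U \<omega>)\<bar> * ((h s y * V s y \<omega>) * (h s z * V s z \<omega>))"
          using fhV[OF _ _ \<omega>, of s] True nn by (intro mult_left_mono mult_mono) auto
        also have "\<dots> = (h s y * h s z) * (\<bar>\<psi> (U \<omega>)\<bar> * (V s y \<omega> * V s z \<omega>))" by (simp add: mult_ac)
        also have "\<dots> \<le> (h s y * h s z) * (\<delta> * \<phi> (U \<omega>) + D * (V s y \<omega> ^ q + V s z \<omega> ^ q))"
          using nn by (intro mult_left_mono young) auto
        finally have "ennreal (\<bar>\<psi> (U \<omega>)\<bar> * (\<bar>f s y \<omega>\<bar> * \<bar>f s z \<omega>\<bar>)) \<le> ennreal ((h s y * h s z) * (\<delta> * \<phi> (U \<omega>) + D * (V s y \<omega> ^ q + V s z \<omega> ^ q)))"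
          by (rule ennreal_leI)
        then show "F \<omega> w \<le> ennreal (h s y * h s z) * (ennreal \<delta> * ennreal (\<phi> (U \<omega>)) + ennreal D * (ennreal (V s y \<omega> ^ q) + ennreal (V s z \<omega> ^ q)))"
          using True nn by (simp add: F_def w ennreal_mult' ennreal_plus)
      qed
      also have "\<dots> = ennreal (h s y * h s z) * (ennreal \<delta> * (\<integral>\<^sup>+\<omega>. ennreal (\<phi> (U \<omega>)) \<partial>P) + ennreal D * ((\<integral>\<^sup>+\<omega>. ennreal (V s y \<omega> ^ q) \<partial>P) + (\<integral>\<^sup>+\<omega>. ennreal (V s z \<omega> ^ q) \<partial>P)))"
        by (simp add: nn_integral_cmult nn_integral_add)
      also have "\<dots> \<le> ennreal (h s y * h s z) * (ennreal \<delta> * a + ennreal D * (ennreal \<kappa> + ennreal \<kappa>))"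
        using True by (intro mult_left_mono add_mono a V\<kappa>) auto
      also have "\<dots> = (ennreal \<delta> * a + ennreal (2 * D * \<kappa>)) * (case w of (s, y, z) \<Rightarrow> ennreal (indicator {r<..r'} s * (\<bar>h s y\<bar> * \<bar>h s z\<bar>)))"
      proof -
        have "ennreal D * (ennreal \<kappa> + ennreal \<kappa>) = ennreal (2 * D * \<kappa>)"
          using nn by (simp add: ennreal_plus[symmetric] ennreal_mult'[symmetric] del: ennreal_plus)
        then show ?thesis using True nn by (simp add: w mult.commute)
      qed
      finally show ?thesis .
    next
      case False
      then have "F \<omega> w = 0" for \<omega> by (auto simp: F_def w)
      then show ?thesis by simp
    qed
  qed
  also have "\<dots> = (ennreal \<delta> * a + ennreal (2 * D * \<kappa>)) * cross_energy K r r' h"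
    unfolding cross_energy_def by (rule nn_integral_cmult[OF G])
  finally show ?thesis .
qed

end

text \<open>Half of \<open>a\<close> can be subtracted only if \<open>a\<close> is finite; in the
  application this is due to the boundedness of \<phi>.\<close>

lemma ennreal_absorb_half:
  fixes a R :: ennreal
  assumes "a < \<infinity>" "a \<le> ennreal (1 / 2) * a + R"
  shows "a \<le> 2 * R"
proof (cases R)
  case (real r)
  obtain x where x: "a = ennreal x" "0 \<le> x" using assms(1) by (cases a) auto
  have "ennreal (1 / 2) * ennreal x = ennreal (1 / 2 * x)" by (rule ennreal_mult'[symmetric]) simp
  then have "ennreal (1 / 2) * a + R = ennreal (1 / 2 * x + r)"
    using real x by (simp only: ennreal_plus)
  with assms(2) x(1) have "ennreal x \<le> ennreal (1 / 2 * x + r)" by simp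
  then have "x \<le> 2 * r" using real x by (subst (asm) ennreal_le_iff) auto
  then have "ennreal x \<le> ennreal (2 * r)" by (rule ennreal_leI)
  then show ?thesis using real x by (simp add: ennreal_mult')
qed (simp add: ennreal_mult_top)

context fourth_moment_martingale_measure
begin

lemma simple_integral_adapted:
  assumes g: "simple_process \<F> g" and r: "0 \<le> r"
  shows "simple_integral M r g \<in> borel_measurable (\<F> r)"
proof -
  obtain X a b A c where g_nth: "\<And>i. i < length g \<Longrightarrow> g ! i = (X i, a i, b i, A i)"
    and ab: "\<And>i. i < length g \<Longrightarrow> 0 \<le> a i" "\<And>i. i < length g \<Longrightarrow> a i \<le> b i"
    and X: "\<And>i. i < length g \<Longrightarrow> X i \<in> borel_measurable (\<F> (a i))"
    and A: "\<And>i. i < length g \<Longrightarrow> A i \<in> bounded_borel_sets"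
    by (rule simple_process_nth[OF g], rule that)
  have "(\<lambda>\<omega>. X i \<omega> * (M (min r (b i)) (A i) \<omega> - M (min r (a i)) (A i) \<omega>)) \<in> borel_measurable (\<F> r)" if i: "i < length g" for i
  proof (cases "a i \<le> r")
    case True
    have "M s (A i) \<in> borel_measurable (\<F> r)" if "0 \<le> s" "s \<le> r" for s
      using measurable_mono[OF M_adapted[OF A[OF i] that(1)] that(2)] .
    moreover have "X i \<in> borel_measurable (\<F> r)" using measurable_mono[OF X[OF i] True] .
    moreover have "0 \<le> b i" using ab[OF i] by simp
    ultimately show ?thesis using ab[OF i] r by (intro borel_measurable_times borel_measurable_diff) auto
  next
    \<comment> \<open>The interval of this term begins after \<open>r\<close>: both of its endpoints
      are stopped at \<open>r\<close>, and \<open>X i\<close>, not yet known at that time, drops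
      out.\<close>
    case False
    then have "min r (b i) = min r (a i)" using ab[OF i] by auto
    then show ?thesis by simp
  qed
  then have "(\<lambda>\<omega>. \<Sum>i<length g. X i \<omega> * (M (min r (b i)) (A i) \<omega> - M (min r (a i)) (A i) \<omega>)) \<in> borel_measurable (\<F> r)"
    by (intro borel_measurable_sum) auto
  moreover have "simple_integral M r g = (\<lambda>\<omega>. \<Sum>i<length g. X i \<omega> * (M (min r (b i)) (A i) \<omega> - M (min r (a i)) (A i) \<omega>))"
    by (intro ext) (simp add: simple_integral_nth g_nth)
  ultimately show ?thesis by simp
qed

lemma simple_eval_measurable:
  assumes g: "simple_process \<F> g"
  shows "(\<lambda>(s, y, \<omega>). simple_eval g s y \<omega>) \<in> borel_measurable (borel \<Otimes>\<^sub>M (borel \<Otimes>\<^sub>M P))"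
proof -
  obtain X a b A c where g_nth: "\<And>i. i < length g \<Longrightarrow> g ! i = (X i, a i, b i, A i)"
    and ab: "\<And>i. i < length g \<Longrightarrow> 0 \<le> a i"
    and X: "\<And>i. i < length g \<Longrightarrow> X i \<in> borel_measurable (\<F> (a i))"
    and A: "\<And>i. i < length g \<Longrightarrow> A i \<in> bounded_borel_sets"
    by (rule simple_process_nth[OF g], rule that)
  have "(\<lambda>(s, y, \<omega>). X i \<omega> * indicator {a i<..b i} s * indicator (A i) y) \<in> borel_measurable (borel \<Otimes>\<^sub>M (borel \<Otimes>\<^sub>M P))"
    if i: "i < length g" for i
  proof -
    have [measurable]: "X i \<in> borel_measurable P" using measurable_P[OF X[OF i] ab[OF i]] .
    have [measurable]: "A i \<in> sets borel" using A[OF i] by (simp add: bounded_borel_sets_def)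
    show ?thesis unfolding split_beta' by measurable
  qed
  then have "(\<lambda>w. \<Sum>i<length g. case w of (s, y, \<omega>) \<Rightarrow> X i \<omega> * indicator {a i<..b i} s * indicator (A i) y) \<in> borel_measurable (borel \<Otimes>\<^sub>M (borel \<Otimes>\<^sub>M P))"
    by (intro borel_measurable_sum) auto
  moreover have "(\<lambda>(s, y, \<omega>). simple_eval g s y \<omega>) = (\<lambda>w. \<Sum>i<length g. case w of (s, y, \<omega>) \<Rightarrow> X i \<omega> * indicator {a i<..b i} s * indicator (A i) y)"
    by (auto simp: fun_eq_iff simple_eval_nth g_nth)
  ultimately show ?thesis by simp
qed

text \<open>An Ito formula in mean. The energy of the simple process is at most twice that of
  \<open>f\<close> plus twice that of the error. The error is weighted with |\<psi>| <= b, which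
  leaves a multiple of Walsh's norm. For \<open>f\<close>, Young's inequality produces \<delta>
  times the supremum \<open>a\<close> of E \<phi>(I r) over r <= t. As 4 \<delta> B <= 1, this
  contribution is at most half of \<open>a\<close>, and its absorption doubles the other
  terms.\<close>

lemma simple_integral_moment:
  fixes \<phi> \<phi>' \<psi> :: "real \<Rightarrow> real" and f V :: "real \<Rightarrow> 'e \<Rightarrow> 'w \<Rightarrow> real"
  assumes g: "simple_process \<F> g" and t: "0 \<le> t"
    and f: "(\<lambda>(s, y, \<omega>). f s y \<omega>) \<in> borel_measurable (borel \<Otimes>\<^sub>M (borel \<Otimes>\<^sub>M P))"
    and V: "(\<lambda>(s, y, \<omega>). V s y \<omega>) \<in> borel_measurable (borel \<Otimes>\<^sub>M (borel \<Otimes>\<^sub>M P))"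
    and h: "(\<lambda>(s, y). h s y) \<in> borel_measurable borel"
    and fhV: "\<And>s y \<omega>. 0 < s \<Longrightarrow> s \<le> t \<Longrightarrow> \<omega> \<in> space P \<Longrightarrow> \<bar>f s y \<omega>\<bar> \<le> h s y * V s y \<omega>"
    and hV: "\<And>s y. 0 \<le> h s y" "\<And>s y \<omega>. 0 \<le> V s y \<omega>"
    and V\<kappa>: "\<And>s y. 0 < s \<Longrightarrow> s \<le> t \<Longrightarrow> (\<integral>\<^sup>+\<omega>. ennreal (V s y \<omega> ^ q) \<partial>P) \<le> ennreal \<kappa>" and \<kappa>: "0 \<le> \<kappa>"
    and B: "cross_energy K 0 t h \<le> ennreal B" "0 \<le> B"
    and \<phi> [measurable]: "\<phi> \<in> borel_measurable borel" "\<phi>' \<in> borel_measurable borel" "\<psi> \<in> borel_measurable borel"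
    and bd: "\<And>x. 0 \<le> \<phi> x" "\<And>x. \<phi> x \<le> b" "\<And>x. \<bar>\<phi>' x\<bar> \<le> b" "\<And>x. \<bar>\<psi> x\<bar> \<le> b" and \<phi>0: "\<phi> 0 = 0"
    and taylor: "\<And>x h. \<phi> (x + h) \<le> \<phi> x + \<phi>' x * h + \<psi> x * h\<^sup>2 + L * \<bar>h\<bar> ^ 3" and L: "0 \<le> L"
    and young: "\<And>x a c. 0 \<le> a \<Longrightarrow> 0 \<le> c \<Longrightarrow> \<bar>\<psi> x\<bar> * (a * c) \<le> \<delta> * \<phi> x + D * (a ^ q + c ^ q)"
    and \<delta>: "0 \<le> \<delta>" "0 \<le> D" "4 * \<delta> * B \<le> 1"
  shows "(\<integral>\<^sup>+\<omega>. ennreal (\<phi> (simple_integral M t g \<omega>)) \<partial>P)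
    \<le> ennreal (8 * D * \<kappa> * B) + ennreal (4 * b) * walsh_norm_sq P (\<lambda>_. K) t (\<lambda>s y \<omega>. simple_eval g s y \<omega> - f s y \<omega>)"
proof -
  have b: "0 \<le> b" using bd(1,2)[of 0] by linarith
  obtain X \<alpha> \<gamma> A c where g_nth: "\<And>i. i < length g \<Longrightarrow> g ! i = (X i, \<alpha> i, \<gamma> i, A i)"
    and ab: "\<And>i. i < length g \<Longrightarrow> 0 \<le> \<alpha> i" "\<And>i. i < length g \<Longrightarrow> \<alpha> i \<le> \<gamma> i"
    and X: "\<And>i. i < length g \<Longrightarrow> X i \<in> borel_measurable (\<F> (\<alpha> i))"
    and A: "\<And>i. i < length g \<Longrightarrow> A i \<in> bounded_borel_sets"
    and Xc: "\<And>i \<omega>. i < length g \<Longrightarrow> \<omega> \<in> space P \<Longrightarrow> \<bar>X i \<omega>\<bar> \<le> c" and c: "0 \<le> c"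
    by (rule simple_process_nth[OF g], rule that)
  define n where "n = length g"
  define I where "I = (\<lambda>r. simple_integral M r g)"
  define E where "E = (\<lambda>s y \<omega>. simple_eval g s y \<omega>)"
  define R where "R = (\<lambda>s y \<omega>. simple_eval g s y \<omega> - f s y \<omega>)"
  define w where "w = walsh_norm_sq P (\<lambda>_. K) t R"
  have Em: "(\<lambda>(s, y, \<omega>). E s y \<omega>) \<in> borel_measurable (borel \<Otimes>\<^sub>M (borel \<Otimes>\<^sub>M P))"
    unfolding E_def by (rule simple_eval_measurable[OF g])
  have Rm: "(\<lambda>(s, y, \<omega>). R s y \<omega>) \<in> borel_measurable (borel \<Otimes>\<^sub>M (borel \<Otimes>\<^sub>M P))"
    using borel_measurable_diff[OF Em f] by (simp add: R_def E_def split_beta')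
  have Im: "I r \<in> borel_measurable (\<F> r)" if "0 \<le> r" for r
    unfolding I_def by (rule simple_integral_adapted[OF g that])
  have ImP [measurable]: "I r \<in> borel_measurable P" if "0 \<le> r" for r using measurable_P[OF Im[OF that] that] .
  define G where "G = (\<lambda>r. \<integral>\<^sup>+\<omega>. ennreal (\<phi> (I r \<omega>)) \<partial>P)"
  \<comment> \<open>A supremum over all times, because Young's inequality on an interval starting at
    r brings back E \<phi>(I r) itself.\<close>
  define a where "a = (SUP r\<in>{0..t}. G r)"
  have Gb: "G r \<le> ennreal b" for r
  proof -
    have "G r \<le> (\<integral>\<^sup>+\<omega>. ennreal b \<partial>P)" unfolding G_def by (intro nn_integral_mono ennreal_leI bd)
    then show ?thesis by (simp add: emeasure_space_1)
  qed
  have Ga: "G r \<le> a" if "0 \<le> r" "r \<le> t" for r unfolding a_def using that by (intro SUP_upper) auto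
  have "a \<le> ennreal b" unfolding a_def by (intro SUP_least Gb)
  then have a_fin: "a < \<infinity>" by (rule le_less_trans) simp
  have I0: "I 0 \<omega> = 0" for \<omega>
  proof -
    have "min 0 (\<gamma> i) = min 0 (\<alpha> i)" if "i < length g" for i using ab[OF that] by auto
    then show ?thesis by (simp add: I_def simple_integral_nth g_nth)
  qed
  have G0: "G 0 = 0" by (simp add: G_def I0 \<phi>0)
  have An: "A i \<in> bounded_borel_sets" if "i < n" for i using A that by (simp add: n_def)
  obtain C where C: "0 \<le> C" and mom: "\<forall>r r' X. 0 \<le> r \<and> r \<le> r' \<and> (\<forall>i<n. \<forall>\<omega>\<in>space P. \<bar>X i \<omega>\<bar> \<le> c) \<longrightarrow>
     (\<integral>\<^sup>+\<omega>. ennreal ((\<Sum>i<n. X i \<omega> * (M r' (A i) \<omega> - M r (A i) \<omega>))\<^sup>2) \<partial>P) \<le> ennreal (C * (r' - r)) \<and>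
     (\<integral>\<^sup>+\<omega>. ennreal ((\<Sum>i<n. X i \<omega> * (M r' (A i) \<omega> - M r (A i) \<omega>)) ^ 4) \<partial>P) \<le> ennreal (C * (r' - r)\<^sup>2)"
    by (rule exE[OF increment_sum_moments[of n A c]], erule An, rule c, elim conjE, rule that)
  define c1 where "c1 = 2 * (ennreal \<delta> * a + ennreal (2 * D * \<kappa>))"
  define W where "W = (\<lambda>r r'. \<integral>\<^sup>+\<omega>. cross_energy K r r' (\<lambda>s y. R s y \<omega>) \<partial>P)"
  have "a \<le> ennreal (8 * D * \<kappa> * B) + ennreal (4 * b) * w"
  proof (rule ennreal_le_epsilon)
    fix e :: real assume "0 < e"
    \<comment> \<open>The error allowed per unit of time; over the whole of [0, t] it adds up to at
      most e/2.\<close>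
    define e' where "e' = e / (2 * (t + 1))"
    have e': "0 < e'" using \<open>0 < e\<close> t by (simp add: e'_def)
    have e't: "e' * t \<le> e / 2" using \<open>0 < e\<close> t unfolding e'_def by (simp add: field_simps)
    \<comment> \<open>The Taylor remainder will be at most 2 L C \<eta> per unit of time; the
      summand 1 prevents division by zero.\<close>
    define \<eta> where "\<eta> = e' / (2 * (L * C + 1))"
    have LC: "0 \<le> L * C" using L C by simp
    have \<eta>: "0 < \<eta>" unfolding \<eta>_def using e' LC by (intro divide_pos_pos) auto
    have \<eta>e: "2 * (L * C) * \<eta> \<le> e'"
    proof -
      have "2 * (L * C) * \<eta> \<le> 2 * (L * C + 1) * \<eta>" using \<eta> by (intro mult_right_mono) auto
      also have "\<dots> = e'" unfolding \<eta>_def using LC by simp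
      finally show ?thesis .
    qed
    define \<Psi> where "\<Psi> = (\<lambda>r r'. c1 * cross_energy K r r' h + ennreal (2 * b) * W r r' + ennreal (e' * (r' - r)))"
    \<comment> \<open>The endpoints of the simple process, between which each term is either fully
      active or inactive, and a grid of mesh \<open>\<eta>\<^sup>2\<close>, for which
      \<open>(r' - r)\<^sup>2 / \<eta>\<close> is at most \<open>\<eta> * (r' - r)\<close>.\<close>
    define S where "S = \<alpha> ` {..<n} \<union> \<gamma> ` {..<n} \<union> (\<lambda>i. real i * \<eta>\<^sup>2) ` {..nat \<lceil>t / \<eta>\<^sup>2\<rceil>}"
    have main: "G r' \<le> G r + \<Psi> r r'" if "0 \<le> r" "r \<le> r'" "r' \<le> t" for r r'
    proof (rule partition_induction[where S = S and t = t, OF _ _ _ that])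
      show "finite S" by (simp add: S_def)
    next
      fix r q r' :: real assume r: "0 \<le> r" "r \<le> q" "q \<le> r'" "r' \<le> t"
      have x: "cross_energy K r q h + cross_energy K q r' h = cross_energy K r r' h"
        by (rule cross_energy_split[OF sets_K h r(2,3)])
      have y: "W r q + W q r' = W r r'"
      proof -
        have "W r q + W q r' = (\<integral>\<^sup>+\<omega>. cross_energy K r q (\<lambda>s y. R s y \<omega>) + cross_energy K q r' (\<lambda>s y. R s y \<omega>) \<partial>P)"
          unfolding W_def by (intro nn_integral_add[symmetric] cross_energy_measurable Rm)
        also have "\<dots> = W r r'"
          unfolding W_def by (intro nn_integral_cong cross_energy_split[OF sets_K section_measurable[OF Rm] r(2,3)])
        finally show ?thesis .
      qed
      have z: "ennreal (e' * (q - r)) + ennreal (e' * (r' - q)) = ennreal (e' * (r' - r))"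
        using r e' by (simp add: ennreal_plus[symmetric] algebra_simps del: ennreal_plus)
      show "\<Psi> r q + \<Psi> q r' \<le> \<Psi> r r'"
        unfolding \<Psi>_def x[symmetric] y[symmetric] z[symmetric] by (simp add: distrib_left add_ac)
    next
      fix r r' :: real assume r: "0 \<le> r" "r < r'" "r' \<le> t" and S0: "{r<..<r'} \<inter> S = {}"
      then have rr': "r \<le> r'" by simp
      have \<alpha>S: "\<alpha> i \<le> r \<or> r' \<le> \<alpha> i" "\<gamma> i \<le> r \<or> r' \<le> \<gamma> i" if "i < n" for i
      proof -
        have "\<alpha> i \<in> S" "\<gamma> i \<in> S" using that by (auto simp: S_def)
        then have "\<alpha> i \<notin> {r<..<r'}" "\<gamma> i \<notin> {r<..<r'}" using S0 by blast+
        then show "\<alpha> i \<le> r \<or> r' \<le> \<alpha> i" "\<gamma> i \<le> r \<or> r' \<le> \<gamma> i" by auto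
      qed
      have mesh: "r' - r \<le> \<eta>\<^sup>2"
      proof (rule ccontr)
        assume "\<not> r' - r \<le> \<eta>\<^sup>2"
        then have "{r<..<r'} \<inter> (\<lambda>i. real i * \<eta>\<^sup>2) ` {..nat \<lceil>t / \<eta>\<^sup>2\<rceil>} \<noteq> {}"
          using r \<eta> by (intro mesh_point) auto
        then show False using S0 unfolding S_def by blast
      qed
      \<comment> \<open>No endpoint lies strictly inside (r, r'), so a term contributes there either
        the whole increment of M or nothing.\<close>
      define X' where "X' = (\<lambda>i \<omega>. if \<alpha> i \<le> r \<and> r' \<le> \<gamma> i then X i \<omega> else 0)"
      have X'm: "X' i \<in> borel_measurable (\<F> r)" if "i < n" for i
        using measurable_mono[OF X[of i], of r] that by (cases "\<alpha> i \<le> r \<and> r' \<le> \<gamma> i") (auto simp: X'_def n_def)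
      have X'c: "\<bar>X' i \<omega>\<bar> \<le> c" if "i < n" "\<omega> \<in> space P" for i \<omega>
        using Xc[of i \<omega>] that c by (auto simp: X'_def n_def)
      have incr: "X i \<omega> * (M (min r' (\<gamma> i)) (A i) \<omega> - M (min r' (\<alpha> i)) (A i) \<omega>)
          = X i \<omega> * (M (min r (\<gamma> i)) (A i) \<omega> - M (min r (\<alpha> i)) (A i) \<omega>) + X' i \<omega> * (M r' (A i) \<omega> - M r (A i) \<omega>)"
        if i: "i < n" for i \<omega>
      proof -
        have "\<alpha> i \<le> \<gamma> i" using ab(2)[of i] i by (simp add: n_def)
        then consider "\<alpha> i \<le> r" "r' \<le> \<gamma> i" | "\<alpha> i \<le> r" "\<gamma> i \<le> r" | "r' \<le> \<alpha> i" "r' \<le> \<gamma> i"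
          using \<alpha>S[OF i] r by linarith
        then show ?thesis
        proof cases
          case 1
          then have "min r' (\<gamma> i) = r'" "min r' (\<alpha> i) = \<alpha> i" "min r (\<gamma> i) = r" "min r (\<alpha> i) = \<alpha> i" using r by auto
          then show ?thesis using 1 by (simp add: X'_def algebra_simps)
        next
          case 2
          then have "min r' (\<gamma> i) = min r (\<gamma> i)" "min r' (\<alpha> i) = min r (\<alpha> i)" "\<not> r' \<le> \<gamma> i" using r by auto
          then show ?thesis by (simp add: X'_def)
        next
          case 3
          then have "min r' (\<gamma> i) = min r' (\<alpha> i)" "min r (\<gamma> i) = min r (\<alpha> i)" "\<not> \<alpha> i \<le> r" using r by auto
          then show ?thesis by (simp add: X'_def)
        qed
      qed
      have I_step: "I r' \<omega> = I r \<omega> + (\<Sum>i<n. X' i \<omega> * (M r' (A i) \<omega> - M r (A i) \<omega>))" for \<omega>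
        unfolding I_def simple_integral_nth n_def[symmetric]
        using incr by (simp add: g_nth[folded n_def] sum.distrib[symmetric])
      have E_step: "(\<Sum>i<n. X' i \<omega> * indicator (A i) y) = E s y \<omega>" if "r < s" "s \<le> r'" for s y \<omega>
      proof -
        have "indicator {\<alpha> i<..\<gamma> i} s = (if \<alpha> i \<le> r \<and> r' \<le> \<gamma> i then 1 else 0 :: real)" if "i < n" for i
          using \<alpha>S[OF that] \<open>r < s\<close> \<open>s \<le> r'\<close> by (auto simp: indicator_def)
        then show ?thesis unfolding E_def simple_eval_nth n_def[symmetric]
          by (intro sum.cong refl) (simp add: g_nth[folded n_def] X'_def)
      qed
      have ce: "cross_energy K r r' (\<lambda>s y. \<Sum>i<n. X' i \<omega> * indicator (A i) y) = cross_energy K r r' (\<lambda>s y. E s y \<omega>)" for \<omega>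
        unfolding cross_energy_def
      proof (rule nn_integral_cong)
        fix w :: "real \<times> 'e \<times> 'e"
        obtain s y z where w: "w = (s, y, z)" by (cases w)
        show "(case w of (s, y, z) \<Rightarrow> ennreal (indicator {r<..r'} s * (\<bar>\<Sum>i<n. X' i \<omega> * indicator (A i) y\<bar> * \<bar>\<Sum>i<n. X' i \<omega> * indicator (A i) z\<bar>)))
           = (case w of (s, y, z) \<Rightarrow> ennreal (indicator {r<..r'} s * (\<bar>E s y \<omega>\<bar> * \<bar>E s z \<omega>\<bar>)))"
        proof (cases "r < s \<and> s \<le> r'")
          case True
          then have "r < s" "s \<le> r'" by auto
          then show ?thesis unfolding w prod.case E_step[OF \<open>r < s\<close> \<open>s \<le> r'\<close>] by simp
        qed (auto simp: w)
      qed
      have "G r' = (\<integral>\<^sup>+\<omega>. ennreal (\<phi> (I r \<omega> + (\<Sum>i<n. X' i \<omega> * (M r' (A i) \<omega> - M r (A i) \<omega>)))) \<partial>P)"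
        by (simp add: G_def I_step)
      also have "\<dots> \<le> G r + (\<integral>\<^sup>+\<omega>. ennreal \<bar>\<psi> (I r \<omega>)\<bar> * cross_energy K r r' (\<lambda>s y. \<Sum>i<n. X' i \<omega> * indicator (A i) y) \<partial>P)
          + ennreal (L * (\<eta> * (C * (r' - r)) + (C * (r' - r)\<^sup>2) / \<eta>))"
        unfolding G_def
      proof (rule one_step[where c = c and b = b and \<phi>' = \<phi>'])
        show "(\<integral>\<^sup>+\<omega>. ennreal ((\<Sum>i<n. X' i \<omega> * (M r' (A i) \<omega> - M r (A i) \<omega>))\<^sup>2) \<partial>P) \<le> ennreal (C * (r' - r))"
          "(\<integral>\<^sup>+\<omega>. ennreal ((\<Sum>i<n. X' i \<omega> * (M r' (A i) \<omega> - M r (A i) \<omega>)) ^ 4) \<partial>P) \<le> ennreal (C * (r' - r)\<^sup>2)"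
          using mom[rule_format, of r r' X'] r X'c by auto
      qed (fact An r(1) rr' X'm X'c Im[OF r(1)] \<phi> bd taylor L \<eta> | use C r in simp)+
      also have "ennreal (L * (\<eta> * (C * (r' - r)) + (C * (r' - r)\<^sup>2) / \<eta>)) \<le> ennreal (e' * (r' - r))"
      proof (rule ennreal_leI)
        have "L * (\<eta> * (C * (r' - r)) + (C * (r' - r)\<^sup>2) / \<eta>) = (L * C) * (\<eta> + (r' - r) / \<eta>) * (r' - r)"
          by (simp add: algebra_simps power2_eq_square add_divide_distrib diff_divide_distrib)
        also have "\<dots> \<le> (L * C) * (\<eta> + \<eta>\<^sup>2 / \<eta>) * (r' - r)"
          using LC mesh \<eta> r by (intro mult_right_mono mult_left_mono add_left_mono divide_right_mono) auto
        also have "\<dots> = (2 * (L * C) * \<eta>) * (r' - r)" by (simp add: power2_eq_square)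
        also have "\<dots> \<le> e' * (r' - r)" using \<eta>e r by (intro mult_right_mono) auto
        finally show "L * (\<eta> * (C * (r' - r)) + (C * (r' - r)\<^sup>2) / \<eta>) \<le> e' * (r' - r)" .
      qed
      also have "(\<integral>\<^sup>+\<omega>. ennreal \<bar>\<psi> (I r \<omega>)\<bar> * cross_energy K r r' (\<lambda>s y. \<Sum>i<n. X' i \<omega> * indicator (A i) y) \<partial>P)
         \<le> c1 * cross_energy K r r' h + ennreal (2 * b) * W r r'"
      proof -
        have "(\<integral>\<^sup>+\<omega>. ennreal \<bar>\<psi> (I r \<omega>)\<bar> * cross_energy K r r' (\<lambda>s y. \<Sum>i<n. X' i \<omega> * indicator (A i) y) \<partial>P)
          \<le> (\<integral>\<^sup>+\<omega>. 2 * (ennreal \<bar>\<psi> (I r \<omega>)\<bar> * cross_energy K r r' (\<lambda>s y. f s y \<omega>)) + ennreal (2 * b) * cross_energy K r r' (\<lambda>s y. R s y \<omega>) \<partial>P)"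
        proof (rule nn_integral_mono)
          fix \<omega> assume \<omega>: "\<omega> \<in> space P"
          have "cross_energy K r r' (\<lambda>s y. E s y \<omega>) \<le> 2 * cross_energy K r r' (\<lambda>s y. f s y \<omega>) + 2 * cross_energy K r r' (\<lambda>s y. R s y \<omega>)"
            by (rule cross_energy_add_le[OF section_measurable[OF f \<omega>] section_measurable[OF Rm \<omega>] r(1)]) (simp add: E_def R_def)
          then have "ennreal \<bar>\<psi> (I r \<omega>)\<bar> * cross_energy K r r' (\<lambda>s y. E s y \<omega>)
             \<le> ennreal \<bar>\<psi> (I r \<omega>)\<bar> * (2 * cross_energy K r r' (\<lambda>s y. f s y \<omega>) + 2 * cross_energy K r r' (\<lambda>s y. R s y \<omega>))"
            by (intro mult_left_mono) auto
          also have "\<dots> = 2 * (ennreal \<bar>\<psi> (I r \<omega>)\<bar> * cross_energy K r r' (\<lambda>s y. f s y \<omega>)) + ennreal \<bar>\<psi> (I r \<omega>)\<bar> * (2 * cross_energy K r r' (\<lambda>s y. R s y \<omega>))"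
            by (simp add: distrib_left mult_ac)
          also have "\<dots> \<le> 2 * (ennreal \<bar>\<psi> (I r \<omega>)\<bar> * cross_energy K r r' (\<lambda>s y. f s y \<omega>)) + ennreal b * (2 * cross_energy K r r' (\<lambda>s y. R s y \<omega>))"
            by (intro add_left_mono mult_right_mono ennreal_leI bd) auto
          also have "ennreal b * (2 * cross_energy K r r' (\<lambda>s y. R s y \<omega>)) = ennreal (2 * b) * cross_energy K r r' (\<lambda>s y. R s y \<omega>)"
            using b by (simp add: ennreal_mult' mult_ac)
          finally show "ennreal \<bar>\<psi> (I r \<omega>)\<bar> * cross_energy K r r' (\<lambda>s y. \<Sum>i<n. X' i \<omega> * indicator (A i) y)
             \<le> 2 * (ennreal \<bar>\<psi> (I r \<omega>)\<bar> * cross_energy K r r' (\<lambda>s y. f s y \<omega>)) + ennreal (2 * b) * cross_energy K r r' (\<lambda>s y. R s y \<omega>)"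
            unfolding ce .
        qed
        also have "\<dots> = 2 * (\<integral>\<^sup>+\<omega>. ennreal \<bar>\<psi> (I r \<omega>)\<bar> * cross_energy K r r' (\<lambda>s y. f s y \<omega>) \<partial>P) + ennreal (2 * b) * W r r'"
        proof -
          note [measurable] = cross_energy_measurable[OF f, of r r'] cross_energy_measurable[OF Rm, of r r'] ImP[OF r(1)]
          show ?thesis unfolding W_def by (simp add: nn_integral_add nn_integral_cmult)
        qed
        also have "(\<integral>\<^sup>+\<omega>. ennreal \<bar>\<psi> (I r \<omega>)\<bar> * cross_energy K r r' (\<lambda>s y. f s y \<omega>) \<partial>P) \<le> (ennreal \<delta> * a + ennreal (2 * D * \<kappa>)) * cross_energy K r r' h"
          using r fhV V\<kappa> hV \<kappa> \<delta> bd(1) Ga[of r]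
          by (intro weighted_energy_le[OF f V h ImP[OF r(1)] \<phi>(1,3) _ _ _ _ _ _ _ young]) (auto simp: G_def)
        finally have "(\<integral>\<^sup>+\<omega>. ennreal \<bar>\<psi> (I r \<omega>)\<bar> * cross_energy K r r' (\<lambda>s y. \<Sum>i<n. X' i \<omega> * indicator (A i) y) \<partial>P)
            \<le> 2 * ((ennreal \<delta> * a + ennreal (2 * D * \<kappa>)) * cross_energy K r r' h) + ennreal (2 * b) * W r r'"
          by (simp add: mult_left_mono add_right_mono)
        then show ?thesis unfolding c1_def mult.assoc[of 2 _ "cross_energy K r r' h"] .
      qed
      finally show "G r' \<le> G r + \<Psi> r r'" unfolding \<Psi>_def by (simp add: add.assoc add_left_mono add_right_mono)
    qed
    have W_w: "W r r' \<le> w" if "0 \<le> r" "r' \<le> t" for r r'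
      unfolding W_def w_def walsh_norm_sq_def cross_energy_def[symmetric]
      by (intro nn_integral_mono) (rule cross_energy_mono[OF that])
    have "G r \<le> ennreal (1 / 2) * a + (ennreal (4 * D * \<kappa> * B) + ennreal (2 * b) * w + ennreal (e / 2))" if r: "0 \<le> r" "r \<le> t" for r
    proof -
      have "G r \<le> \<Psi> 0 r" using main[of 0 r] r G0 by simp
      also have "\<dots> \<le> c1 * ennreal B + ennreal (2 * b) * w + ennreal (e / 2)"
        unfolding \<Psi>_def
      proof (intro add_mono mult_left_mono ennreal_leI)
        show "cross_energy K 0 r h \<le> ennreal B" using cross_energy_mono[of 0 r t K h] r B(1) by simp
        show "W 0 r \<le> w" using W_w r by simp
        have "e' * (r - 0) \<le> e' * t" using r e' by simp
        then show "e' * (r - 0) \<le> e / 2" using e't by linarith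
      qed auto
      also have "c1 * ennreal B = ennreal (2 * \<delta> * B) * a + ennreal (4 * D * \<kappa> * B)"
        unfolding c1_def using \<delta> \<kappa> B(2) by (simp add: distrib_left distrib_right ennreal_mult' mult_ac)
      also have "ennreal (2 * \<delta> * B) * a \<le> ennreal (1 / 2) * a" using \<delta>(3) by (intro mult_right_mono ennreal_leI) auto
      finally show ?thesis by (simp add: add.assoc)
    qed
    then have "a \<le> ennreal (1 / 2) * a + (ennreal (4 * D * \<kappa> * B) + ennreal (2 * b) * w + ennreal (e / 2))"
      unfolding a_def by (intro SUP_least) auto
    from ennreal_absorb_half[OF a_fin this]
    have "a \<le> 2 * (ennreal (4 * D * \<kappa> * B) + ennreal (2 * b) * w + ennreal (e / 2))" .
    also have "\<dots> = ennreal (8 * D * \<kappa> * B) + ennreal (4 * b) * w + ennreal e"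
    proof -
      have dbl: "2 * ennreal v = ennreal (2 * v)" for v by (simp add: ennreal_mult')
      have "2 * ennreal (4 * D * \<kappa> * B) = ennreal (8 * D * \<kappa> * B)" "2 * ennreal (2 * b) = ennreal (4 * b)" "2 * ennreal (e / 2) = ennreal e"
        unfolding dbl by (simp_all add: mult.assoc)
      then show ?thesis by (simp add: distrib_left mult.assoc[symmetric])
    qed
    finally show "a \<le> ennreal (8 * D * \<kappa> * B) + ennreal (4 * b) * w + ennreal e" .
  qed
  moreover have "G t \<le> a" using Ga t by simp
  ultimately show ?thesis unfolding G_def I_def w_def R_def by simp
qed

end

section \<open>Limits: from simple processes to Walsh integrals, from bounded functions to
  powers\<close>

lemma (in prob_space) L2_limit_le:
  fixes X :: "nat \<Rightarrow> 'a \<Rightarrow> real"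
  assumes [measurable]: "\<And>n. X n \<in> borel_measurable M" "Y \<in> borel_measurable M"
    and lim: "(\<lambda>n. \<integral>\<^sup>+\<omega>. ennreal ((X n \<omega> - Y \<omega>)\<^sup>2) \<partial>M) \<longlonglongrightarrow> 0"
    and \<phi>: "continuous_on UNIV \<phi>"
    and le: "\<And>n. (\<integral>\<^sup>+\<omega>. ennreal (\<phi> (X n \<omega>)) \<partial>M) \<le> c n" and c: "c \<longlonglongrightarrow> C"
  shows "(\<integral>\<^sup>+\<omega>. ennreal (\<phi> (Y \<omega>)) \<partial>M) \<le> C"
proof -
  have [measurable]: "\<phi> \<in> borel_measurable borel" using \<phi> by (rule borel_measurable_continuous_onI)
  define u where "u = (\<lambda>n \<omega>. (X n \<omega> - Y \<omega>)\<^sup>2)"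
  have "eventually (\<lambda>n. (\<integral>\<^sup>+\<omega>. ennreal (u n \<omega>) \<partial>M) < 1) sequentially"
    using order_tendstoD(2)[OF lim, of 1] by (simp add: u_def)
  \<comment> \<open>The first distances may be infinite. From \<open>k\<close> on the squares are
    integrable, as the passage to an almost surely convergent subsequence requires.\<close>
  then obtain k where k: "\<And>n. n \<ge> k \<Longrightarrow> (\<integral>\<^sup>+\<omega>. ennreal (u n \<omega>) \<partial>M) < 1" by (auto simp: eventually_sequentially)
  have int: "integrable M (u (n + k))" for n
    using k[of "n + k"] by (intro integrableI_nonneg) (auto simp: u_def intro: less_trans)
  have "ennreal (\<integral>\<omega>. u (n + k) \<omega> \<partial>M) = (\<integral>\<^sup>+\<omega>. ennreal (u (n + k) \<omega>) \<partial>M)" for n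
    using int[of n] by (intro nn_integral_eq_integral[symmetric]) (auto simp: u_def)
  moreover have "(\<lambda>n. \<integral>\<^sup>+\<omega>. ennreal (u (n + k) \<omega>) \<partial>M) \<longlonglongrightarrow> 0"
    using LIMSEQ_ignore_initial_segment[OF lim, of k] by (simp add: u_def)
  ultimately have "(\<lambda>n. ennreal (\<integral>\<omega>. u (n + k) \<omega> \<partial>M)) \<longlonglongrightarrow> ennreal 0" by simp
  then have "(\<lambda>n. \<integral>\<omega>. u (n + k) \<omega> \<partial>M) \<longlonglongrightarrow> 0"
    by (rule tendsto_ennrealD) (auto simp: u_def intro!: always_eventually)
  then have "(\<lambda>n. \<integral>\<omega>. norm (u (n + k) \<omega>) \<partial>M) \<longlonglongrightarrow> 0" by (simp add: u_def)
  \<comment> \<open>Along this subsequence the continuous \<phi> preserves almost sure convergence,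
    and Fatou's lemma gives the bound.\<close>
  from tendsto_L1_AE_subseq[OF int this] obtain r :: "nat \<Rightarrow> nat"
    where r: "strict_mono r" "AE \<omega> in M. (\<lambda>n. u (r n + k) \<omega>) \<longlonglongrightarrow> 0" by auto
  show ?thesis
  proof (rule nn_integral_limit_le)
    show "(\<lambda>\<omega>. ennreal (\<phi> (X (r n + k) \<omega>))) \<in> borel_measurable M" for n by measurable
    show "(\<integral>\<^sup>+\<omega>. ennreal (\<phi> (X (r n + k) \<omega>)) \<partial>M) \<le> c (r n + k)" for n by (rule le)
    show "(\<lambda>n. c (r n + k)) \<longlonglongrightarrow> C"
      using LIMSEQ_subseq_LIMSEQ[OF LIMSEQ_ignore_initial_segment[OF c, of k] r(1)] by (simp add: o_def)
    show "AE \<omega> in M. (\<lambda>n. ennreal (\<phi> (X (r n + k) \<omega>))) \<longlonglongrightarrow> ennreal (\<phi> (Y \<omega>))"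
      using r(2)
    proof eventually_elim
      case (elim \<omega>)
      then have "(\<lambda>n. sqrt (u (r n + k) \<omega>)) \<longlonglongrightarrow> sqrt 0" by (rule tendsto_real_sqrt)
      then have "(\<lambda>n. \<bar>X (r n + k) \<omega> - Y \<omega>\<bar>) \<longlonglongrightarrow> 0" by (simp add: u_def)
      then have "(\<lambda>n. X (r n + k) \<omega> - Y \<omega>) \<longlonglongrightarrow> 0" by (rule tendsto_rabs_zero_cancel)
      then have "(\<lambda>n. X (r n + k) \<omega>) \<longlonglongrightarrow> Y \<omega>" by (rule LIM_zero_cancel)
      then have "(\<lambda>n. \<phi> (X (r n + k) \<omega>)) \<longlonglongrightarrow> \<phi> (Y \<omega>)"
        by (rule continuous_on_tendsto_compose[OF \<phi>]) auto
      then show ?case by (rule tendsto_ennrealI)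
    qed
  qed
qed

text \<open>The limit of sin h / h at zero along h = x / (n + 1); x = 0, where h itself vanishes, is
  treated apart.\<close>

lemma scaled_sin_tendsto: "(\<lambda>n. real (Suc n) * sin (x / real (Suc n))) \<longlonglongrightarrow> x"
proof (cases "x = 0")
  case False
  have "((\<lambda>h. sin h / h) \<longlongrightarrow> 1) (at (0::real))"
    using DERIV_sin[of 0] by (simp add: has_field_derivative_iff)
  moreover have "filterlim (\<lambda>n. x / real (Suc n)) (at 0) sequentially"
    unfolding filterlim_at using False LIMSEQ_Suc[OF lim_const_over_n[of x]] by (simp add: always_eventually)
  ultimately have "(\<lambda>n. sin (x / real (Suc n)) / (x / real (Suc n))) \<longlonglongrightarrow> 1"
    by (rule filterlim_compose)
  then have "(\<lambda>n. x * (sin (x / real (Suc n)) / (x / real (Suc n)))) \<longlonglongrightarrow> x * 1"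
    by (intro tendsto_mult tendsto_const)
  then show ?thesis using False by (simp add: mult.commute)
qed simp

text \<open>The functions \<open>(\<nu> sin (x / \<nu>))\<^sup>p\<close> converge to \<open>x\<^sup>p\<close> as \<open>\<nu> \<rightarrow> \<infinity>\<close>, have bounded derivatives, and their second
  derivative is dominated by the power \<open>1 - 2 / p\<close> of the function itself, uniformly in \<open>\<nu>\<close>.\<close>

lemma sin_power_taylor:
  fixes p :: nat
  assumes "2 \<le> p"
  shows "sin (x + h) ^ p \<le> sin x ^ p + (real p * sin x ^ (p - 1) * cos x) * h
    + ((real p * (real p - 1) * sin x ^ (p - 2) - (real p)\<^sup>2 * sin x ^ p) / 2) * h\<^sup>2
    + (real p) ^ 3 * \<bar>h\<bar> ^ 3"
proof -
  \<comment> \<open>The derivatives up to the third, the squared cosine being eliminated in the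
    second. For p = 2 the truncated exponent \<open>p - 2 - 1\<close> is harmless, since the factor
    \<open>real (p - 2)\<close> is zero.\<close>
  define diff :: "nat \<Rightarrow> real \<Rightarrow> real" where "diff = (\<lambda>m y. if m = 0 then sin (x + y) ^ p
    else if m = 1 then real p * sin (x + y) ^ (p - 1) * cos (x + y)
    else if m = 2 then real p * (real p - 1) * sin (x + y) ^ (p - 2) - (real p)\<^sup>2 * sin (x + y) ^ p
    else real p * (real p - 1) * (real (p - 2) * sin (x + y) ^ (p - 2 - 1) * cos (x + y)) - (real p)\<^sup>2 * (real p * sin (x + y) ^ (p - 1) * cos (x + y)))"
  have cos2: "cos z * cos z = 1 - sin z * sin z" for z :: real
    using sin_cos_squared_add[of z] by (simp add: power2_eq_square)
  have pw: "sin z ^ (p - 1) * sin z = sin z ^ p" "sin z ^ (p - 2) * (sin z * sin z) = sin z ^ p" for z :: real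
  proof -
    have "p = Suc (p - 1)" "p = p - 2 + 2" using assms by auto
    then show "sin z ^ (p - 1) * sin z = sin z ^ p" "sin z ^ (p - 2) * (sin z * sin z) = sin z ^ p"
      by (metis power_Suc2, metis power_add power2_eq_square)
  qed
  have pm: "p - 1 - 1 = p - 2" "real (p - 1) = real p - 1" using assms by auto
  have D: "(diff m has_real_derivative diff (Suc m) y) (at y)" if m: "m < 3" for m y
  proof -
    consider "m = 0" | "m = 1" | "m = 2" using m by linarith
    then show ?thesis
    proof cases
      case 1
      then show ?thesis unfolding diff_def by (auto intro!: derivative_eq_intros)
    next
      case 2
      have "((\<lambda>y. real p * sin (x + y) ^ (p - 1) * cos (x + y)) has_real_derivative
          real p * (real (p - 1) * sin (x + y) ^ (p - 1 - 1) * cos (x + y)) * cos (x + y) + real p * sin (x + y) ^ (p - 1) * (- sin (x + y))) (at y)"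
        by (auto intro!: derivative_eq_intros)
      moreover have "real p * (real (p - 1) * sin (x + y) ^ (p - 1 - 1) * cos (x + y)) * cos (x + y) + real p * sin (x + y) ^ (p - 1) * (- sin (x + y))
          = real p * (real p - 1) * sin (x + y) ^ (p - 2) - (real p)\<^sup>2 * sin (x + y) ^ p"
      proof -
        have "real p * (real (p - 1) * sin (x + y) ^ (p - 1 - 1) * cos (x + y)) * cos (x + y) = real p * (real p - 1) * (sin (x + y) ^ (p - 2) * (1 - sin (x + y) * sin (x + y)))"
          unfolding pm cos2[symmetric] by (simp add: mult_ac)
        also have "\<dots> = real p * (real p - 1) * sin (x + y) ^ (p - 2) - real p * (real p - 1) * sin (x + y) ^ p"
          unfolding right_diff_distrib[of "sin (x + y) ^ (p - 2)"] pw by (simp add: algebra_simps)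
        finally show ?thesis using pw(1)[of "x + y"] by (simp add: algebra_simps power2_eq_square)
      qed
      ultimately show ?thesis using 2 by (simp add: diff_def)
    next
      case 3
      have "((\<lambda>y. real p * (real p - 1) * sin (x + y) ^ (p - 2) - (real p)\<^sup>2 * sin (x + y) ^ p) has_real_derivative
         real p * (real p - 1) * (real (p - 2) * sin (x + y) ^ (p - 2 - 1) * cos (x + y)) - (real p)\<^sup>2 * (real p * sin (x + y) ^ (p - 1) * cos (x + y))) (at y)"
        by (auto intro!: derivative_eq_intros)
      then show ?thesis using 3 by (simp add: diff_def)
    qed
  qed
  obtain z where z: "sin (x + h) ^ p = (\<Sum>m<3. diff m 0 / fact m * h ^ m) + diff 3 z / fact 3 * h ^ 3"
    using Maclaurin_bi_le[of diff "\<lambda>h. sin (x + h) ^ p" 3 h] D by (auto simp: diff_def)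
  have bnd: "\<bar>sin w ^ k * cos w\<bar> \<le> 1" for w :: real and k
    using mult_mono[of "\<bar>sin w\<bar> ^ k" 1 "\<bar>cos w\<bar>" 1] by (simp add: abs_mult power_abs power_le_one)
  have "\<bar>diff 3 z\<bar> \<le> \<bar>real p * (real p - 1) * (real (p - 2) * sin (x + z) ^ (p - 2 - 1) * cos (x + z))\<bar> + \<bar>(real p)\<^sup>2 * (real p * sin (x + z) ^ (p - 1) * cos (x + z))\<bar>"
    unfolding diff_def by (simp add: abs_triangle_ineq4)
  also have "\<dots> = (real p * (real p - 1) * real (p - 2)) * \<bar>sin (x + z) ^ (p - 2 - 1) * cos (x + z)\<bar> + real p ^ 3 * \<bar>sin (x + z) ^ (p - 1) * cos (x + z)\<bar>"
    using assms by (simp add: abs_mult power2_eq_square power3_eq_cube)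
  also have "\<dots> \<le> (real p * (real p - 1) * real (p - 2)) * 1 + real p ^ 3 * 1"
    using assms by (intro add_mono mult_left_mono bnd) auto
  also have "(real p * (real p - 1) * real (p - 2)) \<le> real p * real p * real p"
    using assms by (intro mult_mono) auto
  \<comment> \<open>Division by 3! leaves less than p^3. A crude constant will do, as the remainder
    disappears with the mesh.\<close>
  finally have d3: "\<bar>diff 3 z\<bar> \<le> 2 * real p ^ 3" by (simp add: power3_eq_cube)
  have "diff 3 z / fact 3 * h ^ 3 \<le> \<bar>diff 3 z\<bar> / 6 * \<bar>h\<bar> ^ 3"
    using abs_ge_self[of "diff 3 z / fact 3 * h ^ 3"] by (simp add: abs_mult power_abs fact_numeral)
  also have "\<dots> \<le> (real p) ^ 3 * \<bar>h\<bar> ^ 3"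
    using d3 by (intro mult_right_mono) auto
  finally show ?thesis unfolding z by (simp add: diff_def numeral_3_eq_3 lessThan_Suc numeral_2_eq_2)
qed

text \<open>With p = 2m, half of the second derivative is sin^(p-2) times m (2m-1) - 2 m^2 sin^2,
  and the subtracted term runs from 0 to 2 m^2, at most twice m (2m-1). The constant is thus p
  (p-1)/2, the same as for x^p.\<close>

lemma sin_power_second_derivative:
  fixes m :: nat
  assumes "1 \<le> m"
  shows "\<bar>(real (2 * m) * (real (2 * m) - 1) * sin x ^ (2 * m - 2) - (real (2 * m))\<^sup>2 * sin x ^ (2 * m)) / 2\<bar>
    \<le> (real m * real (2 * m - 1)) * sin x ^ (2 * m - 2)"
proof -
  define a where "a = sin x ^ (2 * m - 2)"
  have "2 * m - 2 = 2 * (m - 1)" by simp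
  then have a: "a \<ge> 0" unfolding a_def by (simp add: power_mult)
  have "2 * m = 2 * m - 2 + 2" using assms by simp
  then have sp: "sin x ^ (2 * m) = a * (sin x)\<^sup>2" unfolding a_def by (metis power_add)
  have eq: "(real (2 * m) * (real (2 * m) - 1) * sin x ^ (2 * m - 2) - (real (2 * m))\<^sup>2 * sin x ^ (2 * m)) / 2
     = a * (real m * (real (2 * m) - 1) - 2 * (real m)\<^sup>2 * (sin x)\<^sup>2)"
    unfolding sp unfolding a_def[symmetric] by (simp add: field_simps power2_eq_square)
  have X: "\<bar>real m * (real (2 * m) - 1) - 2 * (real m)\<^sup>2 * (sin x)\<^sup>2\<bar> \<le> real m * (real (2 * m) - 1)"
  proof -
    have "(sin x)\<^sup>2 \<le> 1" using sin_cos_squared_add[of x] zero_le_power2[of "cos x"] by linarith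
    then have "2 * (real m)\<^sup>2 * (sin x)\<^sup>2 \<le> 2 * (real m)\<^sup>2 * 1" by (intro mult_left_mono) auto
    moreover have "2 * (real m)\<^sup>2 \<le> 2 * (real m * (real (2 * m) - 1))"
      using assms by (simp add: power2_eq_square)
    ultimately show ?thesis by (auto simp: abs_le_iff)
  qed
  have "\<bar>a * (real m * (real (2 * m) - 1) - 2 * (real m)\<^sup>2 * (sin x)\<^sup>2)\<bar> \<le> a * (real m * (real (2 * m) - 1))"
    using mult_left_mono[OF X a] a by (simp add: abs_mult)
  moreover have "real (2 * m) - 1 = real (2 * m - 1)" using assms by simp
  ultimately show ?thesis unfolding eq unfolding a_def by (simp only: mult.commute)
qed

text \<open>Let q be the larger of a and c. If q^2 <= \<epsilon> S^2, the first term on the right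
  suffices; otherwise S^2 is at most q^2/\<epsilon>, and the second does. The free \<epsilon> is
  what later makes the first term absorbable.\<close>

lemma young_power:
  fixes S a c :: real
  assumes "0 \<le> a" "0 \<le> c" "0 < \<epsilon>" "1 \<le> m"
  shows "(S\<^sup>2) ^ (m - 1) * (a * c) \<le> \<epsilon> * (S\<^sup>2) ^ m + (1 / \<epsilon>) ^ (m - 1) * (a ^ (2 * m) + c ^ (2 * m))"
proof -
  define q where "q = max a c"
  have q: "0 \<le> q" "a \<le> q" "c \<le> q" using assms by (auto simp: q_def)
  have ac: "a * c \<le> q\<^sup>2" unfolding power2_eq_square using q assms by (intro mult_mono) auto
  have qm: "q ^ (2 * m) \<le> a ^ (2 * m) + c ^ (2 * m)" using assms by (auto simp: q_def max_def)
  obtain k where m: "m = Suc k" using assms by (cases m) auto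
  have "(S\<^sup>2) ^ (m - 1) * (a * c) \<le> (S\<^sup>2) ^ (m - 1) * q\<^sup>2" using ac by (intro mult_left_mono) auto
  also have "\<dots> \<le> \<epsilon> * (S\<^sup>2) ^ m + (1 / \<epsilon>) ^ (m - 1) * (a ^ (2 * m) + c ^ (2 * m))"
  proof (cases "q\<^sup>2 \<le> \<epsilon> * S\<^sup>2")
    case True
    then have "(S\<^sup>2) ^ (m - 1) * q\<^sup>2 \<le> (S\<^sup>2) ^ (m - 1) * (\<epsilon> * S\<^sup>2)" by (intro mult_left_mono) auto
    also have "\<dots> = \<epsilon> * (S\<^sup>2) ^ m" by (simp add: m)
    finally show ?thesis using assms by (simp add: add_increasing2)
  next
    case False
    then have "S\<^sup>2 \<le> q\<^sup>2 / \<epsilon>" using assms by (simp add: field_simps)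
    then have "(S\<^sup>2) ^ (m - 1) * q\<^sup>2 \<le> (q\<^sup>2 / \<epsilon>) ^ (m - 1) * q\<^sup>2" by (intro mult_right_mono power_mono) auto
    also have "\<dots> = (1 / \<epsilon>) ^ (m - 1) * q ^ (2 * m)"
      unfolding power_mult m by (simp add: power_divide mult_ac)
    also have "\<dots> \<le> (1 / \<epsilon>) ^ (m - 1) * (a ^ (2 * m) + c ^ (2 * m))"
      using qm assms by (intro mult_left_mono) auto
    finally show ?thesis using assms by (simp add: add_increasing)
  qed
  finally show ?thesis .
qed

text \<open>Walsh integrands and the solution are jointly measurable over restricted sets of times,
  whereas the Fubini arguments run over all times.\<close>

lemma clamp_measurable:
  fixes f :: "real \<Rightarrow> 'a \<Rightarrow> 'b \<Rightarrow> real"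
  assumes "(\<lambda>(s, y, \<omega>). f s y \<omega>) \<in> borel_measurable (restrict_space borel A \<Otimes>\<^sub>M (M2 \<Otimes>\<^sub>M M3))"
    and "A \<in> sets borel"
  shows "(\<lambda>(s, y, \<omega>). indicator A s * f s y \<omega>) \<in> borel_measurable (borel \<Otimes>\<^sub>M (M2 \<Otimes>\<^sub>M M3))"
proof (cases "A = {}")
  case False
  then obtain a where a: "a \<in> A" by blast
  \<comment> \<open>Times outside \<open>A\<close> are sent to some point of \<open>A\<close>, so
    that \<open>f\<close> is evaluated only where it is known to be measurable; the indicator then
    erases the value.\<close>
  define c where "c = (\<lambda>s. if s \<in> A then s else a)"
  have [measurable]: "c \<in> measurable borel (restrict_space borel A)"
    unfolding c_def using assms(2) a by (intro measurable_restrict_space2) auto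
  have "(\<lambda>w. indicator A (fst w) * f (c (fst w)) (fst (snd w)) (snd (snd w))) \<in> borel_measurable (borel \<Otimes>\<^sub>M (M2 \<Otimes>\<^sub>M M3))"
  proof -
    note [measurable] = assms(2)
    show ?thesis by (intro borel_measurable_times measurable_curried3[OF assms(1)]) measurable
  qed
  moreover have "(\<lambda>(s, y, \<omega>). indicator A s * f s y \<omega>) = (\<lambda>w. indicator A (fst w) * f (c (fst w)) (fst (snd w)) (snd (snd w)))"
    by (auto simp: fun_eq_iff c_def indicator_def)
  ultimately show ?thesis by simp
qed (simp add: split_beta')

context fourth_moment_martingale_measure
begin

text \<open>For fixed \<nu> the approximation goes to its limit first: convergence in Walsh's norm
  removes the term with \<open>b\<close>, which depends on \<nu>, and the remaining bound is free of
  \<nu>. Then \<nu> tends to infinity along the integers by Fatou's lemma.\<close>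

lemma simple_limit_moment:
  fixes f V :: "real \<Rightarrow> 'e \<Rightarrow> 'w \<Rightarrow> real" and m :: nat
  assumes t: "0 \<le> t" and g: "\<And>n. simple_process \<F> (g n)"
    and Z [measurable]: "Z \<in> borel_measurable P"
    and lim_f: "(\<lambda>n. walsh_norm_sq P (\<lambda>_. K) t (\<lambda>s y \<omega>. simple_eval (g n) s y \<omega> - f s y \<omega>)) \<longlonglongrightarrow> 0"
    and lim_Z: "(\<lambda>n. \<integral>\<^sup>+\<omega>. ennreal ((simple_integral M t (g n) \<omega> - Z \<omega>)\<^sup>2) \<partial>P) \<longlonglongrightarrow> 0"
    and f: "(\<lambda>(s, y, \<omega>). f s y \<omega>) \<in> borel_measurable (borel \<Otimes>\<^sub>M (borel \<Otimes>\<^sub>M P))"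
    and V: "(\<lambda>(s, y, \<omega>). V s y \<omega>) \<in> borel_measurable (borel \<Otimes>\<^sub>M (borel \<Otimes>\<^sub>M P))"
    and h: "(\<lambda>(s, y). h s y) \<in> borel_measurable borel"
    and fhV: "\<And>s y \<omega>. 0 < s \<Longrightarrow> s \<le> t \<Longrightarrow> \<omega> \<in> space P \<Longrightarrow> \<bar>f s y \<omega>\<bar> \<le> h s y * V s y \<omega>"
    and hV: "\<And>s y. 0 \<le> h s y" "\<And>s y \<omega>. 0 \<le> V s y \<omega>"
    and m: "1 \<le> m"
    and V\<kappa>: "\<And>s y. 0 < s \<Longrightarrow> s \<le> t \<Longrightarrow> (\<integral>\<^sup>+\<omega>. ennreal (V s y \<omega> ^ (2 * m)) \<partial>P) \<le> ennreal \<kappa>" and \<kappa>: "0 \<le> \<kappa>"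
    and B: "cross_energy K 0 t h \<le> ennreal B" "0 < B"
  shows "(\<integral>\<^sup>+\<omega>. ennreal (Z \<omega> ^ (2 * m)) \<partial>P) \<le> ennreal (2 * (4 * (real m * real (2 * m - 1)) * B) ^ m * \<kappa>)"
proof -
  define p where "p = 2 * m"
  define k0 where "k0 = real m * real (2 * m - 1)"
  have k0: "0 < k0" using m by (simp add: k0_def)
  \<comment> \<open>Makes 4 \<delta> B equal to 1 for \<delta> = \<open>k0 * \<epsilon>\<close>, the
    largest value that can be absorbed.\<close>
  define \<epsilon> where "\<epsilon> = 1 / (4 * k0 * B)"
  have \<epsilon>: "0 < \<epsilon>" using k0 B by (simp add: \<epsilon>_def)
  \<comment> \<open>The constant from Young's inequality. As 1/\<epsilon> = 4 k0 B, the product 8 D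
    \<kappa> B becomes 2 (4 k0 B)^m \<kappa>.\<close>
  define D where "D = k0 * (1 / \<epsilon>) ^ (m - 1)"
  have D: "0 \<le> D" using k0 \<epsilon> by (simp add: D_def)
  have p2: "2 \<le> p" using m by (simp add: p_def)
  have DB: "8 * D * \<kappa> * B = 2 * (4 * k0 * B) ^ m * \<kappa>"
  proof -
    obtain j where j: "m = Suc j" using m by (cases m) auto
    show ?thesis by (simp add: D_def \<epsilon>_def j)
  qed
  have sinle: "\<bar>sin w ^ k\<bar> \<le> 1" for w :: real and k by (simp add: power_abs power_le_one)
  define \<phi> where "\<phi> = (\<lambda>\<nu> x. (\<nu> * sin (x / \<nu>)) ^ p :: real)"
  have bound: "(\<integral>\<^sup>+\<omega>. ennreal (\<phi> \<nu> (Z \<omega>)) \<partial>P) \<le> ennreal (8 * D * \<kappa> * B)" if \<nu>: "0 < \<nu>" for \<nu>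
  proof -
    define d1 where "d1 = (\<lambda>x. \<nu> ^ p / \<nu> * (real p * sin (x / \<nu>) ^ (p - 1) * cos (x / \<nu>)))"
    \<comment> \<open>Half of the second derivative of \<open>\<phi> \<nu>\<close>; each
      differentiation brings a factor 1/\<nu>.\<close>
    define \<psi> where "\<psi> = (\<lambda>x. \<nu> ^ p / \<nu>\<^sup>2 * ((real p * (real p - 1) * sin (x / \<nu>) ^ (p - 2) - (real p)\<^sup>2 * sin (x / \<nu>) ^ p) / 2))"
    define L where "L = \<nu> ^ p / \<nu> ^ 3 * real p ^ 3"
    define b where "b = \<nu> ^ p + \<nu> ^ p / \<nu> * real p + \<nu> ^ p / \<nu>\<^sup>2 * k0"
    have b: "\<nu> ^ p \<le> b" "\<nu> ^ p / \<nu> * real p \<le> b" "\<nu> ^ p / \<nu>\<^sup>2 * k0 \<le> b"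
      using \<nu> k0 by (auto simp: b_def add_increasing add_increasing2)
    have cont: "continuous_on UNIV (\<phi> \<nu>)" unfolding \<phi>_def using \<nu> by (intro continuous_intros) auto
    have \<psi>_le: "\<bar>\<psi> x\<bar> \<le> \<nu> ^ p / \<nu>\<^sup>2 * (k0 * sin (x / \<nu>) ^ (2 * m - 2))" for x
    proof -
      have "\<bar>(real p * (real p - 1) * sin (x / \<nu>) ^ (p - 2) - (real p)\<^sup>2 * sin (x / \<nu>) ^ p) / 2\<bar> \<le> k0 * sin (x / \<nu>) ^ (2 * m - 2)"
        using sin_power_second_derivative[OF m, of "x / \<nu>"] unfolding p_def k0_def .
      then show ?thesis unfolding \<psi>_def abs_mult using \<nu> by (intro mult_mono) auto
    qed
    have \<phi>_sq: "\<phi> \<nu> x = ((\<nu> * sin (x / \<nu>))\<^sup>2) ^ m" for x by (simp add: \<phi>_def p_def power_mult)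
    have est: "(\<integral>\<^sup>+\<omega>. ennreal (\<phi> \<nu> (simple_integral M t (g n) \<omega>)) \<partial>P)
      \<le> ennreal (8 * D * \<kappa> * B) + ennreal (4 * b) * walsh_norm_sq P (\<lambda>_. K) t (\<lambda>s y \<omega>. simple_eval (g n) s y \<omega> - f s y \<omega>)" for n
    proof (rule simple_integral_moment[where \<phi> = "\<phi> \<nu>" and \<phi>' = d1 and \<psi> = \<psi> and L = L and \<delta> = "k0 * \<epsilon>" and q = p and V = V and h = h])
      show "\<phi> \<nu> \<in> borel_measurable borel" "d1 \<in> borel_measurable borel" "\<psi> \<in> borel_measurable borel"
        unfolding \<phi>_def d1_def \<psi>_def by measurable
      show "0 \<le> \<phi> \<nu> x" for x unfolding \<phi>_sq by simp
      have "\<phi> \<nu> x \<le> \<nu> ^ p" for x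
        using mult_left_mono[OF abs_le_D1[OF sinle[of "x / \<nu>" p]], of "\<nu> ^ p"] \<nu> by (simp add: \<phi>_def power_mult_distrib)
      then show "\<phi> \<nu> x \<le> b" for x using b(1) by (blast intro: order_trans)
      have "\<bar>d1 x\<bar> \<le> \<nu> ^ p / \<nu> * real p" for x
      proof -
        have "\<bar>sin (x / \<nu>) ^ (p - 1)\<bar> * \<bar>cos (x / \<nu>)\<bar> \<le> 1 * 1" by (intro mult_mono sinle) auto
        then have "real p * (\<bar>sin (x / \<nu>) ^ (p - 1)\<bar> * \<bar>cos (x / \<nu>)\<bar>) \<le> real p * 1" by (intro mult_left_mono) auto
        then have "\<nu> ^ p / \<nu> * (real p * (\<bar>sin (x / \<nu>) ^ (p - 1)\<bar> * \<bar>cos (x / \<nu>)\<bar>)) \<le> \<nu> ^ p / \<nu> * (real p * 1)"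
          by (rule mult_left_mono) (use \<nu> in auto)
        then show ?thesis using \<nu> by (simp add: d1_def abs_mult mult.assoc)
      qed
      then show "\<bar>d1 x\<bar> \<le> b" for x using b(2) by (blast intro: order_trans)
      have "\<bar>\<psi> x\<bar> \<le> \<nu> ^ p / \<nu>\<^sup>2 * k0" for x
      proof -
        have "\<nu> ^ p / \<nu>\<^sup>2 * (k0 * sin (x / \<nu>) ^ (2 * m - 2)) \<le> \<nu> ^ p / \<nu>\<^sup>2 * (k0 * 1)"
          using \<nu> k0 abs_le_D1[OF sinle] by (intro mult_left_mono) auto
        with \<psi>_le[of x] show ?thesis by simp
      qed
      then show "\<bar>\<psi> x\<bar> \<le> b" for x using b(3) by (blast intro: order_trans)
      show "\<phi> \<nu> 0 = 0" using p2 by (simp add: \<phi>_def)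
      show "\<phi> \<nu> (x + h) \<le> \<phi> \<nu> x + d1 x * h + \<psi> x * h\<^sup>2 + L * \<bar>h\<bar> ^ 3" for x h
      proof -
        have "\<nu> ^ p * sin (x / \<nu> + h / \<nu>) ^ p \<le> \<nu> ^ p * (sin (x / \<nu>) ^ p + (real p * sin (x / \<nu>) ^ (p - 1) * cos (x / \<nu>)) * (h / \<nu>)
          + ((real p * (real p - 1) * sin (x / \<nu>) ^ (p - 2) - (real p)\<^sup>2 * sin (x / \<nu>) ^ p) / 2) * (h / \<nu>)\<^sup>2
          + (real p) ^ 3 * \<bar>h / \<nu>\<bar> ^ 3)"
          using \<nu> by (intro mult_left_mono sin_power_taylor p2) auto
        also have "\<dots> = \<phi> \<nu> x + d1 x * h + \<psi> x * h\<^sup>2 + L * \<bar>h\<bar> ^ 3"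
          using \<nu> by (simp add: \<phi>_def d1_def \<psi>_def L_def power_mult_distrib distrib_left power_divide abs_divide)
        finally show ?thesis by (simp add: \<phi>_def power_mult_distrib add_divide_distrib)
      qed
      show "0 \<le> L" using \<nu> by (simp add: L_def)
      show "\<bar>\<psi> x\<bar> * (a * c) \<le> k0 * \<epsilon> * \<phi> \<nu> x + D * (a ^ p + c ^ p)" if ac: "0 \<le> a" "0 \<le> c" for x a c
      proof -
        \<comment> \<open>The powers of \<nu> go into the scaled sine, so the constant in front of
          it does not depend on \<nu>.\<close>
        have "\<nu> ^ p / \<nu>\<^sup>2 * sin (x / \<nu>) ^ (2 * m - 2) = ((\<nu> * sin (x / \<nu>))\<^sup>2) ^ (m - 1)"
        proof -
          have "2 * m - 2 = 2 * (m - 1)" "p = 2 * (m - 1) + 2" using m by (auto simp: p_def)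
          then show ?thesis using \<nu> by (simp only: power_add power_mult power_mult_distrib) simp
        qed
        then have "\<bar>\<psi> x\<bar> \<le> k0 * ((\<nu> * sin (x / \<nu>))\<^sup>2) ^ (m - 1)"
          using \<psi>_le[of x] by (simp add: mult.left_commute)
        then have "\<bar>\<psi> x\<bar> * (a * c) \<le> k0 * ((\<nu> * sin (x / \<nu>))\<^sup>2) ^ (m - 1) * (a * c)"
          using ac by (intro mult_right_mono) auto
        also have "\<dots> = k0 * (((\<nu> * sin (x / \<nu>))\<^sup>2) ^ (m - 1) * (a * c))" by simp
        also have "\<dots> \<le> k0 * (\<epsilon> * ((\<nu> * sin (x / \<nu>))\<^sup>2) ^ m + (1 / \<epsilon>) ^ (m - 1) * (a ^ (2 * m) + c ^ (2 * m)))"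
          using k0 by (intro mult_left_mono young_power ac \<epsilon> m) auto
        also have "\<dots> = k0 * \<epsilon> * \<phi> \<nu> x + D * (a ^ p + c ^ p)"
          by (simp add: \<phi>_sq D_def p_def distrib_left)
        finally show ?thesis .
      qed
      show "0 \<le> k0 * \<epsilon>" "4 * (k0 * \<epsilon>) * B \<le> 1" using k0 \<epsilon> B by (auto simp: \<epsilon>_def)
      show "(\<integral>\<^sup>+\<omega>. ennreal (V s y \<omega> ^ p) \<partial>P) \<le> ennreal \<kappa>" if "0 < s" "s \<le> t" for s y
        using V\<kappa>[OF that] by (simp add: p_def)
      show "0 \<le> B" using B by simp
    qed (fact g t f V h fhV hV \<kappa> B D)+
    have meas: "simple_integral M t (g n) \<in> borel_measurable P" for n
      using measurable_P[OF simple_integral_adapted[OF g t] t] .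
    have lim: "(\<lambda>n. ennreal (8 * D * \<kappa> * B) + ennreal (4 * b) * walsh_norm_sq P (\<lambda>_. K) t (\<lambda>s y \<omega>. simple_eval (g n) s y \<omega> - f s y \<omega>))
       \<longlonglongrightarrow> ennreal (8 * D * \<kappa> * B) + ennreal (4 * b) * 0"
      by (intro tendsto_add tendsto_const tendsto_mult_ennreal lim_f) auto
    show ?thesis
      using L2_limit_le[OF meas Z lim_Z cont est lim] by simp
  qed
  have "(\<integral>\<^sup>+\<omega>. ennreal (Z \<omega> ^ p) \<partial>P) \<le> ennreal (8 * D * \<kappa> * B)"
  proof (rule nn_integral_limit_le[OF _ _ bound tendsto_const])
    show "0 < real (Suc n)" for n by simp
    show "(\<lambda>\<omega>. ennreal (\<phi> (real (Suc n)) (Z \<omega>))) \<in> borel_measurable P" for n unfolding \<phi>_def by measurable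
    show "AE \<omega> in P. (\<lambda>n. ennreal (\<phi> (real (Suc n)) (Z \<omega>))) \<longlonglongrightarrow> ennreal (Z \<omega> ^ p)"
      unfolding \<phi>_def by (intro AE_I2 tendsto_ennrealI tendsto_power scaled_sin_tendsto)
  qed
  then show ?thesis unfolding DB by (simp add: p_def k0_def)
qed

text \<open>The difference of integrals up to two times \<open>s \<le> t\<close> is one integral up to time \<open>t\<close>: the
  approximating processes of the second integral are stopped at \<open>s\<close>.\<close>

lemma walsh_increment_moment:
  fixes f1 f2 V :: "real \<Rightarrow> 'e \<Rightarrow> 'w \<Rightarrow> real" and m :: nat
  assumes st: "0 \<le> s" "s \<le> t"
    and Z1: "has_walsh_integral P \<F> M (\<lambda>_. K) t f1 Z1" and Z2: "has_walsh_integral P \<F> M (\<lambda>_. K) s f2 Z2"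
    and V: "(\<lambda>(r, y, \<omega>). V r y \<omega>) \<in> borel_measurable (borel \<Otimes>\<^sub>M (borel \<Otimes>\<^sub>M P))"
    and h: "(\<lambda>(r, y). h r y) \<in> borel_measurable borel"
    and fhV: "\<And>r y \<omega>. 0 < r \<Longrightarrow> r \<le> t \<Longrightarrow> \<omega> \<in> space P \<Longrightarrow> \<bar>f1 r y \<omega> - indicator {..s} r * f2 r y \<omega>\<bar> \<le> h r y * V r y \<omega>"
    and hV: "\<And>r y. 0 \<le> h r y" "\<And>r y \<omega>. 0 \<le> V r y \<omega>"
    and m: "1 \<le> m"
    and V\<kappa>: "\<And>r y. 0 < r \<Longrightarrow> r \<le> t \<Longrightarrow> (\<integral>\<^sup>+\<omega>. ennreal (V r y \<omega> ^ (2 * m)) \<partial>P) \<le> ennreal \<kappa>" and \<kappa>: "0 \<le> \<kappa>"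
    and B: "cross_energy K 0 t h \<le> ennreal B" "0 < B"
  shows "(\<integral>\<^sup>+\<omega>. ennreal ((Z1 \<omega> - Z2 \<omega>) ^ (2 * m)) \<partial>P) \<le> ennreal (2 * (4 * (real m * real (2 * m - 1)) * B) ^ m * \<kappa>)"
proof -
  have t: "0 \<le> t" using st by simp
  obtain g1 where f1: "(\<lambda>(s, y, \<omega>). f1 s y \<omega>) \<in> borel_measurable (restrict_space borel {0..t} \<Otimes>\<^sub>M (borel \<Otimes>\<^sub>M P))"
    and [measurable]: "Z1 \<in> borel_measurable P" and g1: "\<And>n. simple_process \<F> (g1 n)"
    and l1: "(\<lambda>n. walsh_norm_sq P (\<lambda>_. K) t (\<lambda>s y \<omega>. simple_eval (g1 n) s y \<omega> - f1 s y \<omega>)) \<longlonglongrightarrow> 0"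
      "(\<lambda>n. \<integral>\<^sup>+\<omega>. ennreal ((simple_integral M t (g1 n) \<omega> - Z1 \<omega>)\<^sup>2) \<partial>P) \<longlonglongrightarrow> 0"
    using Z1 unfolding has_walsh_integral_def by blast
  obtain g2 where f2: "(\<lambda>(s, y, \<omega>). f2 s y \<omega>) \<in> borel_measurable (restrict_space borel {0..s} \<Otimes>\<^sub>M (borel \<Otimes>\<^sub>M P))"
    and [measurable]: "Z2 \<in> borel_measurable P" and g2: "\<And>n. simple_process \<F> (g2 n)"
    and l2: "(\<lambda>n. walsh_norm_sq P (\<lambda>_. K) s (\<lambda>s y \<omega>. simple_eval (g2 n) s y \<omega> - f2 s y \<omega>)) \<longlonglongrightarrow> 0"
      "(\<lambda>n. \<integral>\<^sup>+\<omega>. ennreal ((simple_integral M s (g2 n) \<omega> - Z2 \<omega>)\<^sup>2) \<partial>P) \<longlonglongrightarrow> 0"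
    using Z2 unfolding has_walsh_integral_def by blast
  \<comment> \<open>Cutting the integrands off at their final times makes them jointly measurable
    over all times and leaves their norms unchanged.\<close>
  define F1 where "F1 = (\<lambda>r y \<omega>. indicator {0..t} r * f1 r y \<omega>)"
  define F2 where "F2 = (\<lambda>r y \<omega>. indicator {0..s} r * f2 r y \<omega>)"
  have F1: "(\<lambda>(r, y, \<omega>). F1 r y \<omega>) \<in> borel_measurable (borel \<Otimes>\<^sub>M (borel \<Otimes>\<^sub>M P))"
    unfolding F1_def by (rule clamp_measurable[OF f1]) simp
  have F2: "(\<lambda>(r, y, \<omega>). F2 r y \<omega>) \<in> borel_measurable (borel \<Otimes>\<^sub>M (borel \<Otimes>\<^sub>M P))"
    unfolding F2_def by (rule clamp_measurable[OF f2]) simp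
  \<comment> \<open>\<open>max a\<close> keeps the interval well formed when s < a; it is then
    empty. The sign turns concatenation of lists into subtraction of processes.\<close>
  define stop :: "('w, 'e) simple_process \<Rightarrow> ('w, 'e) simple_process"
    where "stop = map (\<lambda>(X, a, b, A). (\<lambda>\<omega>. - X \<omega>, a, max a (min b s), A))"
  define g where "g = (\<lambda>n. g1 n @ stop (g2 n))"
  have g: "simple_process \<F> (g n)" for n
    using g1[of n] g2[of n] unfolding g_def stop_def simple_process_def by fastforce
  have stop_eval: "simple_eval (stop g) r y \<omega> = - (indicator {..s} r * simple_eval g r y \<omega>)" if "simple_process \<F> g" for g r y \<omega>
    using that
  proof (induction g)
    case (Cons q g)
    obtain X a b A where q: "q = (X, a, b, A)" by (cases q)
    have "a \<le> b" "simple_process \<F> g" using Cons.prems by (auto simp: simple_process_def q)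
    then show ?case using Cons.IH
      by (auto simp: stop_def simple_eval_def q indicator_def algebra_simps)
  qed (simp add: stop_def simple_eval_def)
  have stop_int: "simple_integral M t (stop g) \<omega> = - simple_integral M s g \<omega>" if "simple_process \<F> g" for g \<omega>
    using that
  proof (induction g)
    case (Cons q g)
    obtain X a b A where q: "q = (X, a, b, A)" by (cases q)
    have ab: "a \<le> b" "simple_process \<F> g" using Cons.prems by (auto simp: simple_process_def q)
    have "M (min t (max a (min b s))) A \<omega> - M (min t a) A \<omega> = M (min s b) A \<omega> - M (min s a) A \<omega>"
    proof (cases "a \<le> s")
      case True
      then have "min t (max a (min b s)) = min s b" "min t a = a" "min s a = a" using st ab by auto
      then show ?thesis by simp
    next
      case False
      then have "max a (min b s) = a" "min s b = s" "min s a = s" using st ab by auto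
      then show ?thesis by simp
    qed
    then show ?case using Cons.IH[OF ab(2)] by (simp add: stop_def simple_integral_def q)
  qed (simp add: stop_def simple_integral_def)
  have int: "simple_integral M t (g n) \<omega> = simple_integral M t (g1 n) \<omega> - simple_integral M s (g2 n) \<omega>" for n \<omega>
  proof -
    have "simple_integral M t (g n) \<omega> = simple_integral M t (g1 n) \<omega> + simple_integral M t (stop (g2 n)) \<omega>"
      by (simp add: g_def simple_integral_def)
    then show ?thesis by (simp add: stop_int[OF g2])
  qed
  have ev: "simple_eval (g n) r y \<omega> = simple_eval (g1 n) r y \<omega> - indicator {..s} r * simple_eval (g2 n) r y \<omega>" for n r y \<omega>
  proof -
    have "simple_eval (g n) r y \<omega> = simple_eval (g1 n) r y \<omega> + simple_eval (stop (g2 n)) r y \<omega>"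
      by (simp add: g_def simple_eval_def)
    then show ?thesis by (simp add: stop_eval[OF g2])
  qed
  define w1 where "w1 = (\<lambda>n. walsh_norm_sq P (\<lambda>_. K) t (\<lambda>s y \<omega>. simple_eval (g1 n) s y \<omega> - f1 s y \<omega>))"
  define w2 where "w2 = (\<lambda>n. walsh_norm_sq P (\<lambda>_. K) s (\<lambda>s y \<omega>. simple_eval (g2 n) s y \<omega> - f2 s y \<omega>))"
  have wle: "walsh_norm_sq P (\<lambda>_. K) t (\<lambda>r y \<omega>. simple_eval (g n) r y \<omega> - (F1 r y \<omega> - F2 r y \<omega>)) \<le> 2 * w1 n + 2 * w2 n" for n
  proof -
    define R1 where "R1 = (\<lambda>r y \<omega>. simple_eval (g1 n) r y \<omega> - F1 r y \<omega>)"
    \<comment> \<open>After time s the second process has been stopped, and its error is zero; its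
      energy up to t is therefore the one up to s.\<close>
    define R2 where "R2 = (\<lambda>r y \<omega>. indicator {..s} r * (simple_eval (g2 n) r y \<omega> - F2 r y \<omega>))"
    have R1: "(\<lambda>(r, y, \<omega>). R1 r y \<omega>) \<in> borel_measurable (borel \<Otimes>\<^sub>M (borel \<Otimes>\<^sub>M P))"
      unfolding R1_def using borel_measurable_diff[OF simple_eval_measurable[OF g1[of n]] F1] by (simp add: split_beta')
    have R2: "(\<lambda>(r, y, \<omega>). R2 r y \<omega>) \<in> borel_measurable (borel \<Otimes>\<^sub>M (borel \<Otimes>\<^sub>M P))"
    proof -
      have "(\<lambda>w. indicator {..s} (fst w) * ((case w of (r, y, \<omega>) \<Rightarrow> simple_eval (g2 n) r y \<omega>) - (case w of (r, y, \<omega>) \<Rightarrow> F2 r y \<omega>)))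
         \<in> borel_measurable (borel \<Otimes>\<^sub>M (borel \<Otimes>\<^sub>M P))"
        by (intro borel_measurable_times borel_measurable_diff simple_eval_measurable[OF g2[of n]] F2) measurable
      then show ?thesis by (simp add: R2_def split_beta')
    qed
    have e1: "cross_energy K 0 t (\<lambda>r y. R1 r y \<omega>) = cross_energy K 0 t (\<lambda>r y. simple_eval (g1 n) r y \<omega> - f1 r y \<omega>)" for \<omega>
      unfolding cross_energy_def R1_def F1_def by (intro nn_integral_cong) (auto simp: indicator_def)
    have e2: "cross_energy K 0 t (\<lambda>r y. R2 r y \<omega>) = cross_energy K 0 s (\<lambda>r y. simple_eval (g2 n) r y \<omega> - f2 r y \<omega>)" for \<omega>
      unfolding cross_energy_def R2_def F2_def using st by (intro nn_integral_cong) (auto simp: indicator_def)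
    have "walsh_norm_sq P (\<lambda>_. K) t (\<lambda>r y \<omega>. simple_eval (g n) r y \<omega> - (F1 r y \<omega> - F2 r y \<omega>))
       = (\<integral>\<^sup>+\<omega>. cross_energy K 0 t (\<lambda>r y. simple_eval (g n) r y \<omega> - (F1 r y \<omega> - F2 r y \<omega>)) \<partial>P)"
      by (simp add: walsh_norm_sq_def cross_energy_def)
    also have "\<dots> \<le> (\<integral>\<^sup>+\<omega>. 2 * cross_energy K 0 t (\<lambda>r y. R1 r y \<omega>) + 2 * cross_energy K 0 t (\<lambda>r y. R2 r y \<omega>) \<partial>P)"
    proof (rule nn_integral_mono)
      fix \<omega> assume \<omega>: "\<omega> \<in> space P"
      show "cross_energy K 0 t (\<lambda>r y. simple_eval (g n) r y \<omega> - (F1 r y \<omega> - F2 r y \<omega>)) \<le> 2 * cross_energy K 0 t (\<lambda>r y. R1 r y \<omega>) + 2 * cross_energy K 0 t (\<lambda>r y. R2 r y \<omega>)"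
      proof (rule cross_energy_add_le[OF section_measurable[OF R1 \<omega>] section_measurable[OF R2 \<omega>] order_refl])
        fix r y assume "0 < r" "r \<le> t"
        have "simple_eval (g n) r y \<omega> - (F1 r y \<omega> - F2 r y \<omega>) = R1 r y \<omega> - R2 r y \<omega>"
          unfolding ev R1_def R2_def by (simp add: F2_def indicator_def)
        then show "\<bar>simple_eval (g n) r y \<omega> - (F1 r y \<omega> - F2 r y \<omega>)\<bar> \<le> \<bar>R1 r y \<omega>\<bar> + \<bar>R2 r y \<omega>\<bar>"
          by (simp add: abs_triangle_ineq4)
      qed
    qed
    also have "\<dots> = 2 * (\<integral>\<^sup>+\<omega>. cross_energy K 0 t (\<lambda>r y. R1 r y \<omega>) \<partial>P) + 2 * (\<integral>\<^sup>+\<omega>. cross_energy K 0 t (\<lambda>r y. R2 r y \<omega>) \<partial>P)"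
    proof -
      note [measurable] = cross_energy_measurable[OF R1, of 0 t] cross_energy_measurable[OF R2, of 0 t]
      show ?thesis by (simp add: nn_integral_add nn_integral_cmult)
    qed
    also have "\<dots> = 2 * w1 n + 2 * w2 n"
    proof -
      have "w1 n = (\<integral>\<^sup>+\<omega>. cross_energy K 0 t (\<lambda>r y. simple_eval (g1 n) r y \<omega> - f1 r y \<omega>) \<partial>P)"
        "w2 n = (\<integral>\<^sup>+\<omega>. cross_energy K 0 s (\<lambda>r y. simple_eval (g2 n) r y \<omega> - f2 r y \<omega>) \<partial>P)"
        by (simp_all add: w1_def w2_def walsh_norm_sq_def cross_energy_def)
      then show ?thesis by (simp only: e1 e2)
    qed
    finally show ?thesis .
  qed
  have lim1: "(\<lambda>n. walsh_norm_sq P (\<lambda>_. K) t (\<lambda>r y \<omega>. simple_eval (g n) r y \<omega> - (F1 r y \<omega> - F2 r y \<omega>))) \<longlonglongrightarrow> 0"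
  proof (rule tendsto_sandwich[OF _ _ tendsto_const])
    have "(\<lambda>n. 2 * w1 n + 2 * w2 n) \<longlonglongrightarrow> 2 * 0 + 2 * 0"
      unfolding w1_def w2_def by (intro tendsto_add tendsto_mult_ennreal tendsto_const l1 l2) auto
    then show "(\<lambda>n. 2 * w1 n + 2 * w2 n) \<longlonglongrightarrow> 0" by simp
  qed (use wle in auto)
  have lim2: "(\<lambda>n. \<integral>\<^sup>+\<omega>. ennreal ((simple_integral M t (g n) \<omega> - (Z1 \<omega> - Z2 \<omega>))\<^sup>2) \<partial>P) \<longlonglongrightarrow> 0"
  proof (rule tendsto_sandwich[OF _ _ tendsto_const])
    let ?u1 = "\<lambda>n. \<integral>\<^sup>+\<omega>. ennreal ((simple_integral M t (g1 n) \<omega> - Z1 \<omega>)\<^sup>2) \<partial>P"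
    let ?u2 = "\<lambda>n. \<integral>\<^sup>+\<omega>. ennreal ((simple_integral M s (g2 n) \<omega> - Z2 \<omega>)\<^sup>2) \<partial>P"
    have "(\<lambda>n. 2 * ?u1 n + 2 * ?u2 n) \<longlonglongrightarrow> 2 * 0 + 2 * 0"
      by (intro tendsto_add tendsto_mult_ennreal tendsto_const l1 l2) auto
    then show "(\<lambda>n. 2 * ?u1 n + 2 * ?u2 n) \<longlonglongrightarrow> 0" by simp
    have "(\<integral>\<^sup>+\<omega>. ennreal ((simple_integral M t (g n) \<omega> - (Z1 \<omega> - Z2 \<omega>))\<^sup>2) \<partial>P) \<le> 2 * ?u1 n + 2 * ?u2 n" for n
    proof -
      have [measurable]: "simple_integral M t (g1 n) \<in> borel_measurable P" "simple_integral M s (g2 n) \<in> borel_measurable P"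
        using measurable_P[OF simple_integral_adapted[OF g1 t] t] measurable_P[OF simple_integral_adapted[OF g2 st(1)] st(1)] by auto
      have "(\<integral>\<^sup>+\<omega>. ennreal ((simple_integral M t (g n) \<omega> - (Z1 \<omega> - Z2 \<omega>))\<^sup>2) \<partial>P)
         \<le> (\<integral>\<^sup>+\<omega>. 2 * ennreal ((simple_integral M t (g1 n) \<omega> - Z1 \<omega>)\<^sup>2) + 2 * ennreal ((simple_integral M s (g2 n) \<omega> - Z2 \<omega>)\<^sup>2) \<partial>P)"
      proof (rule nn_integral_mono)
        fix \<omega>
        have sq: "(a - c - (a' - c'))\<^sup>2 \<le> 2 * (a - a')\<^sup>2 + 2 * (c - c')\<^sup>2" for a c a' c' :: real
          using zero_le_power2[of "(a - a') + (c - c')"] by (simp add: power2_eq_square algebra_simps)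
        have "ennreal ((simple_integral M t (g n) \<omega> - (Z1 \<omega> - Z2 \<omega>))\<^sup>2)
          \<le> ennreal (2 * (simple_integral M t (g1 n) \<omega> - Z1 \<omega>)\<^sup>2 + 2 * (simple_integral M s (g2 n) \<omega> - Z2 \<omega>)\<^sup>2)"
          unfolding int by (intro ennreal_leI sq)
        also have "\<dots> = 2 * ennreal ((simple_integral M t (g1 n) \<omega> - Z1 \<omega>)\<^sup>2) + 2 * ennreal ((simple_integral M s (g2 n) \<omega> - Z2 \<omega>)\<^sup>2)"
          by (simp add: ennreal_mult')
        finally show "ennreal ((simple_integral M t (g n) \<omega> - (Z1 \<omega> - Z2 \<omega>))\<^sup>2)
          \<le> 2 * ennreal ((simple_integral M t (g1 n) \<omega> - Z1 \<omega>)\<^sup>2) + 2 * ennreal ((simple_integral M s (g2 n) \<omega> - Z2 \<omega>)\<^sup>2)" .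
      qed
      also have "\<dots> = 2 * ?u1 n + 2 * ?u2 n" by (simp add: nn_integral_add nn_integral_cmult)
      finally show ?thesis .
    qed
    then show "\<forall>\<^sub>F n in sequentially. (\<integral>\<^sup>+\<omega>. ennreal ((simple_integral M t (g n) \<omega> - (Z1 \<omega> - Z2 \<omega>))\<^sup>2) \<partial>P) \<le> 2 * ?u1 n + 2 * ?u2 n"
      by simp
  qed auto
  show ?thesis
  proof (rule simple_limit_moment[OF t g _ lim1 lim2 _ V h _ hV m V\<kappa> \<kappa> B])
    show "(\<lambda>\<omega>. Z1 \<omega> - Z2 \<omega>) \<in> borel_measurable P" by measurable
    show "(\<lambda>(r, y, \<omega>). F1 r y \<omega> - F2 r y \<omega>) \<in> borel_measurable (borel \<Otimes>\<^sub>M (borel \<Otimes>\<^sub>M P))"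
      using borel_measurable_diff[OF F1 F2] by (simp add: split_beta')
    fix r y \<omega> assume "0 < r" "r \<le> t" "\<omega> \<in> space P"
    then show "\<bar>F1 r y \<omega> - F2 r y \<omega>\<bar> \<le> h r y * V r y \<omega>"
      using fhV[of r \<omega> y] by (simp add: F1_def F2_def indicator_def)
  qed
qed

end

section \<open>The martingale measure of the noise\<close>

text \<open>A normal law of standard deviation \<tau> has the moments \<tau>^2 and 3 \<tau>^4, which
  gives equality; for the point mass at zero the left side vanishes.\<close>

lemma (in prob_space) centered_gaussian_fourth_moment:
  assumes "centered_gaussian M X"
  shows "(\<integral>\<^sup>+\<omega>. ennreal (X \<omega> ^ 4) \<partial>M) \<le> 3 * (\<integral>\<^sup>+\<omega>. ennreal ((X \<omega>)\<^sup>2) \<partial>M)\<^sup>2"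
proof -
  consider "AE \<omega> in M. X \<omega> = 0" | \<tau> where "\<tau> > 0" "distributed M lborel X (\<lambda>x. ennreal (normal_density 0 \<tau> x))"
    using assms unfolding centered_gaussian_def by blast
  then show ?thesis
  proof cases
    case 1
    then have "(\<integral>\<^sup>+\<omega>. ennreal (X \<omega> ^ 4) \<partial>M) = (\<integral>\<^sup>+\<omega>. 0 \<partial>M)"
      by (intro nn_integral_cong_AE) auto
    then show ?thesis by simp
  next
    case 2
    have mom: "(\<integral>\<^sup>+\<omega>. ennreal (X \<omega> ^ (2 * k)) \<partial>M) = ennreal (fact (2 * k) / ((2 / \<tau>\<^sup>2) ^ k * fact k))" for k
    proof -
      have "(\<integral>\<^sup>+\<omega>. ennreal (X \<omega> ^ (2 * k)) \<partial>M) = (\<integral>\<^sup>+x. ennreal (normal_density 0 \<tau> x) * ennreal (x ^ (2 * k)) \<partial>lborel)"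
        by (rule distributed_nn_integral[OF 2(2), symmetric]) simp
      also have "\<dots> = (\<integral>\<^sup>+x. ennreal (normal_density 0 \<tau> x * (x - 0) ^ (2 * k)) \<partial>lborel)"
        by (simp add: ennreal_mult')
      also have "\<dots> = ennreal (fact (2 * k) / ((2 / \<tau>\<^sup>2) ^ k * fact k))"
        using normal_moment_even[OF 2(1), of 0 k]
        by (subst nn_integral_eq_integral) (auto simp: has_bochner_integral_iff zero_le_even_power)
      finally show ?thesis .
    qed
    have e4: "(\<integral>\<^sup>+\<omega>. ennreal (X \<omega> ^ 4) \<partial>M) = ennreal (3 * \<tau> ^ 4)"
      using mom[of 2] by (simp add: fact_numeral power_divide)
    have e2: "(\<integral>\<^sup>+\<omega>. ennreal ((X \<omega>)\<^sup>2) \<partial>M) = ennreal (\<tau>\<^sup>2)"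
      using mom[of 1] by (simp add: fact_numeral)
    have "ennreal (3 * \<tau> ^ 4) = 3 * (ennreal (\<tau>\<^sup>2))\<^sup>2"
      by (simp add: ennreal_mult' ennreal_power)
    then show ?thesis unfolding e4 e2 by simp
  qed
qed

text \<open>The fourth moment passes to the limit by Fatou's lemma. Second moments of the
  approximations are at most 2c plus a null sequence, and 12 = 3 * 2^2.\<close>

lemma (in prob_space) gaussian_L2_limit_fourth_moment:
  assumes G: "\<And>n. centered_gaussian M (G n)" and Y [measurable]: "Y \<in> borel_measurable M"
    and lim: "(\<lambda>n. \<integral>\<^sup>+\<omega>. ennreal ((G n \<omega> - Y \<omega>)\<^sup>2) \<partial>M) \<longlonglongrightarrow> 0"
    and c: "(\<integral>\<^sup>+\<omega>. ennreal ((Y \<omega>)\<^sup>2) \<partial>M) \<le> ennreal c" "0 \<le> c"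
  shows "(\<integral>\<^sup>+\<omega>. ennreal (Y \<omega> ^ 4) \<partial>M) \<le> ennreal (12 * c\<^sup>2)"
proof -
  have [measurable]: "G n \<in> borel_measurable M" for n using G by (simp add: centered_gaussian_def)
  define e where "e = (\<lambda>n. \<integral>\<^sup>+\<omega>. ennreal ((G n \<omega> - Y \<omega>)\<^sup>2) \<partial>M)"
  have e0: "e \<longlonglongrightarrow> 0" using lim by (simp add: e_def)
  have G2: "(\<integral>\<^sup>+\<omega>. ennreal ((G n \<omega>)\<^sup>2) \<partial>M) \<le> ennreal (2 * c) + 2 * e n" for n
  proof -
    have "(\<integral>\<^sup>+\<omega>. ennreal ((G n \<omega>)\<^sup>2) \<partial>M) \<le> (\<integral>\<^sup>+\<omega>. 2 * ennreal ((Y \<omega>)\<^sup>2) + 2 * ennreal ((G n \<omega> - Y \<omega>)\<^sup>2) \<partial>M)"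
    proof (rule nn_integral_mono)
      fix \<omega>
      have "(G n \<omega>)\<^sup>2 \<le> 2 * (Y \<omega>)\<^sup>2 + 2 * (G n \<omega> - Y \<omega>)\<^sup>2"
        using zero_le_power2[of "Y \<omega> - (G n \<omega> - Y \<omega>)"] by (simp add: power2_eq_square algebra_simps)
      then have "ennreal ((G n \<omega>)\<^sup>2) \<le> ennreal (2 * (Y \<omega>)\<^sup>2 + 2 * (G n \<omega> - Y \<omega>)\<^sup>2)" by (rule ennreal_leI)
      then show "ennreal ((G n \<omega>)\<^sup>2) \<le> 2 * ennreal ((Y \<omega>)\<^sup>2) + 2 * ennreal ((G n \<omega> - Y \<omega>)\<^sup>2)"
        by (simp add: ennreal_mult')
    qed
    also have "\<dots> = 2 * (\<integral>\<^sup>+\<omega>. ennreal ((Y \<omega>)\<^sup>2) \<partial>M) + 2 * e n"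
      unfolding e_def by (simp add: nn_integral_add nn_integral_cmult)
    also have "\<dots> \<le> 2 * ennreal c + 2 * e n" by (intro add_right_mono mult_left_mono c) auto
    finally show ?thesis by (simp add: ennreal_mult')
  qed
  have "(\<integral>\<^sup>+\<omega>. ennreal (G n \<omega> ^ 4) \<partial>M) \<le> 3 * (ennreal (2 * c) + 2 * e n)\<^sup>2" for n
    using centered_gaussian_fourth_moment[OF G[of n]] power_mono[OF G2[of n], of 2]
    by (meson mult_left_mono order_trans zero_le)
  moreover have "(\<lambda>n. 3 * (ennreal (2 * c) + 2 * e n)\<^sup>2) \<longlonglongrightarrow> 3 * (ennreal (2 * c) + 2 * 0)\<^sup>2"
    unfolding power2_eq_square by (intro tendsto_mult_ennreal tendsto_add tendsto_const e0) auto
  ultimately have "(\<integral>\<^sup>+\<omega>. ennreal (Y \<omega> ^ 4) \<partial>M) \<le> 3 * (ennreal (2 * c) + 2 * 0)\<^sup>2"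
    by (intro L2_limit_le[OF _ Y lim]) (auto intro: continuous_intros)
  also have "\<dots> = ennreal (12 * c\<^sup>2)"
    using c by (simp add: ennreal_power power_mult_distrib ennreal_mult'[symmetric] mult_ac) (simp add: ennreal_mult')
  finally show ?thesis .
qed

text \<open>On positive times the density is a function of space alone: the noise is white in
  time.\<close>

lemma noise_dominating_measure_time:
  fixes A B :: "(real ^ 'k) set"
  assumes AB: "A \<in> sets borel" "B \<in> sets borel" and r: "0 \<le> r" "r \<le> r'"
  shows "emeasure (noise_dominating_measure \<beta>) ({r<..r'} \<times> A \<times> B)
    = ennreal (r' - r) * (\<integral>\<^sup>+y. (\<integral>\<^sup>+z. ennreal (norm (y - z) powr (-\<beta>)) * indicator (A \<times> B) (y, z) \<partial>lborel) \<partial>lborel)"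
proof -
  let ?S = "{r<..r'} \<times> A \<times> B"
  have S: "?S \<in> sets borel" using AB by (intro borel_Times) auto
  then have "?S \<in> sets (noise_dominating_measure \<beta>)" by (simp add: noise_dominating_measure_def)
  then have "emeasure (noise_dominating_measure \<beta>) ?S = (\<integral>\<^sup>+w. indicator ?S w \<partial>noise_dominating_measure \<beta>)" by simp
  also have "\<dots> = (\<integral>\<^sup>+q. (\<integral>\<^sup>+y. (\<integral>\<^sup>+z. ennreal (indicator {0..} q * norm (y - z) powr (-\<beta>)) * indicator ?S (q, y, z) \<partial>lborel) \<partial>lborel) \<partial>lborel)"
    using S by (intro nn_integral_noise_dominating_measure) auto
  also have "\<dots> = (\<integral>\<^sup>+q. (\<integral>\<^sup>+y. (\<integral>\<^sup>+z. ennreal (norm (y - z) powr (-\<beta>)) * indicator (A \<times> B) (y, z) \<partial>lborel) \<partial>lborel) * indicator {r<..r'} q \<partial>lborel)"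
  proof (rule nn_integral_cong)
    fix q :: real
    show "(\<integral>\<^sup>+y. (\<integral>\<^sup>+z. ennreal (indicator {0..} q * norm (y - z) powr (-\<beta>)) * indicator ?S (q, y, z) \<partial>lborel) \<partial>lborel)
      = (\<integral>\<^sup>+y. (\<integral>\<^sup>+z. ennreal (norm (y - z) powr (-\<beta>)) * indicator (A \<times> B) (y, z) \<partial>lborel) \<partial>lborel) * indicator {r<..r'} q"
      using r by (cases "q \<in> {r<..r'}") (auto simp: indicator_def cong: nn_integral_cong)
  qed
  also have "\<dots> = (\<integral>\<^sup>+y. (\<integral>\<^sup>+z. ennreal (norm (y - z) powr (-\<beta>)) * indicator (A \<times> B) (y, z) \<partial>lborel) \<partial>lborel) * emeasure lborel {r<..r'}"
    by (subst nn_integral_cmult_indicator) auto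
  finally show ?thesis using r by (simp add: mult.commute)
qed

text \<open>An increment of M over (r, r'] is the mean-square limit of differences of two variables
  from one Gaussian family, and worthiness bounds its variance by a multiple of
  \<open>r' - r\<close>. The fourth moment is then of order \<open>(r' - r)\<^sup>2\<close>.\<close>

lemma noise_fourth_moment_martingale_measure:
  fixes M :: "real \<Rightarrow> (real ^ 'k) set \<Rightarrow> 'w \<Rightarrow> real ^ 'd"
  assumes P: "prob_space P" and F: "gaussian_noise P \<beta> F" and M: "noise_martingale_measure P \<beta> F M"
  shows "fourth_moment_martingale_measure P (natural_filtration P M) (\<lambda>t A \<omega>. M t A \<omega> $ i) (noise_dominating_measure \<beta>)"
proof -
  interpret prob_space P by (rule P)
  have worthy: "worthy_martingale_measure P (natural_filtration P M) (\<lambda>t A \<omega>. M t A \<omega> $ i) (\<lambda>_. noise_dominating_measure \<beta>)" for i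
    using M unfolding noise_martingale_measure_def by blast
  have lin: "\<exists>C\<ge>0. \<forall>r r'. 0 \<le> r \<and> r \<le> r' \<longrightarrow> emeasure (noise_dominating_measure \<beta>) ({r<..r'} \<times> A \<times> A) \<le> ennreal (C * (r' - r))"
    if A: "A \<in> bounded_borel_sets" for A :: "(real ^ 'k) set"
  proof -
    have Ab: "A \<in> sets borel" "bounded A" using A by (auto simp: bounded_borel_sets_def)
    obtain c where c: "\<forall>x\<in>A. norm x \<le> c" using Ab unfolding bounded_iff by blast
    define n where "n = nat \<lceil>c\<rceil>"
    have "c \<le> real n" unfolding n_def by (rule real_nat_ceiling_ge)
    then have "norm x \<le> real n" if "x \<in> A" for x using c that by (blast intro: order_trans)
    then have n: "A \<subseteq> cball 0 (real n)" by auto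
    \<comment> \<open>The spatial energy of \<open>A\<close>. Its finiteness is read off from
      Walsh's condition on the time interval (0, 1], where the mass of the box is just this
      energy.\<close>
    define \<gamma> where "\<gamma> = (\<integral>\<^sup>+y. (\<integral>\<^sup>+z. ennreal (norm (y - z) powr (-\<beta>)) * indicator (A \<times> A) (y, z) \<partial>lborel) \<partial>lborel)"
    have "\<gamma> = emeasure (noise_dominating_measure \<beta>) ({0<..1} \<times> A \<times> A)"
      using noise_dominating_measure_time[OF Ab(1,1), of 0 1 \<beta>] by (simp add: \<gamma>_def)
    also have "\<dots> \<le> emeasure (noise_dominating_measure \<beta>) ({0<..1} \<times> cball (0 :: real ^ 'k) (real n) \<times> cball (0 :: real ^ 'k) (real n))"
    proof (rule emeasure_mono)
      show "{0<..1} \<times> A \<times> A \<subseteq> {0<..1} \<times> cball (0 :: real ^ 'k) (real n) \<times> cball (0 :: real ^ 'k) (real n)" using n by (intro Sigma_mono) auto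
      have "{0<..1::real} \<times> cball (0::real^'k) (real n) \<times> cball (0::real^'k) (real n) \<in> sets borel" by (intro borel_Times) auto
      then show "{0<..1} \<times> cball (0 :: real ^ 'k) (real n) \<times> cball (0 :: real ^ 'k) (real n) \<in> sets (noise_dominating_measure \<beta>)"
        by (simp add: noise_dominating_measure_def)
    qed
    also have "\<dots> = (\<integral>\<^sup>+\<omega>. emeasure (noise_dominating_measure \<beta>) ({0<..1} \<times> cball (0 :: real ^ 'k) (real n) \<times> cball (0 :: real ^ 'k) (real n)) \<partial>P)"
      by (simp add: emeasure_space_1)
    also have "\<dots> < \<infinity>"
      using worthy[unfolded worthy_martingale_measure_def, THEN conjunct2, THEN conjunct2, THEN conjunct2, THEN conjunct2, THEN conjunct1] by auto
    finally obtain C where C: "\<gamma> = ennreal C" "0 \<le> C" by (cases \<gamma>) auto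
    have "emeasure (noise_dominating_measure \<beta>) ({r<..r'} \<times> A \<times> A) \<le> ennreal (C * (r' - r))" if "0 \<le> r" "r \<le> r'" for r r'
      unfolding noise_dominating_measure_time[OF Ab(1,1) that] \<gamma>_def[symmetric] C(1)
      using C(2) that by (simp add: ennreal_mult'[symmetric] mult.commute)
    with C(2) show ?thesis by blast
  qed
  have fourth: "\<exists>C\<ge>0. \<forall>r r'. 0 \<le> r \<and> r \<le> r' \<longrightarrow> (\<integral>\<^sup>+\<omega>. ennreal ((M r' A \<omega> $ i - M r A \<omega> $ i) ^ 4) \<partial>P) \<le> ennreal (C * (r' - r)\<^sup>2)"
    if A: "A \<in> bounded_borel_sets" for A
  proof -
    obtain C where C: "0 \<le> C" "\<And>r r'. 0 \<le> r \<Longrightarrow> r \<le> r' \<Longrightarrow> emeasure (noise_dominating_measure \<beta>) ({r<..r'} \<times> A \<times> A) \<le> ennreal (C * (r' - r))"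
      using lin[OF A] by blast
    have "(\<integral>\<^sup>+\<omega>. ennreal ((M r' A \<omega> $ i - M r A \<omega> $ i) ^ 4) \<partial>P) \<le> ennreal (12 * (C * (r' - r))\<^sup>2)" if r: "0 \<le> r" "r \<le> r'" for r r'
    proof -
      have r': "0 \<le> r'" using r by simp
      have approx: "\<exists>\<phi>. (\<forall>n::nat. \<phi> n \<in> test_functions) \<and> (\<lambda>n. \<integral>\<^sup>+\<omega>. ennreal ((norm (F (\<phi> n) \<omega> - M t A \<omega>))\<^sup>2) \<partial>P) \<longlonglongrightarrow> 0" if "0 \<le> t" for t
        using M A that unfolding noise_martingale_measure_def by blast
      obtain \<phi> where \<phi>: "\<And>n::nat. \<phi> n \<in> test_functions" "(\<lambda>n. \<integral>\<^sup>+\<omega>. ennreal ((norm (F (\<phi> n) \<omega> - M r' A \<omega>))\<^sup>2) \<partial>P) \<longlonglongrightarrow> 0"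
        using approx[OF r'] by blast
      obtain \<psi> where \<psi>: "\<And>n::nat. \<psi> n \<in> test_functions" "(\<lambda>n. \<integral>\<^sup>+\<omega>. ennreal ((norm (F (\<psi> n) \<omega> - M r A \<omega>))\<^sup>2) \<partial>P) \<longlonglongrightarrow> 0"
        using approx[OF r(1)] by blast
      have fam: "centered_gaussian P (\<lambda>\<omega>. \<Sum>q\<in>J. c q * (case q of (\<phi>, i) \<Rightarrow> F \<phi> \<omega> $ i))" if "finite J" "J \<subseteq> test_functions \<times> (UNIV :: 'd set)" for J c
        using F that unfolding gaussian_noise_def centered_gaussian_family_def by (simp add: split_beta')
      have [measurable]: "(\<lambda>\<omega>. F \<rho> \<omega> $ i) \<in> borel_measurable P" if "\<rho> \<in> test_functions" for \<rho>
        using fam[of "{(\<rho>, i)}" "\<lambda>_. 1"] that by (simp add: centered_gaussian_def)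
      have G: "centered_gaussian P (\<lambda>\<omega>. F (\<phi> n) \<omega> $ i - F (\<psi> n) \<omega> $ i)" for n
      \<comment> \<open>If the two test functions coincide, the index set below collapses to one
        element and no longer yields the difference; but the difference is then zero, which counts
        as Gaussian.\<close>
      proof (cases "\<phi> n = \<psi> n")
        case True
        then show ?thesis by (simp add: centered_gaussian_def)
      next
        case False
        then show ?thesis
          using fam[of "{(\<phi> n, i), (\<psi> n, i)}" "\<lambda>q. if q = (\<phi> n, i) then 1 else - 1"] \<phi>(1) \<psi>(1) by simp
      qed
      interpret worthy_measure P "natural_filtration P M" "\<lambda>t A \<omega>. M t A \<omega> $ i" "noise_dominating_measure \<beta>"
        by unfold_locales (rule worthy)
      have [measurable]: "(\<lambda>\<omega>. M t A \<omega> $ i) \<in> borel_measurable P" if "0 \<le> t" for t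
        using M_measurable[OF A that] .
      have lim: "(\<lambda>n. \<integral>\<^sup>+\<omega>. ennreal (((F (\<phi> n) \<omega> $ i - F (\<psi> n) \<omega> $ i) - (M r' A \<omega> $ i - M r A \<omega> $ i))\<^sup>2) \<partial>P) \<longlonglongrightarrow> 0"
      proof (rule tendsto_sandwich[OF _ _ tendsto_const])
        let ?u1 = "\<lambda>n. \<integral>\<^sup>+\<omega>. ennreal ((norm (F (\<phi> n) \<omega> - M r' A \<omega>))\<^sup>2) \<partial>P"
        let ?u2 = "\<lambda>n. \<integral>\<^sup>+\<omega>. ennreal ((norm (F (\<psi> n) \<omega> - M r A \<omega>))\<^sup>2) \<partial>P"
        have "(\<lambda>n. 2 * ?u1 n + 2 * ?u2 n) \<longlonglongrightarrow> 2 * 0 + 2 * 0"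
          by (intro tendsto_add tendsto_mult_ennreal tendsto_const \<phi> \<psi>) auto
        then show "(\<lambda>n. 2 * ?u1 n + 2 * ?u2 n) \<longlonglongrightarrow> 0" by simp
        have "(\<integral>\<^sup>+\<omega>. ennreal (((F (\<phi> n) \<omega> $ i - F (\<psi> n) \<omega> $ i) - (M r' A \<omega> $ i - M r A \<omega> $ i))\<^sup>2) \<partial>P) \<le> 2 * ?u1 n + 2 * ?u2 n" for n
        proof -
          have [measurable]: "(\<lambda>\<omega>. F (\<phi> n) \<omega> $ i) \<in> borel_measurable P" "(\<lambda>\<omega>. F (\<psi> n) \<omega> $ i) \<in> borel_measurable P"
            "(\<lambda>\<omega>. M r' A \<omega> $ i) \<in> borel_measurable P" "(\<lambda>\<omega>. M r A \<omega> $ i) \<in> borel_measurable P"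
            using \<phi>(1) \<psi>(1) r r' by auto
          have comp: "(v $ i)\<^sup>2 \<le> (norm v)\<^sup>2" for v :: "real ^ 'd"
            using power_mono[OF component_le_norm_cart[of v i], of 2] by simp
          have "(\<integral>\<^sup>+\<omega>. ennreal (((F (\<phi> n) \<omega> $ i - F (\<psi> n) \<omega> $ i) - (M r' A \<omega> $ i - M r A \<omega> $ i))\<^sup>2) \<partial>P)
            \<le> (\<integral>\<^sup>+\<omega>. 2 * ennreal ((F (\<phi> n) \<omega> $ i - M r' A \<omega> $ i)\<^sup>2) + 2 * ennreal ((F (\<psi> n) \<omega> $ i - M r A \<omega> $ i)\<^sup>2) \<partial>P)"
          proof (rule nn_integral_mono)
            fix \<omega>
            have sq: "(a - c - (a' - c'))\<^sup>2 \<le> 2 * (a - a')\<^sup>2 + 2 * (c - c')\<^sup>2" for a c a' c' :: real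
              using zero_le_power2[of "(a - a') + (c - c')"] by (simp add: power2_eq_square algebra_simps)
            have "ennreal (((F (\<phi> n) \<omega> $ i - F (\<psi> n) \<omega> $ i) - (M r' A \<omega> $ i - M r A \<omega> $ i))\<^sup>2)
              \<le> ennreal (2 * (F (\<phi> n) \<omega> $ i - M r' A \<omega> $ i)\<^sup>2 + 2 * (F (\<psi> n) \<omega> $ i - M r A \<omega> $ i)\<^sup>2)"
              by (intro ennreal_leI sq)
            then show "ennreal (((F (\<phi> n) \<omega> $ i - F (\<psi> n) \<omega> $ i) - (M r' A \<omega> $ i - M r A \<omega> $ i))\<^sup>2)
              \<le> 2 * ennreal ((F (\<phi> n) \<omega> $ i - M r' A \<omega> $ i)\<^sup>2) + 2 * ennreal ((F (\<psi> n) \<omega> $ i - M r A \<omega> $ i)\<^sup>2)"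
              by (simp add: ennreal_mult')
          qed
          also have "\<dots> = 2 * (\<integral>\<^sup>+\<omega>. ennreal ((F (\<phi> n) \<omega> $ i - M r' A \<omega> $ i)\<^sup>2) \<partial>P) + 2 * (\<integral>\<^sup>+\<omega>. ennreal ((F (\<psi> n) \<omega> $ i - M r A \<omega> $ i)\<^sup>2) \<partial>P)"
            by (simp add: nn_integral_add nn_integral_cmult)
          also have "\<dots> \<le> 2 * ?u1 n + 2 * ?u2 n"
            using comp[of "F _ _ - M _ _ _"]
            by (intro add_mono mult_left_mono nn_integral_mono ennreal_leI) auto
          finally show ?thesis .
        qed
        then show "\<forall>\<^sub>F n in sequentially. (\<integral>\<^sup>+\<omega>. ennreal (((F (\<phi> n) \<omega> $ i - F (\<psi> n) \<omega> $ i) - (M r' A \<omega> $ i - M r A \<omega> $ i))\<^sup>2) \<partial>P) \<le> 2 * ?u1 n + 2 * ?u2 n"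
          by simp
      qed auto
      show ?thesis
      proof (rule gaussian_L2_limit_fourth_moment[OF G _ lim])
        show "(\<lambda>\<omega>. M r' A \<omega> $ i - M r A \<omega> $ i) \<in> borel_measurable P" using r r' by measurable
        show "(\<integral>\<^sup>+\<omega>. ennreal ((M r' A \<omega> $ i - M r A \<omega> $ i)\<^sup>2) \<partial>P) \<le> ennreal (C * (r' - r))"
          using increment_square[OF A r] C(2)[OF r] by (rule order_trans)
        show "0 \<le> C * (r' - r)" using C(1) r by simp
      qed
    qed
    then show ?thesis using C(1)
      by (intro exI[of _ "12 * C\<^sup>2"]) (auto simp: power_mult_distrib mult.assoc)
  qed
  show ?thesis
    by unfold_locales (use worthy fourth lin in auto)
qed

section \<open>Moments of the drift\<close>

text \<open>The convex function x^(n+1) lies above its tangent at \<open>c\<close>.\<close>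

lemma power_tangent_le:
  fixes x c :: real
  assumes "0 \<le> x" "0 \<le> c"
  shows "real (Suc n) * c ^ n * x \<le> x ^ Suc n + real n * c ^ Suc n"
proof (induction n)
  case (Suc n)
  have "0 \<le> real (Suc n) * c ^ n * (x - c)\<^sup>2" using assms by simp
  moreover have "real (Suc n) * c ^ n * x * x \<le> (x ^ Suc n + real n * c ^ Suc n) * x"
    using Suc assms by (intro mult_right_mono)
  ultimately show ?case by (simp add: algebra_simps power2_eq_square)
qed simp

text \<open>Jensen's inequality for the measure with density \<open>a\<close>, normalised by the
  bound \<open>N\<close> of its mass: the tangent at y/N is integrated, where y is the integral on
  the left. A mass below \<open>N\<close> does no harm, as the constant term of the tangent stands
  on the right with a nonnegative coefficient.\<close>

lemma nn_integral_power_le: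
  fixes a g :: "'a \<Rightarrow> real"
  assumes [measurable]: "a \<in> borel_measurable M" "g \<in> borel_measurable M"
    and nn: "\<And>x. 0 \<le> a x" "\<And>x. 0 \<le> g x"
    and N: "(\<integral>\<^sup>+x. ennreal (a x) \<partial>M) \<le> ennreal N" "0 < N"
  shows "(\<integral>\<^sup>+x. ennreal (a x * g x) \<partial>M) ^ Suc n \<le> ennreal (N ^ n) * (\<integral>\<^sup>+x. ennreal (a x * g x ^ Suc n) \<partial>M)"
proof (cases "(\<integral>\<^sup>+x. ennreal (a x * g x ^ Suc n) \<partial>M)")
  case (real j)
  have "(\<integral>\<^sup>+x. ennreal (a x * g x) \<partial>M) \<le> (\<integral>\<^sup>+x. ennreal (a x) + ennreal (a x * g x ^ Suc n) \<partial>M)"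
  proof (intro nn_integral_mono)
    fix x
    \<comment> \<open>This gives finiteness of the integral on the left, without which there is no
      point of tangency.\<close>
    have "g x \<le> 1 + g x ^ Suc n"
    proof (cases "g x \<le> 1")
      case True
      then show ?thesis using nn(2)[of x] by (simp add: add_increasing2)
    next
      case False
      then have "g x ^ 1 \<le> g x ^ Suc n" by (intro power_increasing) auto
      then show ?thesis by simp
    qed
    then have "a x * g x \<le> a x * (1 + g x ^ Suc n)" using nn by (intro mult_left_mono) auto
    then have "ennreal (a x * g x) \<le> ennreal (a x + a x * g x ^ Suc n)" by (intro ennreal_leI) (simp add: distrib_left)
    then show "ennreal (a x * g x) \<le> ennreal (a x) + ennreal (a x * g x ^ Suc n)" using nn by (simp add: ennreal_plus)
  qed
  also have "\<dots> = (\<integral>\<^sup>+x. ennreal (a x) \<partial>M) + ennreal j"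
    using real by (subst nn_integral_add) auto
  also have "\<dots> < \<infinity>" using N(1) by (auto simp: less_top[symmetric] top_unique)
  finally obtain y where y: "(\<integral>\<^sup>+x. ennreal (a x * g x) \<partial>M) = ennreal y" "0 \<le> y"
    by (cases "\<integral>\<^sup>+x. ennreal (a x * g x) \<partial>M") auto
  define c where "c = y / N"
  have c: "0 \<le> c" using y N by (simp add: c_def)
  have yc: "y = c * N" using N by (simp add: c_def)
  have "ennreal (real (Suc n) * c ^ n) * ennreal y = (\<integral>\<^sup>+x. ennreal (real (Suc n) * c ^ n) * ennreal (a x * g x) \<partial>M)"
    using y by (subst nn_integral_cmult) auto
  also have "\<dots> \<le> (\<integral>\<^sup>+x. ennreal (a x * g x ^ Suc n) + ennreal (real n * c ^ Suc n) * ennreal (a x) \<partial>M)"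
  proof (intro nn_integral_mono)
    fix x
    have "a x * (real (Suc n) * c ^ n * g x) \<le> a x * (g x ^ Suc n + real n * c ^ Suc n)"
      using nn c by (intro mult_left_mono power_tangent_le) auto
    then have "ennreal (real (Suc n) * c ^ n * (a x * g x)) \<le> ennreal (a x * g x ^ Suc n + real n * c ^ Suc n * a x)"
      by (intro ennreal_leI) (simp only: distrib_left mult_ac)
    then show "ennreal (real (Suc n) * c ^ n) * ennreal (a x * g x) \<le> ennreal (a x * g x ^ Suc n) + ennreal (real n * c ^ Suc n) * ennreal (a x)"
      using nn c by (simp add: ennreal_mult'[symmetric] ennreal_plus[symmetric] del: ennreal_plus power_Suc of_nat_Suc)
  qed
  also have "\<dots> = ennreal j + ennreal (real n * c ^ Suc n) * (\<integral>\<^sup>+x. ennreal (a x) \<partial>M)"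
    using real by (simp add: nn_integral_add nn_integral_cmult)
  also have "\<dots> \<le> ennreal j + ennreal (real n * c ^ Suc n) * ennreal N"
    by (intro add_left_mono mult_left_mono N) auto
  finally have "ennreal (real (Suc n) * c ^ n * y) \<le> ennreal (j + real n * c ^ Suc n * N)"
    using y real c N by (simp add: ennreal_mult'[symmetric] ennreal_plus[symmetric] del: ennreal_plus power_Suc of_nat_Suc)
  then have "real (Suc n) * c ^ n * y \<le> j + real n * c ^ Suc n * N"
    using real c N by (subst (asm) ennreal_le_iff) auto
  then have "c ^ Suc n * N \<le> j" unfolding yc by (simp add: algebra_simps)
  then have "N ^ n * (c ^ Suc n * N) \<le> N ^ n * j" using N by (intro mult_left_mono) auto
  then have "y ^ Suc n \<le> N ^ n * j" unfolding yc by (simp add: power_mult_distrib mult_ac)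
  then have "ennreal (y ^ Suc n) \<le> ennreal (N ^ n * j)" by (rule ennreal_leI)
  then show ?thesis using y real N by (simp add: ennreal_power ennreal_mult' del: power_Suc)
next
  case top
  then show ?thesis using N by (simp add: ennreal_mult_top)
qed

text \<open>Jensen's inequality inside, Fubini outside; a form of Minkowski's integral inequality.
  The moment bound is asked for only where the weight is nonzero, that is, at times in (0, t] in the
  application.\<close>

lemma (in prob_space) nn_integral_nn_integral_power_le:
  fixes a :: "'b \<Rightarrow> real" and v :: "'b \<Rightarrow> 'a \<Rightarrow> real"
  assumes "sigma_finite_measure L"
    and [measurable]: "a \<in> borel_measurable L" "(\<lambda>(x, \<omega>). v x \<omega>) \<in> borel_measurable (L \<Otimes>\<^sub>M M)"
    and nn: "\<And>x. 0 \<le> a x"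
    and N: "(\<integral>\<^sup>+x. ennreal (a x) \<partial>L) \<le> ennreal N" "0 < N"
    and q: "0 < q" and \<kappa>: "\<And>x. x \<in> space L \<Longrightarrow> a x \<noteq> 0 \<Longrightarrow> (\<integral>\<^sup>+\<omega>. ennreal (\<bar>v x \<omega>\<bar> ^ q) \<partial>M) \<le> ennreal \<kappa>" "0 \<le> \<kappa>"
  shows "(\<integral>\<^sup>+\<omega>. (\<integral>\<^sup>+x. ennreal (a x * \<bar>v x \<omega>\<bar>) \<partial>L) ^ q \<partial>M) \<le> ennreal (N ^ q * \<kappa>)"
proof -
  interpret L: sigma_finite_measure L by fact
  interpret LM: pair_sigma_finite L M ..
  obtain n where qn: "q = Suc n" using q by (cases q) auto
  have sec [measurable]: "(\<lambda>x. v x \<omega>) \<in> borel_measurable L" if "\<omega> \<in> space M" for \<omega>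
    using measurable_compose[OF measurable_Pair2'[OF that] assms(3)] by simp
  have sec2 [measurable]: "(\<lambda>\<omega>. v x \<omega>) \<in> borel_measurable M" if "x \<in> space L" for x
    using measurable_compose[OF measurable_Pair1'[OF that] assms(3)] by simp
  have "(\<integral>\<^sup>+\<omega>. (\<integral>\<^sup>+x. ennreal (a x * \<bar>v x \<omega>\<bar>) \<partial>L) ^ q \<partial>M) \<le> (\<integral>\<^sup>+\<omega>. ennreal (N ^ n) * (\<integral>\<^sup>+x. ennreal (a x * \<bar>v x \<omega>\<bar> ^ q) \<partial>L) \<partial>M)"
    unfolding qn by (intro nn_integral_mono nn_integral_power_le[OF assms(2) _ nn _ N] borel_measurable_abs sec) auto
  also have "\<dots> = ennreal (N ^ n) * (\<integral>\<^sup>+\<omega>. (\<integral>\<^sup>+x. ennreal (a x * \<bar>v x \<omega>\<bar> ^ q) \<partial>L) \<partial>M)"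
    by (rule nn_integral_cmult) measurable
  also have "(\<integral>\<^sup>+\<omega>. (\<integral>\<^sup>+x. ennreal (a x * \<bar>v x \<omega>\<bar> ^ q) \<partial>L) \<partial>M) = (\<integral>\<^sup>+x. (\<integral>\<^sup>+\<omega>. ennreal (a x * \<bar>v x \<omega>\<bar> ^ q) \<partial>M) \<partial>L)"
    by (rule LM.Fubini') measurable
  also have "\<dots> \<le> (\<integral>\<^sup>+x. ennreal (a x) * ennreal \<kappa> \<partial>L)"
  proof (rule nn_integral_mono)
    fix x assume x: "x \<in> space L"
    have "(\<integral>\<^sup>+\<omega>. ennreal (a x * \<bar>v x \<omega>\<bar> ^ q) \<partial>M) = ennreal (a x) * (\<integral>\<^sup>+\<omega>. ennreal (\<bar>v x \<omega>\<bar> ^ q) \<partial>M)"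
      using nn x by (subst nn_integral_cmult[symmetric]) (auto simp: ennreal_mult')
    also have "\<dots> \<le> ennreal (a x) * ennreal \<kappa>"
    proof (cases "a x = 0")
      case False
      then show ?thesis using \<kappa>(1)[OF x] by (intro mult_left_mono) auto
    qed simp
    finally show "(\<integral>\<^sup>+\<omega>. ennreal (a x * \<bar>v x \<omega>\<bar> ^ q) \<partial>M) \<le> ennreal (a x) * ennreal \<kappa>" .
  qed
  also have "\<dots> = (\<integral>\<^sup>+x. ennreal (a x) \<partial>L) * ennreal \<kappa>" by (rule nn_integral_multc) measurable
  also have "\<dots> \<le> ennreal N * ennreal \<kappa>" by (intro mult_right_mono N) auto
  finally have "(\<integral>\<^sup>+\<omega>. (\<integral>\<^sup>+x. ennreal (a x * \<bar>v x \<omega>\<bar>) \<partial>L) ^ q \<partial>M) \<le> ennreal (N ^ n) * (ennreal N * ennreal \<kappa>)"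
    by (simp add: mult_left_mono)
  also have "\<dots> = ennreal (N ^ q * \<kappa>)"
    using N \<kappa> by (simp add: ennreal_mult'[symmetric] qn mult_ac)
  finally show ?thesis .
qed

text \<open>The drift is an iterated Bochner integral, which takes a default value where
  integrability fails. Finite kernel mass and the moment bound give joint integrability for almost
  every outcome; there the iterated integrals are space-time integrals, may be subtracted, and
  differ by at most the integral of |v| against the kernel increment.\<close>

lemma (in prob_space) drift_increment_moment:
  fixes v :: "real \<Rightarrow> real ^ 'k \<Rightarrow> 'a \<Rightarrow> real" and x x' :: "real ^ 'k"
  assumes st: "0 \<le> s" "s \<le> t"
    and v: "(\<lambda>(r, y, \<omega>). v r y \<omega>) \<in> borel_measurable (borel \<Otimes>\<^sub>M (borel \<Otimes>\<^sub>M M))"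
    and N: "(\<integral>\<^sup>+r. (\<integral>\<^sup>+y. ennreal (indicator {0<..t} r * \<bar>mild_kernel t x r y - mild_kernel s x' r y\<bar>) \<partial>lborel) \<partial>lborel) \<le> ennreal N" "0 < N"
    and fin: "(\<integral>\<^sup>+r. (\<integral>\<^sup>+y. ennreal (indicator {0<..t} r * mild_kernel t x r y) \<partial>lborel) \<partial>lborel) < \<infinity>"
      "(\<integral>\<^sup>+r. (\<integral>\<^sup>+y. ennreal (indicator {0<..s} r * mild_kernel s x' r y) \<partial>lborel) \<partial>lborel) < \<infinity>"
    and q: "0 < q" and \<kappa>: "\<And>r y. 0 < r \<Longrightarrow> r \<le> t \<Longrightarrow> (\<integral>\<^sup>+\<omega>. ennreal (\<bar>v r y \<omega>\<bar> ^ q) \<partial>M) \<le> ennreal \<kappa>" "0 \<le> \<kappa>"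
  shows "(\<integral>\<^sup>+\<omega>. ennreal (\<bar>(LINT r:{0..t}|lborel. LINT y|lborel. heat_kernel (t - r) (x - y) * v r y \<omega>)
      - (LINT r:{0..s}|lborel. LINT y|lborel. heat_kernel (s - r) (x' - y) * v r y \<omega>)\<bar> ^ q) \<partial>M) \<le> ennreal (N ^ q * \<kappa>)"
proof -
  let ?L = "lborel :: (real \<times> (real ^ 'k)) measure"
  note [measurable] = measurable_curried3[OF v]
  have Lp: "lborel \<Otimes>\<^sub>M lborel = ?L" by (rule lborel_prod)
  have sf: "sigma_finite_measure ?L" ..
  have vm: "(\<lambda>(w, \<omega>). v (fst w) (snd w) \<omega>) \<in> borel_measurable (?L \<Otimes>\<^sub>M M)"
    unfolding Lp[symmetric] split_beta' by measurable
  define a where "a = (\<lambda>\<tau> z (w :: real \<times> (real ^ 'k)). indicator {0<..\<tau>} (fst w) * mild_kernel \<tau> z (fst w) (snd w))"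
  have a_meas [measurable]: "a \<tau> z \<in> borel_measurable ?L" for \<tau> z
    unfolding a_def Lp[symmetric] by measurable
  have a_nn: "0 \<le> a \<tau> z w" for \<tau> z w by (simp add: a_def mild_kernel_def heat_kernel_nonneg)
  have fub: "(\<integral>\<^sup>+w. f (fst w) (snd w) \<partial>?L) = (\<integral>\<^sup>+r. (\<integral>\<^sup>+y. f r y \<partial>lborel) \<partial>lborel)"
    if "(\<lambda>w. f (fst w) (snd w)) \<in> borel_measurable (borel \<Otimes>\<^sub>M borel)" for f :: "real \<Rightarrow> real ^ 'k \<Rightarrow> ennreal"
  proof -
    have "(\<lambda>w. f (fst w) (snd w)) \<in> borel_measurable (lborel \<Otimes>\<^sub>M lborel)" using that by (simp add: lborel_prod borel_prod)
    from lborel.nn_integral_fst[OF this] show ?thesis by (simp add: lborel_prod)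
  qed
  have rep: "AE \<omega> in M. integrable ?L (\<lambda>w. a \<tau> z w * v (fst w) (snd w) \<omega>) \<and>
      (LINT r:{0..\<tau>}|lborel. LINT y|lborel. heat_kernel (\<tau> - r) (z - y) * v r y \<omega>) = (\<integral>w. a \<tau> z w * v (fst w) (snd w) \<omega> \<partial>?L)"
    if \<tau>: "\<tau> \<le> t" and fin: "(\<integral>\<^sup>+r. (\<integral>\<^sup>+y. ennreal (indicator {0<..\<tau>} r * mild_kernel \<tau> z r y) \<partial>lborel) \<partial>lborel) < \<infinity>" for \<tau> z
  proof -
    have "(\<integral>\<^sup>+w. ennreal (a \<tau> z w) \<partial>?L) = (\<integral>\<^sup>+r. (\<integral>\<^sup>+y. ennreal (indicator {0<..\<tau>} r * mild_kernel \<tau> z r y) \<partial>lborel) \<partial>lborel)"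
      unfolding a_def by (rule fub) measurable
    then have "(\<integral>\<^sup>+w. ennreal (a \<tau> z w) \<partial>?L) < top" using fin by simp
    \<comment> \<open>The mass \<open>A\<close> may be zero, so \<open>A + 1\<close> serves as the
      positive bound below.\<close>
    then obtain A where A: "(\<integral>\<^sup>+w. ennreal (a \<tau> z w) \<partial>?L) = ennreal A" "0 \<le> A"
      unfolding less_top_ennreal by blast
    have "(\<integral>\<^sup>+\<omega>. (\<integral>\<^sup>+w. ennreal (a \<tau> z w * \<bar>v (fst w) (snd w) \<omega>\<bar>) \<partial>?L) ^ q \<partial>M) \<le> ennreal ((A + 1) ^ q * \<kappa>)"
    proof (rule nn_integral_nn_integral_power_le[OF sf a_meas vm a_nn _ _ q _ \<kappa>(2)])
      show "(\<integral>\<^sup>+w. ennreal (a \<tau> z w) \<partial>?L) \<le> ennreal (A + 1)" unfolding A(1) by (intro ennreal_leI) simp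
      fix w assume "a \<tau> z w \<noteq> 0"
      then have "0 < fst w" "fst w \<le> t" using \<tau> by (auto simp: a_def indicator_def split: if_splits)
      then show "(\<integral>\<^sup>+\<omega>. ennreal (\<bar>v (fst w) (snd w) \<omega>\<bar> ^ q) \<partial>M) \<le> ennreal \<kappa>" by (rule \<kappa>(1))
    qed (use A in auto)
    also have "\<dots> < \<infinity>" by simp
    finally have "(\<integral>\<^sup>+\<omega>. (\<integral>\<^sup>+w. ennreal (a \<tau> z w * \<bar>v (fst w) (snd w) \<omega>\<bar>) \<partial>?L) ^ q \<partial>M) \<noteq> \<infinity>" by simp
    moreover have "(\<lambda>\<omega>. (\<integral>\<^sup>+w. ennreal (a \<tau> z w * \<bar>v (fst w) (snd w) \<omega>\<bar>) \<partial>?L) ^ q) \<in> borel_measurable M"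
    proof -
      have "(\<lambda>(\<omega>, w). ennreal (a \<tau> z w * \<bar>v (fst w) (snd w) \<omega>\<bar>)) \<in> borel_measurable (M \<Otimes>\<^sub>M ?L)"
        using a_meas[of \<tau> z] unfolding Lp[symmetric] split_beta' by measurable
      from lborel.borel_measurable_nn_integral[OF this]
      have [measurable]: "(\<lambda>\<omega>. \<integral>\<^sup>+w. ennreal (a \<tau> z w * \<bar>v (fst w) (snd w) \<omega>\<bar>) \<partial>?L) \<in> borel_measurable M" .
      show ?thesis by measurable
    qed
    ultimately have "AE \<omega> in M. (\<integral>\<^sup>+w. ennreal (a \<tau> z w * \<bar>v (fst w) (snd w) \<omega>\<bar>) \<partial>?L) ^ q \<noteq> \<infinity>"
      by (intro nn_integral_PInf_AE)
    then show ?thesis using AE_space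
    proof eventually_elim
      case (elim \<omega>)
      have vs: "(\<lambda>w. v (fst w) (snd w) \<omega>) \<in> borel_measurable ?L"
        unfolding Lp[symmetric] using elim(2) by measurable
      have fin': "(\<integral>\<^sup>+w. ennreal (a \<tau> z w * \<bar>v (fst w) (snd w) \<omega>\<bar>) \<partial>?L) < \<infinity>"
        using elim(1) q by (auto simp: less_top power_eq_top_ennreal_iff)
      have int: "integrable ?L (\<lambda>w. a \<tau> z w * v (fst w) (snd w) \<omega>)"
        using vs fin' a_nn by (intro integrableI_bounded) (auto simp: abs_mult)
      have m1: "(\<lambda>w. a \<tau> z w * v (fst w) (snd w) \<omega>) \<in> borel_measurable (lborel \<Otimes>\<^sub>M lborel)"
        unfolding Lp using vs by measurable
      have "(\<integral>w. a \<tau> z w * v (fst w) (snd w) \<omega> \<partial>?L) = (\<integral>r. (\<integral>y. a \<tau> z (r, y) * v r y \<omega> \<partial>lborel) \<partial>lborel)"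
        using lborel_pair.integral_fst[of "\<lambda>r y. a \<tau> z (r, y) * v r y \<omega>"] int
        by (simp add: Lp split_beta')
      also have "\<dots> = (\<integral>r. indicator {0..\<tau>} r *\<^sub>R (\<integral>y. heat_kernel (\<tau> - r) (z - y) * v r y \<omega> \<partial>lborel) \<partial>lborel)"
      proof (rule integral_cong_AE)
        have "(\<lambda>(r, y). a \<tau> z (r, y) * v r y \<omega>) \<in> borel_measurable (lborel \<Otimes>\<^sub>M lborel)"
          using m1 by (simp add: split_beta')
        then show "(\<lambda>r. \<integral>y. a \<tau> z (r, y) * v r y \<omega> \<partial>lborel) \<in> borel_measurable lborel"
          by (rule lborel.borel_measurable_lebesgue_integral)
        have "(\<lambda>(r, y). heat_kernel (\<tau> - r) (z - y) * v r y \<omega>) \<in> borel_measurable (lborel \<Otimes>\<^sub>M lborel)"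
          using elim(2) unfolding split_beta' by measurable
        from lborel.borel_measurable_lebesgue_integral[OF this]
        show "(\<lambda>r. indicator {0..\<tau>} r *\<^sub>R (\<integral>y. heat_kernel (\<tau> - r) (z - y) * v r y \<omega> \<partial>lborel)) \<in> borel_measurable lborel"
          by measurable
        \<comment> \<open>The two sets of times differ at 0 only.\<close>
        show "AE r in lborel. (\<integral>y. a \<tau> z (r, y) * v r y \<omega> \<partial>lborel) = indicator {0..\<tau>} r *\<^sub>R (\<integral>y. heat_kernel (\<tau> - r) (z - y) * v r y \<omega> \<partial>lborel)"
          using AE_lborel_singleton[of 0]
        proof eventually_elim
          case (elim r)
          then show ?case
            by (cases "0 < r \<and> r \<le> \<tau>") (auto simp: a_def mild_kernel_def indicator_def)
        qed
      qed
      finally show ?case using int by (simp add: set_lebesgue_integral_def)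
    qed
  qed
  define b where "b = (\<lambda>w. indicator {0<..t} (fst w) * \<bar>mild_kernel t x (fst w) (snd w) - mild_kernel s x' (fst w) (snd w)\<bar>)"
  have b_meas: "b \<in> borel_measurable ?L" unfolding b_def Lp[symmetric] by measurable
  \<comment> \<open>Although the two weights live on different time intervals, the zero extension
    makes their difference the kernel increment.\<close>
  have ab: "\<bar>a t x w - a s x' w\<bar> = b w" for w
    using st by (auto simp: a_def b_def mild_kernel_def indicator_def)
  have "(\<integral>\<^sup>+\<omega>. ennreal (\<bar>(LINT r:{0..t}|lborel. LINT y|lborel. heat_kernel (t - r) (x - y) * v r y \<omega>)
      - (LINT r:{0..s}|lborel. LINT y|lborel. heat_kernel (s - r) (x' - y) * v r y \<omega>)\<bar> ^ q) \<partial>M)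
    \<le> (\<integral>\<^sup>+\<omega>. (\<integral>\<^sup>+w. ennreal (b w * \<bar>v (fst w) (snd w) \<omega>\<bar>) \<partial>?L) ^ q \<partial>M)"
  proof (rule nn_integral_mono_AE, use rep[OF order_refl fin(1)] rep[OF st(2) fin(2)] in eventually_elim)
    case (elim \<omega>)
    let ?d = "\<lambda>w. a t x w * v (fst w) (snd w) \<omega> - a s x' w * v (fst w) (snd w) \<omega>"
    have int: "integrable ?L ?d" using elim by (intro Bochner_Integration.integrable_diff) auto
    have "ennreal \<bar>(\<integral>w. a t x w * v (fst w) (snd w) \<omega> \<partial>?L) - (\<integral>w. a s x' w * v (fst w) (snd w) \<omega> \<partial>?L)\<bar> = ennreal (norm (\<integral>w. ?d w \<partial>?L))"
      using elim by simp
    also have "\<dots> \<le> (\<integral>\<^sup>+w. ennreal (norm (?d w)) \<partial>?L)" by (rule integral_norm_bound_ennreal[OF int])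
    also have "\<dots> = (\<integral>\<^sup>+w. ennreal (b w * \<bar>v (fst w) (snd w) \<omega>\<bar>) \<partial>?L)"
      unfolding ab[symmetric] by (simp add: abs_mult[symmetric] left_diff_distrib)
    finally show ?case using elim by (simp add: power_mono flip: ennreal_power)
  qed
  also have "\<dots> \<le> ennreal (N ^ q * \<kappa>)"
  proof (rule nn_integral_nn_integral_power_le[OF sf b_meas vm _ _ N(2) q _ \<kappa>(2)])
    show "(\<integral>\<^sup>+w. ennreal (b w) \<partial>?L) \<le> ennreal N"
      unfolding b_def by (subst fub) (use N in auto)
    fix w assume "b w \<noteq> 0"
    then have "0 < fst w" "fst w \<le> t" by (auto simp: b_def indicator_def split: if_splits)
    then show "(\<integral>\<^sup>+\<omega>. ennreal (\<bar>v (fst w) (snd w) \<omega>\<bar> ^ q) \<partial>M) \<le> ennreal \<kappa>" by (rule \<kappa>(1))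
  qed (auto simp: b_def)
  finally show ?thesis .
qed

section \<open>Increments of the solution\<close>

lemma add_power_le:
  fixes a c :: real
  assumes "0 \<le> a" "0 \<le> c"
  shows "(a + c) ^ q \<le> 2 ^ q * (a ^ q + c ^ q)"
proof -
  have "(a + c) ^ q \<le> (2 * max a c) ^ q" using assms by (intro power_mono) auto
  also have "\<dots> = 2 ^ q * max a c ^ q" by (rule power_mult_distrib)
  also have "\<dots> \<le> 2 ^ q * (a ^ q + c ^ q)" using assms by (intro mult_left_mono) (auto simp: max_def)
  finally show ?thesis .
qed

lemma norm_power_le_components:
  fixes v :: "real ^ 'd"
  assumes "0 < q"
  shows "norm v ^ q \<le> real CARD('d) ^ q * (\<Sum>i\<in>UNIV. \<bar>v $ i\<bar> ^ q)"
proof -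
  have "norm v ^ q \<le> (\<Sum>i\<in>UNIV. \<bar>v $ i\<bar>) ^ q" by (intro power_mono norm_le_l1_cart) auto
  also have "\<dots> = \<bar>\<Sum>i\<in>UNIV. \<bar>v $ i\<bar>\<bar> ^ q" by (simp add: sum_nonneg)
  also have "\<dots> \<le> real CARD('d) ^ q * (\<Sum>i\<in>UNIV. \<bar>\<bar>v $ i\<bar>\<bar> ^ q)"
    by (rule abs_sum_power_le) (use assms in auto)
  finally show ?thesis by simp
qed

text \<open>A Lipschitz function grows at most linearly, so its moments along the solution inherit
  the bounds of the solution, uniformly in space and time.\<close>

lemma lipschitz_moment_bounded:
  fixes u :: "real \<Rightarrow> real ^ 'k \<Rightarrow> 'w \<Rightarrow> real ^ 'd" and f :: "real ^ 'd \<Rightarrow> real"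
  assumes P: "prob_space P" and u: "bounded_moments P u" and L: "L-lipschitz_on UNIV f"
    and meas: "\<And>r y. 0 \<le> r \<Longrightarrow> u r y \<in> borel_measurable P" and T: "0 < T" and q: "0 < q"
  shows "\<exists>\<kappa>\<ge>0. \<forall>r y. 0 \<le> r \<and> r \<le> T \<longrightarrow> (\<integral>\<^sup>+\<omega>. ennreal (\<bar>f (u r y \<omega>)\<bar> ^ q) \<partial>P) \<le> ennreal \<kappa>"
proof -
  interpret prob_space P by (rule P)
  have L0: "0 \<le> L" using L by (rule lipschitz_on_nonneg)
  have "\<exists>B\<ge>0. \<forall>r y. 0 \<le> r \<and> r \<le> T \<longrightarrow> (\<integral>\<^sup>+\<omega>. ennreal (\<bar>u r y \<omega> $ i\<bar> ^ q) \<partial>P) \<le> ennreal B" for i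
  proof -
    define S where "S = (SUP (t, x)\<in>{0..T} \<times> UNIV. \<integral>\<^sup>+\<omega>. ennreal (\<bar>u t x \<omega> $ i\<bar> powr real q) \<partial>P)"
    have "S < \<infinity>" using u T q unfolding bounded_moments_def S_def by (auto dest!: spec[of _ T] spec[of _ "real q"])
    then obtain B where B: "S = ennreal B" "0 \<le> B" by (auto simp: less_top_ennreal)
    have "(\<integral>\<^sup>+\<omega>. ennreal (\<bar>u r y \<omega> $ i\<bar> ^ q) \<partial>P) \<le> ennreal B" if "0 \<le> r" "r \<le> T" for r y
    proof -
      have "(\<integral>\<^sup>+\<omega>. ennreal (\<bar>u r y \<omega> $ i\<bar> ^ q) \<partial>P) = (\<integral>\<^sup>+\<omega>. ennreal (\<bar>u r y \<omega> $ i\<bar> powr real q) \<partial>P)"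
        using q by (simp add: powr_realpow')
      also have "\<dots> \<le> S" unfolding S_def by (rule SUP_upper2[of "(r, y)"]) (use that in auto)
      finally show ?thesis by (simp add: B)
    qed
    with B(2) show ?thesis by blast
  qed
  then obtain B where B: "\<And>i. 0 \<le> B i" "\<And>i r y. 0 \<le> r \<Longrightarrow> r \<le> T \<Longrightarrow> (\<integral>\<^sup>+\<omega>. ennreal (\<bar>u r y \<omega> $ i\<bar> ^ q) \<partial>P) \<le> ennreal (B i)"
    by metis
  define \<kappa> where "\<kappa> = 2 ^ q * (\<bar>f 0\<bar> ^ q + (L ^ q * real CARD('d) ^ q) * (\<Sum>i\<in>UNIV. B i))"
  have "0 \<le> \<kappa>" using L0 B(1) by (auto simp: \<kappa>_def intro!: mult_nonneg_nonneg add_nonneg_nonneg sum_nonneg)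
  moreover have "(\<integral>\<^sup>+\<omega>. ennreal (\<bar>f (u r y \<omega>)\<bar> ^ q) \<partial>P) \<le> ennreal \<kappa>" if r: "0 \<le> r" "r \<le> T" for r y
  proof -
    have [measurable]: "(\<lambda>\<omega>. u r y \<omega> $ i) \<in> borel_measurable P" for i
      using measurable_compose[OF meas[OF r(1), of y], of "\<lambda>v. v $ i" borel] borel_measurable_continuous_onI[of "\<lambda>v :: real ^ 'd. v $ i"]
      by (auto intro: continuous_intros)
    have pt: "\<bar>f v\<bar> ^ q \<le> 2 ^ q * (\<bar>f 0\<bar> ^ q + (L ^ q * real CARD('d) ^ q) * (\<Sum>i\<in>UNIV. \<bar>v $ i\<bar> ^ q))" for v
    proof -
      have "\<bar>f v\<bar> \<le> \<bar>f 0\<bar> + L * norm v"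
        using lipschitz_onD[OF L, of v 0] by (simp add: dist_norm)
      then have "\<bar>f v\<bar> ^ q \<le> (\<bar>f 0\<bar> + L * norm v) ^ q" by (intro power_mono) auto
      also have "\<dots> \<le> 2 ^ q * (\<bar>f 0\<bar> ^ q + (L * norm v) ^ q)" using L0 by (intro add_power_le) auto
      also have "\<dots> \<le> 2 ^ q * (\<bar>f 0\<bar> ^ q + L ^ q * (real CARD('d) ^ q * (\<Sum>i\<in>UNIV. \<bar>v $ i\<bar> ^ q)))"
        unfolding power_mult_distrib using L0 q
        by (intro mult_left_mono add_left_mono norm_power_le_components) auto
      finally show ?thesis by (simp add: mult.assoc)
    qed
    have "(\<integral>\<^sup>+\<omega>. ennreal (\<bar>f (u r y \<omega>)\<bar> ^ q) \<partial>P)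
      \<le> (\<integral>\<^sup>+\<omega>. ennreal (2 ^ q * \<bar>f 0\<bar> ^ q) + ennreal (2 ^ q * (L ^ q * real CARD('d) ^ q)) * (\<Sum>i\<in>UNIV. ennreal (\<bar>u r y \<omega> $ i\<bar> ^ q)) \<partial>P)"
    proof (rule nn_integral_mono)
      fix \<omega>
      show "ennreal (\<bar>f (u r y \<omega>)\<bar> ^ q) \<le> ennreal (2 ^ q * \<bar>f 0\<bar> ^ q) + ennreal (2 ^ q * (L ^ q * real CARD('d) ^ q)) * (\<Sum>i\<in>UNIV. ennreal (\<bar>u r y \<omega> $ i\<bar> ^ q))"
        using ennreal_leI[OF pt[of "u r y \<omega>"]] L0
        by (simp add: sum_nonneg distrib_left ennreal_plus ennreal_mult' mult.assoc)
    qed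
    also have "\<dots> = ennreal (2 ^ q * \<bar>f 0\<bar> ^ q) + ennreal (2 ^ q * (L ^ q * real CARD('d) ^ q)) * (\<Sum>i\<in>UNIV. \<integral>\<^sup>+\<omega>. ennreal (\<bar>u r y \<omega> $ i\<bar> ^ q) \<partial>P)"
      by (simp add: nn_integral_add nn_integral_cmult nn_integral_sum emeasure_space_1 del: sum_ennreal)
    also have "\<dots> \<le> ennreal (2 ^ q * \<bar>f 0\<bar> ^ q) + ennreal (2 ^ q * (L ^ q * real CARD('d) ^ q)) * (\<Sum>i\<in>UNIV. ennreal (B i))"
      by (intro add_left_mono mult_left_mono sum_mono B r) auto
    also have "\<dots> = ennreal \<kappa>"
      using B(1) L0 by (simp add: \<kappa>_def sum_nonneg ennreal_mult'[symmetric] ennreal_plus[symmetric] distrib_left mult.assoc del: ennreal_plus)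
    finally show ?thesis .
  qed
  ultimately show ?thesis by blast
qed

text \<open>The mass of one kernel is that of an increment with s = 0, since the kernel with final
  time 0 vanishes at positive times. The horizon t + 1 is positive also for t = 0.\<close>

lemma kernel_integral_finite:
  fixes x :: "real ^ 'k"
  assumes "0 < \<beta>" "\<beta> < 2" "\<beta> < real CARD('k)" "0 \<le> t"
  shows "(\<integral>\<^sup>+r. (\<integral>\<^sup>+y. ennreal (indicator {0<..t} r * mild_kernel t x r y) \<partial>lborel) \<partial>lborel) < \<infinity>"
proof -
  obtain C where C: "\<And>s \<tau> (x :: real ^ 'k) x'. 0 \<le> s \<and> s \<le> \<tau> \<and> \<tau> \<le> t + 1 \<Longrightarrow>
     (\<integral>\<^sup>+r. (\<integral>\<^sup>+y. ennreal (indicator {0<..\<tau>} r * \<bar>mild_kernel \<tau> x r y - mild_kernel s x' r y\<bar>) \<partial>lborel) \<partial>lborel)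
       \<le> ennreal (C * sqrt (\<bar>\<tau> - s\<bar> powr ((2 - \<beta>) / 2) + norm (x - x') powr (2 - \<beta>)))"
    using kernel_increment_bounds[OF assms(1-3), of "t + 1"] assms(4) by fastforce
  have "(\<integral>\<^sup>+r. (\<integral>\<^sup>+y. ennreal (indicator {0<..t} r * mild_kernel t x r y) \<partial>lborel) \<partial>lborel)
    = (\<integral>\<^sup>+r. (\<integral>\<^sup>+y. ennreal (indicator {0<..t} r * \<bar>mild_kernel t x r y - mild_kernel 0 x r y\<bar>) \<partial>lborel) \<partial>lborel)"
    by (intro nn_integral_cong) (auto simp: mild_kernel_def indicator_def heat_kernel_nonneg)
  also have "\<dots> < \<infinity>" using C[of 0 t x x] assms(4) by (auto intro: le_less_trans)
  finally show ?thesis .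
qed

theorem theorem1p1:
  fixes P :: "'w measure"
    and \<beta> :: real
    and \<sigma> :: "'d::finite \<Rightarrow> 'd \<Rightarrow> real ^ 'd \<Rightarrow> real"
    and b :: "'d \<Rightarrow> real ^ 'd \<Rightarrow> real"
    and F :: "(real \<times> (real ^ 'k::finite) \<Rightarrow> real) \<Rightarrow> 'w \<Rightarrow> real ^ 'd"
    and M :: "real \<Rightarrow> (real ^ 'k) set \<Rightarrow> 'w \<Rightarrow> real ^ 'd"
    and u :: "real \<Rightarrow> real ^ 'k \<Rightarrow> 'w \<Rightarrow> real ^ 'd"
  assumes "prob_space P"
    and "0 < \<beta>" and "\<beta> < min 2 (real CARD('k))"
    and "\<And>i j. \<exists>L. L-lipschitz_on UNIV (\<sigma> i j)"
    and "\<And>i. \<exists>L. L-lipschitz_on UNIV (b i)"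
    and "gaussian_noise P \<beta> F"
    and "noise_martingale_measure P \<beta> F M"
    and "mild_solution P \<beta> M \<sigma> b u"
    and "L2_continuous P u"
    and "bounded_moments P u"
  shows "\<forall>T>0. \<forall>p\<ge>2. \<exists>C>0. \<forall>s t x y. 0 \<le> s \<and> s \<le> t \<and> t \<le> T \<longrightarrow>
    (\<integral>\<^sup>+\<omega>. ennreal (norm (u t x \<omega> - u s y \<omega>) powr p) \<partial>P)
      \<le> ennreal (C * (\<bar>t - s\<bar> powr ((2 - \<beta>) / 2) + norm (x - y) powr (2 - \<beta>)) powr (p / 2))"
proof (intro allI impI)
  fix T p :: real assume T: "0 < T" and p: "2 \<le> p"
  interpret prob_space P by fact
  have \<beta>: "0 < \<beta>" "\<beta> < 2" "\<beta> < real CARD('k)" using assms(2,3) by auto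
  note noise = noise_fourth_moment_martingale_measure[OF assms(1,6,7)]
  have u_joint: "(\<lambda>(t, x, \<omega>). u t x \<omega>) \<in> borel_measurable (restrict_space borel {0..} \<Otimes>\<^sub>M (borel \<Otimes>\<^sub>M P))"
    using assms(8) by (simp add: mild_solution_def)
  have u_meas: "u r y \<in> borel_measurable P" if "0 \<le> r" for r y
  proof -
    interpret worthy_measure P "natural_filtration P M" "\<lambda>t A \<omega>. M t A \<omega> $ undefined" "noise_dominating_measure \<beta>"
      using noise[of undefined] by (simp add: fourth_moment_martingale_measure_def)
    have "u r y \<in> borel_measurable (natural_filtration P M r)" using assms(8) that by (simp add: mild_solution_def)
    then show ?thesis by (rule measurable_from_subalg[OF subalg[OF that]])
  qed
  \<comment> \<open>The moment bounds are for even exponents: \<open>q\<close> is an even integer at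
    least p, and the return to the real exponent p comes last.\<close>
  define m where "m = nat \<lceil>p\<rceil>"
  define q where "q = 2 * m"
  have m: "1 \<le> m" "p \<le> real q" using p by (auto simp: m_def q_def) linarith+
  have q: "0 < q" using m by (simp add: q_def)
  have "\<forall>i j. \<exists>\<kappa>\<ge>0. \<forall>r y. 0 \<le> r \<and> r \<le> T \<longrightarrow> (\<integral>\<^sup>+\<omega>. ennreal (\<bar>\<sigma> i j (u r y \<omega>)\<bar> ^ q) \<partial>P) \<le> ennreal \<kappa>"
    using lipschitz_moment_bounded[OF assms(1,10) _ u_meas T q] assms(4) by meson
  then obtain \<kappa>\<sigma> where \<kappa>\<sigma>: "\<And>i j. 0 \<le> \<kappa>\<sigma> i j"
     "\<And>i j r y. 0 \<le> r \<Longrightarrow> r \<le> T \<Longrightarrow> (\<integral>\<^sup>+\<omega>. ennreal (\<bar>\<sigma> i j (u r y \<omega>)\<bar> ^ q) \<partial>P) \<le> ennreal (\<kappa>\<sigma> i j)" by metis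
  have "\<forall>i. \<exists>\<kappa>\<ge>0. \<forall>r y. 0 \<le> r \<and> r \<le> T \<longrightarrow> (\<integral>\<^sup>+\<omega>. ennreal (\<bar>b i (u r y \<omega>)\<bar> ^ q) \<partial>P) \<le> ennreal \<kappa>"
    using lipschitz_moment_bounded[OF assms(1,10) _ u_meas T q] assms(5) by meson
  then obtain \<kappa>b where \<kappa>b: "\<And>i. 0 \<le> \<kappa>b i"
     "\<And>i r y. 0 \<le> r \<Longrightarrow> r \<le> T \<Longrightarrow> (\<integral>\<^sup>+\<omega>. ennreal (\<bar>b i (u r y \<omega>)\<bar> ^ q) \<partial>P) \<le> ennreal (\<kappa>b i)" by metis
  define \<kappa> where "\<kappa> = (\<Sum>i\<in>UNIV. \<Sum>j\<in>UNIV. \<kappa>\<sigma> i j) + (\<Sum>i\<in>UNIV. \<kappa>b i)"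
  have \<kappa>0: "0 \<le> \<kappa>" unfolding \<kappa>_def using \<kappa>\<sigma>(1) \<kappa>b(1) by (intro add_nonneg_nonneg sum_nonneg) auto
  have \<kappa>\<sigma>_le: "\<kappa>\<sigma> i j \<le> \<kappa>" for i j
  proof -
    have "\<kappa>\<sigma> i j \<le> (\<Sum>j\<in>UNIV. \<kappa>\<sigma> i j)" using \<kappa>\<sigma>(1) by (intro member_le_sum) auto
    also have "\<dots> \<le> (\<Sum>i\<in>UNIV. \<Sum>j\<in>UNIV. \<kappa>\<sigma> i j)" using \<kappa>\<sigma>(1) by (intro member_le_sum[where f = "\<lambda>i. \<Sum>j\<in>UNIV. \<kappa>\<sigma> i j"] sum_nonneg) auto
    also have "\<dots> \<le> \<kappa>" unfolding \<kappa>_def using \<kappa>b(1) by (simp add: sum_nonneg)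
    finally show ?thesis .
  qed
  have \<kappa>b_le: "\<kappa>b i \<le> \<kappa>" for i
  proof -
    have "\<kappa>b i \<le> (\<Sum>i\<in>UNIV. \<kappa>b i)" using \<kappa>b(1) by (intro member_le_sum) auto
    also have "\<dots> \<le> \<kappa>" unfolding \<kappa>_def using \<kappa>\<sigma>(1) by (simp add: sum_nonneg)
    finally show ?thesis .
  qed
  obtain C0 where C0: "C0 > 0" and ker: "\<And>s t (x :: real ^ 'k) x'. 0 \<le> s \<and> s \<le> t \<and> t \<le> T \<Longrightarrow>
     (\<integral>\<^sup>+(r, y, z). ennreal (indicator {0<..t} r * (\<bar>mild_kernel t x r y - mild_kernel s x' r y\<bar> * \<bar>mild_kernel t x r z - mild_kernel s x' r z\<bar>)) \<partial>noise_dominating_measure \<beta>)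
       \<le> ennreal (C0 * (\<bar>t - s\<bar> powr ((2 - \<beta>) / 2) + norm (x - x') powr (2 - \<beta>))) \<and>
     (\<integral>\<^sup>+r. (\<integral>\<^sup>+y. ennreal (indicator {0<..t} r * \<bar>mild_kernel t x r y - mild_kernel s x' r y\<bar>) \<partial>lborel) \<partial>lborel)
       \<le> ennreal (C0 * sqrt (\<bar>t - s\<bar> powr ((2 - \<beta>) / 2) + norm (x - x') powr (2 - \<beta>)))"
    using kernel_increment_bounds[OF \<beta> T] by blast
  \<comment> \<open>\<open>C1\<close> is the bound for one Walsh integral with B = C0 \<Theta>, and
    \<open>C2\<close> that for the drift. \<open>C3\<close> collects the Walsh integrals and the
    drift in one component, \<open>C4\<close> the components.\<close>
  define C1 where "C1 = 2 * (4 * (real m * real (2 * m - 1)) * C0) ^ m * \<kappa>"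
  define C2 where "C2 = C0 ^ q * \<kappa>"
  define C3 where "C3 = 2 ^ q * (real CARD('d) ^ q * (real CARD('d) * C1) + C2)"
  define C4 where "C4 = real CARD('d) ^ q * (real CARD('d) * C3)"
  have Cs: "0 \<le> C1" "0 \<le> C2" "0 \<le> C3" "0 \<le> C4"
    using C0 \<kappa>0 by (auto simp: C1_def C2_def C3_def C4_def intro!: mult_nonneg_nonneg add_nonneg_nonneg)
  show "\<exists>C>0. \<forall>s t x y. 0 \<le> s \<and> s \<le> t \<and> t \<le> T \<longrightarrow>
    (\<integral>\<^sup>+\<omega>. ennreal (norm (u t x \<omega> - u s y \<omega>) powr p) \<partial>P)
      \<le> ennreal (C * (\<bar>t - s\<bar> powr ((2 - \<beta>) / 2) + norm (x - y) powr (2 - \<beta>)) powr (p / 2))"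
  proof (intro exI[of _ "1 + C4"] conjI allI impI)
    show "0 < 1 + C4" using Cs by simp
    fix s t and x y :: "real ^ 'k"
    assume "0 \<le> s \<and> s \<le> t \<and> t \<le> T"
    then have st: "0 \<le> s" "s \<le> t" "t \<le> T" "0 \<le> t" by auto
    define \<Theta> where "\<Theta> = \<bar>t - s\<bar> powr ((2 - \<beta>) / 2) + norm (x - y) powr (2 - \<beta>)"
    have \<Theta>0: "0 \<le> \<Theta>" by (simp add: \<Theta>_def)
    have "(\<integral>\<^sup>+\<omega>. ennreal (norm (u t x \<omega> - u s y \<omega>) powr p) \<partial>P) \<le> ennreal ((1 + C4) * \<Theta> powr (p / 2))"
    \<comment> \<open>The energy bound is inverted in the parameter of Young's inequality and has to
      be positive. For \<Theta> = 0 the two space-time points coincide and the increment is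
      zero.\<close>
    proof (cases "\<Theta> = 0")
      case True
      then have "\<bar>t - s\<bar> powr ((2 - \<beta>) / 2) = 0" "norm (x - y) powr (2 - \<beta>) = 0"
        unfolding \<Theta>_def by (simp_all add: add_nonneg_eq_0_iff)
      then have "t = s" "x = y" by auto
      then show ?thesis by simp
    next
      case False
      then have \<Theta>: "0 < \<Theta>" using \<Theta>0 by simp
      have comp_meas [measurable]: "(\<lambda>\<omega>. u r z \<omega> $ i) \<in> borel_measurable P" if "0 \<le> r" for r z i
        using measurable_compose[OF u_meas[OF that, of z], of "\<lambda>v. v $ i" borel] borel_measurable_continuous_onI[of "\<lambda>v :: real ^ 'd. v $ i"]
        by (auto intro: continuous_intros)
      have lip_meas: "(\<lambda>(r, z, \<omega>). indicator {0..} r * f (u r z \<omega>)) \<in> borel_measurable (borel \<Otimes>\<^sub>M (borel \<Otimes>\<^sub>M P))"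
        if "\<exists>L. L-lipschitz_on UNIV f" for f :: "real ^ 'd \<Rightarrow> real"
      proof (rule clamp_measurable)
        have "f \<in> borel_measurable borel" using that lipschitz_on_continuous_on by (blast intro: borel_measurable_continuous_onI)
        from measurable_compose[OF u_joint this]
        show "(\<lambda>(r, z, \<omega>). f (u r z \<omega>)) \<in> borel_measurable (restrict_space borel {0..} \<Otimes>\<^sub>M (borel \<Otimes>\<^sub>M P))"
          by (simp add: split_beta')
      qed simp
      have component: "(\<integral>\<^sup>+\<omega>. ennreal (\<bar>u t x \<omega> $ i - u s y \<omega> $ i\<bar> ^ q) \<partial>P) \<le> ennreal (C3 * \<Theta> ^ m)" for i
      proof -
        have mild: "\<exists>Z. (\<forall>j. has_walsh_integral P (natural_filtration P M) (\<lambda>s A \<omega>. M s A \<omega> $ j) (\<lambda>_. noise_dominating_measure \<beta>) t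
               (\<lambda>s y \<omega>. heat_kernel (t - s) (x - y) * \<sigma> i j (u s y \<omega>)) (Z j)) \<and>
           (AE \<omega> in P. u t x \<omega> $ i = (\<Sum>j\<in>UNIV. Z j \<omega>) + (LINT s:{0..t}|lborel. LINT y|lborel. heat_kernel (t - s) (x - y) * b i (u s y \<omega>)))"
          if "0 \<le> t" for t x
          using assms(8) that unfolding mild_solution_def by blast
        obtain Z where Z: "\<And>j. has_walsh_integral P (natural_filtration P M) (\<lambda>s A \<omega>. M s A \<omega> $ j) (\<lambda>_. noise_dominating_measure \<beta>) t
               (\<lambda>s y \<omega>. heat_kernel (t - s) (x - y) * \<sigma> i j (u s y \<omega>)) (Z j)"
          and Zu: "AE \<omega> in P. u t x \<omega> $ i = (\<Sum>j\<in>UNIV. Z j \<omega>) + (LINT s:{0..t}|lborel. LINT y|lborel. heat_kernel (t - s) (x - y) * b i (u s y \<omega>))"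
          using mild[OF st(4), of x] by blast
        obtain Z' where Z': "\<And>j. has_walsh_integral P (natural_filtration P M) (\<lambda>s A \<omega>. M s A \<omega> $ j) (\<lambda>_. noise_dominating_measure \<beta>) s
               (\<lambda>r z \<omega>. heat_kernel (s - r) (y - z) * \<sigma> i j (u r z \<omega>)) (Z' j)"
          and Zu': "AE \<omega> in P. u s y \<omega> $ i = (\<Sum>j\<in>UNIV. Z' j \<omega>) + (LINT r:{0..s}|lborel. LINT z|lborel. heat_kernel (s - r) (y - z) * b i (u r z \<omega>))"
          using mild[OF st(1), of y] by blast
        have [measurable]: "Z j \<in> borel_measurable P" "Z' j \<in> borel_measurable P" for j
          using Z[of j] Z'[of j] unfolding has_walsh_integral_def by auto
        have Zj: "(\<integral>\<^sup>+\<omega>. ennreal (\<bar>Z j \<omega> - Z' j \<omega>\<bar> ^ q) \<partial>P) \<le> ennreal (C1 * \<Theta> ^ m)" for j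
        proof -
          interpret N: fourth_moment_martingale_measure P "natural_filtration P M" "\<lambda>t A \<omega>. M t A \<omega> $ j" "noise_dominating_measure \<beta>"
            by (rule noise)
          \<comment> \<open>Both integrands contain the same factor \<sigma>(u), so their difference
            is the kernel increment times this factor: the product form \<open>h V\<close> of the
            majorant.\<close>
          define V where "V = (\<lambda>r z \<omega>. \<bar>indicator {0..} r * \<sigma> i j (u r z \<omega>)\<bar>)"
          define h where "h = (\<lambda>r z. \<bar>mild_kernel t x r z - mild_kernel s y r z\<bar>)"
          have "(\<integral>\<^sup>+\<omega>. ennreal ((Z j \<omega> - Z' j \<omega>) ^ (2 * m)) \<partial>P) \<le> ennreal (2 * (4 * (real m * real (2 * m - 1)) * (C0 * \<Theta>)) ^ m * \<kappa>)"
          proof (rule N.walsh_increment_moment[OF st(1,2) Z Z' _ _ _ _ _ m(1) _ \<kappa>0, where V = V and h = h])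
            show "(\<lambda>(r, z, \<omega>). V r z \<omega>) \<in> borel_measurable (borel \<Otimes>\<^sub>M (borel \<Otimes>\<^sub>M P))"
              using borel_measurable_abs[OF lip_meas[OF assms(4)[of i j]]] by (simp add: V_def split_beta')
            show "(\<lambda>(r, z). h r z) \<in> borel_measurable borel"
              unfolding h_def borel_prod[symmetric] split_beta' by measurable
            show "\<bar>heat_kernel (t - r) (x - z) * \<sigma> i j (u r z \<omega>) - indicator {..s} r * (heat_kernel (s - r) (y - z) * \<sigma> i j (u r z \<omega>))\<bar> \<le> h r z * V r z \<omega>"
              if "0 < r" "r \<le> t" for r z \<omega>
            proof -
              have "heat_kernel (t - r) (x - z) * \<sigma> i j (u r z \<omega>) - indicator {..s} r * (heat_kernel (s - r) (y - z) * \<sigma> i j (u r z \<omega>))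
                 = (mild_kernel t x r z - mild_kernel s y r z) * (indicator {0..} r * \<sigma> i j (u r z \<omega>))"
                using that by (simp add: mild_kernel_def left_diff_distrib)
              then show ?thesis unfolding h_def V_def by (simp add: abs_mult)
            qed
            show "(\<integral>\<^sup>+\<omega>. ennreal (V r z \<omega> ^ (2 * m)) \<partial>P) \<le> ennreal \<kappa>" if "0 < r" "r \<le> t" for r z
            proof -
              have "(\<integral>\<^sup>+\<omega>. ennreal (V r z \<omega> ^ (2 * m)) \<partial>P) = (\<integral>\<^sup>+\<omega>. ennreal (\<bar>\<sigma> i j (u r z \<omega>)\<bar> ^ q) \<partial>P)"
                using that by (simp add: V_def q_def)
              also have "\<dots> \<le> ennreal (\<kappa>\<sigma> i j)" using that st by (intro \<kappa>\<sigma>(2)) auto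
              also have "\<dots> \<le> ennreal \<kappa>" by (intro ennreal_leI \<kappa>\<sigma>_le)
              finally show ?thesis .
            qed
            show "cross_energy (noise_dominating_measure \<beta>) 0 t h \<le> ennreal (C0 * \<Theta>)"
              unfolding cross_energy_def h_def abs_abs \<Theta>_def using ker[of s t x y] st by blast
            show "0 < C0 * \<Theta>" using C0 \<Theta> by simp
          qed (auto simp: h_def V_def)
          also have "2 * (4 * (real m * real (2 * m - 1)) * (C0 * \<Theta>)) ^ m * \<kappa> = C1 * \<Theta> ^ m"
            by (simp add: C1_def power_mult_distrib mult_ac)
          finally show ?thesis by (simp add: q_def power_even_abs)
        qed
        \<comment> \<open>The drift part, taken as what the stochastic part leaves of the increment:
          this makes it measurable at once, and it equals the difference of the drift integrals
          almost surely.\<close>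
        define D where "D = (\<lambda>\<omega>. u t x \<omega> $ i - u s y \<omega> $ i - (\<Sum>j\<in>UNIV. Z j \<omega> - Z' j \<omega>))"
        have [measurable]: "D \<in> borel_measurable P" unfolding D_def using st by measurable
        define v where "v = (\<lambda>r z \<omega>. indicator {0..} r * b i (u r z \<omega>))"
        have lint: "(LINT r:{0..\<tau>}|lborel. LINT z|lborel. heat_kernel (\<tau> - r) (w - z) * b i (u r z \<omega>))
            = (LINT r:{0..\<tau>}|lborel. LINT z|lborel. heat_kernel (\<tau> - r) (w - z) * v r z \<omega>)" for \<tau> w \<omega>
          unfolding set_lebesgue_integral_def by (intro Bochner_Integration.integral_cong refl) (auto simp: v_def indicator_def)
        have DE: "(\<integral>\<^sup>+\<omega>. ennreal (\<bar>D \<omega>\<bar> ^ q) \<partial>P) \<le> ennreal (C2 * \<Theta> ^ m)"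
        proof -
          have "(\<integral>\<^sup>+\<omega>. ennreal (\<bar>D \<omega>\<bar> ^ q) \<partial>P) = (\<integral>\<^sup>+\<omega>. ennreal (\<bar>(LINT r:{0..t}|lborel. LINT z|lborel. heat_kernel (t - r) (x - z) * v r z \<omega>)
             - (LINT r:{0..s}|lborel. LINT z|lborel. heat_kernel (s - r) (y - z) * v r z \<omega>)\<bar> ^ q) \<partial>P)"
            by (rule nn_integral_cong_AE, use Zu Zu' in eventually_elim) (simp add: D_def lint sum_subtractf)
          also have "\<dots> \<le> ennreal ((C0 * sqrt \<Theta>) ^ q * \<kappa>)"
          proof (rule drift_increment_moment[OF st(1,2)])
            show "(\<lambda>(r, z, \<omega>). v r z \<omega>) \<in> borel_measurable (borel \<Otimes>\<^sub>M (borel \<Otimes>\<^sub>M P))"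
              unfolding v_def by (rule lip_meas[OF assms(5)])
            show "(\<integral>\<^sup>+r. (\<integral>\<^sup>+z. ennreal (indicator {0<..t} r * \<bar>mild_kernel t x r z - mild_kernel s y r z\<bar>) \<partial>lborel) \<partial>lborel) \<le> ennreal (C0 * sqrt \<Theta>)"
              unfolding \<Theta>_def using ker[of s t x y] st by blast
            show "0 < C0 * sqrt \<Theta>" using C0 \<Theta> by simp
            show "(\<integral>\<^sup>+\<omega>. ennreal (\<bar>v r z \<omega>\<bar> ^ q) \<partial>P) \<le> ennreal \<kappa>" if "0 < r" "r \<le> t" for r z
            proof -
              have "(\<integral>\<^sup>+\<omega>. ennreal (\<bar>v r z \<omega>\<bar> ^ q) \<partial>P) = (\<integral>\<^sup>+\<omega>. ennreal (\<bar>b i (u r z \<omega>)\<bar> ^ q) \<partial>P)"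
                using that by (simp add: v_def)
              also have "\<dots> \<le> ennreal (\<kappa>b i)" using that st by (intro \<kappa>b(2)) auto
              also have "\<dots> \<le> ennreal \<kappa>" by (intro ennreal_leI \<kappa>b_le)
              finally show ?thesis .
            qed
          qed (use kernel_integral_finite[OF \<beta>] st q \<kappa>0 in auto)
          also have "(C0 * sqrt \<Theta>) ^ q * \<kappa> = C2 * \<Theta> ^ m"
          proof -
            \<comment> \<open>The mass of the kernel increment is bounded by the root of the energy
              rate, so the drift has the same order as the stochastic part.\<close>
            have "sqrt \<Theta> ^ q = \<Theta> ^ m" unfolding q_def power_mult using \<Theta>0 by simp
            then show ?thesis by (simp add: C2_def power_mult_distrib)
          qed
          finally show ?thesis .
        qed
        have pt: "\<bar>u t x \<omega> $ i - u s y \<omega> $ i\<bar> ^ q \<le> 2 ^ q * (real CARD('d) ^ q * (\<Sum>j\<in>UNIV. \<bar>Z j \<omega> - Z' j \<omega>\<bar> ^ q) + \<bar>D \<omega>\<bar> ^ q)" for \<omega>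
        proof -
          have "\<bar>u t x \<omega> $ i - u s y \<omega> $ i\<bar> \<le> \<bar>\<Sum>j\<in>UNIV. Z j \<omega> - Z' j \<omega>\<bar> + \<bar>D \<omega>\<bar>" unfolding D_def by linarith
          then have "\<bar>u t x \<omega> $ i - u s y \<omega> $ i\<bar> ^ q \<le> (\<bar>\<Sum>j\<in>UNIV. Z j \<omega> - Z' j \<omega>\<bar> + \<bar>D \<omega>\<bar>) ^ q" by (intro power_mono) auto
          also have "\<dots> \<le> 2 ^ q * (\<bar>\<Sum>j\<in>UNIV. Z j \<omega> - Z' j \<omega>\<bar> ^ q + \<bar>D \<omega>\<bar> ^ q)" by (intro add_power_le) auto
          also have "\<dots> \<le> 2 ^ q * (real CARD('d) ^ q * (\<Sum>j\<in>UNIV. \<bar>Z j \<omega> - Z' j \<omega>\<bar> ^ q) + \<bar>D \<omega>\<bar> ^ q)"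
            using q by (intro mult_left_mono add_right_mono abs_sum_power_le) auto
          finally show ?thesis .
        qed
        have "(\<integral>\<^sup>+\<omega>. ennreal (\<bar>u t x \<omega> $ i - u s y \<omega> $ i\<bar> ^ q) \<partial>P)
          \<le> (\<integral>\<^sup>+\<omega>. ennreal (2 ^ q) * (ennreal (real CARD('d) ^ q) * (\<Sum>j\<in>UNIV. ennreal (\<bar>Z j \<omega> - Z' j \<omega>\<bar> ^ q)) + ennreal (\<bar>D \<omega>\<bar> ^ q)) \<partial>P)"
        proof (rule nn_integral_mono)
          fix \<omega>
          have "ennreal (2 ^ q * (real CARD('d) ^ q * (\<Sum>j\<in>UNIV. \<bar>Z j \<omega> - Z' j \<omega>\<bar> ^ q) + \<bar>D \<omega>\<bar> ^ q))
            = ennreal (2 ^ q) * (ennreal (real CARD('d) ^ q) * (\<Sum>j\<in>UNIV. ennreal (\<bar>Z j \<omega> - Z' j \<omega>\<bar> ^ q)) + ennreal (\<bar>D \<omega>\<bar> ^ q))"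
            by (subst sum_ennreal, simp) (simp only: ennreal_mult' ennreal_plus zero_le_power zero_le_numeral of_nat_0_le_iff mult_nonneg_nonneg sum_nonneg abs_ge_zero)
          with ennreal_leI[OF pt[of \<omega>]]
          show "ennreal (\<bar>u t x \<omega> $ i - u s y \<omega> $ i\<bar> ^ q) \<le> ennreal (2 ^ q) * (ennreal (real CARD('d) ^ q) * (\<Sum>j\<in>UNIV. ennreal (\<bar>Z j \<omega> - Z' j \<omega>\<bar> ^ q)) + ennreal (\<bar>D \<omega>\<bar> ^ q))"
            by simp
        qed
        also have "\<dots> = ennreal (2 ^ q) * (ennreal (real CARD('d) ^ q) * (\<Sum>j\<in>UNIV. \<integral>\<^sup>+\<omega>. ennreal (\<bar>Z j \<omega> - Z' j \<omega>\<bar> ^ q) \<partial>P) + (\<integral>\<^sup>+\<omega>. ennreal (\<bar>D \<omega>\<bar> ^ q) \<partial>P))"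
          by (simp add: nn_integral_cmult nn_integral_add nn_integral_sum del: sum_ennreal)
        also have "\<dots> \<le> ennreal (2 ^ q) * (ennreal (real CARD('d) ^ q) * (\<Sum>j\<in>(UNIV :: 'd set). ennreal (C1 * \<Theta> ^ m)) + ennreal (C2 * \<Theta> ^ m))"
          by (intro mult_left_mono add_mono sum_mono Zj DE) auto
        also have "\<dots> = ennreal (2 ^ q * (real CARD('d) ^ q * (\<Sum>j\<in>(UNIV :: 'd set). C1 * \<Theta> ^ m) + C2 * \<Theta> ^ m))"
          using Cs \<Theta>0 by (subst sum_ennreal, simp) (simp only: ennreal_mult' ennreal_plus zero_le_power zero_le_numeral of_nat_0_le_iff mult_nonneg_nonneg sum_nonneg)
        also have "2 ^ q * (real CARD('d) ^ q * (\<Sum>j\<in>(UNIV :: 'd set). C1 * \<Theta> ^ m) + C2 * \<Theta> ^ m) = C3 * \<Theta> ^ m"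
          by (simp add: C3_def algebra_simps)
        finally show ?thesis .
      qed
      have norm_meas [measurable]: "(\<lambda>\<omega>. norm (u t x \<omega> - u s y \<omega>)) \<in> borel_measurable P"
        using u_meas[OF st(4), of x] u_meas[OF st(1), of y] by measurable
      have full: "(\<integral>\<^sup>+\<omega>. ennreal (norm (u t x \<omega> - u s y \<omega>) ^ q) \<partial>P) \<le> ennreal (C4 * \<Theta> ^ m)"
      proof -
        have "(\<integral>\<^sup>+\<omega>. ennreal (norm (u t x \<omega> - u s y \<omega>) ^ q) \<partial>P)
          \<le> (\<integral>\<^sup>+\<omega>. ennreal (real CARD('d) ^ q) * (\<Sum>i\<in>UNIV. ennreal (\<bar>u t x \<omega> $ i - u s y \<omega> $ i\<bar> ^ q)) \<partial>P)"
        proof (rule nn_integral_mono)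
          fix \<omega>
          show "ennreal (norm (u t x \<omega> - u s y \<omega>) ^ q) \<le> ennreal (real CARD('d) ^ q) * (\<Sum>i\<in>UNIV. ennreal (\<bar>u t x \<omega> $ i - u s y \<omega> $ i\<bar> ^ q))"
            using ennreal_leI[OF norm_power_le_components[OF q, of "u t x \<omega> - u s y \<omega>"]]
            by (simp add: ennreal_mult' sum_nonneg)
        qed
        also have "\<dots> = ennreal (real CARD('d) ^ q) * (\<Sum>i\<in>UNIV. \<integral>\<^sup>+\<omega>. ennreal (\<bar>u t x \<omega> $ i - u s y \<omega> $ i\<bar> ^ q) \<partial>P)"
          using st by (simp add: nn_integral_cmult nn_integral_sum del: sum_ennreal)
        also have "\<dots> \<le> ennreal (real CARD('d) ^ q) * (\<Sum>i\<in>(UNIV :: 'd set). ennreal (C3 * \<Theta> ^ m))"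
          by (intro mult_left_mono sum_mono component) auto
        also have "\<dots> = ennreal (C4 * \<Theta> ^ m)"
          using Cs \<Theta>0 by (subst sum_ennreal, simp) (simp add: C4_def ennreal_mult'[symmetric] mult_ac)
        finally show ?thesis .
      qed
      \<comment> \<open>From the exponent q to p: scaled by sqrt \<Theta>, the increment satisfies
        c^p <= 1 + c^q because q >= p. The q-th moment of the scaled increment is at most C4, whence
        the constant 1 + C4.\<close>
      have pt: "a powr p \<le> \<Theta> powr (p / 2) * (1 + a ^ q / \<Theta> ^ m)" if "0 \<le> a" for a :: real
      proof -
        define c where "c = a / sqrt \<Theta>"
        have c: "0 \<le> c" using that \<Theta> by (simp add: c_def)
        have "c powr p \<le> 1 + c ^ q"
        proof (cases "c \<le> 1")
          case True
          then have "c powr p \<le> 1 powr p" using c p by (intro powr_mono2) auto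
          then show ?thesis using c by (simp add: add_increasing2)
        next
          case False
          then have "c powr p \<le> c powr real q" using m by (intro powr_mono) auto
          also have "\<dots> = c ^ q" using False by (simp add: powr_realpow)
          finally show ?thesis by simp
        qed
        moreover have "a powr p = \<Theta> powr (p / 2) * c powr p"
          using that \<Theta> by (simp add: c_def powr_divide powr_half_sqrt[symmetric] powr_powr)
        moreover have "c ^ q = a ^ q / \<Theta> ^ m"
          using \<Theta> by (simp add: c_def power_divide q_def power_mult)
        ultimately show ?thesis using \<Theta> by (simp add: mult_left_mono)
      qed
      have "(\<integral>\<^sup>+\<omega>. ennreal (norm (u t x \<omega> - u s y \<omega>) powr p) \<partial>P)
        \<le> (\<integral>\<^sup>+\<omega>. ennreal (\<Theta> powr (p / 2)) * (1 + ennreal (1 / \<Theta> ^ m) * ennreal (norm (u t x \<omega> - u s y \<omega>) ^ q)) \<partial>P)"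
      proof (rule nn_integral_mono)
        fix \<omega>
        have "ennreal (\<Theta> powr (p / 2) * (1 + norm (u t x \<omega> - u s y \<omega>) ^ q / \<Theta> ^ m))
          = ennreal (\<Theta> powr (p / 2)) * (1 + ennreal (1 / \<Theta> ^ m) * ennreal (norm (u t x \<omega> - u s y \<omega>) ^ q))"
        proof -
          define z where "z = norm (u t x \<omega> - u s y \<omega>) ^ q"
          have z: "0 \<le> z" and i: "0 \<le> 1 / \<Theta> ^ m" using \<Theta> by (simp_all add: z_def)
          have "ennreal (1 + 1 / \<Theta> ^ m * z) = 1 + ennreal (1 / \<Theta> ^ m) * ennreal z"
            using ennreal_plus[OF zero_le_one mult_nonneg_nonneg[OF i z]] ennreal_mult'[OF i, of z] by (simp only: ennreal_1)
          moreover have "\<Theta> powr (p / 2) * (1 + z / \<Theta> ^ m) = \<Theta> powr (p / 2) * (1 + 1 / \<Theta> ^ m * z)" by simp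
          ultimately show ?thesis unfolding z_def[symmetric] by (simp only: ennreal_mult' powr_ge_zero)
        qed
        with ennreal_leI[OF pt[of "norm (u t x \<omega> - u s y \<omega>)"]]
        show "ennreal (norm (u t x \<omega> - u s y \<omega>) powr p) \<le> ennreal (\<Theta> powr (p / 2)) * (1 + ennreal (1 / \<Theta> ^ m) * ennreal (norm (u t x \<omega> - u s y \<omega>) ^ q))"
          by simp
      qed
      also have "\<dots> = ennreal (\<Theta> powr (p / 2)) * (1 + ennreal (1 / \<Theta> ^ m) * (\<integral>\<^sup>+\<omega>. ennreal (norm (u t x \<omega> - u s y \<omega>) ^ q) \<partial>P))"
        by (simp add: nn_integral_cmult nn_integral_add emeasure_space_1)
      also have "\<dots> \<le> ennreal (\<Theta> powr (p / 2)) * (1 + ennreal (1 / \<Theta> ^ m) * ennreal (C4 * \<Theta> ^ m))"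
        by (intro mult_left_mono add_left_mono full) auto
      also have "ennreal (1 / \<Theta> ^ m) * ennreal (C4 * \<Theta> ^ m) = ennreal C4"
        using \<Theta> by (subst ennreal_mult'[symmetric]) auto
      also have "ennreal (\<Theta> powr (p / 2)) * (1 + ennreal C4) = ennreal ((1 + C4) * \<Theta> powr (p / 2))"
        using Cs by (simp add: ennreal_mult' mult.commute)
      finally show ?thesis .
    qed
    then show "(\<integral>\<^sup>+\<omega>. ennreal (norm (u t x \<omega> - u s y \<omega>) powr p) \<partial>P)
      \<le> ennreal ((1 + C4) * (\<bar>t - s\<bar> powr ((2 - \<beta>) / 2) + norm (x - y) powr (2 - \<beta>)) powr (p / 2))"
      unfolding \<Theta>_def .
  qed
qed

end
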